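(* Let $(M,\omega)$ be a closed symplectic manifold and let $X,Y\subset M$ be compact subsets such that: (P1) $\theta(Y)\cap X\neq\emptyset$ for every Hamiltonian diffeomorphism $\theta\in \mathrm{Ham}(M,\omega)$; (P2) there exists a path $\{\psi_t\}_{t\in[0,1]}$ of symplectomorphisms of $(M,\omega)$ with $\psi_0=\mathrm{id}$ and $\psi_1(Y)\cap X=\emptyset$. Put $X':=\psi_1(Y)$ and $a:=\mathrm{Flux}(\{\psi_t\})\in H^1(M,\mathbb{R})$. Then for every $F\in C^\infty(M)$ with $F|_X\le 0$ and $F|_{X'}\ge 1$, the Hamiltonian flow $\{\phi_t\}$ of $F$ possesses an invariant Borel probability measure $\mu$ with $$|\langle a,\rho(\mu,\mathrm{sgrad}\,F)\rangle|\ge 1 .$$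
   Context: Paths of symplectomorphisms are smooth. For a path $\{\phi_t\}_{t\in[0,1]}$ of symplectomorphisms of $(M,\omega)$ with $\phi_0=\mathrm{id}$, generated by the time-dependent vector field $v_t$, the 1-form $\lambda_t:=i_{v_t}\omega$ is closed, and the flux of the path is $\mathrm{Flux}(\{\phi_t\}):=\int_0^1[\lambda_t]\,dt\in H^1(M,\mathbb{R})$. $\mathrm{Symp}_0(M,\omega)$ is the identity component of the symplectomorphism group of $M$. A diffeomorphism $\theta\in\mathrm{Symp}_0(M,\omega)$ is called Hamiltonian if it is the time-one map of such a path with vanishing flux; the group of Hamiltonian diffeomorphisms is denoted $\mathrm{Ham}(M,\omega)$. The Hamiltonian vector field $\mathrm{sgrad}\,F$ of $F\in C^\infty(M)$ is defined by $i_{\mathrm{sgrad} F}\,\omega=-dF$; the Hamiltonian flow of $F$ is the flow of this vector field. Rotation vector: if $v$ is a smooth vector field on a closed manifold $M$ with flow $\phi_t$, and $\mu$ is a Borel probability measure on $M$ invariant under $\phi_t$, then $\rho(\mu,v)\in H_1(M,\mathbb{R})$ is defined by $\langle a,\rho(\mu,v)\rangle:=\int_M\alpha(v)\,d\mu$ for all $a\in H^1(M,\mathbb{R})$, where $\alpha$ is any closed 1-form representing $a$ (the value does not depend on the choice of $\alpha$). *)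

theory Defs
  imports "HOL-Probability.Probability"
begin

section \<open>Smooth functions between Euclidean spaces\<close>

text \<open>
  Derivatives are taken within the domain, so that the definition also covers
  relatively open subsets of \<open>[0,1] \<times> \<real>\<^sup>m\<close>, with one-sided derivatives
  at the end points of the interval. On open sets this is the usual notion.
\<close>

primrec Ck_on :: "nat \<Rightarrow> 'a::euclidean_space set \<Rightarrow> ('a \<Rightarrow> 'b::euclidean_space) \<Rightarrow> bool" where
  "Ck_on 0 S f \<longleftrightarrow> continuous_on S f"
| "Ck_on (Suc k) S f \<longleftrightarrow>
     (\<exists>f'. (\<forall>x\<in>S. (f has_derivative f' x) (at x within S)) \<and> (\<forall>v. Ck_on k S (\<lambda>x. f' x v)))"

definition smooth_on :: "'a::euclidean_space set \<Rightarrow> ('a \<Rightarrow> 'b::euclidean_space) \<Rightarrow> bool" where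
  "smooth_on S f \<longleftrightarrow> (\<forall>k. Ck_on k S f)"


section \<open>Smooth manifolds\<close>

text \<open>
  The underlying space of a manifold is a Hausdorff type \<open>'m\<close>; its smooth structure is given
  by an atlas of charts with values in the Euclidean space \<open>'e\<close>. A chart is a pair of an open
  domain and a map, of which only the values on the domain matter.
\<close>

type_synonym ('m, 'e) chart = "'m set \<times> ('m \<Rightarrow> 'e)"
type_synonym ('m, 'e) atlas = "('m, 'e) chart set"

abbreviation cdom :: "('m, 'e) chart \<Rightarrow> 'm set" where
  "cdom c \<equiv> fst c"

abbreviation cmap :: "('m, 'e) chart \<Rightarrow> 'm \<Rightarrow> 'e" where
  "cmap c \<equiv> snd c"

definition cimg :: "('m, 'e) chart \<Rightarrow> 'e set" where
  "cimg c = cmap c ` cdom c"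

definition cinv :: "('m, 'e) chart \<Rightarrow> 'e \<Rightarrow> 'm" where
  "cinv c = inv_into (cdom c) (cmap c)"

text \<open>
  The local representative of a map \<open>f\<close> in the charts \<open>c\<close> (source) and \<open>d\<close> (target), and the
  set on which it is meaningful. For \<open>f = id\<close> these are the transition map from \<open>c\<close> to \<open>d\<close> and
  the overlap of the two charts seen in \<open>c\<close>.
\<close>

definition local_rep :: "('m, 'e) chart \<Rightarrow> ('m, 'e) chart \<Rightarrow> ('m \<Rightarrow> 'm) \<Rightarrow> 'e \<Rightarrow> 'e" where
  "local_rep c d f = (\<lambda>y. cmap d (f (cinv c y)))"

definition rep_dom :: "('m, 'e) chart \<Rightarrow> ('m, 'e) chart \<Rightarrow> ('m \<Rightarrow> 'm) \<Rightarrow> 'e set" where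
  "rep_dom c d f = {y \<in> cimg c. f (cinv c y) \<in> cdom d}"

definition smooth_atlas :: "('m::t2_space, 'e::euclidean_space) atlas \<Rightarrow> bool" where
  "smooth_atlas A \<longleftrightarrow>
     (\<Union>c\<in>A. cdom c) = UNIV \<and>
     (\<forall>c\<in>A. open (cdom c) \<and> open (cimg c) \<and> homeomorphism (cdom c) (cimg c) (cmap c) (cinv c)) \<and>
     (\<forall>c\<in>A. \<forall>d\<in>A. smooth_on (rep_dom c d id) (local_rep c d id))"

definition closed_manifold :: "('m::t2_space, 'e::euclidean_space) atlas \<Rightarrow> bool" where
  "closed_manifold A \<longleftrightarrow> smooth_atlas A \<and> compact (UNIV :: 'm set)"

definition smooth_fun :: "('m::t2_space, 'e::euclidean_space) atlas \<Rightarrow> ('m \<Rightarrow> real) \<Rightarrow> bool" where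
  "smooth_fun A f \<longleftrightarrow> (\<forall>c\<in>A. smooth_on (cimg c) (\<lambda>y. f (cinv c y)))"

definition smooth_map :: "('m::t2_space, 'e::euclidean_space) atlas \<Rightarrow> ('m \<Rightarrow> 'm) \<Rightarrow> bool" where
  "smooth_map A f \<longleftrightarrow>
     continuous_on UNIV f \<and>
     (\<forall>c\<in>A. \<forall>d\<in>A. smooth_on (rep_dom c d f) (local_rep c d f))"

definition diffeomorphism :: "('m::t2_space, 'e::euclidean_space) atlas \<Rightarrow> ('m \<Rightarrow> 'm) \<Rightarrow> bool" where
  "diffeomorphism A f \<longleftrightarrow> bij f \<and> smooth_map A f \<and> smooth_map A (inv f)"


section \<open>Vector fields and differential forms\<close>

text \<open>
  Tensor fields are given by their components in every chart of the atlas, subject to the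
  transformation law under transition maps. The components in a chart \<open>c\<close> are functions of the
  coordinates \<open>y \<in> cimg c\<close>; values at other points and at pairs \<open>c\<close> outside the atlas are
  irrelevant.
\<close>

type_synonym ('m, 'e) vfield = "('m, 'e) chart \<Rightarrow> 'e \<Rightarrow> 'e"
type_synonym ('m, 'e) form1 = "('m, 'e) chart \<Rightarrow> 'e \<Rightarrow> 'e \<Rightarrow> real"
type_synonym ('m, 'e) form2 = "('m, 'e) chart \<Rightarrow> 'e \<Rightarrow> 'e \<Rightarrow> 'e \<Rightarrow> real"

definition one_form :: "('m::t2_space, 'e::euclidean_space) atlas \<Rightarrow> ('m, 'e) form1 \<Rightarrow> bool" where
  "one_form A \<alpha> \<longleftrightarrow>
     (\<forall>c\<in>A. (\<forall>y\<in>cimg c. linear (\<alpha> c y)) \<and> (\<forall>\<xi>. smooth_on (cimg c) (\<lambda>y. \<alpha> c y \<xi>))) \<and>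
     (\<forall>c\<in>A. \<forall>d\<in>A. \<forall>y\<in>rep_dom c d id. \<forall>\<xi>.
        \<alpha> c y \<xi> = \<alpha> d (local_rep c d id y) (frechet_derivative (local_rep c d id) (at y) \<xi>))"

text \<open>The differential of a function, and the exterior derivatives of 1-forms and 2-forms
  evaluated on constant coordinate vectors (whose Lie brackets vanish).\<close>

definition ext_d0 :: "('m \<Rightarrow> real) \<Rightarrow> ('m, 'e::euclidean_space) form1" where
  "ext_d0 f c y \<xi> = frechet_derivative (\<lambda>z. f (cinv c z)) (at y) \<xi>"

definition ext_d1 :: "('m, 'e::euclidean_space) form1 \<Rightarrow> ('m, 'e) form2" where
  "ext_d1 \<alpha> c y \<xi> \<eta> =
     frechet_derivative (\<lambda>z. \<alpha> c z \<eta>) (at y) \<xi> - frechet_derivative (\<lambda>z. \<alpha> c z \<xi>) (at y) \<eta>"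

definition ext_d2 :: "('m, 'e::euclidean_space) form2 \<Rightarrow> ('m, 'e) chart \<Rightarrow> 'e \<Rightarrow> 'e \<Rightarrow> 'e \<Rightarrow> 'e \<Rightarrow> real" where
  "ext_d2 \<omega> c y \<xi> \<eta> \<zeta> =
     frechet_derivative (\<lambda>z. \<omega> c z \<eta> \<zeta>) (at y) \<xi>
     - frechet_derivative (\<lambda>z. \<omega> c z \<xi> \<zeta>) (at y) \<eta>
     + frechet_derivative (\<lambda>z. \<omega> c z \<xi> \<eta>) (at y) \<zeta>"

definition closed_one_form :: "('m::t2_space, 'e::euclidean_space) atlas \<Rightarrow> ('m, 'e) form1 \<Rightarrow> bool" where
  "closed_one_form A \<alpha> \<longleftrightarrow>
     one_form A \<alpha> \<and> (\<forall>c\<in>A. \<forall>y\<in>cimg c. \<forall>\<xi> \<eta>. ext_d1 \<alpha> c y \<xi> \<eta> = 0)"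

definition two_form :: "('m::t2_space, 'e::euclidean_space) atlas \<Rightarrow> ('m, 'e) form2 \<Rightarrow> bool" where
  "two_form A \<omega> \<longleftrightarrow>
     (\<forall>c\<in>A. (\<forall>y\<in>cimg c. bilinear (\<omega> c y) \<and> (\<forall>\<xi>. \<omega> c y \<xi> \<xi> = 0)) \<and>
             (\<forall>\<xi> \<eta>. smooth_on (cimg c) (\<lambda>y. \<omega> c y \<xi> \<eta>))) \<and>
     (\<forall>c\<in>A. \<forall>d\<in>A. \<forall>y\<in>rep_dom c d id. \<forall>\<xi> \<eta>.
        \<omega> c y \<xi> \<eta> = \<omega> d (local_rep c d id y)
                        (frechet_derivative (local_rep c d id) (at y) \<xi>)
                        (frechet_derivative (local_rep c d id) (at y) \<eta>))"

definition symplectic_form :: "('m::t2_space, 'e::euclidean_space) atlas \<Rightarrow> ('m, 'e) form2 \<Rightarrow> bool" where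
  "symplectic_form A \<omega> \<longleftrightarrow>
     two_form A \<omega> \<and>
     (\<forall>c\<in>A. \<forall>y\<in>cimg c. \<forall>\<xi> \<eta> \<zeta>. ext_d2 \<omega> c y \<xi> \<eta> \<zeta> = 0) \<and>
     (\<forall>c\<in>A. \<forall>y\<in>cimg c. \<forall>\<xi>. \<xi> \<noteq> 0 \<longrightarrow> (\<exists>\<eta>. \<omega> c y \<xi> \<eta> \<noteq> 0))"

definition interior_product :: "('m, 'e) vfield \<Rightarrow> ('m, 'e) form2 \<Rightarrow> ('m, 'e) form1" where
  "interior_product v \<omega> c y \<xi> = \<omega> c y (v c y) \<xi>"

text \<open>The function \<open>\<alpha>(v)\<close>; its value at a point does not depend on the chart used.\<close>

definition form_apply :: "('m, 'e) atlas \<Rightarrow> ('m, 'e) form1 \<Rightarrow> ('m, 'e) vfield \<Rightarrow> 'm \<Rightarrow> real" where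
  "form_apply A \<alpha> v x =
     (let c = SOME c. c \<in> A \<and> x \<in> cdom c in \<alpha> c (cmap c x) (v c (cmap c x)))"


section \<open>First de Rham cohomology\<close>

text \<open>Elements of \<open>H\<^sup>1(M,\<real>)\<close> are sets of closed 1-forms, namely the cosets of the exact ones.\<close>

definition cohom_class ::
    "('m::t2_space, 'e::euclidean_space) atlas \<Rightarrow> ('m, 'e) form1 \<Rightarrow> ('m, 'e) form1 set" where
  "cohom_class A \<alpha> =
     {\<beta>. closed_one_form A \<beta> \<and>
          (\<exists>f. smooth_fun A f \<and>
               (\<forall>c\<in>A. \<forall>y\<in>cimg c. \<forall>\<xi>. \<beta> c y \<xi> - \<alpha> c y \<xi> = ext_d0 f c y \<xi>))}"


section \<open>Symplectomorphisms, flux and Hamiltonian diffeomorphisms\<close>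

definition symplectomorphism ::
    "('m::t2_space, 'e::euclidean_space) atlas \<Rightarrow> ('m, 'e) form2 \<Rightarrow> ('m \<Rightarrow> 'm) \<Rightarrow> bool" where
  "symplectomorphism A \<omega> f \<longleftrightarrow>
     diffeomorphism A f \<and>
     (\<forall>c\<in>A. \<forall>d\<in>A. \<forall>y\<in>rep_dom c d f. \<forall>\<xi> \<eta>.
        \<omega> d (local_rep c d f y)
            (frechet_derivative (local_rep c d f) (at y) \<xi>)
            (frechet_derivative (local_rep c d f) (at y) \<eta>) = \<omega> c y \<xi> \<eta>)"

definition symplectic_path ::
    "('m::t2_space, 'e::euclidean_space) atlas \<Rightarrow> ('m, 'e) form2 \<Rightarrow> (real \<Rightarrow> 'm \<Rightarrow> 'm) \<Rightarrow> bool" where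
  "symplectic_path A \<omega> \<psi> \<longleftrightarrow>
     (\<forall>t\<in>{0..1}. symplectomorphism A \<omega> (\<psi> t)) \<and>
     continuous_on ({0..1} \<times> UNIV) (\<lambda>(t, x). \<psi> t x) \<and>
     (\<forall>c\<in>A. \<forall>d\<in>A. smooth_on {(t, y). t \<in> {0..1} \<and> y \<in> rep_dom c d (\<psi> t)}
                               (\<lambda>(t, y). local_rep c d (\<psi> t) y))"

text \<open>The time-dependent vector field \<open>v\<^sub>t\<close> generating a path, i.e.
  \<open>d/ds \<psi>\<^sub>s(x) = v\<^sub>t(\<psi>\<^sub>t(x))\<close> at \<open>s = t\<close>, one-sided at \<open>t = 0\<close> and \<open>t = 1\<close>.\<close>

definition path_velocity :: "(real \<Rightarrow> 'm \<Rightarrow> 'm) \<Rightarrow> real \<Rightarrow> ('m, 'e::euclidean_space) vfield" where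
  "path_velocity \<psi> t c y =
     vector_derivative (\<lambda>s. cmap c (\<psi> s (inv (\<psi> t) (cinv c y)))) (at t within {0..1})"

text \<open>The integral over \<open>t\<close> of the classes \<open>[\<lambda>\<^sub>t]\<close> is the class of the form obtained by
  integrating \<open>\<lambda>\<^sub>t\<close> pointwise, since passing to cohomology classes is linear and continuous.\<close>

definition flux ::
    "('m::t2_space, 'e::euclidean_space) atlas \<Rightarrow> ('m, 'e) form2 \<Rightarrow> (real \<Rightarrow> 'm \<Rightarrow> 'm) \<Rightarrow> ('m, 'e) form1 set" where
  "flux A \<omega> \<psi> =
     cohom_class A (\<lambda>c y \<xi>. integral {0..1} (\<lambda>t. interior_product (path_velocity \<psi> t) \<omega> c y \<xi>))"

text \<open>The time-one maps below automatically lie in the identity component of the group of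
  symplectomorphisms, being joined to the identity by a smooth path.\<close>

definition Ham :: "('m::t2_space, 'e::euclidean_space) atlas \<Rightarrow> ('m, 'e) form2 \<Rightarrow> ('m \<Rightarrow> 'm) set" where
  "Ham A \<omega> =
     {\<theta>. \<exists>\<psi>. symplectic_path A \<omega> \<psi> \<and> \<psi> 0 = id \<and> \<psi> 1 = \<theta> \<and>
              flux A \<omega> \<psi> = cohom_class A (\<lambda>_ _ _. 0)}"


section \<open>Hamiltonian flows and rotation vectors\<close>

definition sgrad :: "('m, 'e::euclidean_space) form2 \<Rightarrow> ('m \<Rightarrow> real) \<Rightarrow> ('m, 'e) vfield" where
  "sgrad \<omega> F c y = (THE v. \<forall>\<xi>. \<omega> c y v \<xi> = - ext_d0 F c y \<xi>)"

text \<open>Continuity of the trajectories is required separately because the derivative is taken in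
  a chart and \<open>cmap c\<close> is arbitrary outside \<open>cdom c\<close>.\<close>

definition is_flow ::
    "('m::t2_space, 'e::euclidean_space) atlas \<Rightarrow> ('m, 'e) vfield \<Rightarrow> (real \<Rightarrow> 'm \<Rightarrow> 'm) \<Rightarrow> bool" where
  "is_flow A v \<phi> \<longleftrightarrow>
     \<phi> 0 = id \<and>
     (\<forall>x. continuous_on UNIV (\<lambda>t. \<phi> t x)) \<and>
     (\<forall>x t. \<forall>c\<in>A. \<phi> t x \<in> cdom c \<longrightarrow>
        ((\<lambda>s. cmap c (\<phi> s x)) has_vector_derivative v c (cmap c (\<phi> t x))) (at t))"

definition invariant_borel_prob :: "(real \<Rightarrow> 'm \<Rightarrow> 'm) \<Rightarrow> 'm::topological_space measure \<Rightarrow> bool" where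
  "invariant_borel_prob \<phi> \<mu> \<longleftrightarrow>
     prob_space \<mu> \<and> sets \<mu> = sets borel \<and>
     (\<forall>t. \<phi> t \<in> measurable \<mu> \<mu> \<and> distr \<mu> \<mu> (\<phi> t) = \<mu>)"

text \<open>\<open>H\<^sub>1(M,\<real>)\<close> is regarded as the dual of \<open>H\<^sup>1(M,\<real>)\<close>, so the pairing of \<open>a\<close> with
  \<open>\<rho>(\<mu>,v)\<close> is \<open>rotation_vector A \<mu> v a\<close>. The integral is the same for every representative.\<close>

definition rotation_vector ::
    "('m::t2_space, 'e::euclidean_space) atlas \<Rightarrow> 'm measure \<Rightarrow> ('m, 'e) vfield \<Rightarrow> ('m, 'e) form1 set \<Rightarrow> real" where
  "rotation_vector A \<mu> v a = integral\<^sup>L \<mu> (form_apply A (SOME \<alpha>. \<alpha> \<in> a) v)"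

end

theory Submission
  imports Defs
begin

text \<open>Suppose that no invariant probability measure of the flow \<open>\<phi>\<close> of \<open>sgrad F\<close> has the required
  property, and let \<open>\<beta>\<close> represent the flux \<open>a\<close>. Weak limits of time averages are invariant measures, so
  for some \<open>N\<close> the average of \<open>\<beta>(sgrad F)\<close> over every orbit segment of length \<open>N\<close> is less than \<open>1\<close> in
  absolute value. Adding to \<open>\<beta>\<close> the differential of
  \<open>x \<mapsto> \<integral>\<^sub>0\<^sup>N (1 - s / N) \<beta>(sgrad F)(\<phi>\<^sub>s x) ds\<close> replaces \<open>\<beta>(sgrad F)\<close> by this average, so \<open>a\<close> is
  represented by a form \<open>\<beta>'\<close> with \<open>\<bar>\<beta>'(sgrad F)\<bar> < 1\<close> everywhere. The symplectic flow \<open>T\<close> of the field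
  dual to \<open>-\<beta>'\<close> then changes \<open>F\<close> by less than \<open>1\<close> in unit time. Following the path \<open>\<psi>\<close> by \<open>T\<close> gives a
  path of vanishing flux, so \<open>T\<^sub>1 \<circ> \<psi>\<^sub>1\<close> is Hamiltonian and moves a point of \<open>Y\<close> into \<open>X\<close>. But \<open>F\<close> is at
  least \<open>1\<close> on \<open>\<psi>\<^sub>1(Y)\<close> and at most \<open>0\<close> on \<open>X\<close>.\<close>

section \<open>Calculus of smooth functions\<close>

text \<open>The speed estimate rests on the antisymmetry of \<open>\<omega>\<close>: for
  \<open>u = sharp \<gamma>\<close> and \<open>v = sgrad \<omega> F\<close>, dF(u) = -\<omega>(v, u)
  = \<omega>(u, v) = \<gamma>(v). The change of \<open>F\<close> along the flow of \<open>u\<close>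
  is thus controlled by a quantity that can be averaged along the orbits of \<open>v\<close>, and
  the threshold 1 is the guaranteed gap between the values of \<open>F\<close> on the two sets. A
  uniform \<open>N\<close> is found by contradiction: otherwise every length would have its own bad
  starting point, and the occupation measures of these segments, although they lie on different
  orbits, accumulate at an invariant measure. Taking absolute values before the limit treats both
  signs at once. Time runs through the closed interval [0,1], so smoothness is developed within sets
  that are not open: uniqueness of derivatives, exchange of partial derivatives and inverse maps
  have to be valid up to the end points. The manifold carries no metric; flows, smoothness of the
  inverse path, closedness of the flux form and weak limits of measures are all obtained from charts
  and compactness.\<close>

lemma Ck_on_imp_continuous: "Ck_on k S f \<Longrightarrow> continuous_on S f"
  by (cases k) (auto simp: continuous_on_eq_continuous_within dest: has_derivative_continuous)

lemma Ck_on_Suc_imp: "Ck_on (Suc k) S f \<Longrightarrow> Ck_on k S f"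
proof (induction k arbitrary: f)
  case 0
  then show ?case using Ck_on_imp_continuous[OF 0] by simp
next
  case (Suc k)
  then show ?case by (metis Ck_on.simps(2))
qed

lemma Ck_on_subset: "Ck_on k S f \<Longrightarrow> T \<subseteq> S \<Longrightarrow> Ck_on k T f"
proof (induction k arbitrary: f)
  case 0
  then show ?case by (auto intro: continuous_on_subset)
next
  case (Suc k)
  then obtain f' where f': "\<forall>x\<in>S. (f has_derivative f' x) (at x within S)" "\<forall>v. Ck_on k S (\<lambda>x. f' x v)"
    by auto
  with Suc show ?case
    by (auto intro!: exI[of _ f'] intro: has_derivative_subset)
qed

lemma Ck_on_cong: "Ck_on k S f \<Longrightarrow> (\<And>x. x \<in> S \<Longrightarrow> f x = g x) \<Longrightarrow> Ck_on k S g"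
proof (cases k)
  case 0
  moreover assume "Ck_on k S f" "\<And>x. x \<in> S \<Longrightarrow> f x = g x"
  ultimately show ?thesis by (auto intro: continuous_on_eq)
next
  case (Suc j)
  assume *: "Ck_on k S f" "\<And>x. x \<in> S \<Longrightarrow> f x = g x"
  with Suc obtain f' where f': "\<forall>x\<in>S. (f has_derivative f' x) (at x within S)" "\<forall>v. Ck_on j S (\<lambda>x. f' x v)"
    by auto
  then have "\<forall>x\<in>S. (g has_derivative f' x) (at x within S)"
    using *(2) by (metis has_derivative_transform)
  then show ?thesis using f' Suc by auto
qed

lemma Ck_on_const [simp, intro]: "Ck_on k S (\<lambda>x. c)"
proof (induction k arbitrary: c)
  case (Suc k)
  then show ?case by (auto intro!: exI[of _ "\<lambda>x v. 0"])
qed auto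

lemma Ck_on_bounded_linear: "bounded_linear f \<Longrightarrow> Ck_on k S f"
proof (cases k)
  case 0
  then show "bounded_linear f \<Longrightarrow> ?thesis" by (simp add: linear_continuous_on)
next
  case (Suc j)
  then show "bounded_linear f \<Longrightarrow> ?thesis"
    by (auto intro!: exI[of _ "\<lambda>x. f"] bounded_linear_imp_has_derivative)
qed

lemma Ck_on_add: "Ck_on k S f \<Longrightarrow> Ck_on k S g \<Longrightarrow> Ck_on k S (\<lambda>x. f x + g x)"
proof (induction k arbitrary: f g)
  case 0
  then show ?case by (auto intro: continuous_intros)
next
  case (Suc k)
  obtain f' where f': "\<forall>x\<in>S. (f has_derivative f' x) (at x within S)" "\<forall>v. Ck_on k S (\<lambda>x. f' x v)"
    using Suc by auto
  obtain g' where g': "\<forall>x\<in>S. (g has_derivative g' x) (at x within S)" "\<forall>v. Ck_on k S (\<lambda>x. g' x v)"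
    using Suc by auto
  show ?case using Suc.IH f' g'
    by (auto intro!: exI[of _ "\<lambda>x v. f' x v + g' x v"] has_derivative_add)
qed

lemma Ck_on_bilinear:
  fixes f :: "'a::euclidean_space \<Rightarrow> 'b::euclidean_space" and g :: "'a \<Rightarrow> 'c::euclidean_space"
  assumes p: "bounded_bilinear (p :: 'b \<Rightarrow> 'c \<Rightarrow> 'd::euclidean_space)"
  shows "Ck_on k S f \<Longrightarrow> Ck_on k S g \<Longrightarrow> Ck_on k S (\<lambda>x. p (f x) (g x))"
proof (induction k arbitrary: f g)
  case 0
  then show ?case by (auto intro: bounded_bilinear.continuous_on[OF p])
next
  case (Suc k)
  obtain f' where f': "\<forall>x\<in>S. (f has_derivative f' x) (at x within S)" "\<forall>v. Ck_on k S (\<lambda>x. f' x v)"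
    using Suc by auto
  obtain g' where g': "\<forall>x\<in>S. (g has_derivative g' x) (at x within S)" "\<forall>v. Ck_on k S (\<lambda>x. g' x v)"
    using Suc by auto
  have "Ck_on k S f" "Ck_on k S g" using Suc.prems Ck_on_Suc_imp by blast+
  then show ?case using Suc.IH f' g'
    by (auto intro!: Ck_on_add exI[of _ "\<lambda>x v. p (f x) (g' x v) + p (f' x v) (g x)"]
        bounded_bilinear.FDERIV[OF p])
qed

lemma Ck_on_scaleR: "Ck_on k S f \<Longrightarrow> Ck_on k S g \<Longrightarrow> Ck_on k S (\<lambda>x. f x *\<^sub>R g x)"
  by (rule Ck_on_bilinear[OF bounded_bilinear_scaleR])

lemma Ck_on_mult: "Ck_on k S f \<Longrightarrow> Ck_on k S g \<Longrightarrow> Ck_on k S (\<lambda>x. f x * g x :: real)"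
  by (rule Ck_on_bilinear[OF bounded_bilinear_mult])

lemma Ck_on_inner: "Ck_on k S f \<Longrightarrow> Ck_on k S g \<Longrightarrow> Ck_on k S (\<lambda>x. f x \<bullet> g x)"
  by (rule Ck_on_bilinear[OF bounded_bilinear_inner])

lemma Ck_on_minus: "Ck_on k S f \<Longrightarrow> Ck_on k S (\<lambda>x. - f x)"
  using Ck_on_scaleR[of k S "\<lambda>_. -1" f] by simp

lemma Ck_on_diff: "Ck_on k S f \<Longrightarrow> Ck_on k S g \<Longrightarrow> Ck_on k S (\<lambda>x. f x - g x)"
  using Ck_on_add[of k S f "\<lambda>x. - g x"] Ck_on_minus by auto

lemma Ck_on_sum: "(\<And>i. i \<in> I \<Longrightarrow> Ck_on k S (f i)) \<Longrightarrow> Ck_on k S (\<lambda>x. \<Sum>i\<in>I. f i x)"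
  by (induction I rule: infinite_finite_induct) (auto intro: Ck_on_add)

text \<open>\<open>Ck_on\<close> asks for the derivative in every direction; by linearity the basis
  directions suffice.\<close>

lemma Ck_on_SucI:
  assumes f': "\<And>x. x \<in> S \<Longrightarrow> (f has_derivative f' x) (at x within S)"
    and Ck: "\<And>b. b \<in> Basis \<Longrightarrow> Ck_on k S (\<lambda>x. f' x b)"
  shows "Ck_on (Suc k) S f"
proof -
  have "Ck_on k S (\<lambda>x. f' x v)" for v
  proof (rule Ck_on_cong)
    show "Ck_on k S (\<lambda>x. \<Sum>b\<in>Basis. (v \<bullet> b) *\<^sub>R f' x b)"
      by (intro Ck_on_sum Ck_on_scaleR Ck_on_const Ck)
    fix x assume "x \<in> S"
    then have l: "linear (f' x)"
      using f' has_derivative_bounded_linear bounded_linear.linear by blast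
    have "f' x v = f' x (\<Sum>b\<in>Basis. (v \<bullet> b) *\<^sub>R b)" by (simp add: euclidean_representation)
    then show "(\<Sum>b\<in>Basis. (v \<bullet> b) *\<^sub>R f' x b) = f' x v"
      using l by (simp add: linear_sum linear_cmul)
  qed
  then show ?thesis using f' by auto
qed

lemma Ck_on_linear_comp:
  assumes L: "bounded_linear L"
  shows "Ck_on k S f \<Longrightarrow> Ck_on k S (\<lambda>x. L (f x))"
proof (induction k arbitrary: f)
  case 0
  then show ?case using L by (auto intro: bounded_linear.continuous_on)
next
  case (Suc k)
  obtain f' where f': "\<forall>x\<in>S. (f has_derivative f' x) (at x within S)" "\<forall>v. Ck_on k S (\<lambda>x. f' x v)"
    using Suc by auto
  then have "\<forall>x\<in>S. ((\<lambda>x. L (f x)) has_derivative (\<lambda>v. L (f' x v))) (at x within S)"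
    using bounded_linear.has_derivative[OF L] by blast
  then show ?case using Suc.IH f' by auto
qed

lemma Ck_on_Pair: "Ck_on k S f \<Longrightarrow> Ck_on k S g \<Longrightarrow> Ck_on k S (\<lambda>x. (f x, g x))"
  using Ck_on_add[OF Ck_on_linear_comp[of "\<lambda>x. (x, 0)" k S f] Ck_on_linear_comp[of "\<lambda>x. (0, x)" k S g]]
  using bounded_linear_Pair[OF bounded_linear_ident bounded_linear_zero]
    bounded_linear_Pair[OF bounded_linear_zero bounded_linear_ident] by simp

lemma Ck_on_fst: "Ck_on k S f \<Longrightarrow> Ck_on k S (\<lambda>x. fst (f x))"
  by (rule Ck_on_linear_comp[OF bounded_linear_fst])

lemma Ck_on_snd: "Ck_on k S f \<Longrightarrow> Ck_on k S (\<lambda>x. snd (f x))"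
  by (rule Ck_on_linear_comp[OF bounded_linear_snd])

lemma Ck_on_compose:
  fixes f :: "'a::euclidean_space \<Rightarrow> 'b::euclidean_space" and g :: "'b \<Rightarrow> 'c::euclidean_space"
  shows "Ck_on k T g \<Longrightarrow> Ck_on k S f \<Longrightarrow> f ` S \<subseteq> T \<Longrightarrow> Ck_on k S (\<lambda>x. g (f x))"
proof (induction k arbitrary: g)
  case 0
  then show ?case by (auto intro: continuous_on_compose2)
next
  case (Suc k)
  obtain f' where f': "\<forall>x\<in>S. (f has_derivative f' x) (at x within S)" "\<forall>v. Ck_on k S (\<lambda>x. f' x v)"
    using Suc by auto
  obtain g' where g': "\<forall>x\<in>T. (g has_derivative g' x) (at x within T)" "\<forall>v. Ck_on k T (\<lambda>x. g' x v)"
    using Suc by auto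
  have f: "Ck_on k S f" using Suc.prems Ck_on_Suc_imp by blast
  show ?case
  proof (rule Ck_on_SucI)
    fix x assume x: "x \<in> S"
    then show "((\<lambda>x. g (f x)) has_derivative (\<lambda>v. g' (f x) (f' x v))) (at x within S)"
      using f' g' Suc.prems(3) by (intro has_derivative_in_compose2[of T g g' f S x "f' x"]) auto
  next
    fix b :: 'a
    \<comment> \<open>The direction in which \<open>g'\<close> is evaluated varies with the point.
      Expanding it in the basis leaves derivatives of \<open>g\<close> in fixed directions, to which
      the induction hypothesis applies.\<close>
    have "Ck_on k S (\<lambda>x. \<Sum>i\<in>Basis. (f' x b \<bullet> i) *\<^sub>R g' (f x) i)"
      using f' g' f Suc.prems(3) by (intro Ck_on_sum Ck_on_scaleR Ck_on_inner Ck_on_const Suc.IH) auto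
    moreover have "(\<Sum>i\<in>Basis. (f' x b \<bullet> i) *\<^sub>R g' (f x) i) = g' (f x) (f' x b)" if "x \<in> S" for x
    proof -
      have l: "linear (g' (f x))"
        using g' that Suc.prems(3) has_derivative_bounded_linear bounded_linear.linear by blast
      have "g' (f x) (f' x b) = g' (f x) (\<Sum>i\<in>Basis. (f' x b \<bullet> i) *\<^sub>R i)"
        by (simp add: euclidean_representation)
      then show ?thesis using l by (simp add: linear_sum linear_cmul)
    qed
    ultimately show "Ck_on k S (\<lambda>x. g' (f x) (f' x b))" by (rule Ck_on_cong)
  qed
qed

lemma Ck_on_inverse:
  fixes f :: "'a::euclidean_space \<Rightarrow> real"
  assumes nz: "\<And>x. x \<in> S \<Longrightarrow> f x \<noteq> 0"
  shows "Ck_on k S f \<Longrightarrow> Ck_on k S (\<lambda>x. inverse (f x))"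
proof (induction k)
  case 0
  then show ?case using nz by (auto intro: continuous_on_inverse)
next
  case (Suc k)
  obtain f' where f': "\<forall>x\<in>S. (f has_derivative f' x) (at x within S)" "\<forall>v. Ck_on k S (\<lambda>x. f' x v)"
    using Suc by auto
  have f: "Ck_on k S f" using Suc.prems Ck_on_Suc_imp by blast
  have "\<forall>x\<in>S. ((\<lambda>x. inverse (f x)) has_derivative (\<lambda>v. - (inverse (f x) * f' x v * inverse (f x)))) (at x within S)"
    using f' nz by (auto intro!: has_derivative_inverse)
  moreover have "\<forall>v. Ck_on k S (\<lambda>x. - (inverse (f x) * f' x v * inverse (f x)))"
    using f' Suc.IH[OF f] by (auto intro!: Ck_on_minus Ck_on_mult)
  ultimately show ?case by auto
qed

text \<open>On such sets derivatives are unique, which makes smoothness a local property.\<close>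

definition thick :: "'a::euclidean_space set \<Rightarrow> bool" where
  "thick S \<longleftrightarrow> (\<forall>x\<in>S. \<forall>i\<in>Basis. \<forall>e>0. \<exists>d. 0 < \<bar>d\<bar> \<and> \<bar>d\<bar> < e \<and> x + d *\<^sub>R i \<in> S)"

lemma thick_unique:
  "thick S \<Longrightarrow> x \<in> S \<Longrightarrow> (f has_derivative f') (at x within S) \<Longrightarrow> (f has_derivative f'') (at x within S) \<Longrightarrow> f' = f''"
  by (rule frechet_derivative_unique_within) (auto simp: thick_def)

lemma thick_Int_open:
  assumes "thick S" "open U" shows "thick (S \<inter> U)"
  unfolding thick_def
proof safe
  fix x i and e::real assume *: "x \<in> S" "x \<in> U" "i \<in> (Basis :: 'a set)" "0 < e"
  obtain r where r: "r > 0" "ball x r \<subseteq> U" using assms * open_contains_ball by blast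
  obtain d where d: "0 < \<bar>d\<bar>" "\<bar>d\<bar> < min e r" "x + d *\<^sub>R i \<in> S"
    using assms * r unfolding thick_def by (metis min_less_iff_conj)
  then have "x + d *\<^sub>R i \<in> U" using r * by (auto simp: dist_norm subset_iff)
  then show "\<exists>d. 0 < \<bar>d\<bar> \<and> \<bar>d\<bar> < e \<and> x + d *\<^sub>R i \<in> S \<inter> U" using d by auto
qed

lemma thick_UNIV: "thick UNIV"
  unfolding thick_def
proof safe
  fix i :: 'a and e :: real assume "0 < e"
  then show "\<exists>d. 0 < \<bar>d\<bar> \<and> \<bar>d\<bar> < e \<and> x + d *\<^sub>R i \<in> UNIV" for x
    by (intro exI[of _ "e/2"]) auto
qed

lemma thick_open: "open S \<Longrightarrow> thick S"
  using thick_Int_open[OF thick_UNIV] by auto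

lemma thick_Times: "thick S \<Longrightarrow> thick T \<Longrightarrow> thick (S \<times> T)"
  unfolding thick_def Basis_prod_def by fastforce

lemma thick_Icc: "a < b \<Longrightarrow> thick {a..b::real}"
  unfolding thick_def
proof safe
  fix x i and e::real assume *: "x \<in> {a..b}" "i \<in> (Basis :: real set)" "0 < e" "a < b"
  show "\<exists>d. 0 < \<bar>d\<bar> \<and> \<bar>d\<bar> < e \<and> x + d *\<^sub>R i \<in> {a..b}"
  proof (cases "x < b")
    case True
    then show ?thesis using * by (auto intro!: exI[of _ "min (b - x) (e/2)"] simp: min_def)
  next
    case False
    then show ?thesis using * by (auto intro!: exI[of _ "- min (b - a) (e/2)"] simp: min_def)
  qed
qed

lemma thick_relopen: "thick S \<Longrightarrow> openin (top_of_set S) T \<Longrightarrow> thick T"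
  by (auto simp: openin_open thick_Int_open)

lemma at_within_Int_open: "open U \<Longrightarrow> x \<in> U \<Longrightarrow> at x within (S \<inter> U) = at x within S"
  by (rule at_within_nhd[of x U]) auto

text \<open>On a thick set the derivatives found on overlapping neighbourhoods coincide, so
  pointwise choices form one derivative whose directional derivatives are again locally C^k.\<close>

lemma Ck_on_local:
  assumes S: "thick S" and loc: "\<And>x. x \<in> S \<Longrightarrow> \<exists>U. open U \<and> x \<in> U \<and> Ck_on k (S \<inter> U) f"
  shows "Ck_on k S f"
  using loc
proof (induction k arbitrary: f)
  case 0
  show ?case unfolding Ck_on.simps continuous_on_eq_continuous_within
  proof
    fix x assume "x \<in> S"
    then obtain U where "open U" "x \<in> U" "continuous_on (S \<inter> U) f" using 0 by auto
    then show "continuous (at x within S) f" using \<open>x \<in> S\<close>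
      by (metis IntI at_within_Int_open continuous_on_eq_continuous_within)
  qed
next
  case (Suc k)
  have at: "at x within S \<inter> U = at x within S" if "open U" "x \<in> U" for x U
    using that by (rule at_within_Int_open)
  have ex: "\<exists>f'. (f has_derivative f') (at x within S)" if x: "x \<in> S" for x
  proof -
    obtain U where U: "open U" "x \<in> U" "Ck_on (Suc k) (S \<inter> U) f" using Suc.prems x by blast
    then obtain g' where "\<forall>y\<in>S \<inter> U. (f has_derivative g' y) (at y within S \<inter> U)" by auto
    then have "(f has_derivative g' x) (at x within S)" using x U at[OF U(1,2)] by (metis IntI)
    then show ?thesis by blast
  qed
  then obtain f' where f': "\<And>x. x \<in> S \<Longrightarrow> (f has_derivative f' x) (at x within S)" by metis
  have "Ck_on k S (\<lambda>x. f' x v)" for v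
  proof (rule Suc.IH)
    fix x assume x: "x \<in> S"
    obtain U where U: "open U" "x \<in> U" "Ck_on (Suc k) (S \<inter> U) f" using Suc.prems x by blast
    then obtain g' where g': "\<forall>y\<in>S \<inter> U. (f has_derivative g' y) (at y within S \<inter> U)"
        "\<forall>v. Ck_on k (S \<inter> U) (\<lambda>y. g' y v)" by auto
    have "g' y = f' y" if "y \<in> S \<inter> U" for y
      using g' that f' at[OF U(1)] by (intro thick_unique[OF S]) auto
    then have "Ck_on k (S \<inter> U) (\<lambda>y. f' y v)" using g'(2) by (auto intro: Ck_on_cong)
    then show "\<exists>U. open U \<and> x \<in> U \<and> Ck_on k (S \<inter> U) (\<lambda>x. f' x v)" using U by auto
  qed
  then show ?case using f' by auto
qed

lemma smooth_on_Ck: "smooth_on S f \<Longrightarrow> Ck_on k S f"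
  by (simp add: smooth_on_def)

lemma smooth_on_imp_continuous: "smooth_on S f \<Longrightarrow> continuous_on S f"
  using smooth_on_Ck[of S f 0] by simp

lemma smooth_on_subset: "smooth_on S f \<Longrightarrow> T \<subseteq> S \<Longrightarrow> smooth_on T f"
  unfolding smooth_on_def using Ck_on_subset by blast

lemma smooth_on_cong: "smooth_on S f \<Longrightarrow> (\<And>x. x \<in> S \<Longrightarrow> f x = g x) \<Longrightarrow> smooth_on S g"
  unfolding smooth_on_def using Ck_on_cong by blast

lemma smooth_on_local:
  assumes "thick S" "\<And>x. x \<in> S \<Longrightarrow> \<exists>U. open U \<and> x \<in> U \<and> smooth_on (S \<inter> U) f"
  shows "smooth_on S f"
  unfolding smooth_on_def
proof
  fix k show "Ck_on k S f" by (rule Ck_on_local[OF assms(1)]) (use assms(2) smooth_on_Ck in blast)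
qed

lemma smooth_on_compose:
  "smooth_on T g \<Longrightarrow> smooth_on S f \<Longrightarrow> f ` S \<subseteq> T \<Longrightarrow> smooth_on S (\<lambda>x. g (f x))"
  unfolding smooth_on_def by (blast intro: Ck_on_compose)

named_theorems smooth_intros

lemma
  shows smooth_on_const [simp, smooth_intros]: "smooth_on S (\<lambda>x. c)"
    and smooth_on_bounded_linear: "bounded_linear h \<Longrightarrow> smooth_on S h"
    and smooth_on_scaleR [smooth_intros]: "smooth_on S r \<Longrightarrow> smooth_on S f \<Longrightarrow> smooth_on S (\<lambda>x. r x *\<^sub>R f x)"
    and smooth_on_mult [smooth_intros]: "smooth_on S r \<Longrightarrow> smooth_on S q \<Longrightarrow> smooth_on S (\<lambda>x. r x * q x :: real)"
    and smooth_on_inner [smooth_intros]: "smooth_on S f \<Longrightarrow> smooth_on S g \<Longrightarrow> smooth_on S (\<lambda>x. f x \<bullet> g x)"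
    and smooth_on_add [smooth_intros]: "smooth_on S f \<Longrightarrow> smooth_on S g \<Longrightarrow> smooth_on S (\<lambda>x. f x + g x)"
    and smooth_on_diff [smooth_intros]: "smooth_on S f \<Longrightarrow> smooth_on S g \<Longrightarrow> smooth_on S (\<lambda>x. f x - g x)"
    and smooth_on_sum [smooth_intros]: "(\<And>i. i \<in> I \<Longrightarrow> smooth_on S (F i)) \<Longrightarrow> smooth_on S (\<lambda>x. \<Sum>i\<in>I. F i x)"
    and smooth_on_Pair [smooth_intros]: "smooth_on S f \<Longrightarrow> smooth_on S h' \<Longrightarrow> smooth_on S (\<lambda>x. (f x, h' x))"
    and smooth_on_fst [smooth_intros]: "smooth_on S P \<Longrightarrow> smooth_on S (\<lambda>x. fst (P x))"
    and smooth_on_snd [smooth_intros]: "smooth_on S P \<Longrightarrow> smooth_on S (\<lambda>x. snd (P x))"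
    and smooth_on_inverse: "smooth_on S r \<Longrightarrow> (\<And>x. x \<in> S \<Longrightarrow> r x \<noteq> 0) \<Longrightarrow> smooth_on S (\<lambda>x. inverse (r x))"
  unfolding smooth_on_def
  by (auto intro: Ck_on_bounded_linear Ck_on_linear_comp Ck_on_scaleR Ck_on_mult Ck_on_inner Ck_on_add
     Ck_on_minus Ck_on_diff Ck_on_sum Ck_on_Pair Ck_on_fst Ck_on_snd Ck_on_inverse)

lemma smooth_on_id [simp, smooth_intros]: "smooth_on S (\<lambda>x. x)"
  by (rule smooth_on_bounded_linear[OF bounded_linear_ident])

text \<open>The definition permits a different derivative for every order k; uniqueness on thick
  sets identifies them all with \<open>frechet_derivative\<close>.\<close>

lemma smooth_on_derivative:
  assumes "thick S" "smooth_on S f"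
  shows "x \<in> S \<Longrightarrow> (f has_derivative frechet_derivative f (at x within S)) (at x within S)"
    and "smooth_on S (\<lambda>x. frechet_derivative f (at x within S) v)"
proof -
  show 1: "x \<in> S \<Longrightarrow> (f has_derivative frechet_derivative f (at x within S)) (at x within S)" for x
    using smooth_on_Ck[OF assms(2), of "Suc 0"]
    by (metis Ck_on.simps(2) differentiableI frechet_derivative_works)
  show "smooth_on S (\<lambda>x. frechet_derivative f (at x within S) v)"
    unfolding smooth_on_def
  proof
    fix k
    from smooth_on_Ck[OF assms(2), of "Suc k"] obtain f' where f': "\<forall>x\<in>S. (f has_derivative f' x) (at x within S)"
      "\<forall>v. Ck_on k S (\<lambda>x. f' x v)" by auto
    moreover have "f' x = frechet_derivative f (at x within S)" if "x \<in> S" for x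
      using that 1 f' by (intro thick_unique[OF assms(1)]) auto
    ultimately show "Ck_on k S (\<lambda>x. frechet_derivative f (at x within S) v)"
      using Ck_on_cong[of k S "\<lambda>x. f' x v" "\<lambda>x. frechet_derivative f (at x within S) v"] by simp
  qed
qed

lemma smooth_on_open_derivative:
  assumes "open S" "smooth_on S f"
  shows "x \<in> S \<Longrightarrow> (f has_derivative frechet_derivative f (at x)) (at x)"
    and "smooth_on S (\<lambda>x. frechet_derivative f (at x) v)"
proof -
  show "x \<in> S \<Longrightarrow> (f has_derivative frechet_derivative f (at x)) (at x)"
    using smooth_on_derivative(1)[OF thick_open[OF assms(1)] assms(2), of x] by (simp add: at_within_open[OF _ assms(1)])
  show "smooth_on S (\<lambda>x. frechet_derivative f (at x) v)"
    by (rule smooth_on_cong[OF smooth_on_derivative(2)[OF thick_open[OF assms(1)] assms(2), of v]])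
      (simp add: at_within_open[OF _ assms(1)])
qed

text \<open>At a zero of \<open>f\<close> the product rule needs only continuity of
  \<open>g\<close>, because the derivative of \<open>g\<close> would be multiplied by 0. It is
  applied to a solution of a linear equation that is not yet known to be differentiable.\<close>

lemma has_derivative_mult_vanishing:
  fixes g :: "'a::real_normed_vector \<Rightarrow> real" and f :: "'a \<Rightarrow> 'b::real_normed_vector"
  assumes g: "continuous (at x within S) g" and f: "(f has_derivative f') (at x within S)" and "f x = 0"
  shows "((\<lambda>y. g y *\<^sub>R f y) has_derivative (\<lambda>h. g x *\<^sub>R f' h)) (at x within S)"
proof -
  interpret f': bounded_linear f' using f by (rule has_derivative_bounded_linear)
  have 1: "((\<lambda>y. norm (f y - f' (y - x)) / norm (y - x)) \<longlongrightarrow> 0) (at x within S)"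
    using f \<open>f x = 0\<close> by (simp add: has_derivative_iff_norm)
  have g0: "((\<lambda>y. g y - g x) \<longlongrightarrow> 0) (at x within S)"
    using g by (simp add: continuous_within LIM_zero)
  obtain K where K: "\<And>h. norm (f' h) \<le> norm h * K" "K > 0" using f'.pos_bounded by blast
  have 2: "((\<lambda>y. \<bar>g y\<bar> * (norm (f y - f' (y - x)) / norm (y - x)) + \<bar>g y - g x\<bar> * K) \<longlongrightarrow> \<bar>g x\<bar> * 0 + 0 * K) (at x within S)"
    using g by (intro tendsto_intros 1 tendsto_rabs_zero g0) (simp add: continuous_within)
  have "((\<lambda>y. norm (g y *\<^sub>R f y - g x *\<^sub>R f x - g x *\<^sub>R f' (y - x)) / norm (y - x)) \<longlongrightarrow> 0) (at x within S)"
  proof (rule Lim_null_comparison)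
    show "((\<lambda>y. \<bar>g y\<bar> * (norm (f y - f' (y - x)) / norm (y - x)) + \<bar>g y - g x\<bar> * K) \<longlongrightarrow> 0) (at x within S)"
      using 2 by simp
    show "\<forall>\<^sub>F y in at x within S. norm (norm (g y *\<^sub>R f y - g x *\<^sub>R f x - g x *\<^sub>R f' (y - x)) / norm (y - x))
        \<le> \<bar>g y\<bar> * (norm (f y - f' (y - x)) / norm (y - x)) + \<bar>g y - g x\<bar> * K"
    proof (rule eventuallyI)
      fix y
      have "norm (g y *\<^sub>R f y - g x *\<^sub>R f x - g x *\<^sub>R f' (y - x)) =
          norm (g y *\<^sub>R (f y - f' (y - x)) + (g y - g x) *\<^sub>R f' (y - x))"
        using \<open>f x = 0\<close> by (simp add: algebra_simps)
      also have "\<dots> \<le> \<bar>g y\<bar> * norm (f y - f' (y - x)) + \<bar>g y - g x\<bar> * norm (f' (y - x))"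
        by (metis norm_scaleR norm_triangle_ineq)
      also have "\<dots> \<le> \<bar>g y\<bar> * norm (f y - f' (y - x)) + \<bar>g y - g x\<bar> * (norm (y - x) * K)"
        by (intro add_left_mono mult_left_mono K) auto
      finally show "norm (norm (g y *\<^sub>R f y - g x *\<^sub>R f x - g x *\<^sub>R f' (y - x)) / norm (y - x))
          \<le> \<bar>g y\<bar> * (norm (f y - f' (y - x)) / norm (y - x)) + \<bar>g y - g x\<bar> * K"
        by (cases "y = x") (auto simp: field_simps)
    qed
  qed
  moreover have "bounded_linear (\<lambda>h. g x *\<^sub>R f' h)"
    by (rule bounded_linear_scaleR_right[THEN bounded_linear_compose]) (rule f'.bounded_linear_axioms)
  ultimately show ?thesis by (simp add: has_derivative_iff_norm)
qed

section \<open>Linear equations with smooth coefficients and derivatives of inverse maps\<close>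

context
  fixes S :: "'p::euclidean_space set" and B :: "'p \<Rightarrow> 'e::euclidean_space \<Rightarrow> 'e"
  assumes lin: "\<And>x. x \<in> S \<Longrightarrow> linear (B x)" and inj: "\<And>x v. x \<in> S \<Longrightarrow> B x v = 0 \<Longrightarrow> v = 0"
begin

definition solve where "solve x = inv (B x)"

lemma solve: 
  assumes "x \<in> S" shows "bounded_linear (solve x)" "B x (solve x w) = w" "solve x (B x w) = w"
proof -
  have "inj (B x)" using lin inj assms linear_injective_0 by blast
  then have "surj (B x)" using lin assms linear_injective_imp_surjective by blast
  then show "B x (solve x w) = w" "solve x (B x w) = w"
    unfolding solve_def using \<open>inj (B x)\<close> by (auto simp: surj_f_inv_f)
  show "bounded_linear (solve x)" unfolding solve_def
    using linear_conv_bounded_linear \<open>inj (B x)\<close> \<open>surj (B x)\<close> assms lin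
    by (metis inj_iff linear_injective_left_inverse linear_surj_right_inverse surj_iff linear_inverse_left left_right_inverse_eq)
qed

text \<open>Everything follows from B x (u y - u x) = (b y - b x) - (B y - B x) (u y). It gives
  continuity of \<open>u\<close>; then, since B y - B x vanishes at y = x, it gives
  differentiability; and the derivative solves a linear equation with the same \<open>B\<close>, so
  that induction on k applies.\<close>

lemma Ck_on_linear_solve:
  shows "(\<And>v. Ck_on k S (\<lambda>x. B x v)) \<Longrightarrow> Ck_on k S b \<Longrightarrow> (\<And>x. x \<in> S \<Longrightarrow> B x (u x) = b x) \<Longrightarrow> Ck_on k S u"
proof (induction k arbitrary: b u)
  case 0
  show ?case unfolding Ck_on.simps continuous_on_eq_continuous_within continuous_within
  proof
    fix x assume x: "x \<in> S"
    interpret J: bounded_linear "solve x" by (rule solve(1)[OF x])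
    obtain C where C: "\<And>h. norm (solve x h) \<le> norm h * C" "C > 0" using J.pos_bounded by blast
    define e where "e y = (\<Sum>i\<in>Basis. norm (B y i - B x i))" for y
    have Bc: "((\<lambda>y. B y i) \<longlongrightarrow> B x i) (at x within S)" for i
      using 0(1)[of i] x by (auto simp: continuous_on_def)
    have e0: "(e \<longlongrightarrow> 0) (at x within S)" unfolding e_def
      using tendsto_sum[of Basis "\<lambda>i y. norm (B y i - B x i)" "\<lambda>i. 0" "at x within S"] Bc
      by (simp add: tendsto_norm_zero LIM_zero)
    have bc: "(b \<longlongrightarrow> b x) (at x within S)" using 0(2) x by (auto simp: continuous_on_def)
    have R: "((\<lambda>y. 2 * C * (norm (b y - b x) + e y * norm (u x))) \<longlongrightarrow> 2 * C * (0 + 0 * norm (u x))) (at x within S)"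
      by (intro tendsto_intros e0 tendsto_norm_zero) (use bc LIM_zero in blast)
    have eb: "norm (B y w - B x w) \<le> e y * norm w" if "y \<in> S" for y w
    proof -
      have "B y w - B x w = (\<Sum>i\<in>Basis. (w \<bullet> i) *\<^sub>R (B y i - B x i))"
        using linear_sum[OF lin[OF that], of "\<lambda>i. (w \<bullet> i) *\<^sub>R i" Basis] linear_sum[OF lin[OF x], of "\<lambda>i. (w \<bullet> i) *\<^sub>R i" Basis]
          linear_cmul[OF lin[OF that]] linear_cmul[OF lin[OF x]]
        by (simp add: euclidean_representation scaleR_diff_right sum_subtractf)
      also have "norm \<dots> \<le> (\<Sum>i\<in>Basis. norm (B y i - B x i) * norm w)"
        by (rule sum_norm_le) (simp add: Basis_le_norm mult.commute[of _ "norm w"] mult_right_mono)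
      finally show ?thesis by (simp add: e_def sum_distrib_right)
    qed
    \<comment> \<open>\<open>e y\<close> bounds the operator norm of B y - B x and \<open>C\<close>
      that of the inverse of B x. Below this threshold at most half of
      \<open>norm (u y - u x)\<close> appears on the right and can be absorbed.\<close>
    have "eventually (\<lambda>y. e y < 1 / (2 * C)) (at x within S)"
      using order_tendstoD(2)[OF e0] C(2) by simp
    moreover have "eventually (\<lambda>y. y \<in> S) (at x within S)" by (simp add: eventually_at_filter)
    ultimately have "eventually (\<lambda>y. norm (u y - u x) \<le> 2 * C * (norm (b y - b x) + e y * norm (u x))) (at x within S)"
    proof eventually_elim
      case (elim y)
      have "B x (u y - u x) = (b y - b x) - (B y (u y) - B x (u y))"
        using 0(3)[OF x] 0(3)[OF elim(2)] linear_diff[OF lin[OF x]] by simp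
      then have "u y - u x = solve x ((b y - b x) - (B y (u y) - B x (u y)))"
        using solve(3)[OF x] by metis
      also have "norm \<dots> \<le> norm ((b y - b x) - (B y (u y) - B x (u y))) * C" by (rule C)
      also have "\<dots> \<le> (norm (b y - b x) + e y * norm (u y)) * C"
        using C(2) eb[OF elim(2), of "u y"] by (intro mult_right_mono) (auto intro: order_trans[OF norm_triangle_ineq4])
      also have "\<dots> \<le> (norm (b y - b x) + e y * (norm (u x) + norm (u y - u x))) * C"
        using C(2) by (intro mult_right_mono add_left_mono mult_left_mono) (auto simp: e_def sum_nonneg norm_triangle_sub add.commute)
      finally have *: "norm (u y - u x) \<le> C * (norm (b y - b x) + e y * norm (u x)) + (e y * C) * norm (u y - u x)"
        by (simp add: algebra_simps)
      have "e y * C \<le> 1 / 2" using elim(1) C(2) by (simp add: field_simps)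
      then have "(e y * C) * norm (u y - u x) \<le> 1 / 2 * norm (u y - u x)" by (rule mult_right_mono) simp
      with * show ?case by (simp add: algebra_simps)
    qed
    moreover have "((\<lambda>y. 2 * C * (norm (b y - b x) + e y * norm (u x))) \<longlongrightarrow> 0) (at x within S)"
      using R by simp
    ultimately have "((\<lambda>y. u y - u x) \<longlongrightarrow> 0) (at x within S)"
      by (rule Lim_null_comparison)
    then show "(u \<longlongrightarrow> u x) (at x within S)" by (simp add: LIM_zero_iff)
  qed
next
  case (Suc k)
  have Bk: "Ck_on k S (\<lambda>x. B x v)" for v using Suc.prems(1) Ck_on_Suc_imp by blast
  have uk: "Ck_on k S u" using Suc.IH[OF Bk _ Suc.prems(3)] Suc.prems(2) Ck_on_Suc_imp by blast
  have "\<forall>v. \<exists>f'. (\<forall>x\<in>S. ((\<lambda>x. B x v) has_derivative f' x) (at x within S)) \<and> (\<forall>w. Ck_on k S (\<lambda>x. f' x w))"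
    using Suc.prems(1) by auto
  then obtain B' where B': "\<And>v x. x \<in> S \<Longrightarrow> ((\<lambda>x. B x v) has_derivative B' v x) (at x within S)"
    "\<And>v w. Ck_on k S (\<lambda>x. B' v x w)" by metis
  obtain b' where b': "\<And>x. x \<in> S \<Longrightarrow> (b has_derivative b' x) (at x within S)" "\<And>v. Ck_on k S (\<lambda>x. b' x v)"
    using Suc.prems(2) by auto
  \<comment> \<open>Formal differentiation of B x (u x) = b x in direction \<open>w\<close> yields B
    x (u' x w) = \<open>R x w\<close>.\<close>
  define R where "R x w = b' x w - (\<Sum>i\<in>Basis. (u x \<bullet> i) *\<^sub>R B' i x w)" for x w
  show ?case
  proof (rule Ck_on_SucI)
    fix x assume x: "x \<in> S"
    interpret J: bounded_linear "solve x" by (rule solve(1)[OF x])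
    have uc: "continuous (at x within S) u" using Ck_on_imp_continuous[OF uk] x
      by (simp add: continuous_on_eq_continuous_within)
    have eq: "u y = u x + solve x ((b y - b x) - (\<Sum>i\<in>Basis. (u y \<bullet> i) *\<^sub>R (B y i - B x i)))" if y: "y \<in> S" for y
    proof -
      define w where "w = u y"
      have "B y w - B x w = (\<Sum>i\<in>Basis. (w \<bullet> i) *\<^sub>R (B y i - B x i))"
        using linear_sum[OF lin[OF y], of "\<lambda>i. (w \<bullet> i) *\<^sub>R i" Basis] linear_sum[OF lin[OF x], of "\<lambda>i. (w \<bullet> i) *\<^sub>R i" Basis]
          linear_cmul[OF lin[OF y]] linear_cmul[OF lin[OF x]]
        by (simp add: euclidean_representation scaleR_diff_right sum_subtractf)
      moreover have "B x (u y - u x) = (b y - b x) - (B y w - B x w)"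
        using Suc.prems(3)[OF x] Suc.prems(3)[OF y] linear_diff[OF lin[OF x]] by (simp add: w_def)
      ultimately have "B x (u y - u x) = (b y - b x) - (\<Sum>i\<in>Basis. (u y \<bullet> i) *\<^sub>R (B y i - B x i))"
        unfolding w_def by (rule trans[OF _ arg_cong[of _ _ "(-) (b y - b x)"], rotated])
      then have "u y - u x = solve x ((b y - b x) - (\<Sum>i\<in>Basis. (u y \<bullet> i) *\<^sub>R (B y i - B x i)))"
        using solve(3)[OF x, of "u y - u x"] by argo
      then show ?thesis by (simp only: algebra_simps)
    qed
    have "((\<lambda>y. u x + solve x ((b y - b x) - (\<Sum>i\<in>Basis. (u y \<bullet> i) *\<^sub>R (B y i - B x i)))) has_derivative
       (\<lambda>w. solve x (R x w))) (at x within S)"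
    proof -
      have "((\<lambda>y. \<Sum>i\<in>Basis. (u y \<bullet> i) *\<^sub>R (B y i - B x i)) has_derivative (\<lambda>w. \<Sum>i\<in>Basis. (u x \<bullet> i) *\<^sub>R (B' i x w))) (at x within S)"
        using has_derivative_diff[OF B'(1)[OF x] has_derivative_const]
        by (intro has_derivative_sum has_derivative_mult_vanishing continuous_inner continuous_const uc) auto
      from has_derivative_diff[OF has_derivative_diff[OF b'(1)[OF x] has_derivative_const] this]
      have "((\<lambda>y. b y - b x - (\<Sum>i\<in>Basis. (u y \<bullet> i) *\<^sub>R (B y i - B x i))) has_derivative R x) (at x within S)"
        by (simp add: R_def[abs_def])
      from has_derivative_add[OF has_derivative_const J.has_derivative[OF this]] show ?thesis by simp
    qed
    then show "(u has_derivative (\<lambda>w. solve x (R x w))) (at x within S)"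
      by (rule has_derivative_transform[OF x, rotated]) (rule eq)
  next
    fix i :: 'p
    show "Ck_on k S (\<lambda>x. solve x (R x i))"
    proof (rule Suc.IH[OF Bk])
      show "Ck_on k S (\<lambda>x. R x i)" unfolding R_def
        by (intro Ck_on_diff b' Ck_on_sum Ck_on_scaleR Ck_on_inner uk Ck_on_const B')
    qed (simp add: solve)
  qed
qed

lemma smooth_on_linear_solve:
  "(\<And>v. smooth_on S (\<lambda>x. B x v)) \<Longrightarrow> smooth_on S b \<Longrightarrow> (\<And>x. x \<in> S \<Longrightarrow> B x (u x) = b x) \<Longrightarrow> smooth_on S u"
  unfolding smooth_on_def by (blast intro: Ck_on_linear_solve)

end

text \<open>The sets \<open>S\<close> and \<open>T\<close> may be closed in some directions, such as
  time; continuity of \<open>g\<close> brings \<open>g z\<close> close enough to \<open>g y\<close>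
  for the differentiability of \<open>f\<close> to be used.\<close>

lemma has_derivative_inverse_within:
  fixes f :: "'a::real_normed_vector \<Rightarrow> 'b::real_normed_vector"
  assumes f: "(f has_derivative f') (at (g y) within S)" and g': "bounded_linear g'" "\<And>v. g' (f' v) = v"
    and g: "continuous (at y within T) g" and "y \<in> T" and T: "\<And>z. z \<in> T \<Longrightarrow> g z \<in> S \<and> f (g z) = z"
  shows "(g has_derivative g') (at y within T)"
  unfolding has_derivative_within_alt
proof (intro conjI allI impI)
  interpret g': bounded_linear g' by fact
  obtain C where C: "C > 0" "\<And>h. norm (g' h) \<le> norm h * C" using g'.pos_bounded by blast
  fix e :: real assume e: "0 < e"
  \<comment> \<open>The first bound absorbs half of \<open>norm (g z - g y)\<close> and so yields
    norm (g z - g y) \<le> 2 * C * norm (z - y); the second turns this into the required error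
    \<open>e\<close>.\<close>
  define e1 where "e1 = min (1 / (2 * C)) (e / (2 * C * C))"
  have e1: "e1 > 0" "e1 * C \<le> 1/2" "e1 * C * (2 * C) \<le> e"
    using e C by (auto simp: e1_def min_def field_simps)
  obtain d where d: "d > 0" "\<And>x. x \<in> S \<Longrightarrow> norm (x - g y) < d \<Longrightarrow> norm (f x - f (g y) - f' (x - g y)) \<le> e1 * norm (x - g y)"
    using f e1(1) unfolding has_derivative_within_alt by metis
  obtain d' where d': "d' > 0" "\<And>z. z \<in> T \<Longrightarrow> dist z y < d' \<Longrightarrow> dist (g z) (g y) < d"
    using g d(1) unfolding continuous_within_eps_delta by metis
  show "\<exists>d>0. \<forall>z\<in>T. norm (z - y) < d \<longrightarrow> norm (g z - g y - g' (z - y)) \<le> e * norm (z - y)"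
  proof (intro exI conjI ballI impI)
    fix z assume z: "z \<in> T" "norm (z - y) < d'"
    have *: "norm (z - y - f' (g z - g y)) \<le> e1 * norm (g z - g y)"
      using d(2)[of "g z"] d'(2)[of z] z T[of z] T[OF \<open>y \<in> T\<close>] by (simp add: dist_norm)
    have "g z - g y - g' (z - y) = - g' (z - y - f' (g z - g y))" by (simp add: g'.diff g'(2))
    then have "norm (g z - g y - g' (z - y)) \<le> norm (z - y - f' (g z - g y)) * C" using C(2) by simp
    also have "\<dots> \<le> e1 * norm (g z - g y) * C" using * C by (intro mult_right_mono) auto
    finally have 1: "norm (g z - g y - g' (z - y)) \<le> (e1 * C) * norm (g z - g y)" by (simp add: ac_simps)
    also have "\<dots> \<le> 1/2 * norm (g z - g y)" using e1 by (intro mult_right_mono) auto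
    finally have "norm (g z - g y) \<le> 1/2 * norm (g z - g y) + norm (g' (z - y))"
      by (smt (verit) norm_triangle_ineq2)
    then have "norm (g z - g y) \<le> 2 * C * norm (z - y)" using C(2)[of "z - y"] by (simp add: ac_simps)
    with 1 have "norm (g z - g y - g' (z - y)) \<le> (e1 * C) * (2 * C * norm (z - y))"
      using e1(1) C(1) by (smt (verit) mult_left_mono mult_pos_pos)
    also have "\<dots> \<le> e * norm (z - y)" using mult_right_mono[OF e1(3), of "norm (z - y)"] by (simp add: ac_simps)
    finally show "norm (g z - g y - g' (z - y)) \<le> e * norm (z - y)" .
  qed (use d' in auto)
qed (rule g')

section \<open>Integrals depending on a parameter\<close>

lemma continuous_on_Times_swap:
  "continuous_on (A \<times> B) (\<lambda>p. F (fst p) (snd p)) \<Longrightarrow> continuous_on (B \<times> A) (\<lambda>q. F (snd q) (fst q))"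
  by (rule continuous_on_compose2[of "A \<times> B" "\<lambda>p. F (fst p) (snd p)" "B \<times> A" "\<lambda>q. (snd q, fst q)", simplified])
    (auto intro!: continuous_intros)

lemma continuous_on_Times_section:
  "continuous_on (A \<times> B) (\<lambda>p. F (fst p) (snd p)) \<Longrightarrow> y \<in> B \<Longrightarrow> continuous_on A (\<lambda>s. F s y)"
  by (rule continuous_on_compose2[of "A \<times> B" "\<lambda>p. F (fst p) (snd p)" "A" "\<lambda>s. (s, y)", simplified])
    (auto intro!: continuous_intros)

lemma continuous_on_Times_section':
  "continuous_on (B \<times> A) (\<lambda>(x, s). D x s) \<Longrightarrow> x \<in> B \<Longrightarrow> continuous_on A (D x)"
  by (rule continuous_on_compose2[of "B \<times> A" "\<lambda>(x, s). D x s" "A" "\<lambda>s. (x, s)", simplified])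
    (auto intro!: continuous_intros)

text \<open>Each derivative passes under the integral by \<open>leibniz_rule\<close>, which works on
  convex sets and wants the derivative to be a continuous map into the bounded linear operators;
  hence the detour through \<open>Blinfun\<close>.\<close>

lemma Ck_on_integral_convex:
  fixes f :: "real \<Rightarrow> 'a::euclidean_space \<Rightarrow> 'b::euclidean_space"
  assumes ab: "a < b" and U: "open U" "convex U"
  shows "Ck_on k ({a..b} \<times> U) (\<lambda>p. f (fst p) (snd p)) \<Longrightarrow> Ck_on k U (\<lambda>x. integral {a..b} (\<lambda>s. f s x))"
proof (induction k arbitrary: f)
  case 0
  have "continuous_on (U \<times> cbox a b) (\<lambda>(x, s). f s x)"
    using 0 by (simp add: split_beta continuous_on_Times_swap)
  then show ?case using integral_continuous_on_param[of U a b "\<lambda>x s. f s x"] by simp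
next
  case (Suc k)
  then obtain f' where f': "\<And>p. p \<in> {a..b} \<times> U \<Longrightarrow> ((\<lambda>p. f (fst p) (snd p)) has_derivative f' p) (at p within {a..b} \<times> U)"
    "\<And>v. Ck_on k ({a..b} \<times> U) (\<lambda>p. f' p v)" by auto
  define D where "D x s = Blinfun (\<lambda>h. f' (s, x) (0, h))" for x s
  have der: "((\<lambda>x. f s x) has_derivative (\<lambda>h. f' (s, x) (0, h))) (at x within U)" if "s \<in> {a..b}" "x \<in> U" for s x
  proof -
    have "((\<lambda>x. (\<lambda>p. f (fst p) (snd p)) (s, x)) has_derivative (\<lambda>h. f' (s, x) (0, h))) (at x within U)"
      using that by (intro has_derivative_in_compose2[of "{a..b} \<times> U" "\<lambda>p. f (fst p) (snd p)" f' "\<lambda>x. (s, x)" U x "\<lambda>h. (0, h)"] f' has_derivative_Pair has_derivative_const has_derivative_ident) auto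
    then show ?thesis by simp
  qed
  have D: "blinfun_apply (D x s) = (\<lambda>h. f' (s, x) (0, h))" if "s \<in> {a..b}" "x \<in> U" for s x
    unfolding D_def using der[OF that] by (intro bounded_linear_Blinfun_apply has_derivative_bounded_linear)
  have Dc: "continuous_on (U \<times> {a..b}) (\<lambda>(x, s). D x s)"
  proof (rule continuous_on_blinfun_componentwise)
    fix i :: 'a
    have "continuous_on ({a..b} \<times> U) (\<lambda>p. f' (fst p, snd p) (0, i))"
      using Ck_on_imp_continuous[OF f'(2), of "(0, i)"] by simp
    then have "continuous_on (U \<times> {a..b}) (\<lambda>q. f' (snd q, fst q) (0, i))"
      by (rule continuous_on_Times_swap)
    then show "continuous_on (U \<times> {a..b}) (\<lambda>q. blinfun_apply (case q of (x, s) \<Rightarrow> D x s) i)"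
      by (rule continuous_on_eq) (auto simp: D)
  qed
  have fc: "(\<lambda>s. f s x) integrable_on cbox a b" if "x \<in> U" for x
  proof (rule integrable_continuous)
    have "continuous_on ({a..b} \<times> U) (\<lambda>p. f (fst p) (snd p))" by (rule Ck_on_imp_continuous[OF Suc.prems])
    then show "continuous_on (cbox a b) (\<lambda>s. f s x)"
      using continuous_on_Times_section[OF _ that] by simp
  qed
  show ?case
  proof (rule Ck_on_SucI)
    fix x assume x: "x \<in> U"
    have "((\<lambda>x. integral (cbox a b) (\<lambda>s. f s x)) has_derivative integral (cbox a b) (D x)) (at x within U)"
      by (rule leibniz_rule) (use der D Dc x U fc in auto)
    moreover have "D x integrable_on cbox a b"
      using continuous_on_Times_section'[OF Dc x] by (intro integrable_continuous) simp
    then have "blinfun_apply (integral (cbox a b) (D x)) h = integral {a..b} (\<lambda>s. f' (s, x) (0, h))" for h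
      by (simp add: blinfun_apply_integral) (use D x in \<open>auto intro!: integral_cong\<close>)
    then have "blinfun_apply (integral (cbox a b) (D x)) = (\<lambda>h. integral {a..b} (\<lambda>s. f' (s, x) (0, h)))" ..
    ultimately show "((\<lambda>x. integral {a..b} (\<lambda>s. f s x)) has_derivative (\<lambda>h. integral {a..b} (\<lambda>s. f' (s, x) (0, h)))) (at x within U)"
      by simp
  next
    fix i :: 'a
    show "Ck_on k U (\<lambda>x. integral {a..b} (\<lambda>s. f' (s, x) (0, i)))"
      by (rule Suc.IH) (simp add: f'(2))
  qed
qed

text \<open>Smoothness is local, so balls supply the convexity.\<close>

lemma smooth_on_integral:
  fixes f :: "real \<Rightarrow> 'a::euclidean_space \<Rightarrow> 'b::euclidean_space"
  assumes "open U" "smooth_on ({a..b} \<times> U) (\<lambda>p. f (fst p) (snd p))"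
  shows "smooth_on U (\<lambda>x. integral {a..b} (\<lambda>s. f s x))"
proof (cases "a < b")
  case True
  show ?thesis
  proof (rule smooth_on_local[OF thick_open[OF assms(1)]])
    fix x assume "x \<in> U"
    then obtain r where r: "r > 0" "ball x r \<subseteq> U" using assms(1) open_contains_ball by blast
    have "smooth_on (ball x r) (\<lambda>x. integral {a..b} (\<lambda>s. f s x))"
      unfolding smooth_on_def
    proof
      fix k have "{a..b} \<times> ball x r \<subseteq> {a..b} \<times> U" using r by auto
      then show "Ck_on k (ball x r) (\<lambda>x. integral {a..b} (\<lambda>s. f s x))"
        by (intro Ck_on_integral_convex True open_ball convex_ball Ck_on_subset[OF smooth_on_Ck[OF assms(2)]])
    qed
    moreover have "U \<inter> ball x r = ball x r" using r by auto
    ultimately show "\<exists>V. open V \<and> x \<in> V \<and> smooth_on (U \<inter> V) (\<lambda>x. integral {a..b} (\<lambda>s. f s x))"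
      using r by (intro exI[of _ "ball x r"]) simp
  qed
next
  case False
  then have "integral {a..b} g = 0" for g :: "real \<Rightarrow> 'b" by (cases "a = b") auto
  then show ?thesis by simp
qed

lemma has_derivative_integral_param:
  fixes f :: "real \<Rightarrow> 'a::euclidean_space \<Rightarrow> 'b::euclidean_space"
  assumes U: "open U" "x \<in> U"
    and f': "\<And>s x. s \<in> {a..b} \<Longrightarrow> x \<in> U \<Longrightarrow> (f s has_derivative f' s x) (at x)"
    and c: "\<And>v. continuous_on ({a..b} \<times> U) (\<lambda>p. f' (fst p) (snd p) v)"
    and cf: "\<And>x. x \<in> U \<Longrightarrow> continuous_on {a..b} (\<lambda>s. f s x)"
  shows "((\<lambda>x. integral {a..b} (\<lambda>s. f s x)) has_derivative (\<lambda>v. integral {a..b} (\<lambda>s. f' s x v))) (at x)"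
proof -
  obtain r where r: "r > 0" "ball x r \<subseteq> U" using U open_contains_ball by blast
  define D where "D x s = Blinfun (f' s x)" for x s
  have D: "blinfun_apply (D x s) = f' s x" if "s \<in> {a..b}" "x \<in> U" for s x
    unfolding D_def using f'[OF that] by (intro bounded_linear_Blinfun_apply has_derivative_bounded_linear)
  have Dc: "continuous_on (ball x r \<times> {a..b}) (\<lambda>(x, s). D x s)"
  proof (rule continuous_on_blinfun_componentwise)
    fix i :: 'a
    have "continuous_on (ball x r \<times> {a..b}) (\<lambda>q. f' (snd q) (fst q) i)"
      using r by (intro continuous_on_Times_swap[of "{a..b}" "ball x r" "\<lambda>s x. f' s x i"] continuous_on_subset[OF c[of i]]) auto
    then show "continuous_on (ball x r \<times> {a..b}) (\<lambda>q. blinfun_apply (case q of (x, s) \<Rightarrow> D x s) i)"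
      by (rule continuous_on_eq) (use r in \<open>auto simp: D subset_iff\<close>)
  qed
  have "((\<lambda>x. integral (cbox a b) (\<lambda>s. f s x)) has_derivative integral (cbox a b) (D x)) (at x within ball x r)"
  proof (rule leibniz_rule)
    fix z s assume z: "z \<in> ball x r" "s \<in> cbox a b"
    then have "z \<in> U" using r by auto
    with z show "(f s has_derivative blinfun_apply (D z s)) (at z within ball x r)"
      using f'[of s z] D[of s z] by (simp add: has_derivative_at_withinI)
  next
    fix z assume "z \<in> ball x r"
    then have "z \<in> U" using r by auto
    then show "(\<lambda>s. f s z) integrable_on cbox a b" using cf by (intro integrable_continuous) simp
  qed (use r Dc in auto)
  moreover have "D x integrable_on cbox a b"
    using continuous_on_Times_section'[OF Dc, of x] r by (intro integrable_continuous) simp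
  then have "blinfun_apply (integral (cbox a b) (D x)) v = integral {a..b} (\<lambda>s. f' s x v)" for v
    by (simp add: blinfun_apply_integral) (use D U in \<open>auto intro!: integral_cong\<close>)
  then have "blinfun_apply (integral (cbox a b) (D x)) = (\<lambda>v. integral {a..b} (\<lambda>s. f' s x v))" ..
  ultimately show ?thesis using r by (simp add: at_within_open[of x "ball x r"])
qed

text \<open>Integrating in time, differentiating under the integral and applying the fundamental theorem
  of calculus avoids second differences, which are one-sided at the end points.\<close>

lemma mixed_partials:
  fixes f :: "real \<Rightarrow> 'a::euclidean_space \<Rightarrow> 'b::euclidean_space"
  assumes ab: "a < b" and U: "open U" and y: "y \<in> U" and t: "t \<in> {a..b}"
    and h: "\<And>t y. t \<in> {a..b} \<Longrightarrow> y \<in> U \<Longrightarrow> ((\<lambda>s. f s y) has_vector_derivative h t y) (at t within {a..b})"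
    and hc: "\<And>y. y \<in> U \<Longrightarrow> continuous_on {a..b} (\<lambda>s. h s y)"
    and g: "\<And>t y. t \<in> {a..b} \<Longrightarrow> y \<in> U \<Longrightarrow> (f t has_derivative g t y) (at y)"
    and h': "\<And>t y. t \<in> {a..b} \<Longrightarrow> y \<in> U \<Longrightarrow> (h t has_derivative h' t y) (at y)"
    and c: "\<And>v. continuous_on ({a..b} \<times> U) (\<lambda>p. h' (fst p) (snd p) v)"
  shows "((\<lambda>s. g s y v) has_vector_derivative h' t y v) (at t within {a..b})"
proof -
  have eq: "g s y v = g a y v + integral {a..s} (\<lambda>r. h' r y v)" if s: "s \<in> {a..b}" for s
  proof -
    have "((\<lambda>y. integral {a..s} (\<lambda>r. h r y)) has_derivative (\<lambda>v. integral {a..s} (\<lambda>r. h' r y v))) (at y)"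
      using s by (intro has_derivative_integral_param[OF U y] h' continuous_on_subset[OF c] continuous_on_subset[OF hc]) auto
    then have "((\<lambda>y. f a y + integral {a..s} (\<lambda>r. h r y)) has_derivative (\<lambda>v. g a y v + integral {a..s} (\<lambda>r. h' r y v))) (at y)"
      using g[of a y] ab y by (intro has_derivative_add) auto
    moreover have "f a z + integral {a..s} (\<lambda>r. h r z) = f s z" if z: "z \<in> U" for z
    proof -
      have "((\<lambda>r. h r z) has_integral (f s z - f a z)) {a..s}"
        using s by (intro fundamental_theorem_of_calculus has_vector_derivative_within_subset[OF h[OF _ z]]) auto
      then show ?thesis by (simp add: integral_unique)
    qed
    ultimately have "(f s has_derivative (\<lambda>v. g a y v + integral {a..s} (\<lambda>r. h' r y v))) (at y)"
      by (rule has_derivative_transform_within_open[OF _ U y])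
    from fun_cong[OF has_derivative_unique[OF g[OF s y] this]] show ?thesis .
  qed
  have "((\<lambda>s. g a y v + integral {a..s} (\<lambda>r. h' r y v)) has_vector_derivative 0 + h' t y v) (at t within {a..b})"
    using t y by (intro has_vector_derivative_add has_vector_derivative_const integral_has_vector_derivative
        continuous_on_Times_section[OF c[of v]])
  from has_vector_derivative_transform[OF t eq this] show ?thesis unfolding add_0_left .
qed

section \<open>Bump functions\<close>

text \<open>For n = 0 this is exp(-1/x) extended by 0 to x \<le> 0. The powers of 1/x make the
  family closed under differentiation up to linear combinations.\<close>

definition expinv :: "nat \<Rightarrow> real \<Rightarrow> real" where
  "expinv n x = (if x > 0 then (1 / x) ^ n / exp (1 / x) else 0)"

lemma expinv_tendsto: "(expinv n \<longlongrightarrow> 0) (at 0)"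
proof -
  have "((\<lambda>x::real. (inverse x) ^ n / exp (inverse x)) \<longlongrightarrow> 0) (at_right 0)"
    by (rule filterlim_compose[OF tendsto_power_div_exp_0 filterlim_inverse_at_top_right])
  then have "(expinv n \<longlongrightarrow> 0) (at_right 0)"
    by (rule Lim_transform_eventually) (auto simp: expinv_def eventually_at_filter inverse_eq_divide)
  moreover have "(expinv n \<longlongrightarrow> 0) (at_left 0)"
    by (rule Lim_transform_eventually[OF tendsto_const]) (auto simp: expinv_def eventually_at_filter)
  ultimately show ?thesis by (simp add: filterlim_split_at)
qed

lemma expinv_deriv: "(expinv n has_real_derivative expinv (n + 2) x - n * expinv (n + 1) x) (at x)"
proof -
  consider "x > 0" | "x < 0" | "x = 0" by linarith
  then show ?thesis
  proof cases
    case 1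
    have "((\<lambda>x. (1 / x) ^ n / exp (1 / x)) has_real_derivative expinv (n + 2) x - n * expinv (n + 1) x) (at x)"
    proof (cases n)
      case (Suc m)
      have "real n * (1 / x) ^ (n - Suc 0) * (- 1 / (x * x)) = - n * (1 / x) ^ (n + 1)"
        using 1 by (simp add: Suc field_simps)
      then show ?thesis using 1
        by (auto intro!: derivative_eq_intros simp: expinv_def field_simps power2_eq_square)
    qed (use 1 in \<open>auto intro!: derivative_eq_intros simp: expinv_def field_simps power2_eq_square\<close>)
    then show ?thesis
      by (rule has_field_derivative_transform_within_open[of _ _ _ "{0<..}"]) (use 1 in \<open>auto simp: expinv_def\<close>)
  next
    case 2
    have "((\<lambda>x. 0) has_real_derivative expinv (n + 2) x - n * expinv (n + 1) x) (at x)"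
      using 2 by (simp add: expinv_def)
    then show ?thesis
      by (rule has_field_derivative_transform_within_open[of _ _ _ "{..<0}"]) (use 2 in \<open>auto simp: expinv_def\<close>)
  next
    case 3
    \<comment> \<open>The difference quotient of \<open>expinv n\<close> at 0 is
      \<open>expinv (Suc n)\<close>.\<close>
    have "((\<lambda>h. (expinv n (0 + h) - expinv n 0) / h) \<longlongrightarrow> 0) (at 0)"
      by (rule Lim_transform_eventually[OF expinv_tendsto[of "Suc n"]])
        (auto simp: expinv_def eventually_at_filter)
    then have "(expinv n has_real_derivative 0) (at 0)" by (simp add: DERIV_def)
    then show ?thesis using 3 by (simp add: expinv_def)
  qed
qed

lemma Ck_on_expinv: "Ck_on k UNIV (expinv n)"
proof (induction k arbitrary: n)
  case 0
  show ?case using DERIV_isCont[OF expinv_deriv] by (simp add: continuous_at_imp_continuous_on)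
next
  case (Suc k)
  have d: "(expinv n has_derivative (\<lambda>v. (expinv (n + 2) x - n * expinv (n + 1) x) * v)) (at x)" for x
    using expinv_deriv[of n x] by (simp add: has_field_derivative_def)
  show ?case
    by (rule Ck_on_SucI[OF d]) (intro Ck_on_mult Ck_on_diff Ck_on_const Suc.IH)
qed

lemma smooth_on_expinv: "smooth_on UNIV (expinv n)"
  by (simp add: smooth_on_def Ck_on_expinv)

lemma expinv_nonneg: "0 \<le> expinv n x" and expinv_pos: "0 < x \<Longrightarrow> 0 < expinv n x"
  and expinv_0: "x \<le> 0 \<Longrightarrow> expinv n x = 0"
  by (auto simp: expinv_def)

text \<open>The quotient f / (f + g), where \<open>f\<close> is positive exactly on the open ball of
  radius \<open>R\<close> and \<open>g\<close> exactly off the closed ball of radius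
  \<open>r\<close>. Squared distances keep both smooth at the centre.\<close>

lemma bump_function:
  fixes a :: "'a::euclidean_space"
  assumes "0 < r" "r < R"
  obtains \<rho> :: "'a \<Rightarrow> real" where "smooth_on UNIV \<rho>" "\<And>x. x \<in> cball a r \<Longrightarrow> \<rho> x = 1"
    "\<And>x. x \<notin> ball a R \<Longrightarrow> \<rho> x = 0"
proof
  define f where "f x = expinv 0 (R\<^sup>2 - (x - a) \<bullet> (x - a))" for x
  define g where "g x = expinv 0 ((x - a) \<bullet> (x - a) - r\<^sup>2)" for x
  have rR: "r\<^sup>2 < R\<^sup>2" using assms by (simp add: power_strict_mono)
  have pos: "f x + g x > 0" for x
  proof (cases "(x - a) \<bullet> (x - a) < R\<^sup>2")
    case True
    then show ?thesis unfolding f_def g_def by (intro add_pos_nonneg expinv_pos expinv_nonneg) simp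
  next
    case False
    then show ?thesis unfolding f_def g_def using rR by (intro add_nonneg_pos expinv_pos expinv_nonneg) simp
  qed
  have fs: "smooth_on UNIV f" "smooth_on UNIV g" unfolding f_def g_def
    by (auto intro!: smooth_on_compose[OF smooth_on_expinv] smooth_intros)
  show "smooth_on UNIV (\<lambda>x. f x * inverse (f x + g x))"
    using pos by (intro smooth_intros smooth_on_inverse fs) (metis less_irrefl)
  show "f x * inverse (f x + g x) = 1" if "x \<in> cball a r" for x
  proof -
    have "(x - a) \<bullet> (x - a) \<le> r\<^sup>2"
      using that assms by (simp add: dist_norm norm_minus_commute flip: power2_norm_eq_inner)
    then have "g x = 0" unfolding g_def by (intro expinv_0) simp
    then show ?thesis using pos[of x] by simp
  qed
  show "f x * inverse (f x + g x) = 0" if "x \<notin> ball a R" for x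
  proof -
    have "R\<^sup>2 \<le> (x - a) \<bullet> (x - a)"
      using that assms by (simp add: dist_norm norm_minus_commute flip: power2_norm_eq_inner)
    then have "f x = 0" unfolding f_def by (intro expinv_0) simp
    then show ?thesis by simp
  qed
qed

section \<open>Ordinary differential equations\<close>

text \<open>Gronwall's argument: the squared distance of the curves, multiplied by exp(-2 L (t -
  t0)) after \<open>t0\<close> and by exp(2 L (t - t0)) before it, is monotone and vanishes at
  \<open>t0\<close>. The estimate \<open>L\<close> is needed only along the two curves, so a field
  that is Lipschitz merely in a chart ball can be treated.\<close>

lemma ode_unique:
  fixes y z :: "real \<Rightarrow> 'b::euclidean_space"
  assumes y: "\<And>t. t \<in> {a<..<b} \<Longrightarrow> (y has_vector_derivative y' t) (at t)"
    and z: "\<And>t. t \<in> {a<..<b} \<Longrightarrow> (z has_vector_derivative z' t) (at t)"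
    and L: "\<And>t. t \<in> {a<..<b} \<Longrightarrow> norm (y' t - z' t) \<le> L * norm (y t - z t)"
    and t0: "t0 \<in> {a<..<b}" "y t0 = z t0" and t: "t \<in> {a<..<b}"
  shows "y t = z t"
proof -
  define r where "r t = y t - z t" for t
  have r: "(r has_vector_derivative (y' t - z' t)) (at t)" if "t \<in> {a<..<b}" for t
    unfolding r_def[abs_def] using y z that by (intro derivative_intros) auto
  have rr: "((\<lambda>t. r t \<bullet> r t) has_real_derivative 2 * (r t \<bullet> (y' t - z' t))) (at t)" if "t \<in> {a<..<b}" for t
    using r[OF that] unfolding has_vector_derivative_def has_field_derivative_def
    by (auto intro!: derivative_eq_intros simp: inner_commute algebra_simps)
  have bd: "\<bar>r t \<bullet> (y' t - z' t)\<bar> \<le> L * (r t \<bullet> r t)" if "t \<in> {a<..<b}" for t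
  proof -
    have "\<bar>r t \<bullet> (y' t - z' t)\<bar> \<le> norm (r t) * norm (y' t - z' t)" by (rule Cauchy_Schwarz_ineq2)
    also have "\<dots> \<le> norm (r t) * (L * norm (r t))"
      using L[OF that] by (intro mult_left_mono) (auto simp: r_def)
    finally show ?thesis by (simp add: power2_eq_square ac_simps flip: power2_norm_eq_inner)
  qed
  have "r t \<bullet> r t \<le> 0"
  proof (cases "t0 \<le> t")
    case True
    have "(r t \<bullet> r t) * exp (- 2 * L * (t - t0)) \<le> (r t0 \<bullet> r t0) * exp (- 2 * L * (t0 - t0))"
    proof (rule DERIV_nonpos_imp_nonincreasing[OF True])
      fix s assume s: "t0 \<le> s" "s \<le> t"
      then have s': "s \<in> {a<..<b}" using t0 t by auto
      have "((\<lambda>s. (r s \<bullet> r s) * exp (- 2 * L * (s - t0))) has_real_derivative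
          2 * exp (- 2 * L * (s - t0)) * (r s \<bullet> (y' s - z' s) - L * (r s \<bullet> r s))) (at s)"
        by (auto intro!: derivative_eq_intros rr[OF s'] simp: algebra_simps)
      moreover have "2 * exp (- 2 * L * (s - t0)) * (r s \<bullet> (y' s - z' s) - L * (r s \<bullet> r s)) \<le> 0"
        using bd[OF s'] by (intro mult_nonneg_nonpos) auto
      ultimately show "\<exists>y. ((\<lambda>s. (r s \<bullet> r s) * exp (- 2 * L * (s - t0))) has_real_derivative y) (at s) \<and> y \<le> 0"
        by blast
    qed
    then show ?thesis using t0 by (simp add: r_def mult_le_0_iff)
  next
    case False
    then have le: "t \<le> t0" by simp
    have "(r t \<bullet> r t) * exp (2 * L * (t - t0)) \<le> (r t0 \<bullet> r t0) * exp (2 * L * (t0 - t0))"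
    proof (rule DERIV_nonneg_imp_nondecreasing[OF le])
      fix s assume s: "t \<le> s" "s \<le> t0"
      then have s': "s \<in> {a<..<b}" using t0 t by auto
      have "((\<lambda>s. (r s \<bullet> r s) * exp (2 * L * (s - t0))) has_real_derivative
          2 * exp (2 * L * (s - t0)) * (r s \<bullet> (y' s - z' s) + L * (r s \<bullet> r s))) (at s)"
        by (auto intro!: derivative_eq_intros rr[OF s'] simp: algebra_simps)
      moreover have "0 \<le> 2 * exp (2 * L * (s - t0)) * (r s \<bullet> (y' s - z' s) + L * (r s \<bullet> r s))"
        using bd[OF s'] by (intro mult_nonneg_nonneg) auto
      ultimately show "\<exists>y. ((\<lambda>s. (r s \<bullet> r s) * exp (2 * L * (s - t0))) has_real_derivative y) (at s) \<and> 0 \<le> y"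
        by blast
    qed
    then show ?thesis using t0 by (simp add: r_def mult_le_0_iff)
  qed
  then have "r t \<bullet> r t = 0" by (rule antisym) simp
  then show ?thesis by (simp add: r_def)
qed

text \<open>The substitution of \<open>t * s\<close> gives the integral from \<open>0\<close> to \<open>t\<close> for either sign of \<open>t\<close>.\<close>

definition prim :: "(real \<Rightarrow> 'b::euclidean_space) \<Rightarrow> real \<Rightarrow> 'b" where
  "prim g t = t *\<^sub>R integral {0..1} (\<lambda>s. g (t * s))"

lemma prim_has_vector_derivative:
  assumes "continuous_on UNIV g"
  shows "(prim g has_vector_derivative g t) (at t)"
proof -
  define N where "N = \<bar>t\<bar> + 1"
  obtain G where G: "\<And>x. x \<in> {-N..N} \<Longrightarrow> (G has_vector_derivative g x) (at x within {-N..N})"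
    using antiderivative_continuous[of "-N" N g] continuous_on_subset[OF assms] by (metis subset_UNIV)
  have eq: "prim g x = G x - G 0" if x: "x \<in> {-N<..<N}" for x
  proof -
    have "((\<lambda>s. G (x * s)) has_vector_derivative x *\<^sub>R g (x * s)) (at s within {0..1})" if "s \<in> {0..1}" for s
    proof -
      have "x * s \<in> {-N..N}" if "s \<in> {0..1}" for s
      proof -
        have "\<bar>x * s\<bar> \<le> \<bar>x\<bar> * 1" unfolding abs_mult using that by (intro mult_left_mono) auto
        then show ?thesis using x by auto
      qed
      then have "((G \<circ> (\<lambda>s. x * s)) has_vector_derivative x *\<^sub>R g (x * s)) (at s within {0..1})"
        using that by (intro vector_diff_chain_within has_vector_derivative_within_subset[OF G])
          (auto intro!: derivative_eq_intros simp: has_vector_derivative_def)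
      then show ?thesis by (simp add: o_def)
    qed
    then have "((\<lambda>s. x *\<^sub>R g (x * s)) has_integral (G (x * 1) - G (x * 0))) {0..1}"
      by (intro fundamental_theorem_of_calculus) auto
    from integral_unique[OF this] show ?thesis by (simp add: prim_def)
  qed
  have t: "t \<in> {-N<..<N}" by (auto simp: N_def)
  then have "(G has_vector_derivative g t) (at t within {-N<..<N})"
    by (intro has_vector_derivative_within_subset[OF G]) auto
  then have "((\<lambda>x. G x - G 0) has_vector_derivative g t - 0) (at t)"
    unfolding at_within_open[OF t open_greaterThanLessThan]
    by (rule has_vector_derivative_diff[OF _ has_vector_derivative_const])
  then show ?thesis
    unfolding diff_0_right
    by (rule has_vector_derivative_transform_within_open[OF _ open_greaterThanLessThan t]) (rule eq[symmetric])
qed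

text \<open>Picard iteration, carried out for all parameters at once. The Lipschitz bound is global
  in the unknown, so solutions exist for all times, and convergence is uniform on bounded sets of
  times and parameters, which makes the solution jointly continuous.\<close>

lemma ode_exists:
  fixes W :: "real \<times> 'p::euclidean_space \<times> 'b::euclidean_space \<Rightarrow> 'b"
  assumes W: "continuous_on UNIV W" and L: "\<And>t p y z. norm (W (t, p, y) - W (t, p, z)) \<le> L * norm (y - z)"
  obtains \<eta> :: "real \<times> 'p \<Rightarrow> 'b" where "continuous_on UNIV \<eta>" "\<And>p. \<eta> (0, p) = 0"
    "\<And>t p. ((\<lambda>s. \<eta> (s, p)) has_vector_derivative W (t, p, \<eta> (t, p))) (at t)"
proof -
  \<comment> \<open>The sign of \<open>L\<close> follows by comparing two arguments at distance
    1.\<close>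
  have L0: "0 \<le> L"
  proof -
    obtain b :: 'b where "b \<in> Basis" using nonempty_Basis by blast
    then show ?thesis using order_trans[OF norm_ge_zero L[of 0 0 b 0]] by simp
  qed
  define T :: "(real \<times> 'p \<Rightarrow> 'b) \<Rightarrow> real \<times> 'p \<Rightarrow> 'b" where
    "T y q = prim (\<lambda>s. W (s, snd q, y (s, snd q))) (fst q)" for y q
  define y where "y n = (T ^^ n) (\<lambda>q. 0)" for n
  have ySuc: "y (Suc n) = T (y n)" for n by (simp add: y_def)
  have y0: "y 0 = (\<lambda>q. 0)" by (simp add: y_def)
  have yc: "continuous_on UNIV (y n)" for n
  proof (induction n)
    case 0
    then show ?case by (simp add: y0)
  next
    case (Suc n)
    have "continuous_on (UNIV \<times> cbox 0 1) (\<lambda>z. W (fst (fst z) * snd z, snd (fst z), y n (fst (fst z) * snd z, snd (fst z))))"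
      by (intro continuous_on_compose2[OF W] continuous_on_Pair continuous_on_compose2[OF Suc] continuous_intros) auto
    then have "continuous_on UNIV (\<lambda>q. integral (cbox 0 1) (\<lambda>s. W (fst q * s, snd q, y n (fst q * s, snd q))))"
      by (intro integral_continuous_on_param) (simp add: split_beta)
    then show ?case unfolding ySuc T_def prim_def by (intro continuous_intros) auto
  qed
  have Wc: "continuous_on {0..1} (\<lambda>s. W (t * s, p, f (t * s, p)))" if "continuous_on UNIV f" for f t p
    by (intro continuous_on_compose2[OF W] continuous_on_Pair continuous_on_compose2[OF that] continuous_intros) auto
  \<comment> \<open>These boxes exhaust all times and parameters. Each contains (t * s, p) along
    with (t, p) for s in [0,1], as the integrals in \<open>prim\<close> require.\<close>
  define Q where "Q N = {-N..N::real} \<times> cball (0::'p) N" for N :: real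
  have conv: "uniform_limit (Q N) y (\<lambda>q. \<Sum>n. y (Suc n) q - y n q) sequentially" for N
  proof -
    have "compact (y 1 ` Q N)" unfolding Q_def
      by (intro compact_continuous_image continuous_on_subset[OF yc] compact_Times) auto
    then have "bounded (y 1 ` Q N)" by (rule compact_imp_bounded)
    then obtain C0 where C0: "\<And>q. q \<in> Q N \<Longrightarrow> norm (y 1 q) \<le> C0"
      unfolding bounded_iff by blast
    define C where "C = max C0 0"
    have C: "0 \<le> C" "\<And>q. q \<in> Q N \<Longrightarrow> norm (y 1 q) \<le> C" using C0 by (force simp: C_def)+
    \<comment> \<open>Each iteration integrates s^n once more, which builds up the factorial; the
      comparison series is exponential.\<close>
    have bd: "norm (y (Suc n) (t, p) - y n (t, p)) \<le> C * (L * \<bar>t\<bar>) ^ n / fact n" if "(t, p) \<in> Q N" for n t p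
      using that
    proof (induction n arbitrary: t)
      case 0
      then show ?case using C(2) by (simp add: y0)
    next
      case (Suc n)
      have bd1: "norm (W (t * s, p, y (Suc n) (t * s, p)) - W (t * s, p, y n (t * s, p))) \<le> L * (C * (L * \<bar>t\<bar>) ^ n / fact n) * s ^ n"
        if s: "s \<in> {0..1}" for s
      proof -
        have "\<bar>t * s\<bar> \<le> \<bar>t\<bar> * 1" unfolding abs_mult using s by (intro mult_left_mono) auto
        then have "(t * s, p) \<in> Q N" using Suc.prems by (auto simp: Q_def)
        then have "norm (y (Suc n) (t * s, p) - y n (t * s, p)) \<le> C * (L * \<bar>t * s\<bar>) ^ n / fact n" by (rule Suc.IH)
        then have "norm (W (t * s, p, y (Suc n) (t * s, p)) - W (t * s, p, y n (t * s, p))) \<le> L * (C * (L * \<bar>t * s\<bar>) ^ n / fact n)"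
          by (intro order_trans[OF L] mult_left_mono L0)
        then show ?thesis using s by (simp add: abs_mult power_mult_distrib mult_ac)
      qed
      have int: "(\<lambda>s. W (t * s, p, y m (t * s, p))) integrable_on {0..1}" for m
        by (intro integrable_continuous_real Wc yc)
      have pint: "((\<lambda>s::real. K * s ^ n) has_integral K * (1 / Suc n)) {0..1}" for K :: real
      proof -
        have "((\<lambda>s. K * (s ^ Suc n / Suc n)) has_real_derivative K * s ^ n) (at s within {0..1})" for s
          by (auto intro!: derivative_eq_intros simp del: of_nat_Suc power_Suc)
        then show ?thesis
          using fundamental_theorem_of_calculus[of 0 1 "\<lambda>s. K * (s ^ Suc n / Suc n)" "\<lambda>s. K * s ^ n"]
          by (simp add: has_real_derivative_iff_has_vector_derivative[symmetric] del: power_Suc)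
      qed
      have yS: "y (Suc m) (t, p) = t *\<^sub>R integral {0..1} (\<lambda>s. W (t * s, p, y m (t * s, p)))" for m
        unfolding ySuc[of m] T_def prim_def by simp
      have "y (Suc (Suc n)) (t, p) - y (Suc n) (t, p) =
          t *\<^sub>R integral {0..1} (\<lambda>s. W (t * s, p, y (Suc n) (t * s, p)) - W (t * s, p, y n (t * s, p)))"
        unfolding yS[of "Suc n"] yS[of n] integral_diff[OF int int] scaleR_diff_right ..
      also have "norm \<dots> \<le> \<bar>t\<bar> * (L * (C * (L * \<bar>t\<bar>) ^ n / fact n) * (1 / Suc n))"
        unfolding norm_scaleR
        by (intro mult_left_mono order_trans[OF integral_norm_bound_integral[OF integrable_diff[OF int int] has_integral_integrable[OF pint] bd1]])
          (simp_all only: integral_unique[OF pint] order_refl abs_ge_zero)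
      also have "\<dots> = C * (L * \<bar>t\<bar>) ^ Suc n / fact (Suc n)" by (simp add: field_simps)
      finally show ?case .
    qed
    have "uniform_limit (Q N) (\<lambda>n q. \<Sum>i<n. y (Suc i) q - y i q) (\<lambda>q. \<Sum>n. y (Suc n) q - y n q) sequentially"
    proof (rule Weierstrass_m_test)
      show "summable (\<lambda>n. C * ((L * \<bar>N\<bar>) ^ n / fact n))"
        using summable_exp[of "L * \<bar>N\<bar>"] by (intro summable_mult) (simp add: field_simps)
      fix n q assume q: "q \<in> Q N"
      have "norm (y (Suc n) (fst q, snd q) - y n (fst q, snd q)) \<le> C * (L * \<bar>fst q\<bar>) ^ n / fact n"
        using q by (intro bd) simp
      also have "\<dots> \<le> C * (L * \<bar>N\<bar>) ^ n / fact n"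
        using q C(1) L0 by (intro divide_right_mono mult_left_mono power_mono) (auto simp: Q_def)
      finally show "norm (y (Suc n) q - y n q) \<le> C * ((L * \<bar>N\<bar>) ^ n / fact n)" by simp
    qed
    moreover have "(\<Sum>i<n. y (Suc i) q - y i q) = y n q" for n q
      using sum_lessThan_telescope[of "\<lambda>i. y i q" n] by (simp add: y0)
    ultimately show ?thesis by simp
  qed
  define \<eta> where "\<eta> q = (\<Sum>n. y (Suc n) q - y n q)" for q
  have conv: "uniform_limit (Q N) y \<eta> sequentially" for N
    using conv[of N] by (simp add: \<eta>_def[abs_def])
  have c: "continuous_on UNIV \<eta>"
  proof (rule continuous_at_imp_continuous_on, rule ballI)
    fix q :: "real \<times> 'p"
    define N where "N = \<bar>fst q\<bar> + norm (snd q) + 1"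
    have "continuous_on (Q N) \<eta>"
      by (rule uniform_limit_theorem[OF always_eventually conv]) (auto intro: continuous_on_subset[OF yc])
    moreover have "q \<in> {-N<..<N} \<times> ball 0 N"
    proof -
      have "\<bar>fst q\<bar> < N" "norm (snd q) < N" using norm_ge_zero[of "snd q"] by (auto simp: N_def simp del: norm_ge_zero)
      then show ?thesis by (cases q) auto
    qed
    moreover have "open ({-N<..<N} \<times> ball (0::'p) N)" by (intro open_Times) auto
    moreover have "{-N<..<N} \<times> ball (0::'p) N \<subseteq> Q N" by (auto simp: Q_def)
    ultimately show "isCont \<eta> q"
      using continuous_on_eq_continuous_at continuous_on_subset by blast
  qed
  have fix_eq: "\<eta> (t, p) = prim (\<lambda>s. W (s, p, \<eta> (s, p))) t" for t p
  proof -
    define N where "N = \<bar>t\<bar> + norm p"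
    have mem: "(t * s, p) \<in> Q N" if "s \<in> {0..1}" for s
    proof -
      have "\<bar>t * s\<bar> \<le> \<bar>t\<bar> * 1" unfolding abs_mult using that by (intro mult_left_mono) auto
      moreover have "\<bar>t\<bar> \<le> N" "norm p \<le> N" by (auto simp: N_def)
      ultimately show ?thesis by (auto simp: Q_def)
    qed
    have lim: "(\<lambda>n. y (Suc n) (t, p)) \<longlonglongrightarrow> \<eta> (t, p)"
      using LIMSEQ_Suc[OF tendsto_uniform_limitI[OF conv mem[of 1]]] by simp
    have "uniform_limit {0..1} (\<lambda>n s. W (t * s, p, y n (t * s, p))) (\<lambda>s. W (t * s, p, \<eta> (t * s, p))) sequentially"
      unfolding uniform_limit_iff
    proof (intro allI impI)
      fix e :: real assume e: "e > 0"
      have "\<forall>\<^sub>F n in sequentially. \<forall>q\<in>Q N. dist (y n q) (\<eta> q) < e / (L + 1)"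
        using conv e L0 unfolding uniform_limit_iff by (simp add: divide_pos_pos)
      then show "\<forall>\<^sub>F n in sequentially. \<forall>s\<in>{0..1}. dist (W (t * s, p, y n (t * s, p))) (W (t * s, p, \<eta> (t * s, p))) < e"
      proof eventually_elim
        case (elim n)
        show ?case
        proof
          fix s :: real assume "s \<in> {0..1}"
          then have "norm (y n (t * s, p) - \<eta> (t * s, p)) < e / (L + 1)"
            using elim mem by (simp add: dist_norm)
          then have "L * norm (y n (t * s, p) - \<eta> (t * s, p)) \<le> L * (e / (L + 1))"
            using L0 by (intro mult_left_mono) auto
          also have "\<dots> < e" using L0 e by (simp add: field_simps)
          finally show "dist (W (t * s, p, y n (t * s, p))) (W (t * s, p, \<eta> (t * s, p))) < e"
            unfolding dist_norm by (rule order_le_less_trans[OF L])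
        qed
      qed
    qed
    then have u: "uniform_limit (cbox 0 1) (\<lambda>n s. W (t * s, p, y n (t * s, p))) (\<lambda>s. W (t * s, p, \<eta> (t * s, p))) sequentially"
      by simp
    obtain I J where IJ: "\<And>n. ((\<lambda>s. W (t * s, p, y n (t * s, p))) has_integral I n) (cbox 0 1)"
      "((\<lambda>s. W (t * s, p, \<eta> (t * s, p))) has_integral J) (cbox 0 1)" "I \<longlonglongrightarrow> J"
      by (rule uniform_limit_integral_cbox[OF u]) (auto intro: Wc yc)
    have "integral {0..1} (\<lambda>s. W (t * s, p, y n (t * s, p))) = I n" for n
      using integral_unique[OF IJ(1)] by simp
    moreover have "integral {0..1} (\<lambda>s. W (t * s, p, \<eta> (t * s, p))) = J"
      using integral_unique[OF IJ(2)] by simp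
    ultimately have "(\<lambda>n. t *\<^sub>R integral {0..1} (\<lambda>s. W (t * s, p, y n (t * s, p)))) \<longlonglongrightarrow> t *\<^sub>R integral {0..1} (\<lambda>s. W (t * s, p, \<eta> (t * s, p)))"
      using IJ(3) by (simp add: tendsto_scaleR)
    then have "(\<lambda>n. y (Suc n) (t, p)) \<longlonglongrightarrow> prim (\<lambda>s. W (s, p, \<eta> (s, p))) t"
      by (simp add: ySuc T_def prim_def)
    then show ?thesis using lim LIMSEQ_unique by blast
  qed
  show thesis
  proof (rule that[OF c])
    show "\<eta> (0, p) = 0" for p by (subst fix_eq) (simp add: prim_def)
    show "((\<lambda>s. \<eta> (s, p)) has_vector_derivative W (t, p, \<eta> (t, p))) (at t)" for t p
    proof -
      have "continuous_on UNIV (\<lambda>s. W (s, p, \<eta> (s, p)))"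
        by (intro continuous_on_compose2[OF W] continuous_on_Pair continuous_on_compose2[OF c] continuous_intros) auto
      from prim_has_vector_derivative[OF this, of t] show ?thesis unfolding ext[OF fix_eq[of _ p]] .
    qed
  qed
qed

section \<open>Smooth dependence of solutions on parameters\<close>

lemma has_vector_derivative_0_iff:
  "(f has_vector_derivative D) (at 0) \<longleftrightarrow> ((\<lambda>s. (1 / s) *\<^sub>R (f s - f 0)) \<longlongrightarrow> D) (at 0)"
proof -
  have "(f has_vector_derivative D) (at 0) \<longleftrightarrow> ((\<lambda>s. norm (f s - f 0 - s *\<^sub>R D) / norm s) \<longlongrightarrow> 0) (at 0)"
    by (simp add: has_vector_derivative_def has_derivative_iff_norm bounded_linear_scaleR_left)
  also have "\<dots> \<longleftrightarrow> ((\<lambda>s. norm ((1 / s) *\<^sub>R (f s - f 0) - D)) \<longlongrightarrow> 0) (at 0)"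
  proof (rule filterlim_cong[OF refl refl])
    have "norm (f s - f 0 - s *\<^sub>R D) / norm s = norm ((1 / s) *\<^sub>R (f s - f 0) - D)" if "s \<noteq> 0" for s
    proof -
      have "(1 / s) *\<^sub>R (f s - f 0) - D = (1 / s) *\<^sub>R (f s - f 0 - s *\<^sub>R D)"
        using that by (simp add: algebra_simps)
      then show ?thesis by simp
    qed
    then show "\<forall>\<^sub>F s in at 0. norm (f s - f 0 - s *\<^sub>R D) / norm s = norm ((1 / s) *\<^sub>R (f s - f 0) - D)"
      by (auto simp: eventually_at_filter)
  qed
  also have "\<dots> \<longleftrightarrow> ((\<lambda>s. (1 / s) *\<^sub>R (f s - f 0)) \<longlongrightarrow> D) (at 0)"
    by (simp add: tendsto_norm_zero_iff LIM_zero_iff)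
  finally show ?thesis .
qed

text \<open>Coordinates are moved one at a time. By the mean value inequality, moving one of them
  costs an error controlled by the continuity of that partial derivative.\<close>

lemma has_derivative_partials:
  fixes f :: "'a::euclidean_space \<Rightarrow> 'b::euclidean_space"
  assumes g: "\<And>x b. b \<in> Basis \<Longrightarrow> ((\<lambda>s. f (x + s *\<^sub>R b)) has_vector_derivative g b x) (at 0)"
    and c: "\<And>b. b \<in> Basis \<Longrightarrow> continuous_on UNIV (g b)"
  shows "(f has_derivative (\<lambda>v. \<Sum>b\<in>Basis. (v \<bullet> b) *\<^sub>R g b x)) (at x)"
proof -
  have g': "((\<lambda>s. f (x + s *\<^sub>R b)) has_vector_derivative g b (x + s0 *\<^sub>R b)) (at s0)" if "b \<in> Basis" for x b s0
  proof -
    have "((\<lambda>s. s - s0) has_vector_derivative 1 - 0) (at s0)"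
      by (intro has_vector_derivative_diff has_vector_derivative_const has_vector_derivative_id)
    from vector_diff_chain_at[OF this, of "\<lambda>s. f ((x + s0 *\<^sub>R b) + s *\<^sub>R b)" "g b (x + s0 *\<^sub>R b)"]
    have "((\<lambda>s. f ((x + s0 *\<^sub>R b) + (s - s0) *\<^sub>R b)) has_vector_derivative g b (x + s0 *\<^sub>R b)) (at s0)"
      using g[OF that] by (simp add: o_def)
    then show ?thesis by (simp add: algebra_simps)
  qed
  \<comment> \<open>\<open>P B v\<close> is the part of \<open>v\<close> along the directions in
    \<open>B\<close>; the induction enlarges \<open>B\<close> until it is the whole basis.\<close>
  define P where "P B v = (\<Sum>b\<in>B. (v \<bullet> b) *\<^sub>R b)" for B and v :: 'a
  have "\<exists>d>0. \<forall>v. norm v < d \<longrightarrow> norm (f (x + P B v) - f x - (\<Sum>b\<in>B. (v \<bullet> b) *\<^sub>R g b x)) \<le> e * norm v"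
    if "B \<subseteq> Basis" "finite B" "e > 0" for B e
    using that(2,1,3)
  proof (induction B arbitrary: e rule: finite_induct)
    case empty
    then show ?case by (intro exI[of _ 1]) (simp add: P_def)
  next
    case (insert b B)
    then have b: "b \<in> Basis" and B: "B \<subseteq> Basis" by auto
    obtain d1 where d1: "d1 > 0" "\<And>v. norm v < d1 \<Longrightarrow> norm (f (x + P B v) - f x - (\<Sum>b\<in>B. (v \<bullet> b) *\<^sub>R g b x)) \<le> e/2 * norm v"
      using insert.IH[OF B, of "e/2"] insert.prems by auto
    have "isCont (g b) x" using c[OF b] by (simp add: continuous_on_eq_continuous_at)
    then obtain d2 where d2: "d2 > 0" "\<And>z. norm (z - x) < d2 \<Longrightarrow> norm (g b z - g b x) < e/2"
      using insert.prems unfolding continuous_at_eps_delta dist_norm by (metis half_gt_zero)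
    \<comment> \<open>Each of the \<open>card B\<close> coordinates of \<open>P B v\<close>, and the
      new one, contributes at most \<open>norm v\<close>; this keeps all intermediate points within
      M * norm v of \<open>x\<close>.\<close>
    define M where "M = real (card B) + 1"
    have Pn: "norm (P B v + s *\<^sub>R b) \<le> M * norm v" if "\<bar>s\<bar> \<le> norm v" for v s
    proof -
      have "norm (P B v) \<le> (\<Sum>b\<in>B. norm v)" unfolding P_def
        using B by (intro sum_norm_le) (auto simp: Basis_le_norm)
      moreover have "norm (s *\<^sub>R b) \<le> norm v" using that b by simp
      ultimately show ?thesis using norm_triangle_ineq[of "P B v" "s *\<^sub>R b"] by (simp add: M_def algebra_simps)
    qed
    have M: "M > 0" by (simp add: M_def)
    show ?case
    proof (intro exI[of _ "min d1 (d2 / M)"] conjI allI impI)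
      show "0 < min d1 (d2 / M)" using d1 d2 M by simp
      fix v :: 'a assume v: "norm v < min d1 (d2 / M)"
      define y where "y = x + P B v"
      have vb: "\<bar>v \<bullet> b\<bar> \<le> norm v" using b by (rule Basis_le_norm)
      have "norm ((f (y + (v \<bullet> b) *\<^sub>R b) - (v \<bullet> b) *\<^sub>R g b x) - (f (y + 0 *\<^sub>R b) - 0 *\<^sub>R g b x)) \<le> e/2 * norm (v \<bullet> b - 0)"
      proof (rule differentiable_bound[of "{-norm v..norm v}" _ "\<lambda>s h. h *\<^sub>R (g b (y + s *\<^sub>R b) - g b x)"])
        fix s assume s: "s \<in> {-norm v..norm v}"
        have "((\<lambda>s. f (y + s *\<^sub>R b) - s *\<^sub>R g b x) has_vector_derivative g b (y + s *\<^sub>R b) - 1 *\<^sub>R g b x) (at s within {-norm v..norm v})"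
          by (intro has_vector_derivative_diff has_vector_derivative_at_within[OF g'] b) (auto intro!: derivative_eq_intros simp: has_vector_derivative_def)
        then show "((\<lambda>s. f (y + s *\<^sub>R b) - s *\<^sub>R g b x) has_derivative (\<lambda>h. h *\<^sub>R (g b (y + s *\<^sub>R b) - g b x))) (at s within {-norm v..norm v})"
          by (simp add: has_vector_derivative_def)
        have "norm (y + s *\<^sub>R b - x) \<le> M * norm v" using Pn[of s v] s by (auto simp: y_def algebra_simps)
        also have "\<dots> < d2" using v M by (simp add: field_simps)
        finally have "norm (g b (y + s *\<^sub>R b) - g b x) < e/2" by (rule d2(2))
        then show "onorm (\<lambda>h. h *\<^sub>R (g b (y + s *\<^sub>R b) - g b x)) \<le> e / 2"
        proof (intro onorm_le)
          fix h :: real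
          have "\<bar>h\<bar> * norm (g b (y + s *\<^sub>R b) - g b x) \<le> \<bar>h\<bar> * (e/2)"
            using \<open>norm (g b (y + s *\<^sub>R b) - g b x) < e/2\<close> by (intro mult_left_mono) auto
          then show "norm (h *\<^sub>R (g b (y + s *\<^sub>R b) - g b x)) \<le> e/2 * norm h"
            by (simp add: mult.commute)
        qed
      qed (use vb in auto)
      also have "\<dots> \<le> e/2 * norm v" using vb insert.prems by (intro mult_left_mono) auto
      finally have 1: "norm (f (y + (v \<bullet> b) *\<^sub>R b) - f y - (v \<bullet> b) *\<^sub>R g b x) \<le> e/2 * norm v"
        by (simp add: algebra_simps)
      have 2: "norm (f y - f x - (\<Sum>b\<in>B. (v \<bullet> b) *\<^sub>R g b x)) \<le> e/2 * norm v"
        using d1(2)[of v] v by (simp add: y_def)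
      have "f (x + P (insert b B) v) - f x - (\<Sum>b\<in>insert b B. (v \<bullet> b) *\<^sub>R g b x) =
         (f (y + (v \<bullet> b) *\<^sub>R b) - f y - (v \<bullet> b) *\<^sub>R g b x) + (f y - f x - (\<Sum>b\<in>B. (v \<bullet> b) *\<^sub>R g b x))"
        using insert.hyps by (simp add: P_def y_def algebra_simps)
      also have "norm \<dots> \<le> e * norm v" using norm_triangle_ineq[of "f (y + (v \<bullet> b) *\<^sub>R b) - f y - (v \<bullet> b) *\<^sub>R g b x" "f y - f x - (\<Sum>b\<in>B. (v \<bullet> b) *\<^sub>R g b x)"] 1 2
        by simp
      finally show "norm (f (x + P (insert b B) v) - f x - (\<Sum>b\<in>insert b B. (v \<bullet> b) *\<^sub>R g b x)) \<le> e * norm v" .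
    qed
  qed
  from this[OF order_refl finite_Basis] have
    d: "\<exists>d>0. \<forall>v. norm v < d \<longrightarrow> norm (f (x + v) - f x - (\<Sum>b\<in>Basis. (v \<bullet> b) *\<^sub>R g b x)) \<le> e * norm v" if "e > 0" for e
    using that by (simp add: P_def euclidean_representation)
  have bl: "bounded_linear (\<lambda>v. \<Sum>b\<in>Basis. (v \<bullet> b) *\<^sub>R g b x)"
    by (intro bounded_linear_sum bounded_linear_scaleR_const bounded_linear_inner_left)
  show ?thesis
    unfolding has_derivative_within_alt
  proof (intro conjI bl allI impI)
    fix e :: real assume "e > 0"
    from d[OF this] obtain d where d: "d > 0" "\<And>v. norm v < d \<Longrightarrow> norm (f (x + v) - f x - (\<Sum>b\<in>Basis. (v \<bullet> b) *\<^sub>R g b x)) \<le> e * norm v"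
      by blast
    show "\<exists>d>0. \<forall>y\<in>UNIV. norm (y - x) < d \<longrightarrow> norm (f y - f x - (\<Sum>b\<in>Basis. ((y - x) \<bullet> b) *\<^sub>R g b x)) \<le> e * norm (y - x)"
      using d(1) d(2)[of "y - x" for y] by (intro exI[of _ d]) auto
  qed
qed

text \<open>The linearised equation inherits the Lipschitz constant of the original one, so that
  \<open>ode_exists\<close> applies to it and the induction on regularity can go on.\<close>

lemma derivative_Lipschitz_bound:
  fixes W :: "real \<times> 'p::euclidean_space \<times> 'b::euclidean_space \<Rightarrow> 'b"
  assumes L: "\<And>t p y z. norm (W (t, p, y) - W (t, p, z)) \<le> L * norm (y - z)"
    and W': "(W has_derivative W' x) (at x)"
  shows "norm (W' x (0, 0, v)) \<le> L * norm v"
proof -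
  obtain t p y where x: "x = (t, p, y)" by (cases x) auto
  have "((\<lambda>s. x + s *\<^sub>R (0, 0, v)) has_vector_derivative (0, 0, v)) (at 0)"
    unfolding has_vector_derivative_def by (auto intro!: derivative_eq_intros simp del: scaleR_Pair)
  from vector_derivative_diff_chain_within[OF this, of W "W' x"] W'
  have "((\<lambda>s. W (x + s *\<^sub>R (0, 0, v))) has_vector_derivative W' x (0, 0, v)) (at 0)"
    by (simp add: o_def has_derivative_at_withinI zero_prod_def[symmetric] del: scaleR_Pair)
  then have "((\<lambda>s. (1 / s) *\<^sub>R (W (x + s *\<^sub>R (0, 0, v)) - W x)) \<longlongrightarrow> W' x (0, 0, v)) (at 0)"
    by (simp add: has_vector_derivative_0_iff zero_prod_def[symmetric])
  then have "((\<lambda>s. norm ((1 / s) *\<^sub>R (W (x + s *\<^sub>R (0, 0, v)) - W x))) \<longlongrightarrow> norm (W' x (0, 0, v))) (at 0)"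
    by (rule tendsto_norm)
  then show ?thesis
  proof (rule tendsto_upperbound)
    show "\<forall>\<^sub>F s in at 0. norm ((1 / s) *\<^sub>R (W (x + s *\<^sub>R (0, 0, v)) - W x)) \<le> L * norm v"
    proof (intro eventually_at_filter[THEN iffD2] eventuallyI impI)
      fix s :: real assume "s \<noteq> 0"
      have "norm (W (x + s *\<^sub>R (0, 0, v)) - W x) \<le> L * norm (s *\<^sub>R v)"
        using L[of t p "y + s *\<^sub>R v" y] by (simp add: x)
      then show "norm ((1 / s) *\<^sub>R (W (x + s *\<^sub>R (0, 0, v)) - W x)) \<le> L * norm v"
        using \<open>s \<noteq> 0\<close> by (simp add: divide_le_eq mult_ac del: scaleR_Pair flip: scaleR_diff_right)
    qed
  qed simp
qed

text \<open>A solution is differentiated in the parameter by observing that its difference quotients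
  satisfy, by the fundamental theorem of calculus, a linear equation whose coefficients stay
  continuous when the increment \<open>\<epsilon>\<close>, taken as a further parameter, reaches \<open>0\<close>.\<close>

lemma ode_param_derivative:
  fixes W :: "real \<times> 'p::euclidean_space \<times> 'b::euclidean_space \<Rightarrow> 'b" and \<eta> :: "real \<times> 'p \<Rightarrow> 'b"
  assumes L: "\<And>t p y z. norm (W (t, p, y) - W (t, p, z)) \<le> L * norm (y - z)"
    and W': "\<And>x. (W has_derivative W' x) (at x)" and W'c: "\<And>v. continuous_on UNIV (\<lambda>x. W' x v)"
    and \<eta>c: "continuous_on UNIV \<eta>" and \<eta>0: "\<And>p. \<eta> (0, p) = 0"
    and \<eta>: "\<And>t p. ((\<lambda>s. \<eta> (s, p)) has_vector_derivative W (t, p, \<eta> (t, p))) (at t)"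
  obtains \<zeta> :: "real \<times> 'p \<Rightarrow> 'b" where "continuous_on UNIV \<zeta>" "\<And>p. \<zeta> (0, p) = 0"
    "\<And>t p. ((\<lambda>s. \<zeta> (s, p)) has_vector_derivative W' (t, p, \<eta> (t, p)) (0, b, \<zeta> (t, p))) (at t)"
    "\<And>t p. ((\<lambda>s. \<eta> (t, p + s *\<^sub>R b)) has_vector_derivative \<zeta> (t, p)) (at 0)"
proof -
  have lin: "linear (W' x)" for x using W' has_derivative_bounded_linear bounded_linear.linear by blast
  have W'L: "norm (W' x (0, 0, v)) \<le> L * norm v" for x v by (rule derivative_Lipschitz_bound[OF L W'])
  have W'jc: "continuous_on UNIV (\<lambda>q. W' (fst q) (snd q))"
  proof -
    have "continuous_on UNIV (\<lambda>q. \<Sum>i\<in>Basis. (snd q \<bullet> i) *\<^sub>R W' (fst q) i)"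
      by (intro continuous_intros continuous_on_compose2[OF W'c]) auto
    moreover have "(\<Sum>i\<in>Basis. (v \<bullet> i) *\<^sub>R W' x i) = W' x v" for x v
      using linear_sum[OF lin, of x "\<lambda>i. (v \<bullet> i) *\<^sub>R i" Basis] linear_cmul[OF lin]
      by (simp add: euclidean_representation)
    ultimately show ?thesis by simp
  qed
  \<comment> \<open>\<open>V\<close> averages the derivative of \<open>W\<close> over the segment
    joining the two solutions, with \<open>z\<close> in the place of their difference quotient; at
    \<epsilon> = 0 it is the linearised equation.\<close>
  define V where "V q = (case q of (t, (p, \<epsilon>), z) \<Rightarrow>
     integral {0..1} (\<lambda>s. W' (t, p + (s * \<epsilon>) *\<^sub>R b, \<eta> (t, p) + s *\<^sub>R (\<eta> (t, p + \<epsilon> *\<^sub>R b) - \<eta> (t, p))) (0, b, z)))"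
    for q :: "real \<times> ('p \<times> real) \<times> 'b"
  have sc: "continuous_on {0..1} (\<lambda>s. W' (t, p + (s * \<epsilon>) *\<^sub>R b, y + s *\<^sub>R z) v)" for t p \<epsilon> y z v
    by (intro continuous_on_compose2[OF W'c] continuous_intros) auto
  have Vc: "continuous_on UNIV V"
  proof -
    have "continuous_on (UNIV \<times> cbox 0 1) (\<lambda>(q, s). W' (fst q, fst (fst (snd q)) + (s * snd (fst (snd q))) *\<^sub>R b,
        \<eta> (fst q, fst (fst (snd q))) + s *\<^sub>R (\<eta> (fst q, fst (fst (snd q)) + snd (fst (snd q)) *\<^sub>R b) - \<eta> (fst q, fst (fst (snd q)))))
        (0, b, snd (snd q)))"
      unfolding split_beta
      by (intro continuous_on_compose2[OF W'jc, where f="\<lambda>q. (F q, G q)" for F G, unfolded fst_conv snd_conv]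
          continuous_on_compose2[OF \<eta>c] continuous_intros) auto
    from integral_continuous_on_param[OF this] show ?thesis
      unfolding V_def split_beta by simp
  qed
  have VL: "norm (V (t, q, y) - V (t, q, z)) \<le> L * norm (y - z)" for t q y z
  proof -
    obtain p \<epsilon> where q: "q = (p, \<epsilon>)" by (cases q)
    define w where "w s = (t, p + (s * \<epsilon>) *\<^sub>R b, \<eta> (t, p) + s *\<^sub>R (\<eta> (t, p + \<epsilon> *\<^sub>R b) - \<eta> (t, p)))" for s
    have int: "(\<lambda>s. W' (w s) v) integrable_on {0..1}" for v
      unfolding w_def by (intro integrable_continuous_real sc)
    have "V (t, q, y) - V (t, q, z) = integral {0..1} (\<lambda>s. W' (w s) (0, b, y) - W' (w s) (0, b, z))"
      by (simp add: V_def q w_def[symmetric] integral_diff[OF int int])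
    also have "\<dots> = integral {0..1} (\<lambda>s. W' (w s) (0, 0, y - z))"
      by (simp add: linear_diff[OF lin, symmetric])
    also have "norm \<dots> \<le> integral {0..1} (\<lambda>s::real. L * norm (y - z))"
      by (intro integral_norm_bound_integral int W'L) auto
    finally show ?thesis by simp
  qed
  obtain \<xi> where \<xi>: "continuous_on UNIV \<xi>" "\<And>q. \<xi> (0, q) = 0"
    "\<And>t q. ((\<lambda>s. \<xi> (s, q)) has_vector_derivative V (t, q, \<xi> (t, q))) (at t)"
    using ode_exists[OF Vc VL] by blast
  \<comment> \<open>For \<epsilon> \<noteq> 0 the true difference quotient solves the equation that
    defines \<xi>, with the same initial value 0, so uniqueness identifies them.\<close>
  have quot: "\<eta> (t, p + \<epsilon> *\<^sub>R b) - \<eta> (t, p) = \<epsilon> *\<^sub>R \<xi> (t, (p, \<epsilon>))" if "\<epsilon> \<noteq> 0" for t p \<epsilon>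
  proof -
    define q where "q t = (1 / \<epsilon>) *\<^sub>R (\<eta> (t, p + \<epsilon> *\<^sub>R b) - \<eta> (t, p))" for t
    have \<epsilon>q: "\<epsilon> *\<^sub>R q t = \<eta> (t, p + \<epsilon> *\<^sub>R b) - \<eta> (t, p)" for t using that by (simp add: q_def)
    have qd: "(q has_vector_derivative V (t, (p, \<epsilon>), q t)) (at t)" for t
    proof -
      have "(q has_vector_derivative (1 / \<epsilon>) *\<^sub>R (W (t, p + \<epsilon> *\<^sub>R b, \<eta> (t, p + \<epsilon> *\<^sub>R b)) - W (t, p, \<eta> (t, p)))) (at t)"
        unfolding q_def[abs_def] using bounded_linear.has_vector_derivative[OF bounded_linear_scaleR_right has_vector_derivative_diff[OF \<eta> \<eta>]] .
      moreover have "W (t, p + \<epsilon> *\<^sub>R b, \<eta> (t, p + \<epsilon> *\<^sub>R b)) - W (t, p, \<eta> (t, p)) = \<epsilon> *\<^sub>R V (t, (p, \<epsilon>), q t)"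
      proof -
        define w where "w s = (t, p + (s * \<epsilon>) *\<^sub>R b, \<eta> (t, p) + s *\<^sub>R (\<epsilon> *\<^sub>R q t))" for s
        have "((\<lambda>s. W (w s)) has_vector_derivative \<epsilon> *\<^sub>R W' (w s) (0, b, q t)) (at s within {0..1})" for s
        proof -
          have w: "(w has_vector_derivative (0, \<epsilon> *\<^sub>R b, \<epsilon> *\<^sub>R q t)) (at s within {0..1})"
            unfolding w_def[abs_def] has_vector_derivative_def
            by (auto intro!: derivative_eq_intros simp: algebra_simps)
          have "((\<lambda>s. W (w s)) has_vector_derivative W' (w s) (0, \<epsilon> *\<^sub>R b, \<epsilon> *\<^sub>R q t)) (at s within {0..1})"
            using vector_derivative_diff_chain_within[OF w has_derivative_at_withinI[OF W']] by (simp add: o_def)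
          moreover have "W' (w s) (0, \<epsilon> *\<^sub>R b, \<epsilon> *\<^sub>R q t) = \<epsilon> *\<^sub>R W' (w s) (0, b, q t)"
            using linear_cmul[OF lin, of "w s" \<epsilon> "(0, b, q t)"] by simp
          ultimately show ?thesis by simp
        qed
        then have "((\<lambda>s. \<epsilon> *\<^sub>R W' (w s) (0, b, q t)) has_integral (W (w 1) - W (w 0))) {0..1}"
          by (intro fundamental_theorem_of_calculus) auto
        from integral_unique[OF this] show ?thesis by (simp add: w_def V_def \<epsilon>q)
      qed
      ultimately show ?thesis using that by simp
    qed
    have "q t = \<xi> (t, (p, \<epsilon>))"
    proof (rule ode_unique[of "- \<bar>t\<bar> - 1" "\<bar>t\<bar> + 1" q "\<lambda>t. V (t, (p, \<epsilon>), q t)" "\<lambda>t. \<xi> (t, (p, \<epsilon>))" "\<lambda>t. V (t, (p, \<epsilon>), \<xi> (t, (p, \<epsilon>)))" L 0])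
      show "q 0 = \<xi> (0, (p, \<epsilon>))" by (simp add: q_def \<xi>(2) \<eta>0)
    qed (auto intro: qd \<xi>(3) VL)
    then show ?thesis using \<epsilon>q[of t] by simp
  qed
  define \<zeta> where "\<zeta> q = \<xi> (fst q, (snd q, 0))" for q
  show thesis
  proof (rule that[of \<zeta>])
    show "continuous_on UNIV \<zeta>" unfolding \<zeta>_def
      by (intro continuous_on_compose2[OF \<xi>(1)] continuous_intros) auto
    show "\<zeta> (0, p) = 0" for p by (simp add: \<zeta>_def \<xi>)
    show "((\<lambda>s. \<zeta> (s, p)) has_vector_derivative W' (t, p, \<eta> (t, p)) (0, b, \<zeta> (t, p))) (at t)" for t p
      using \<xi>(3)[of "(p, 0)" t] by (simp add: \<zeta>_def V_def)
    show "((\<lambda>s. \<eta> (t, p + s *\<^sub>R b)) has_vector_derivative \<zeta> (t, p)) (at 0)" for t p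
    proof -
      have "continuous_on UNIV (\<lambda>s. \<xi> (t, (p, s)))" by (intro continuous_on_compose2[OF \<xi>(1)] continuous_intros) auto
      then have "((\<lambda>s. \<xi> (t, (p, s))) \<longlongrightarrow> \<xi> (t, (p, 0))) (at 0)"
        by (simp add: continuous_on_def)
      then have "((\<lambda>s. (1 / s) *\<^sub>R (\<eta> (t, p + s *\<^sub>R b) - \<eta> (t, p))) \<longlongrightarrow> \<zeta> (t, p)) (at 0)"
        unfolding \<zeta>_def fst_conv snd_conv
        by (rule Lim_transform_eventually) (auto simp: eventually_at_filter quot)
      then show ?thesis by (simp add: has_vector_derivative_0_iff zero_prod_def[symmetric])
    qed
  qed
qed

text \<open>The induction covers all equations at once: a parameter derivative of \<eta> solves the
  linearised equation, whose right-hand side is built from \<open>W'\<close> and from \<eta> itself.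
  Both are C^k by the time they are needed, so the derivative is C^k and \<eta> gains one
  order.\<close>

lemma Ck_on_ode_solution:
  fixes W :: "real \<times> 'p::euclidean_space \<times> 'b::euclidean_space \<Rightarrow> 'b"
  assumes "Ck_on k UNIV W"
    and "\<And>t p y z. norm (W (t, p, y) - W (t, p, z)) \<le> L * norm (y - z)"
    and "continuous_on UNIV \<eta>" "\<And>p. \<eta> (0, p) = 0"
    and "\<And>t p. ((\<lambda>s. \<eta> (s, p)) has_vector_derivative W (t, p, \<eta> (t, p))) (at t)"
  shows "Ck_on k UNIV \<eta>"
  using assms
proof (induction k arbitrary: W \<eta>)
  case 0
  then show ?case by simp
next
  case (Suc k)
  note L = Suc.prems(2) and \<eta>c = Suc.prems(3) and \<eta>0 = Suc.prems(4) and \<eta> = Suc.prems(5)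
  obtain W' where W': "\<And>x. (W has_derivative W' x) (at x)" "\<And>v. Ck_on k UNIV (\<lambda>x. W' x v)"
    using Suc.prems(1) by auto
  note W'c = Ck_on_imp_continuous[OF W'(2)]
  have lin: "linear (W' x)" for x using W' has_derivative_bounded_linear bounded_linear.linear by blast
  have Wk: "Ck_on k UNIV W" using Suc.prems(1) Ck_on_Suc_imp by blast
  have \<eta>k: "Ck_on k UNIV \<eta>" by (rule Suc.IH[OF Wk L \<eta>c \<eta>0 \<eta>])
  have "\<exists>\<zeta>. continuous_on UNIV \<zeta> \<and> (\<forall>p. \<zeta> (0, p) = 0) \<and>
    (\<forall>t p. ((\<lambda>s. \<zeta> (s, p)) has_vector_derivative W' (t, p, \<eta> (t, p)) (0, b, \<zeta> (t, p))) (at t)) \<and>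
    (\<forall>t p. ((\<lambda>s. \<eta> (t, p + s *\<^sub>R b)) has_vector_derivative \<zeta> (t, p)) (at 0))" for b
    by (rule ode_param_derivative[OF L W'(1) W'c \<eta>c \<eta>0 \<eta>, of b]) blast
  then obtain \<zeta> where \<zeta>: "\<And>b. continuous_on UNIV (\<zeta> b)" "\<And>b p. \<zeta> b (0, p) = 0"
    "\<And>b t p. ((\<lambda>s. \<zeta> b (s, p)) has_vector_derivative W' (t, p, \<eta> (t, p)) (0, b, \<zeta> b (t, p))) (at t)"
    "\<And>b t p. ((\<lambda>s. \<eta> (t, p + s *\<^sub>R b)) has_vector_derivative \<zeta> b (t, p)) (at 0)"
    by metis
  have \<zeta>k: "Ck_on k UNIV (\<zeta> b)" for b
  proof (rule Suc.IH[OF _ _ \<zeta>(1,2)])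
    let ?W = "\<lambda>q. W' (fst q, fst (snd q), \<eta> (fst q, fst (snd q))) (0, b, snd (snd q))"
    have \<eta>q: "Ck_on k UNIV (\<lambda>q :: real \<times> 'p \<times> 'b. (fst q, fst (snd q), \<eta> (fst q, fst (snd q))))"
      by (intro Ck_on_Pair Ck_on_fst Ck_on_snd Ck_on_compose[OF \<eta>k] Ck_on_bounded_linear[OF bounded_linear_ident]) auto
    have "?W q = W' (fst q, fst (snd q), \<eta> (fst q, fst (snd q))) (0, b, 0) +
        (\<Sum>i\<in>Basis. (snd (snd q) \<bullet> i) *\<^sub>R W' (fst q, fst (snd q), \<eta> (fst q, fst (snd q))) (0, 0, i))" for q
    proof -
      obtain x where x: "x = (fst q, fst (snd q), \<eta> (fst q, fst (snd q)))" by blast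
      define y where "y = snd (snd q)"
      have "(\<Sum>i\<in>Basis. (y \<bullet> i) *\<^sub>R W' x (0, 0, i)) = W' x (\<Sum>i\<in>Basis. (y \<bullet> i) *\<^sub>R (0, 0, i))"
        by (simp only: linear_sum[OF lin] linear_cmul[OF lin])
      also have "(\<Sum>i\<in>Basis. (y \<bullet> i) *\<^sub>R (0::real, 0::'p, i)) = (0, 0, \<Sum>i\<in>Basis. (y \<bullet> i) *\<^sub>R i)"
        by (simp add: prod_eq_iff fst_sum snd_sum)
      finally have "(\<Sum>i\<in>Basis. (y \<bullet> i) *\<^sub>R W' x (0, 0, i)) = W' x (0, 0, y)" by (simp add: euclidean_representation)
      then show ?thesis using linear_add[OF lin, of x "(0, b, 0)" "(0, 0, y)"] by (simp add: x[symmetric] y_def)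
    qed
    moreover have "Ck_on k UNIV (\<lambda>q. W' (fst q, fst (snd q), \<eta> (fst q, fst (snd q))) (0, b, 0) +
        (\<Sum>i\<in>Basis. (snd (snd q) \<bullet> i) *\<^sub>R W' (fst q, fst (snd q), \<eta> (fst q, fst (snd q))) (0, 0, i)))"
      by (intro Ck_on_add Ck_on_sum Ck_on_scaleR Ck_on_inner Ck_on_snd Ck_on_const Ck_on_bounded_linear[OF bounded_linear_ident]
          Ck_on_compose[OF W'(2) \<eta>q]) auto
    ultimately show "Ck_on k UNIV ?W" by simp
    show "norm (?W (t, p, y) - ?W (t, p, z)) \<le> L * norm (y - z)" for t p y z
    proof -
      have *: "norm (W' x (0, 0, v)) \<le> L * norm v" for x v by (rule derivative_Lipschitz_bound[OF L W'(1)])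
      show ?thesis using *[of _ "y - z"] by (simp add: linear_diff[OF lin, symmetric])
    qed
    show "((\<lambda>s. \<zeta> b (s, p)) has_vector_derivative ?W (t, p, \<zeta> b (t, p))) (at t)" for t p
      using \<zeta>(3) by simp
  qed
  \<comment> \<open>A basis vector of the product is purely temporal or purely spatial. In the first
    case only the equation itself contributes, since \<zeta> 0 vanishes; in the second only the
    parameter derivative does.\<close>
  define G where "G b q = fst b *\<^sub>R W (fst q, snd q, \<eta> q) + \<zeta> (snd b) q" for b q
  have pd: "((\<lambda>s. \<eta> (q + s *\<^sub>R b)) has_vector_derivative G b q) (at 0)" if b: "b \<in> Basis" for q b
  proof -
    obtain t p where q: "q = (t, p)" by (cases q)
    consider "b = (1, 0)" | b' where "b = (0, b')" using b unfolding Basis_prod_def by auto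
    then show ?thesis
    proof cases
      case 1
      have z: "\<zeta> 0 (t, p) = 0"
        using \<zeta>(4)[where b=0 and t=t and p=p] vector_derivative_unique_at[OF _ has_vector_derivative_const[of "\<eta> (t, p)"]] by auto
      have "((\<lambda>s. t + s) has_vector_derivative 0 + 1) (at 0)"
        by (intro has_vector_derivative_add has_vector_derivative_const has_vector_derivative_id)
      from vector_diff_chain_at[OF this, of "\<lambda>s. \<eta> (s, p)" "W (t, p, \<eta> (t, p))"]
      show ?thesis using \<eta> by (simp add: o_def 1 q G_def z)
    next
      case 2
      then show ?thesis using \<zeta>(4) by (simp add: q G_def)
    qed
  qed
  have Gk: "Ck_on k UNIV (G b)" for b unfolding G_def
    by (intro Ck_on_add Ck_on_scaleR Ck_on_const \<zeta>k[unfolded eta_contract_eq] Ck_on_compose[OF Wk] Ck_on_Pair Ck_on_fst Ck_on_snd \<eta>k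
        Ck_on_bounded_linear[OF bounded_linear_ident]) auto
  show ?case
  proof (rule Ck_on_SucI)
    show "(\<eta> has_derivative (\<lambda>v. \<Sum>b\<in>Basis. (v \<bullet> b) *\<^sub>R G b x)) (at x within UNIV)" for x
      by (rule has_derivative_partials[OF pd Ck_on_imp_continuous[OF Gk]])
    show "Ck_on k UNIV (\<lambda>x. \<Sum>b\<in>Basis. (v \<bullet> b) *\<^sub>R G b x)" for v
      by (intro Ck_on_sum Ck_on_scaleR Ck_on_const Gk)
  qed
qed

text \<open>The starting point becomes the parameter and the displacement from it the unknown, which
  then starts at 0.\<close>

lemma smooth_flow:
  fixes V :: "'a::euclidean_space \<Rightarrow> 'a"
  assumes V: "smooth_on UNIV V" and L: "\<And>y z. norm (V y - V z) \<le> L * norm (y - z)"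
  obtains \<Phi> :: "real \<times> 'a \<Rightarrow> 'a" where "smooth_on UNIV \<Phi>" "\<And>x. \<Phi> (0, x) = x"
    "\<And>t x. ((\<lambda>s. \<Phi> (s, x)) has_vector_derivative V (\<Phi> (t, x))) (at t)"
proof -
  define W where "W q = V (fst (snd q) + snd (snd q))" for q :: "real \<times> 'a \<times> 'a"
  have Ws: "smooth_on UNIV W" unfolding W_def
    by (intro smooth_on_compose[OF V] smooth_intros) auto
  have WL: "norm (W (t, p, y) - W (t, p, z)) \<le> L * norm (y - z)" for t p y z
    using L[of "p + y" "p + z"] by (simp add: W_def)
  obtain \<eta> where \<eta>: "continuous_on UNIV \<eta>" "\<And>p. \<eta> (0, p) = 0"
    "\<And>t p. ((\<lambda>s. \<eta> (s, p)) has_vector_derivative W (t, p, \<eta> (t, p))) (at t)"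
    using ode_exists[OF smooth_on_imp_continuous[OF Ws] WL] by blast
  have \<eta>s: "smooth_on UNIV \<eta>" unfolding smooth_on_def
    using Ck_on_ode_solution[OF smooth_on_Ck[OF Ws] WL \<eta>] by blast
  show thesis
  proof (rule that[of "\<lambda>q. snd q + \<eta> q"])
    show "smooth_on UNIV (\<lambda>q. snd q + \<eta> q)" by (intro smooth_intros \<eta>s)
    show "snd (0::real, x) + \<eta> (0, x) = x" for x by (simp add: \<eta>)
    show "((\<lambda>s. snd (s, x) + \<eta> (s, x)) has_vector_derivative V (snd (t, x) + \<eta> (t, x))) (at t)" for t x
      using has_vector_derivative_add[OF has_vector_derivative_const[of x] \<eta>(3)[of x t]] by (simp add: W_def)
  qed
qed

section \<open>Maps into a manifold\<close>

locale smooth_manifold =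
  fixes A :: "('m::t2_space, 'e::euclidean_space) atlas"
  assumes atlas: "smooth_atlas A"
begin

lemma chart:
  assumes "c \<in> A"
  shows open_cdom: "open (cdom c)" and open_cimg: "open (cimg c)"
    and continuous_on_cmap: "continuous_on (cdom c) (cmap c)"
    and continuous_on_cinv: "continuous_on (cimg c) (cinv c)"
    and cmap_in: "x \<in> cdom c \<Longrightarrow> cmap c x \<in> cimg c" and cinv_in: "y \<in> cimg c \<Longrightarrow> cinv c y \<in> cdom c"
    and cinv_cmap: "x \<in> cdom c \<Longrightarrow> cinv c (cmap c x) = x" and cmap_cinv: "y \<in> cimg c \<Longrightarrow> cmap c (cinv c y) = y"
proof -
  have h: "homeomorphism (cdom c) (cimg c) (cmap c) (cinv c)" "open (cdom c)" "open (cimg c)"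
    using atlas assms by (auto simp: smooth_atlas_def)
  then show "open (cdom c)" "open (cimg c)" "continuous_on (cdom c) (cmap c)" "continuous_on (cimg c) (cinv c)"
    by (auto simp: homeomorphism_def)
  show "x \<in> cdom c \<Longrightarrow> cmap c x \<in> cimg c" "y \<in> cimg c \<Longrightarrow> cinv c y \<in> cdom c"
    "x \<in> cdom c \<Longrightarrow> cinv c (cmap c x) = x" "y \<in> cimg c \<Longrightarrow> cmap c (cinv c y) = y"
    using h(1) by (auto simp: homeomorphism_def)
qed

lemma chart_at: obtains c where "c \<in> A" "x \<in> cdom c"
  using atlas unfolding smooth_atlas_def by (metis UN_E UNIV_I)

lemma rep_dom_id: "rep_dom c d id = {y \<in> cimg c. cinv c y \<in> cdom d}"
  by (simp add: rep_dom_def)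

lemma local_rep_id: "local_rep c d id = (\<lambda>y. cmap d (cinv c y))"
  by (simp add: local_rep_def)

lemma smooth_transition:
  "c \<in> A \<Longrightarrow> d \<in> A \<Longrightarrow> smooth_on {y \<in> cimg c. cinv c y \<in> cdom d} (\<lambda>y. cmap d (cinv c y))"
  using atlas by (auto simp: smooth_atlas_def rep_dom_id local_rep_id)

lemma open_transition_dom: "c \<in> A \<Longrightarrow> open U \<Longrightarrow> open {y \<in> cimg c. cinv c y \<in> U}"
  using continuous_on_open_vimage[OF open_cimg, of c "cinv c"] continuous_on_cinv[of c]
  by (auto simp: vimage_def Int_def conj_commute)

lemma open_rep_dom_id: "c \<in> A \<Longrightarrow> d \<in> A \<Longrightarrow> open (rep_dom c d id)"
  by (simp add: rep_dom_id open_transition_dom open_cdom)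

lemma open_chart_image: "c \<in> A \<Longrightarrow> open V \<Longrightarrow> open {x \<in> cdom c. cmap c x \<in> V}"
  using continuous_on_open_vimage[OF open_cdom, of c "cmap c"] continuous_on_cmap[of c]
  by (auto simp: vimage_def Int_def conj_commute)

text \<open>Continuity is demanded separately: the chart condition only sees the points sent into
  one chart domain, and continuity is what makes these sets relatively open. The source may have a
  boundary, as [0,1] times an open set does.\<close>

definition smooth_into :: "'p::euclidean_space set \<Rightarrow> ('p \<Rightarrow> 'm) \<Rightarrow> bool" where
  "smooth_into S g \<longleftrightarrow> continuous_on S g \<and> (\<forall>c\<in>A. smooth_on {p \<in> S. g p \<in> cdom c} (\<lambda>p. cmap c (g p)))"

lemma smooth_into_continuous: "smooth_into S g \<Longrightarrow> continuous_on S g"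
  by (simp add: smooth_into_def)

lemma smooth_into_chart: "smooth_into S g \<Longrightarrow> c \<in> A \<Longrightarrow> T \<subseteq> S \<Longrightarrow> g ` T \<subseteq> cdom c \<Longrightarrow> smooth_on T (\<lambda>p. cmap c (g p))"
  unfolding smooth_into_def by (rule smooth_on_subset[of "{p \<in> S. g p \<in> cdom c}"]) auto

lemma smooth_into_cong: "smooth_into S g \<Longrightarrow> (\<And>p. p \<in> S \<Longrightarrow> g p = h p) \<Longrightarrow> smooth_into S h"
  unfolding smooth_into_def
proof (intro conjI ballI; elim conjE)
  assume *: "continuous_on S g" "\<And>p. p \<in> S \<Longrightarrow> g p = h p" "\<forall>c\<in>A. smooth_on {p \<in> S. g p \<in> cdom c} (\<lambda>p. cmap c (g p))"
  then show "continuous_on S h" using continuous_on_eq by blast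
  fix c assume "c \<in> A"
  moreover have "{p \<in> S. h p \<in> cdom c} = {p \<in> S. g p \<in> cdom c}" using * by auto
  ultimately show "smooth_on {p \<in> S. h p \<in> cdom c} (\<lambda>p. cmap c (h p))"
    using * by (auto intro: smooth_on_cong)
qed

lemma smooth_into_compose:
  assumes "smooth_into S g" "smooth_on T h" "h ` T \<subseteq> S"
  shows "smooth_into T (\<lambda>q. g (h q))"
  unfolding smooth_into_def
proof (intro conjI ballI)
  show "continuous_on T (\<lambda>q. g (h q))"
    using assms by (intro continuous_on_compose2[OF smooth_into_continuous smooth_on_imp_continuous]) auto
  fix c assume "c \<in> A"
  then have "smooth_on {p \<in> S. g p \<in> cdom c} (\<lambda>p. cmap c (g p))"
    using assms(1) by (simp add: smooth_into_def)
  then show "smooth_on {q \<in> T. g (h q) \<in> cdom c} (\<lambda>q. cmap c (g (h q)))"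
    by (rule smooth_on_compose[OF _ smooth_on_subset[OF assms(2)]]) (use assms(3) in blast)+
qed

lemma smooth_into_subset: "smooth_into S g \<Longrightarrow> T \<subseteq> S \<Longrightarrow> smooth_into T g"
  using smooth_into_compose[of S g T "\<lambda>p. p"] by auto

lemma smooth_into_preimage_openin:
  assumes "continuous_on S g" "open U"
  shows "openin (top_of_set S) {p \<in> S. g p \<in> U}"
  using continuous_openin_preimage_gen[OF assms] by (auto simp: vimage_def Int_def)

lemma smooth_into_preimage_open:
  assumes "continuous_on S g" "open U" "p \<in> S" "g p \<in> U"
  obtains V where "open V" "p \<in> V" "\<And>q. q \<in> S \<inter> V \<Longrightarrow> g q \<in> U"
  using smooth_into_preimage_openin[OF assms(1,2)] assms(3,4) unfolding openin_open by blast

lemma smooth_into_local: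
  assumes S: "thick S" and loc: "\<And>p. p \<in> S \<Longrightarrow> \<exists>U. open U \<and> p \<in> U \<and> smooth_into (S \<inter> U) g"
  shows "smooth_into S g"
  unfolding smooth_into_def
proof (intro conjI ballI)
  show c: "continuous_on S g"
    unfolding continuous_on_eq_continuous_within
  proof
    fix x assume "x \<in> S"
    then obtain U where "open U" "x \<in> U" "continuous_on (S \<inter> U) g"
      using loc smooth_into_continuous by blast
    then show "continuous (at x within S) g" using \<open>x \<in> S\<close>
      by (metis IntI at_within_Int_open continuous_on_eq_continuous_within)
  qed
  fix d assume d: "d \<in> A"
  have T: "thick {p \<in> S. g p \<in> cdom d}"
    using thick_relopen[OF S smooth_into_preimage_openin[OF c open_cdom[OF d]]] .
  show "smooth_on {p \<in> S. g p \<in> cdom d} (\<lambda>p. cmap d (g p))"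
  proof (rule smooth_on_local[OF T])
    fix p assume "p \<in> {p \<in> S. g p \<in> cdom d}"
    then obtain U where U: "open U" "p \<in> U" "smooth_into (S \<inter> U) g" using loc by blast
    then have "smooth_on ({p \<in> S. g p \<in> cdom d} \<inter> U) (\<lambda>p. cmap d (g p))"
      by (intro smooth_into_chart[OF U(3) d]) auto
    then show "\<exists>U. open U \<and> p \<in> U \<and> smooth_on ({p \<in> S. g p \<in> cdom d} \<inter> U) (\<lambda>p. cmap d (g p))"
      using U by blast
  qed
qed

lemma smooth_into_cinv: "c \<in> A \<Longrightarrow> smooth_into (cimg c) (cinv c)"
  unfolding smooth_into_def using smooth_transition continuous_on_cinv by auto

lemma smooth_into_cinv_comp: "c \<in> A \<Longrightarrow> smooth_on S h \<Longrightarrow> h ` S \<subseteq> cimg c \<Longrightarrow> smooth_into S (\<lambda>p. cinv c (h p))"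
  by (rule smooth_into_compose[OF smooth_into_cinv])

lemma smooth_into_chart_nbhd:
  assumes "smooth_into S g" "p \<in> S"
  obtains U c where "open U" "p \<in> U" "c \<in> A" "\<And>q. q \<in> S \<inter> U \<Longrightarrow> g q \<in> cdom c" "smooth_on (S \<inter> U) (\<lambda>q. cmap c (g q))"
proof -
  obtain c where c: "c \<in> A" "g p \<in> cdom c" by (rule chart_at)
  obtain U where U: "open U" "p \<in> U" "\<And>q. q \<in> S \<inter> U \<Longrightarrow> g q \<in> cdom c"
    using smooth_into_preimage_open[OF smooth_into_continuous[OF assms(1)] open_cdom[OF c(1)] assms(2) c(2)] by blast
  show thesis using U c by (intro that[of U c] smooth_into_chart[OF assms(1)]) auto
qed

lemma smooth_fun_comp:
  assumes "thick S" "smooth_into S g" "smooth_fun A f"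
  shows "smooth_on S (\<lambda>p. f (g p))"
proof (rule smooth_on_local[OF assms(1)])
  fix p assume "p \<in> S"
  obtain U c where U: "open U" "p \<in> U" "c \<in> A" "\<And>q. q \<in> S \<inter> U \<Longrightarrow> g q \<in> cdom c" "smooth_on (S \<inter> U) (\<lambda>q. cmap c (g q))"
    using smooth_into_chart_nbhd[OF assms(2) \<open>p \<in> S\<close>] by blast
  have "smooth_on (cimg c) (\<lambda>y. f (cinv c y))" using assms(3) U by (simp add: smooth_fun_def)
  then have "smooth_on (S \<inter> U) (\<lambda>q. f (cinv c (cmap c (g q))))"
    by (rule smooth_on_compose[OF _ U(5)]) (use U in \<open>auto simp: cmap_in\<close>)
  then have "smooth_on (S \<inter> U) (\<lambda>q. f (g q))" by (rule smooth_on_cong) (simp add: U cinv_cmap)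
  then show "\<exists>U. open U \<and> p \<in> U \<and> smooth_on (S \<inter> U) (\<lambda>p. f (g p))" using U by blast
qed

text \<open>One notion for paths, with \<open>Q = {0..1}\<close>, and flows, with
  \<open>Q = UNIV\<close>. A chart is fixed only in the source; the values may run through many
  charts.\<close>

definition smooth_family :: "'q::euclidean_space set \<Rightarrow> ('q \<Rightarrow> 'm \<Rightarrow> 'm) \<Rightarrow> bool" where
  "smooth_family Q H \<longleftrightarrow> (\<forall>c\<in>A. smooth_into (Q \<times> cimg c) (\<lambda>p. H (fst p) (cinv c (snd p))))"

lemma smooth_family_comp:
  assumes "thick S" "smooth_family Q H" "smooth_on S q" "q ` S \<subseteq> Q" "smooth_into S g"
  shows "smooth_into S (\<lambda>p. H (q p) (g p))"
proof (rule smooth_into_local[OF assms(1)])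
  fix p assume "p \<in> S"
  obtain U c where U: "open U" "p \<in> U" "c \<in> A" "\<And>q. q \<in> S \<inter> U \<Longrightarrow> g q \<in> cdom c" "smooth_on (S \<inter> U) (\<lambda>q. cmap c (g q))"
    using smooth_into_chart_nbhd[OF assms(5) \<open>p \<in> S\<close>] by blast
  have "smooth_into (Q \<times> cimg c) (\<lambda>p. H (fst p) (cinv c (snd p)))"
    using assms(2) U by (simp add: smooth_family_def)
  moreover have "smooth_on (S \<inter> U) (\<lambda>x. (q x, cmap c (g x)))"
    by (rule smooth_on_Pair[OF smooth_on_subset[OF assms(3)] U(5)]) simp
  moreover have "(\<lambda>x. (q x, cmap c (g x))) ` (S \<inter> U) \<subseteq> Q \<times> cimg c"
    using assms(4) U by (auto simp: cmap_in)
  ultimately have "smooth_into (S \<inter> U) (\<lambda>x. (\<lambda>p. H (fst p) (cinv c (snd p))) (q x, cmap c (g x)))"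
    by (rule smooth_into_compose)
  then have "smooth_into (S \<inter> U) (\<lambda>x. H (q x) (g x))" by (rule smooth_into_cong) (simp add: U cinv_cmap)
  then show "\<exists>U. open U \<and> p \<in> U \<and> smooth_into (S \<inter> U) (\<lambda>x. H (q x) (g x))" using U by blast
qed

lemma smooth_family_comp_family:
  assumes "thick Q" "smooth_family P H" "smooth_on Q q" "q ` Q \<subseteq> P" "smooth_family Q G"
  shows "smooth_family Q (\<lambda>t x. H (q t) (G t x))"
  unfolding smooth_family_def
proof
  fix c assume c: "c \<in> A"
  have "smooth_on (Q \<times> cimg c) (\<lambda>p. q (fst p))"
    by (rule smooth_on_compose[OF assms(3)]) (auto intro: smooth_intros)
  moreover have "(\<lambda>p. q (fst p)) ` (Q \<times> cimg c) \<subseteq> P" using assms(4) by auto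
  moreover have "smooth_into (Q \<times> cimg c) (\<lambda>p. G (fst p) (cinv c (snd p)))"
    using assms(5) c by (simp add: smooth_family_def)
  ultimately show "smooth_into (Q \<times> cimg c) (\<lambda>p. H (q (fst p)) (G (fst p) (cinv c (snd p))))"
    by (rule smooth_family_comp[OF thick_Times[OF assms(1) thick_open[OF open_cimg[OF c]]] assms(2)])
qed

lemma smooth_family_const_compose:
  assumes "smooth_family P H" "smooth_on Q q" "q ` Q \<subseteq> P"
  shows "smooth_family Q (\<lambda>t. H (q t))"
  unfolding smooth_family_def
proof
  fix c assume c: "c \<in> A"
  have "smooth_into (P \<times> cimg c) (\<lambda>p. H (fst p) (cinv c (snd p)))"
    using assms(1) c by (simp add: smooth_family_def)
  moreover have "smooth_on (Q \<times> cimg c) (\<lambda>p. (q (fst p), snd p))"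
    by (intro smooth_on_Pair smooth_on_snd smooth_on_id smooth_on_compose[OF assms(2)] smooth_on_fst) auto
  moreover have "(\<lambda>p. (q (fst p), snd p)) ` (Q \<times> cimg c) \<subseteq> P \<times> cimg c" using assms(3) by auto
  ultimately have "smooth_into (Q \<times> cimg c) (\<lambda>p. (\<lambda>p. H (fst p) (cinv c (snd p))) (q (fst p), snd p))"
    by (rule smooth_into_compose)
  then show "smooth_into (Q \<times> cimg c) (\<lambda>p. H (q (fst p)) (cinv c (snd p)))" by simp
qed

lemma smooth_family_continuous:
  assumes "smooth_family Q H"
  shows "continuous_on (Q \<times> UNIV) (\<lambda>p. H (fst p) (snd p))"
  unfolding continuous_on_eq_continuous_within
proof
  fix p :: "'a \<times> 'm" assume p: "p \<in> Q \<times> UNIV"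
  obtain c where c: "c \<in> A" "snd p \<in> cdom c" by (rule chart_at)
  have "continuous_on (Q \<times> cimg c) (\<lambda>p. H (fst p) (cinv c (snd p)))"
    using assms c by (auto simp: smooth_family_def intro: smooth_into_continuous)
  moreover have "continuous_on (Q \<times> cdom c) (\<lambda>p. (fst p, cmap c (snd p)))"
    by (intro continuous_on_Pair continuous_on_fst continuous_on_snd continuous_on_id
        continuous_on_compose2[OF continuous_on_cmap[OF c(1)]]) auto
  ultimately have "continuous_on (Q \<times> cdom c) (\<lambda>p. (\<lambda>p. H (fst p) (cinv c (snd p))) (fst p, cmap c (snd p)))"
    by (rule continuous_on_compose2) (auto simp: cmap_in c)
  then have "continuous_on (Q \<times> cdom c) (\<lambda>p. H (fst p) (snd p))"
    by (rule continuous_on_eq) (auto simp: cinv_cmap c)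
  then have *: "continuous (at p within (Q \<times> UNIV) \<inter> (UNIV \<times> cdom c)) (\<lambda>p. H (fst p) (snd p))"
    using p c by (cases p) (auto simp: continuous_on_eq_continuous_within Times_Int_Times)
  have "at p within (Q \<times> UNIV) \<inter> (UNIV \<times> cdom c) = at p within (Q \<times> UNIV)"
    using c by (cases p) (auto intro!: at_within_Int_open open_Times open_cdom)
  then show "continuous (at p within Q \<times> UNIV) (\<lambda>p. H (fst p) (snd p))" using * by simp
qed

lemma smooth_familyI:
  assumes "continuous_on (Q \<times> UNIV) (\<lambda>p. H (fst p) (snd p))"
    and "\<And>c d. c \<in> A \<Longrightarrow> d \<in> A \<Longrightarrow> smooth_on {p. fst p \<in> Q \<and> snd p \<in> rep_dom c d (H (fst p))} (\<lambda>p. local_rep c d (H (fst p)) (snd p))"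
  shows "smooth_family Q H"
  unfolding smooth_family_def smooth_into_def
proof (intro ballI conjI)
  fix c assume c: "c \<in> A"
  show "continuous_on (Q \<times> cimg c) (\<lambda>p. H (fst p) (cinv c (snd p)))"
  proof -
    have "continuous_on (Q \<times> cimg c) (\<lambda>p. (fst p, cinv c (snd p)))"
      by (intro continuous_on_Pair continuous_on_fst continuous_on_snd continuous_on_id
          continuous_on_compose2[OF continuous_on_cinv[OF c]]) auto
    from continuous_on_compose2[OF assms(1) this] show ?thesis by (auto simp: image_subset_iff)
  qed
  fix d assume d: "d \<in> A"
  have "{p. fst p \<in> Q \<and> snd p \<in> rep_dom c d (H (fst p))} = {p \<in> Q \<times> cimg c. H (fst p) (cinv c (snd p)) \<in> cdom d}"
    by (auto simp: rep_dom_def)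
  then show "smooth_on {p \<in> Q \<times> cimg c. H (fst p) (cinv c (snd p)) \<in> cdom d} (\<lambda>p. cmap d (H (fst p) (cinv c (snd p))))"
    using assms(2)[OF c d] by (simp add: local_rep_def)
qed

lemma smooth_family_rep:
  assumes "smooth_family Q H" "c \<in> A" "d \<in> A"
  shows "smooth_on {p. fst p \<in> Q \<and> snd p \<in> rep_dom c d (H (fst p))} (\<lambda>p. local_rep c d (H (fst p)) (snd p))"
proof -
  have "{p. fst p \<in> Q \<and> snd p \<in> rep_dom c d (H (fst p))} = {p \<in> Q \<times> cimg c. H (fst p) (cinv c (snd p)) \<in> cdom d}"
    by (auto simp: rep_dom_def)
  then show ?thesis using assms by (simp add: smooth_family_def smooth_into_def local_rep_def)
qed

lemma smooth_map_of_family: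
  assumes "smooth_family Q H" "t \<in> Q"
  shows "smooth_map A (H t)"
  unfolding smooth_map_def
proof (intro conjI ballI)
  show "continuous_on UNIV (H t)"
  proof -
    have "continuous_on UNIV (\<lambda>x::'m. (t, x))" by (intro continuous_intros)
    from continuous_on_compose2[OF smooth_family_continuous[OF assms(1)] this] assms(2)
    show ?thesis by (auto simp: image_subset_iff)
  qed
  fix c d assume "c \<in> A" "d \<in> A"
  have "smooth_on (rep_dom c d (H t)) (\<lambda>y. (\<lambda>p. local_rep c d (H (fst p)) (snd p)) (t, y))"
    by (rule smooth_on_compose[OF smooth_family_rep[OF assms(1) \<open>c \<in> A\<close> \<open>d \<in> A\<close>]])
      (use assms(2) in \<open>auto intro!: smooth_intros\<close>)
  then show "smooth_on (rep_dom c d (H t)) (local_rep c d (H t))" by simp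
qed

lemma smooth_into_map:
  assumes "smooth_map A f" "smooth_into S g" "thick S"
  shows "smooth_into S (\<lambda>p. f (g p))"
proof -
  have f: "continuous_on UNIV f" "\<And>c d. c \<in> A \<Longrightarrow> d \<in> A \<Longrightarrow> smooth_on (rep_dom c d f) (local_rep c d f)"
    using assms by (auto simp: smooth_map_def)
  \<comment> \<open>A single map is treated as a family that is constant in a dummy parameter, so
    that the composition result for families applies.\<close>
  have "smooth_family (UNIV :: real set) (\<lambda>t. f)"
  proof (rule smooth_familyI)
    show "continuous_on (UNIV \<times> UNIV) (\<lambda>p::real \<times> 'm. f (snd p))"
      by (rule continuous_on_compose2[OF f(1)]) (auto intro: continuous_intros)
    fix c d assume "c \<in> A" "d \<in> A"
    then show "smooth_on {p::real \<times> 'e. fst p \<in> UNIV \<and> snd p \<in> rep_dom c d f} (\<lambda>p. local_rep c d f (snd p))"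
      by (intro smooth_on_compose[OF f(2)] smooth_intros) auto
  qed
  from smooth_family_comp[OF assms(3) this, of "\<lambda>_. 0"] assms(2) show ?thesis by auto
qed

end

section \<open>Vector fields and their flows\<close>

lemma smooth_on_Lipschitz_cball:
  fixes f :: "'a::euclidean_space \<Rightarrow> 'b::euclidean_space"
  assumes "open U" "smooth_on U f" "cball y r \<subseteq> U"
  obtains L where "\<And>x z. x \<in> cball y r \<Longrightarrow> z \<in> cball y r \<Longrightarrow> norm (f x - f z) \<le> L * norm (x - z)"
proof -
  let ?D = "\<lambda>x. frechet_derivative f (at x)"
  note d = smooth_on_open_derivative[OF assms(1,2)]
  define g where "g x = (\<Sum>b\<in>Basis. norm (?D x b))" for x
  have "continuous_on (cball y r) g"
    unfolding g_def using d(2) assms(3)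
    by (intro continuous_intros) (meson continuous_on_subset smooth_on_imp_continuous)
  then have "bounded (g ` cball y r)"
    by (intro compact_imp_bounded compact_continuous_image) auto
  then obtain L where L: "\<And>x. x \<in> cball y r \<Longrightarrow> norm (g x) \<le> L"
    unfolding bounded_iff by blast
  show thesis
  proof (rule that)
    fix x z assume "x \<in> cball y r" "z \<in> cball y r"
    then show "norm (f x - f z) \<le> L * norm (x - z)"
    proof (rule differentiable_bound[OF convex_cball, rotated 2])
      fix x assume x: "x \<in> cball y r"
      then have dx: "(f has_derivative ?D x) (at x)" using d(1) assms(3) by auto
      then show "(f has_derivative ?D x) (at x within cball y r)" by (rule has_derivative_at_withinI)
      have l: "linear (?D x)" using dx has_derivative_bounded_linear bounded_linear.linear by blast
      show "onorm (?D x) \<le> L"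
      proof (rule onorm_le)
        fix v
        have "norm (?D x v) = norm (\<Sum>b\<in>Basis. (v \<bullet> b) *\<^sub>R ?D x b)"
          using linear_sum[OF l, of "\<lambda>b. (v \<bullet> b) *\<^sub>R b" Basis] by (simp add: euclidean_representation linear_cmul[OF l])
        also have "\<dots> \<le> (\<Sum>b\<in>Basis. norm (?D x b) * norm v)"
          by (rule sum_norm_le) (simp add: Basis_le_norm mult.commute[of _ "norm v"] mult_right_mono)
        also have "\<dots> = g x * norm v" by (simp add: g_def sum_distrib_right)
        also have "\<dots> \<le> L * norm v" using L[OF x] by (intro mult_right_mono) auto
        finally show "norm (?D x v) \<le> L * norm v" .
      qed
    qed
  qed
qed

text \<open>Pairs in the ball of radius 3 r are handled by the mean value inequality. A point of the
  ball of radius r and one beyond 3 r are at least 2 r apart, while the value of \<open>f\<close> is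
  bounded by comparison with a point \<open>w\<close> at distance 2 r from the centre, where
  \<open>f\<close> vanishes.\<close>

lemma smooth_compact_support_Lipschitz:
  fixes f :: "'a::euclidean_space \<Rightarrow> 'b::euclidean_space"
  assumes f: "smooth_on UNIV f" and z: "\<And>x. x \<notin> cball a r \<Longrightarrow> f x = 0" and r: "0 < r"
  obtains L where "\<And>x z. norm (f x - f z) \<le> L * norm (x - z)" "\<And>x. norm (f x) \<le> L * (2 * r)" "0 \<le> L"
proof -
  obtain L0 where L0: "\<And>x z. x \<in> cball a (3 * r) \<Longrightarrow> z \<in> cball a (3 * r) \<Longrightarrow> norm (f x - f z) \<le> L0 * norm (x - z)"
    using smooth_on_Lipschitz_cball[OF open_UNIV f subset_UNIV] by blast
  define L where "L = max L0 0"
  have L: "0 \<le> L" "\<And>x z. x \<in> cball a (3 * r) \<Longrightarrow> z \<in> cball a (3 * r) \<Longrightarrow> norm (f x - f z) \<le> L * norm (x - z)"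
  proof -
    fix x z assume "x \<in> cball a (3 * r)" "z \<in> cball a (3 * r)"
    then show "norm (f x - f z) \<le> L * norm (x - z)"
      using L0[of x z] mult_right_mono[of L0 L "norm (x - z)"] by (auto simp: L_def)
  qed (simp add: L_def)
  obtain b :: 'a where b: "b \<in> Basis" using nonempty_Basis by blast
  obtain w where w: "norm (w - a) = 2 * r" by (rule that[of "a + (2 * r) *\<^sub>R b"]) (use b r in simp)
  have fw: "f w = 0" using z[of w] w r by (simp add: dist_norm norm_minus_commute)
  have bd: "norm (f x) \<le> L * (norm (x - a) + 2 * r)" if "x \<in> cball a r" for x
  proof -
    have "norm (f x - f w) \<le> L * norm (x - w)" using that w r by (intro L) (auto simp: dist_norm norm_minus_commute)
    also have "\<dots> \<le> L * (norm (x - a) + 2 * r)"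
      using norm_triangle_ineq4[of "x - a" "w - a"] w L(1) by (intro mult_left_mono) auto
    finally show ?thesis using fw by simp
  qed
  have far: "norm (f x - f z) \<le> 3 * L * norm (x - z)" if x: "x \<in> cball a r" and zz: "z \<notin> cball a (3 * r)" for x z
  proof -
    have 1: "norm (x - z) \<ge> 2 * r" using x zz norm_triangle_ineq4[of "x - z" "x - a"] by (auto simp: dist_norm norm_minus_commute)
    have "f z = 0" using zz r by (intro z) auto
    then have "norm (f x - f z) \<le> L * (norm (x - a) + 2 * r)" using bd[OF x] by simp
    also have "\<dots> \<le> L * (3 * norm (x - z))"
      using 1 x r L(1) by (intro mult_left_mono) (auto simp: dist_norm norm_minus_commute)
    finally show ?thesis by simp
  qed
  show thesis
  proof (rule that[of "3 * L"])
    fix x z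
    consider "x \<in> cball a (3 * r)" "z \<in> cball a (3 * r)" | "x \<notin> cball a (3 * r)" "z \<in> cball a r" | "x \<in> cball a r" "z \<notin> cball a (3 * r)"
      | "x \<notin> cball a r" "z \<notin> cball a r"
      using r by fastforce
    then show "norm (f x - f z) \<le> 3 * L * norm (x - z)"
    proof cases
      case 1
      have "norm (f x - f z) \<le> L * norm (x - z)" by (rule L(2)[OF 1])
      also have "\<dots> \<le> 3 * L * norm (x - z)" using L(1) by (intro mult_right_mono) auto
      finally show ?thesis .
    next
      case 2
      then show ?thesis using far[of z x] by (simp add: norm_minus_commute)
    next
      case 3
      then show ?thesis by (rule far)
    next
      case 4
      then show ?thesis using L(1) by (simp add: z)
    qed
  next
    fix x
    show "norm (f x) \<le> 3 * L * (2 * r)"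
    proof (cases "x \<in> cball a r")
      case True
      have "norm (f x) \<le> L * (norm (x - a) + 2 * r)" by (rule bd[OF True])
      also have "\<dots> \<le> L * (3 * (2 * r))" using True r L(1) by (intro mult_left_mono) (auto simp: dist_norm norm_minus_commute)
      finally show ?thesis by simp
    next
      case False
      then show ?thesis using L(1) r by (simp add: z)
    qed
  qed (use L in simp)
qed

section \<open>Integral curves and local flows on a manifold\<close>

context smooth_manifold
begin

definition vector_field :: "('m, 'e) vfield \<Rightarrow> bool" where
  "vector_field u \<longleftrightarrow> (\<forall>c\<in>A. smooth_on (cimg c) (u c)) \<and>
     (\<forall>c\<in>A. \<forall>d\<in>A. \<forall>y\<in>rep_dom c d id. u d (local_rep c d id y) = frechet_derivative (local_rep c d id) (at y) (u c y))"

definition integral_curve :: "('m, 'e) vfield \<Rightarrow> real set \<Rightarrow> (real \<Rightarrow> 'm) \<Rightarrow> bool" where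
  "integral_curve u I \<gamma> \<longleftrightarrow> continuous_on I \<gamma> \<and>
     (\<forall>t\<in>I. \<forall>c\<in>A. \<gamma> t \<in> cdom c \<longrightarrow> ((\<lambda>s. cmap c (\<gamma> s)) has_vector_derivative u c (cmap c (\<gamma> t))) (at t))"

lemma transition_derivative:
  assumes "c \<in> A" "d \<in> A" "y \<in> rep_dom c d id"
  shows "(local_rep c d id has_derivative frechet_derivative (local_rep c d id) (at y)) (at y)"
  using smooth_on_open_derivative(1)[OF open_rep_dom_id[OF assms(1,2)], of "local_rep c d id" y]
    smooth_transition[OF assms(1,2)] assms(3) by (simp add: rep_dom_id local_rep_id)

text \<open>The velocity of a curve and the components of a field transform by the same derivative
  of the transition map, so one chart suffices to check the equation.\<close>

lemma integral_curve_change_chart: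
  assumes u: "vector_field u" and cA: "c \<in> A" "d \<in> A" and x: "\<gamma> t \<in> cdom c" "\<gamma> t \<in> cdom d"
    and cont: "continuous_on I \<gamma>" "open I" "t \<in> I"
    and der: "((\<lambda>s. cmap c (\<gamma> s)) has_vector_derivative u c (cmap c (\<gamma> t))) (at t)"
  shows "((\<lambda>s. cmap d (\<gamma> s)) has_vector_derivative u d (cmap d (\<gamma> t))) (at t)"
proof -
  define y where "y = cmap c (\<gamma> t)"
  have y: "y \<in> rep_dom c d id" using x cA by (simp add: y_def rep_dom_id cmap_in cinv_cmap)
  have "((local_rep c d id \<circ> (\<lambda>s. cmap c (\<gamma> s))) has_vector_derivative frechet_derivative (local_rep c d id) (at y) (u c y)) (at t)"
    using vector_derivative_diff_chain_within[OF der has_derivative_at_withinI[OF transition_derivative[OF cA y, unfolded y_def]]]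
    by (simp add: y_def)
  moreover have "frechet_derivative (local_rep c d id) (at y) (u c y) = u d (cmap d (\<gamma> t))"
  proof -
    have "u d (local_rep c d id y) = frechet_derivative (local_rep c d id) (at y) (u c y)"
      using u cA y unfolding vector_field_def by blast
    then show ?thesis using x cA by (simp add: local_rep_id y_def cinv_cmap)
  qed
  moreover have "open (I \<inter> \<gamma> -` cdom c)" using cont open_cdom[OF cA(1)]
    by (metis Int_commute continuous_on_open_vimage)
  moreover have "t \<in> I \<inter> \<gamma> -` cdom c" using x cont by simp
  moreover have "(local_rep c d id \<circ> (\<lambda>s. cmap c (\<gamma> s))) s = cmap d (\<gamma> s)" if "s \<in> I \<inter> \<gamma> -` cdom c" for s
    using that cA by (simp add: local_rep_id cinv_cmap)
  ultimately show ?thesis by (metis has_vector_derivative_transform_within_open)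
qed

lemma integral_curve_chart:
  assumes u: "vector_field u" and cA: "c \<in> A" and I: "open I" "\<And>t. t \<in> I \<Longrightarrow> y t \<in> cimg c"
    and der: "\<And>t. t \<in> I \<Longrightarrow> (y has_vector_derivative u c (y t)) (at t)"
  shows "integral_curve u I (\<lambda>t. cinv c (y t))"
proof -
  have yc: "continuous_on I y"
    using der by (auto simp: continuous_on_eq_continuous_within intro: has_vector_derivative_continuous has_vector_derivative_at_within)
  then have c: "continuous_on I (\<lambda>t. cinv c (y t))"
    by (rule continuous_on_compose2[OF continuous_on_cinv[OF cA]]) (use I in auto)
  show ?thesis
    unfolding integral_curve_def
  proof (intro conjI c ballI impI)
    fix t d assume t: "t \<in> I" and d: "d \<in> A" "cinv c (y t) \<in> cdom d"
    have "((\<lambda>s. cmap c (cinv c (y s))) has_vector_derivative u c (y t)) (at t)"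
      by (rule has_vector_derivative_transform_within_open[OF der[OF t] I(1) t]) (simp add: cmap_cinv[OF cA] I)
    then have "((\<lambda>s. cmap c (cinv c (y s))) has_vector_derivative u c (cmap c (cinv c (y t)))) (at t)"
      using I(2)[OF t] by (simp add: cmap_cinv[OF cA])
    from integral_curve_change_chart[OF u cA d(1) _ d(2) c I(1) t this]
    show "((\<lambda>s. cmap d (cinv c (y s))) has_vector_derivative u d (cmap d (cinv c (y t)))) (at t)"
      using cinv_in[OF cA I(2)[OF t]] by simp
  qed
qed

lemma integral_curve_subset: "integral_curve u I \<gamma> \<Longrightarrow> J \<subseteq> I \<Longrightarrow> integral_curve u J \<gamma>"
  by (auto simp: integral_curve_def intro: continuous_on_subset)

lemma integral_curve_shift:
  assumes "integral_curve u I \<gamma>" "\<And>t. t \<in> J \<Longrightarrow> t + b \<in> I"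
  shows "integral_curve u J (\<lambda>t. \<gamma> (t + b))"
  unfolding integral_curve_def
proof (intro conjI ballI impI)
  have c: "continuous_on I \<gamma>" using assms(1) by (simp add: integral_curve_def)
  show "continuous_on J (\<lambda>t. \<gamma> (t + b))"
    by (rule continuous_on_compose2[OF c]) (use assms(2) in \<open>auto intro!: continuous_intros\<close>)
  fix t c assume t: "t \<in> J" "c \<in> A" "\<gamma> (t + b) \<in> cdom c"
  then have d: "((\<lambda>s. cmap c (\<gamma> s)) has_vector_derivative u c (cmap c (\<gamma> (t + b)))) (at (t + b))"
    using assms by (simp add: integral_curve_def)
  have "((\<lambda>s. s + b) has_vector_derivative 1 + 0) (at t)"
    by (intro has_vector_derivative_add has_vector_derivative_const has_vector_derivative_id)
  from vector_diff_chain_at[OF this, of "\<lambda>s. cmap c (\<gamma> s)"] d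
  show "((\<lambda>s. cmap c (\<gamma> (s + b))) has_vector_derivative u c (cmap c (\<gamma> (t + b)))) (at t)"
    by (simp add: o_def)
qed

text \<open>Agreement and disagreement of the two curves are both open in time: the first by
  uniqueness in a chart ball, where the field is Lipschitz, the second because the manifold is
  Hausdorff. Connectedness of \<open>I\<close> then decides.\<close>

lemma integral_curve_unique:
  assumes u: "vector_field u" and g: "integral_curve u I \<gamma>" "integral_curve u I \<delta>"
    and I: "open I" "connected I" and t0: "t0 \<in> I" "\<gamma> t0 = \<delta> t0" and t: "t \<in> I"
  shows "\<gamma> t = \<delta> t"
proof (rule ccontr)
  assume ne: "\<gamma> t \<noteq> \<delta> t"
  have c: "continuous_on I \<gamma>" "continuous_on I \<delta>" using g by (auto simp: integral_curve_def)
  define E where "E = {t \<in> I. \<gamma> t = \<delta> t}"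
  define N where "N = {t \<in> I. \<gamma> t \<noteq> \<delta> t}"
  have "open N"
  proof (subst open_subopen, intro ballI)
    fix s assume "s \<in> N"
    then have s: "s \<in> I" "\<gamma> s \<noteq> \<delta> s" by (auto simp: N_def)
    obtain U V where UV: "open U" "open V" "\<gamma> s \<in> U" "\<delta> s \<in> V" "U \<inter> V = {}" using hausdorff[OF s(2)] by blast
    have "open ((\<gamma> -` U \<inter> I) \<inter> (\<delta> -` V \<inter> I))"
      using UV c I by (intro open_Int continuous_on_open_vimage[THEN iffD1, rule_format]) auto
    moreover have "s \<in> (\<gamma> -` U \<inter> I) \<inter> (\<delta> -` V \<inter> I)" using s UV by auto
    moreover have "(\<gamma> -` U \<inter> I) \<inter> (\<delta> -` V \<inter> I) \<subseteq> N"
    proof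
      fix r assume "r \<in> (\<gamma> -` U \<inter> I) \<inter> (\<delta> -` V \<inter> I)"
      then have "r \<in> I" "\<gamma> r \<in> U" "\<delta> r \<in> V" by auto
      then show "r \<in> N" using UV(5) unfolding N_def by auto
    qed
    ultimately show "\<exists>T. open T \<and> s \<in> T \<and> T \<subseteq> N" by blast
  qed
  moreover have "open E"
  proof (subst open_subopen, intro ballI)
    fix s assume "s \<in> E"
    then have s: "s \<in> I" "\<gamma> s = \<delta> s" by (auto simp: E_def)
    obtain d where d: "d \<in> A" "\<gamma> s \<in> cdom d" by (rule chart_at)
    define y where "y = cmap d (\<gamma> s)"
    obtain r where r: "r > 0" "cball y r \<subseteq> cimg d"
      using open_cimg[OF d(1)] cmap_in[OF d] open_contains_cball unfolding y_def by blast
    have "smooth_on (cimg d) (u d)" using u d by (simp add: vector_field_def)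
    then obtain L where L: "\<And>x z. x \<in> cball y r \<Longrightarrow> z \<in> cball y r \<Longrightarrow> norm (u d x - u d z) \<le> L * norm (x - z)"
      using smooth_on_Lipschitz_cball[OF open_cimg[OF d(1)] _ r(2)] by metis
    define W where "W = {x \<in> cdom d. cmap d x \<in> ball y r}"
    have W: "open W" unfolding W_def by (intro open_chart_image d open_ball)
    have "open ((\<gamma> -` W \<inter> I) \<inter> (\<delta> -` W \<inter> I))"
      using W c I by (intro open_Int continuous_on_open_vimage[THEN iffD1, rule_format]) auto
    moreover have "s \<in> (\<gamma> -` W \<inter> I) \<inter> (\<delta> -` W \<inter> I)"
      using s d r by (auto simp: W_def y_def)
    ultimately obtain e where e: "e > 0" "ball s e \<subseteq> (\<gamma> -` W \<inter> I) \<inter> (\<delta> -` W \<inter> I)"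
      using open_contains_ball by blast
    have *: "\<gamma> r \<in> W" "\<delta> r \<in> W" "r \<in> I" if "r \<in> {s - e<..<s + e}" for r
    proof -
      have "r \<in> ball s e" using that by (auto simp: dist_real_def)
      then show "\<gamma> r \<in> W" "\<delta> r \<in> W" "r \<in> I" using e by auto
    qed
    have "r \<in> E" if r: "r \<in> ball s e" for r
    proof -
      have r': "r \<in> {s - e<..<s + e}" using r by (auto simp: dist_real_def)
      have "cmap d (\<gamma> r) = cmap d (\<delta> r)"
      proof (rule ode_unique[of "s - e" "s + e" "\<lambda>r. cmap d (\<gamma> r)" "\<lambda>r. u d (cmap d (\<gamma> r))" "\<lambda>r. cmap d (\<delta> r)" "\<lambda>r. u d (cmap d (\<delta> r))" L s])
        fix q assume q: "q \<in> {s - e<..<s + e}"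
        note * = *[OF q]
        show "((\<lambda>r. cmap d (\<gamma> r)) has_vector_derivative u d (cmap d (\<gamma> q))) (at q)"
          using g(1) d(1) * by (simp add: integral_curve_def W_def)
        show "((\<lambda>r. cmap d (\<delta> r)) has_vector_derivative u d (cmap d (\<delta> q))) (at q)"
          using g(2) d(1) * by (simp add: integral_curve_def W_def)
        show "norm (u d (cmap d (\<gamma> q)) - u d (cmap d (\<delta> q))) \<le> L * norm (cmap d (\<gamma> q) - cmap d (\<delta> q))"
          using * by (intro L) (auto simp: W_def)
      qed (use r' s e in auto)
      then have "\<gamma> r = \<delta> r" using *[OF r'] cinv_cmap[OF d(1)] unfolding W_def by (metis (mono_tags) mem_Collect_eq)
      then show ?thesis using *[OF r'] by (simp add: E_def)
    qed
    then show "\<exists>T. open T \<and> s \<in> T \<and> T \<subseteq> E" using e by (intro exI[of _ "ball s e"]) auto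
  qed
  moreover have "E \<inter> N \<inter> I = {}" "I \<subseteq> E \<union> N" "E \<inter> I \<noteq> {}" "N \<inter> I \<noteq> {}"
    using ne t t0 by (auto simp: E_def N_def)
  ultimately show False using connectedD[OF I(2)] by metis
qed

text \<open>Cutting the field off inside a chart makes it smooth and globally Lipschitz on Euclidean
  space. For short times its flow does not leave the region where the cut-off function is 1, hence
  follows the original field.\<close>

lemma local_flow:
  assumes u: "vector_field u"
  obtains U \<epsilon> \<Theta> where "open U" "x0 \<in> U" "\<epsilon> > 0" "\<And>x. x \<in> U \<Longrightarrow> integral_curve u {-\<epsilon><..<\<epsilon>} (\<lambda>t. \<Theta> t x)"
    "\<And>x. x \<in> U \<Longrightarrow> \<Theta> 0 x = x"
    "\<And>c. c \<in> A \<Longrightarrow> smooth_into ({-\<epsilon><..<\<epsilon>} \<times> {y \<in> cimg c. cinv c y \<in> U}) (\<lambda>p. \<Theta> (fst p) (cinv c (snd p)))"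
proof -
  obtain d where d: "d \<in> A" "x0 \<in> cdom d" by (rule chart_at)
  define y0 where "y0 = cmap d x0"
  obtain R where R: "R > 0" "cball y0 R \<subseteq> cimg d"
    using open_cimg[OF d(1)] cmap_in[OF d] open_contains_cball unfolding y0_def by blast
  define r where "r = R / 3"
  have r: "r > 0" "2 * r < R" using R by (auto simp: r_def)
  obtain \<rho> :: "'e \<Rightarrow> real" where \<rho>: "smooth_on UNIV \<rho>" "\<And>x. x \<in> cball y0 (2 * r) \<Longrightarrow> \<rho> x = 1" "\<And>x. x \<notin> ball y0 R \<Longrightarrow> \<rho> x = 0"
    using bump_function[of "2 * r" R y0] r by (metis mult_pos_pos zero_less_numeral)
  define V where "V y = (if y \<in> cimg d then \<rho> y *\<^sub>R u d y else 0)" for y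
  have Vs: "smooth_on UNIV V"
  proof (rule smooth_on_local[OF thick_UNIV])
    fix y :: 'e
    show "\<exists>W. open W \<and> y \<in> W \<and> smooth_on (UNIV \<inter> W) V"
    proof (cases "y \<in> cimg d")
      case True
      have "smooth_on (cimg d) (\<lambda>y. \<rho> y *\<^sub>R u d y)"
        using u d by (intro smooth_intros smooth_on_subset[OF \<rho>(1)]) (auto simp: vector_field_def)
      then have "smooth_on (cimg d) V" by (rule smooth_on_cong) (simp add: V_def)
      then show ?thesis using True open_cimg[OF d(1)] by auto
    next
      case False
      have "smooth_on (- cball y0 R) (\<lambda>y. 0 :: 'e)" by simp
      then have "smooth_on (- cball y0 R) V" by (rule smooth_on_cong) (use \<rho>(3) in \<open>auto simp: V_def\<close>)
      then show ?thesis using False R by (intro exI[of _ "- cball y0 R"]) auto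
    qed
  qed
  have V0: "V y = 0" if "y \<notin> cball y0 R" for y using \<rho>(3)[of y] that by (auto simp: V_def)
  obtain L where L: "\<And>x z. norm (V x - V z) \<le> L * norm (x - z)" "\<And>x. norm (V x) \<le> L * (2 * R)" "0 \<le> L"
    using smooth_compact_support_Lipschitz[OF Vs V0 R(1)] by blast
  obtain \<Phi> where \<Phi>: "smooth_on UNIV \<Phi>" "\<And>x. \<Phi> (0, x) = x" "\<And>t x. ((\<lambda>s. \<Phi> (s, x)) has_vector_derivative V (\<Phi> (t, x))) (at t)"
    using smooth_flow[OF Vs L(1)] by blast
  \<comment> \<open>A positive bound for the speed of the cut-off field: in time less than r / B an
    orbit moves less than r, so from the ball of radius r it cannot leave the ball of radius 2
    r.\<close>
  define B where "B = L * (2 * R) + 1"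
  have B: "B > 0" using L(3) R by (simp add: B_def add_nonneg_pos)
  define \<epsilon> where "\<epsilon> = r / B"
  have \<epsilon>: "\<epsilon> > 0" using r B by (simp add: \<epsilon>_def)
  have near: "\<Phi> (t, y) \<in> ball y0 (2 * r)" if "t \<in> {-\<epsilon><..<\<epsilon>}" "y \<in> ball y0 r" for t y
  proof -
    have "norm (\<Phi> (t, y) - \<Phi> (0, y)) \<le> B * norm (t - 0)"
    proof (rule differentiable_bound[OF convex_UNIV, of "\<lambda>s. \<Phi> (s, y)" "\<lambda>s h. h *\<^sub>R V (\<Phi> (s, y))"])
      fix s show "((\<lambda>s. \<Phi> (s, y)) has_derivative (\<lambda>h. h *\<^sub>R V (\<Phi> (s, y)))) (at s within UNIV)"
        using \<Phi>(3) by (simp add: has_vector_derivative_def)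
      show "onorm (\<lambda>h. h *\<^sub>R V (\<Phi> (s, y))) \<le> B"
      proof (rule onorm_le)
        fix h :: real
        have "norm (h *\<^sub>R V (\<Phi> (s, y))) = \<bar>h\<bar> * norm (V (\<Phi> (s, y)))" by simp
        also have "\<dots> \<le> \<bar>h\<bar> * B" using L(2)[of "\<Phi> (s, y)"] by (intro mult_left_mono) (auto simp: B_def)
        finally show "norm (h *\<^sub>R V (\<Phi> (s, y))) \<le> B * norm h" by (simp add: mult.commute)
      qed
    qed auto
    also have "\<dots> < B * \<epsilon>" using that(1) B by (intro mult_strict_left_mono) auto
    finally have "norm (\<Phi> (t, y) - y) < r" using B by (simp add: \<Phi>(2) \<epsilon>_def)
    then show ?thesis using that(2) norm_triangle_ineq[of "\<Phi> (t, y) - y" "y - y0"] by (simp add: dist_norm norm_minus_commute)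
  qed
  have img: "ball y0 (2 * r) \<subseteq> cimg d" "ball y0 r \<subseteq> ball y0 (2 * r)" using R r by auto
  define U where "U = {x \<in> cdom d. cmap d x \<in> ball y0 r}"
  define \<Theta> where "\<Theta> t x = cinv d (\<Phi> (t, cmap d x))" for t x
  show thesis
  proof (rule that[of U \<epsilon> \<Theta>])
    show "open U" unfolding U_def by (intro open_chart_image d open_ball)
    show "x0 \<in> U" using d r by (simp add: U_def y0_def)
    show "\<epsilon> > 0" by (rule \<epsilon>)
    fix x assume x: "x \<in> U"
    show "\<Theta> 0 x = x" using x by (simp add: \<Theta>_def \<Phi> U_def cinv_cmap[OF d(1)])
    show "integral_curve u {-\<epsilon><..<\<epsilon>} (\<lambda>t. \<Theta> t x)"
      unfolding \<Theta>_def
    proof (rule integral_curve_chart[OF u d(1)])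
      fix t assume t: "t \<in> {-\<epsilon><..<\<epsilon>}"
      have n: "\<Phi> (t, cmap d x) \<in> ball y0 (2 * r)" using near[OF t] x by (simp add: U_def)
      then show "\<Phi> (t, cmap d x) \<in> cimg d" using img by auto
      moreover have "\<rho> (\<Phi> (t, cmap d x)) = 1" using n by (intro \<rho>(2)) auto
      ultimately have "V (\<Phi> (t, cmap d x)) = u d (\<Phi> (t, cmap d x))" by (simp add: V_def)
      then show "((\<lambda>t. \<Phi> (t, cmap d x)) has_vector_derivative u d (\<Phi> (t, cmap d x))) (at t)"
        using \<Phi>(3)[of "cmap d x" t] by simp
    qed simp
  next
    fix c assume c: "c \<in> A"
    let ?S = "{-\<epsilon><..<\<epsilon>} \<times> {y \<in> cimg c. cinv c y \<in> U}"
    have "smooth_on ?S (\<lambda>p. cmap d (cinv c (snd p)))"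
      by (rule smooth_on_compose[OF smooth_transition[OF c d(1)]]) (auto simp: U_def intro: smooth_intros)
    then have "smooth_on ?S (\<lambda>p. (fst p, cmap d (cinv c (snd p))))" by (intro smooth_intros)
    then have "smooth_on ?S (\<lambda>p. \<Phi> (fst p, cmap d (cinv c (snd p))))"
      by (rule smooth_on_compose[OF \<Phi>(1)]) simp
    then show "smooth_into ?S (\<lambda>p. \<Theta> (fst p) (cinv c (snd p)))"
      unfolding \<Theta>_def
    proof (rule smooth_into_cinv_comp[OF d(1)], intro image_subsetI)
      fix p assume "p \<in> ?S"
      then have "\<Phi> (fst p, cmap d (cinv c (snd p))) \<in> ball y0 (2 * r)" by (intro near) (auto simp: U_def)
      then show "\<Phi> (fst p, cmap d (cinv c (snd p))) \<in> cimg d" using img by auto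
    qed
  qed
qed

end

section \<open>From short times to a global flow\<close>

lemma funpow_commute_comp:
  assumes "f \<circ> g = g \<circ> f"
  shows "(f \<circ> g) ^^ n = (f ^^ n) \<circ> (g ^^ n)"
proof -
  have c: "g \<circ> (f ^^ n) = (f ^^ n) \<circ> g" for n
  proof (induction n)
    case (Suc n)
    have "g \<circ> (f ^^ Suc n) = (g \<circ> f) \<circ> (f ^^ n)" by (simp add: o_assoc)
    also have "\<dots> = f \<circ> (g \<circ> (f ^^ n))" by (simp add: assms[symmetric] o_assoc)
    also have "\<dots> = (f ^^ Suc n) \<circ> g" by (simp only: Suc funpow.simps o_assoc)
    finally show ?case .
  qed simp
  show ?thesis
  proof (induction n)
    case (Suc n)
    have "(f \<circ> g) ^^ Suc n = f \<circ> (g \<circ> (f ^^ n)) \<circ> (g ^^ n)" by (simp only: Suc funpow.simps o_assoc)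
    also have "\<dots> = (f ^^ Suc n) \<circ> (g ^^ Suc n)" by (simp only: c funpow.simps o_assoc)
    finally show ?case .
  qed simp
qed

text \<open>\<open>T t\<close> is \<theta>(t / N) iterated N times for large N. Two choices of N
  agree since both equal the iteration for their product; the group law follows from one N that
  serves \<open>s\<close>, \<open>t\<close> and \<open>s + t\<close>, since the two small steps
  commute.\<close>

lemma local_one_parameter_group_extends:
  fixes \<theta> :: "real \<Rightarrow> 'm \<Rightarrow> 'm"
  assumes \<epsilon>: "\<epsilon> > 0" and z: "\<theta> 0 = id"
    and add: "\<And>a b. \<bar>a\<bar> < \<epsilon> \<Longrightarrow> \<bar>b\<bar> < \<epsilon> \<Longrightarrow> \<bar>a + b\<bar> < \<epsilon> \<Longrightarrow> \<theta> (a + b) = \<theta> a \<circ> \<theta> b"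
  obtains T where "\<And>t. \<bar>t\<bar> < \<epsilon> \<Longrightarrow> T t = \<theta> t" "\<And>s t. T (s + t) = T s \<circ> T t"
    "\<And>t. \<exists>s n. \<bar>s\<bar> < \<epsilon> \<and> T t = \<theta> s ^^ n"
proof -
  have sub: "\<theta> (s / M) ^^ M = \<theta> s" if s: "\<bar>s\<bar> < \<epsilon>" and M: "M > 0" for s and M :: nat
  proof -
    have small: "\<bar>s * k / M\<bar> < \<epsilon>" if "k \<le> M" for k :: nat
    proof -
      have "\<bar>s * k / M\<bar> = \<bar>s\<bar> * (k / M)" by (simp add: abs_mult)
      also have "\<dots> \<le> \<bar>s\<bar> * 1" using that M by (intro mult_left_mono) auto
      finally show ?thesis using s by simp
    qed
    have "\<theta> (s / M) ^^ k = \<theta> (s * k / M)" if "k \<le> M" for k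
      using that
    proof (induction k)
      case (Suc k)
      have eq: "s / M + s * k / M = s * Suc k / M" by (simp add: distrib_left add_divide_distrib)
      have "\<theta> (s / M) ^^ Suc k = \<theta> (s / M) \<circ> \<theta> (s * k / M)" using Suc by simp
      also have "\<dots> = \<theta> (s / M + s * k / M)"
        using small[of 1] small[of k] small[of "Suc k"] Suc.prems M by (intro add[symmetric]) (simp_all only: eq, auto)
      finally show ?case by (simp only: eq)
    qed (simp add: z)
    from this[of M] M show ?thesis by simp
  qed
  have indep: "\<theta> (t / N) ^^ N = \<theta> (t / N') ^^ N'" if "N > 0" "N' > 0" "\<bar>t / N\<bar> < \<epsilon>" "\<bar>t / N'\<bar> < \<epsilon>" for t and N N' :: nat
  proof -
    have "\<theta> (t / (real N * real M)) ^^ (N * M) = \<theta> (t / N) ^^ N" if "M > 0" "\<bar>t / N\<bar> < \<epsilon>" for N M :: nat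
    proof -
      have "\<theta> (t / (real N * real M)) ^^ (N * M) = (\<theta> (t / N / M) ^^ M) ^^ N"
        by (simp add: funpow_mult mult.commute)
      then show ?thesis using sub[OF that(2,1)] by simp
    qed
    from this[of N' N] this[of N N'] that show ?thesis by (simp add: mult.commute)
  qed
  \<comment> \<open>The added 1 makes \<open>n t\<close> positive also for t = 0 and the step size
    strictly smaller than \<epsilon>.\<close>
  define n where "n t = nat \<lceil>\<bar>t\<bar> / \<epsilon>\<rceil> + 1" for t
  have n: "n t > 0" "\<bar>t\<bar> / n t < \<epsilon>" for t
  proof -
    show "n t > 0" by (simp add: n_def)
    have "\<bar>t\<bar> / \<epsilon> < n t" unfolding n_def by linarith
    then show "\<bar>t\<bar> / n t < \<epsilon>" using \<epsilon> \<open>n t > 0\<close> by (simp add: field_simps)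
  qed
  define T where "T t = \<theta> (t / n t) ^^ n t" for t
  have T: "T t = \<theta> (t / N) ^^ N" if "N > 0" "\<bar>t\<bar> / N < \<epsilon>" for t and N :: nat
    unfolding T_def using that n by (intro indep) auto
  show thesis
  proof (rule that[of T])
    show "T t = \<theta> t" if "\<bar>t\<bar> < \<epsilon>" for t using T[of 1 t] that by simp
    show "\<exists>s n. \<bar>s\<bar> < \<epsilon> \<and> T t = \<theta> s ^^ n" for t
      using n[of t] by (intro exI[of _ "t / n t"] exI[of _ "n t"]) (simp add: T_def)
    show "T (s + t) = T s \<circ> T t" for s t
    proof -
      define N where "N = n (\<bar>s\<bar> + \<bar>t\<bar>)"
      have N: "N > 0" "(\<bar>s\<bar> + \<bar>t\<bar>) / N < \<epsilon>" using n[of "\<bar>s\<bar> + \<bar>t\<bar>"] by (auto simp: N_def)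
      have le: "\<bar>x\<bar> / N < \<epsilon>" if "\<bar>x\<bar> \<le> \<bar>s\<bar> + \<bar>t\<bar>" for x
        using divide_right_mono[OF that, of N] N by simp
      have sm: "\<bar>s / N\<bar> < \<epsilon>" "\<bar>t / N\<bar> < \<epsilon>" "\<bar>s / N + t / N\<bar> < \<epsilon>" "\<bar>t / N + s / N\<bar> < \<epsilon>"
        using le[of s] le[of t] le[of "s + t"] by (simp_all add: abs_divide add.commute flip: add_divide_distrib)
      have a: "\<theta> (s / N + t / N) = \<theta> (s / N) \<circ> \<theta> (t / N)" "\<theta> (t / N + s / N) = \<theta> (t / N) \<circ> \<theta> (s / N)"
        by (rule add[OF sm(1,2,3)], rule add[OF sm(2,1,4)])
      then have c: "\<theta> (s / N) \<circ> \<theta> (t / N) = \<theta> (t / N) \<circ> \<theta> (s / N)" by (simp add: add.commute)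
      have "T (s + t) = \<theta> (s / N + t / N) ^^ N" using T[OF N(1) le[of "s + t"]] by (simp add: add_divide_distrib)
      also have "\<dots> = (\<theta> (s / N) ^^ N) \<circ> (\<theta> (t / N) ^^ N)" unfolding a(1) by (rule funpow_commute_comp[OF c])
      also have "\<dots> = T s \<circ> T t" using T[OF N(1) le[of s]] T[OF N(1) le[of t]] by simp
      finally show ?thesis .
    qed
  qed
qed

locale closed_smooth_manifold = smooth_manifold +
  assumes compact: "compact (UNIV :: 'a set)"
begin

text \<open>Compactness turns the existence times of the local flows into one time \<open>e\<close>
  valid everywhere. Uniqueness of integral curves makes the local flows agree and gives the group
  law for short times; iteration removes the restriction on time.\<close>

lemma flow_exists:
  assumes u: "vector_field u"
  obtains T where "smooth_family UNIV T" "T 0 = id" "\<And>s t. T (s + t) = T s \<circ> T t" "\<And>x. integral_curve u UNIV (\<lambda>t. T t x)"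
proof -
  define P where "P x0 z \<longleftrightarrow> (case z of (U, \<epsilon>, \<Theta>) \<Rightarrow> open U \<and> x0 \<in> U \<and> \<epsilon> > 0 \<and>
    (\<forall>x\<in>U. integral_curve u {-\<epsilon><..<\<epsilon>} (\<lambda>t. \<Theta> t x) \<and> \<Theta> 0 x = x) \<and>
    (\<forall>c\<in>A. smooth_into ({-\<epsilon><..<\<epsilon>} \<times> {y \<in> cimg c. cinv c y \<in> U}) (\<lambda>p. \<Theta> (fst p) (cinv c (snd p)))))"
    for x0 :: 'a and z :: "'a set \<times> real \<times> (real \<Rightarrow> 'a \<Rightarrow> 'a)"
  have "\<exists>z. P x0 z" for x0
  proof (rule local_flow[OF u, of x0], goal_cases)
    case (1 U \<epsilon> \<Theta>)
    then have "P x0 (U, \<epsilon>, \<Theta>)" unfolding P_def prod.case by blast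
    then show ?case by blast
  qed
  then obtain z where z: "\<And>x0. P x0 (z x0)" by metis
  define U where "U x0 = fst (z x0)" for x0
  define \<epsilon> where "\<epsilon> x0 = fst (snd (z x0))" for x0
  define \<Theta> where "\<Theta> x0 = snd (snd (z x0))" for x0
  have loc: "open (U x0)" "x0 \<in> U x0" "\<epsilon> x0 > 0"
    "x \<in> U x0 \<Longrightarrow> integral_curve u {-\<epsilon> x0<..<\<epsilon> x0} (\<lambda>t. \<Theta> x0 t x)" "x \<in> U x0 \<Longrightarrow> \<Theta> x0 0 x = x"
    "c \<in> A \<Longrightarrow> smooth_into ({-\<epsilon> x0<..<\<epsilon> x0} \<times> {y \<in> cimg c. cinv c y \<in> U x0}) (\<lambda>p. \<Theta> x0 (fst p) (cinv c (snd p)))"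
    for x x0 c
    using z[of x0] by (auto simp: P_def U_def \<epsilon>_def \<Theta>_def split: prod.splits)
  obtain C where C: "finite C" "UNIV \<subseteq> (\<Union>x0\<in>C. U x0)"
    by (rule compactE_image[OF compact, of UNIV U]) (use loc(1,2) in blast)+
  then have "C \<noteq> {}" by auto
  define e where "e = Min (\<epsilon> ` C)"
  have e: "e > 0" "\<And>x0. x0 \<in> C \<Longrightarrow> e \<le> \<epsilon> x0"
    using C(1) \<open>C \<noteq> {}\<close> loc(3) by (auto simp: e_def)
  \<comment> \<open>The choice of a covering set for each \<open>x\<close> is arbitrary and need not
    vary continuously. Smoothness of \<theta> survives because every covering set that contains
    \<open>x\<close> yields the same curve.\<close>
  define p where "p x = (SOME x0. x0 \<in> C \<and> x \<in> U x0)" for x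
  have p: "p x \<in> C" "x \<in> U (p x)" for x
    using someI_ex[of "\<lambda>x0. x0 \<in> C \<and> x \<in> U x0"] C(2) unfolding p_def by blast+
  define \<theta> where "\<theta> t x = \<Theta> (p x) t x" for t x
  have curve: "integral_curve u {-e<..<e} (\<lambda>t. \<Theta> x0 t x)" if "x0 \<in> C" "x \<in> U x0" for x0 x
    by (rule integral_curve_subset[OF loc(4)[OF that(2)]]) (use e(2)[OF that(1)] in auto)
  have curve\<theta>: "integral_curve u {-e<..<e} (\<lambda>t. \<theta> t x)" for x
    unfolding \<theta>_def by (rule curve[OF p])
  have \<theta>0: "\<theta> 0 x = x" for x unfolding \<theta>_def by (rule loc(5)[OF p(2)])
  have \<theta>: "\<theta> t x = \<Theta> x0 t x" if "x0 \<in> C" "x \<in> U x0" "t \<in> {-e<..<e}" for x0 x t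
    by (rule integral_curve_unique[OF u curve\<theta> curve[OF that(1,2)], of 0])
      (use e(1) that loc(5)[OF that(2)] \<theta>0 in auto)
  have sm: "smooth_family {-e<..<e} \<theta>"
    unfolding smooth_family_def
  proof
    fix c assume c: "c \<in> A"
    show "smooth_into ({-e<..<e} \<times> cimg c) (\<lambda>p. \<theta> (fst p) (cinv c (snd p)))"
    proof (rule smooth_into_local)
      show "thick ({-e<..<e} \<times> cimg c)" using open_cimg[OF c] by (intro thick_open open_Times) auto
      fix q assume q: "q \<in> {-e<..<e} \<times> cimg c"
      obtain x0 where x0: "x0 \<in> C" "cinv c (snd q) \<in> U x0" using C(2) by blast
      define W where "W = {y \<in> cimg c. cinv c y \<in> U x0}"
      have W: "open W" unfolding W_def by (rule open_transition_dom[OF c loc(1)])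
      have int: "({-e<..<e} \<times> cimg c) \<inter> (UNIV \<times> W) = {-e<..<e} \<times> W" by (auto simp: W_def)
      have "smooth_into ({-e<..<e} \<times> W) (\<lambda>p. \<Theta> x0 (fst p) (cinv c (snd p)))"
        unfolding W_def by (rule smooth_into_subset[OF loc(6)[OF c]]) (use e(2)[OF x0(1)] in auto)
      then have "smooth_into ({-e<..<e} \<times> W) (\<lambda>p. \<theta> (fst p) (cinv c (snd p)))"
        by (rule smooth_into_cong) (auto simp: W_def \<theta>[OF x0(1)])
      then have "smooth_into (({-e<..<e} \<times> cimg c) \<inter> (UNIV \<times> W)) (\<lambda>p. \<theta> (fst p) (cinv c (snd p)))"
        by (simp only: int)
      moreover have "q \<in> UNIV \<times> W" using q x0 by (auto simp: W_def mem_Times_iff)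
      ultimately show "\<exists>O'. open O' \<and> q \<in> O' \<and> smooth_into (({-e<..<e} \<times> cimg c) \<inter> O') (\<lambda>p. \<theta> (fst p) (cinv c (snd p)))"
        using open_Times[OF open_UNIV W] by blast
    qed
  qed
  have grp: "\<theta> (a + b) = \<theta> a \<circ> \<theta> b" if "\<bar>a\<bar> < e" "\<bar>b\<bar> < e" "\<bar>a + b\<bar> < e" for a b
  proof
    fix x
    \<comment> \<open>The times s for which s and s + b are both admissible; 0 and \<open>a\<close>
      are among them.\<close>
    define I where "I = {max (-e) (-e - b)<..<min e (e - b)}"
    have "\<theta> (a + b) x = \<theta> a (\<theta> b x)"
    proof (rule integral_curve_unique[OF u, of I "\<lambda>s. \<theta> (s + b) x" "\<lambda>s. \<theta> s (\<theta> b x)" 0 a])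
      show "integral_curve u I (\<lambda>s. \<theta> (s + b) x)"
        by (rule integral_curve_shift[OF curve\<theta>[of x]]) (auto simp: I_def)
      show "integral_curve u I (\<lambda>s. \<theta> s (\<theta> b x))"
        by (rule integral_curve_subset[OF curve\<theta>]) (auto simp: I_def)
    qed (use that \<theta>0 in \<open>auto simp: I_def\<close>)
    then show "\<theta> (a + b) x = (\<theta> a \<circ> \<theta> b) x" by simp
  qed
  have z: "\<theta> 0 = id" using \<theta>0 by auto
  obtain T where T: "\<And>t. \<bar>t\<bar> < e \<Longrightarrow> T t = \<theta> t" "\<And>s t. T (s + t) = T s \<circ> T t"
    "\<And>t. \<exists>s n. \<bar>s\<bar> < e \<and> T t = \<theta> s ^^ n"
    using local_one_parameter_group_extends[OF e(1) z grp] by blast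
  have near: "T t x = \<theta> (t - t0) (T t0 x)" if "\<bar>t - t0\<bar> < e" for t t0 x
    using T(2)[of "t - t0" t0] T(1)[OF that] by simp
  have pow: "smooth_into S (\<lambda>p. (\<theta> s ^^ n) (g p))" if "\<bar>s\<bar> < e" "thick S" "smooth_into S g" for s n g and S :: "(real \<times> 'b) set"
  proof (induction n)
    case (Suc n)
    have s: "s \<in> {-e<..<e}" using that(1) by auto
    show ?case using smooth_family_comp[OF that(2) sm _ _ Suc, of "\<lambda>_. s"] s by (auto simp: image_subset_iff)
  qed (use that in simp)
  show thesis
  proof (rule that[of T])
    show "T 0 = id" using T(1)[of 0] e z by simp
    show "T (s + t) = T s \<circ> T t" for s t by (rule T(2))
    show "integral_curve u UNIV (\<lambda>t. T t x)" for x
      unfolding integral_curve_def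
    proof (intro conjI ballI impI)
      have loc: "integral_curve u {t0 - e<..<t0 + e} (\<lambda>t. \<theta> (t - t0) (T t0 x))" for t0
        using integral_curve_shift[OF curve\<theta>[of "T t0 x"], of "{t0 - e<..<t0 + e}" "- t0"] by auto
      have c: "isCont (\<lambda>t. T t x) t0" for t0
      proof -
        have "continuous_on {t0 - e<..<t0 + e} (\<lambda>t. T t x)"
        proof (rule continuous_on_eq)
          show "continuous_on {t0 - e<..<t0 + e} (\<lambda>t. \<theta> (t - t0) (T t0 x))"
            using loc[of t0] by (simp add: integral_curve_def)
          show "\<theta> (t - t0) (T t0 x) = T t x" if "t \<in> {t0 - e<..<t0 + e}" for t
            by (rule near[symmetric]) (use that in auto)
        qed
        then show ?thesis using e by (simp add: continuous_on_eq_continuous_at)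
      qed
      then show "continuous_on UNIV (\<lambda>t. T t x)" by (simp add: continuous_at_imp_continuous_on)
      fix t0 c assume c: "c \<in> A" "T t0 x \<in> cdom c"
      have t0: "t0 \<in> {t0 - e<..<t0 + e}" using e by simp
      have "((\<lambda>t. cmap c (\<theta> (t - t0) (T t0 x))) has_vector_derivative u c (cmap c (T t0 x))) (at t0)"
      proof -
        have h: "\<theta> (t0 - t0) (T t0 x) = T t0 x" by (simp add: \<theta>0)
        have "\<forall>c\<in>A. \<theta> (t0 - t0) (T t0 x) \<in> cdom c \<longrightarrow>
            ((\<lambda>t. cmap c (\<theta> (t - t0) (T t0 x))) has_vector_derivative u c (cmap c (\<theta> (t0 - t0) (T t0 x)))) (at t0)"
          using loc[of t0] t0 unfolding integral_curve_def by blast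
        then show ?thesis using c unfolding h by blast
      qed
      then show "((\<lambda>t. cmap c (T t x)) has_vector_derivative u c (cmap c (T t0 x))) (at t0)"
      proof (rule has_vector_derivative_transform_within_open[OF _ open_greaterThanLessThan t0])
        show "cmap c (\<theta> (t - t0) (T t0 x)) = cmap c (T t x)" if "t \<in> {t0 - e<..<t0 + e}" for t
          by (rule arg_cong[OF near[symmetric]]) (use that in auto)
      qed
    qed
    show "smooth_family UNIV T"
      unfolding smooth_family_def
    proof
      fix c assume c: "c \<in> A"
      show "smooth_into (UNIV \<times> cimg c) (\<lambda>p. T (fst p) (cinv c (snd p)))"
      proof (rule smooth_into_local)
        show "thick (UNIV \<times> cimg c)" using open_cimg[OF c] by (intro thick_open open_Times) auto
        fix q :: "real \<times> 'b" assume "q \<in> UNIV \<times> cimg c"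
        define t0 where "t0 = fst q"
        define S where "S = {t0 - e<..<t0 + e} \<times> cimg c"
        have S: "thick S" unfolding S_def using open_cimg[OF c] by (intro thick_open open_Times) auto
        \<comment> \<open>Near \<open>t0\<close> the flow is \<theta>(t - t0) after
          \<open>T t0\<close>, and \<open>T t0\<close> is an iterate of one smooth map.\<close>
        obtain s n where sn: "\<bar>s\<bar> < e" "T t0 = \<theta> s ^^ n" using T(3) by blast
        have "smooth_into S (\<lambda>p. T t0 (cinv c (snd p)))"
          unfolding sn(2) by (intro pow sn(1) S smooth_into_cinv_comp[OF c] smooth_intros) (auto simp: S_def)
        then have "smooth_into S (\<lambda>p. \<theta> (fst p - t0) (T t0 (cinv c (snd p))))"
          by (rule smooth_family_comp[OF S sm, of "\<lambda>p. fst p - t0", rotated 2]) (auto simp: S_def intro!: smooth_intros)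
        then have "smooth_into S (\<lambda>p. T (fst p) (cinv c (snd p)))"
        proof (rule smooth_into_cong)
          show "\<theta> (fst p - t0) (T t0 (cinv c (snd p))) = T (fst p) (cinv c (snd p))" if "p \<in> S" for p
            by (rule near[symmetric]) (use that in \<open>auto simp: S_def\<close>)
        qed
        moreover have "(UNIV \<times> cimg c) \<inter> ({t0 - e<..<t0 + e} \<times> UNIV) = S" by (auto simp: S_def)
        moreover have "q \<in> {t0 - e<..<t0 + e} \<times> UNIV" using e by (cases q) (auto simp: t0_def)
        moreover have "open ({t0 - e<..<t0 + e} \<times> (UNIV :: 'b set))" by (intro open_Times) auto
        ultimately show "\<exists>O'. open O' \<and> q \<in> O' \<and> smooth_into ((UNIV \<times> cimg c) \<inter> O') (\<lambda>p. T (fst p) (cinv c (snd p)))"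
          by metis
      qed
    qed
  qed
qed

end

section \<open>Differential forms and the Lie derivative\<close>

text \<open>Translating the argument by t \<xi> turns the derivative in direction \<xi> into a time
  derivative, and \<open>mixed_partials\<close> exchanges it with the one in direction
  \<eta>.\<close>

lemma smooth_second_derivative_symmetric:
  fixes f :: "'a::euclidean_space \<Rightarrow> 'b::euclidean_space"
  assumes U: "open U" and f: "smooth_on U f" and y: "y \<in> U"
  shows "frechet_derivative (\<lambda>z. frechet_derivative f (at z) \<eta>) (at y) \<xi> = frechet_derivative (\<lambda>z. frechet_derivative f (at z) \<xi>) (at y) \<eta>"
proof -
  let ?D = "\<lambda>z. frechet_derivative f (at z)"
  note d1 = smooth_on_open_derivative(1)[OF U f] and s1 = smooth_on_open_derivative(2)[OF U f]
  note d2 = smooth_on_open_derivative(1)[OF U s1] and s2 = smooth_on_open_derivative(2)[OF U s1]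
  let ?S = "\<lambda>z \<xi>. frechet_derivative (\<lambda>z. ?D z \<xi>) (at z)"
  obtain r where r: "r > 0" "ball y r \<subseteq> U" using U y open_contains_ball by blast
  \<comment> \<open>Translations by t \<xi> with |t| \<le> \<delta> move points by at most r / 2;
    the added 1 covers \<xi> = 0.\<close>
  define \<delta> where "\<delta> = r / (2 * (norm \<xi> + 1))"
  have den: "0 < norm \<xi> + 1" by (rule add_nonneg_pos) auto
  have \<delta>: "\<delta> > 0" using r den by (simp add: \<delta>_def)
  have \<delta>\<xi>: "\<delta> * norm \<xi> \<le> r / 2"
  proof -
    have "r * norm \<xi> \<le> r * (norm \<xi> + 1)" using r by (intro mult_left_mono) auto
    then show ?thesis using den by (simp add: \<delta>_def field_simps)
  qed
  have inU: "z + t *\<^sub>R \<xi> \<in> U" if "t \<in> {-\<delta>..\<delta>}" "z \<in> ball y (r / 2)" for t z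
  proof -
    have "\<bar>t\<bar> \<le> \<delta>" using that(1) by auto
    then have "norm (t *\<^sub>R \<xi>) \<le> \<delta> * norm \<xi>" by (simp add: mult_right_mono)
    then have "dist y (z + t *\<^sub>R \<xi>) < r"
      using that(2) \<delta>\<xi> norm_triangle_ineq4[of "y - z" "t *\<^sub>R \<xi>"] by (simp add: dist_norm algebra_simps)
    then show ?thesis using r by auto
  qed
  have "((\<lambda>s. ?D (y + s *\<^sub>R \<xi>) \<eta>) has_vector_derivative ?S (y + 0 *\<^sub>R \<xi>) \<xi> \<eta>) (at 0 within {-\<delta>..\<delta>})"
  proof (rule mixed_partials[where f="\<lambda>t z. f (z + t *\<^sub>R \<xi>)" and h="\<lambda>t z. ?D (z + t *\<^sub>R \<xi>) \<xi>" and g="\<lambda>t z. ?D (z + t *\<^sub>R \<xi>)"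
        and h'="\<lambda>t z. ?S (z + t *\<^sub>R \<xi>) \<xi>" and U="ball y (r/2)"])
    fix t z assume tz: "t \<in> {-\<delta>..\<delta>}" "z \<in> ball y (r / 2)"
    have v: "((\<lambda>s. z + s *\<^sub>R \<xi>) has_vector_derivative \<xi>) (at t within {-\<delta>..\<delta>})"
      unfolding has_vector_derivative_def by (auto intro!: derivative_eq_intros)
    show "((\<lambda>s. f (z + s *\<^sub>R \<xi>)) has_vector_derivative ?D (z + t *\<^sub>R \<xi>) \<xi>) (at t within {-\<delta>..\<delta>})"
      using vector_derivative_diff_chain_within[OF v has_derivative_at_withinI[OF d1[OF inU[OF tz]]]] by (simp add: o_def)
    have tr: "((\<lambda>z. z + t *\<^sub>R \<xi>) has_derivative (\<lambda>h. h)) (at z)" by (auto intro!: derivative_eq_intros)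
    show "((\<lambda>z. f (z + t *\<^sub>R \<xi>)) has_derivative ?D (z + t *\<^sub>R \<xi>)) (at z)"
      using diff_chain_at[OF tr d1[OF inU[OF tz]]] by (simp add: o_def)
    show "((\<lambda>z. ?D (z + t *\<^sub>R \<xi>) \<xi>) has_derivative ?S (z + t *\<^sub>R \<xi>) \<xi>) (at z)"
      using diff_chain_at[OF tr d2[OF inU[OF tz]]] by (simp add: o_def)
  next
    fix z assume "z \<in> ball y (r / 2)"
    then show "continuous_on {-\<delta>..\<delta>} (\<lambda>t. ?D (z + t *\<^sub>R \<xi>) \<xi>)"
      using inU by (intro continuous_on_compose2[OF smooth_on_imp_continuous[OF s1]] continuous_intros) auto
  next
    fix v
    show "continuous_on ({-\<delta>..\<delta>} \<times> ball y (r / 2)) (\<lambda>p. ?S (snd p + fst p *\<^sub>R \<xi>) \<xi> v)"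
      using inU by (intro continuous_on_compose2[OF smooth_on_imp_continuous[OF s2]] continuous_intros) auto
  qed (use \<delta> r in auto)
  moreover have "((\<lambda>s. ?D (y + s *\<^sub>R \<xi>) \<eta>) has_vector_derivative ?S y \<eta> \<xi>) (at 0 within {-\<delta>..\<delta>})"
  proof -
    have v: "((\<lambda>s. y + s *\<^sub>R \<xi>) has_vector_derivative \<xi>) (at 0 within {-\<delta>..\<delta>})"
      unfolding has_vector_derivative_def by (auto intro!: derivative_eq_intros)
    have "((\<lambda>z. ?D z \<eta>) has_derivative ?S y \<eta>) (at (y + 0 *\<^sub>R \<xi>))" using d2[OF y] by simp
    from vector_derivative_diff_chain_within[OF v has_derivative_at_withinI[OF this]] show ?thesis by (simp add: o_def)
  qed
  ultimately have "?S (y + 0 *\<^sub>R \<xi>) \<xi> \<eta> = ?S y \<eta> \<xi>"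
    using \<delta> by (intro vector_derivative_unique_within_closed_interval[of "-\<delta>" \<delta> 0]) auto
  then show ?thesis by simp
qed

context smooth_manifold
begin

lemma smooth_fun_chart: "smooth_fun A f \<Longrightarrow> c \<in> A \<Longrightarrow> smooth_on (cimg c) (\<lambda>y. f (cinv c y))"
  by (simp add: smooth_fun_def)

lemma ext_d0_has_derivative:
  assumes "smooth_fun A f" "c \<in> A" "y \<in> cimg c"
  shows "((\<lambda>y. f (cinv c y)) has_derivative ext_d0 f c y) (at y)"
  using smooth_on_open_derivative(1)[OF open_cimg[OF assms(2)] smooth_fun_chart[OF assms(1,2)] assms(3)]
  by (simp add: ext_d0_def[abs_def])

lemma transition_inverse:
  assumes cd: "c \<in> A" "d \<in> A" and y: "y \<in> rep_dom c d id"
  defines "z \<equiv> local_rep c d id y"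
  shows "z \<in> rep_dom d c id" "local_rep d c id z = y"
    "frechet_derivative (local_rep c d id) (at y) (frechet_derivative (local_rep d c id) (at z) v) = v"
    "frechet_derivative (local_rep d c id) (at z) (frechet_derivative (local_rep c d id) (at y) w) = w"
proof -
  show zr: "z \<in> rep_dom d c id" and zy: "local_rep d c id z = y"
    using y cd by (auto simp: z_def rep_dom_id local_rep_id cmap_in cinv_cmap cmap_cinv cinv_in)
  have 1: "frechet_derivative (local_rep d c id) (at (local_rep c d id y)) (frechet_derivative (local_rep c d id) (at y) w) = w"
    if cd: "c \<in> A" "d \<in> A" and y: "y \<in> rep_dom c d id" and z: "local_rep c d id y \<in> rep_dom d c id" for c d y w
  proof -
    have "(local_rep d c id \<circ> local_rep c d id has_derivative
        frechet_derivative (local_rep d c id) (at (local_rep c d id y)) \<circ> frechet_derivative (local_rep c d id) (at y)) (at y)"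
      by (intro diff_chain_at transition_derivative cd y z)
    moreover have "(local_rep d c id \<circ> local_rep c d id has_derivative id) (at y)"
      by (rule has_derivative_transform_within_open[OF has_derivative_id open_rep_dom_id[OF cd] y])
        (use cd in \<open>auto simp: rep_dom_id local_rep_id cinv_cmap cmap_cinv\<close>)
    ultimately show ?thesis by (metis comp_apply has_derivative_unique id_apply)
  qed
  show "frechet_derivative (local_rep d c id) (at z) (frechet_derivative (local_rep c d id) (at y) w) = w"
    unfolding z_def by (rule 1) (use cd y zr in \<open>auto simp: z_def\<close>)
  show "frechet_derivative (local_rep c d id) (at y) (frechet_derivative (local_rep d c id) (at z) v) = v"
    using 1[of d c z v] cd zr zy y by simp
qed

lemma closed_one_form_ext_d0:
  assumes f: "smooth_fun A f"
  shows "closed_one_form A (ext_d0 f)"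
  unfolding closed_one_form_def one_form_def
proof (intro conjI ballI allI)
  fix c y assume c: "c \<in> A" "y \<in> cimg c"
  show "linear (ext_d0 f c y)"
    using ext_d0_has_derivative[OF f c] has_derivative_bounded_linear bounded_linear.linear by blast
  fix \<xi> \<eta>
  show "ext_d1 (ext_d0 f) c y \<xi> \<eta> = 0"
    unfolding ext_d1_def ext_d0_def
    using smooth_second_derivative_symmetric[OF open_cimg[OF c(1)] smooth_fun_chart[OF f c(1)] c(2)] by simp
next
  fix c \<xi> assume c: "c \<in> A"
  show "smooth_on (cimg c) (\<lambda>y. ext_d0 f c y \<xi>)"
    unfolding ext_d0_def by (rule smooth_on_open_derivative(2)[OF open_cimg[OF c] smooth_fun_chart[OF f c]])
next
  fix c d y \<xi> assume cd: "c \<in> A" "d \<in> A" and y: "y \<in> rep_dom c d id"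
  have z: "local_rep c d id y \<in> cimg d" using y cd by (auto simp: rep_dom_id local_rep_id cmap_in)
  have "((\<lambda>z. f (cinv d z)) \<circ> local_rep c d id has_derivative
      ext_d0 f d (local_rep c d id y) \<circ> frechet_derivative (local_rep c d id) (at y)) (at y)"
    by (intro diff_chain_at transition_derivative cd y ext_d0_has_derivative f z)
  then have "((\<lambda>z. f (cinv c z)) has_derivative
      ext_d0 f d (local_rep c d id y) \<circ> frechet_derivative (local_rep c d id) (at y)) (at y)"
    by (rule has_derivative_transform_within_open[OF _ open_rep_dom_id[OF cd] y])
      (use cd in \<open>auto simp: rep_dom_id local_rep_id cinv_cmap\<close>)
  moreover have "y \<in> cimg c" using y by (simp add: rep_dom_id)
  ultimately have "ext_d0 f c y = ext_d0 f d (local_rep c d id y) \<circ> frechet_derivative (local_rep c d id) (at y)"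
    using ext_d0_has_derivative[OF f cd(1)] has_derivative_unique by blast
  then show "ext_d0 f c y \<xi> = ext_d0 f d (local_rep c d id y) (frechet_derivative (local_rep c d id) (at y) \<xi>)"
    by simp
qed

lemma closed_one_form_lincomb:
  assumes "closed_one_form A \<alpha>" "closed_one_form A \<beta>"
  shows "closed_one_form A (\<lambda>c y \<xi>. r * \<alpha> c y \<xi> + s * \<beta> c y \<xi>)"
  unfolding closed_one_form_def one_form_def
proof (intro conjI ballI allI)
  have a: "\<And>c y. c \<in> A \<Longrightarrow> y \<in> cimg c \<Longrightarrow> linear (\<alpha> c y)" "\<And>c \<xi>. c \<in> A \<Longrightarrow> smooth_on (cimg c) (\<lambda>y. \<alpha> c y \<xi>)"
    "\<And>c d y \<xi>. c \<in> A \<Longrightarrow> d \<in> A \<Longrightarrow> y \<in> rep_dom c d id \<Longrightarrow> \<alpha> c y \<xi> = \<alpha> d (local_rep c d id y) (frechet_derivative (local_rep c d id) (at y) \<xi>)"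
    "\<And>c y \<xi> \<eta>. c \<in> A \<Longrightarrow> y \<in> cimg c \<Longrightarrow> ext_d1 \<alpha> c y \<xi> \<eta> = 0"
    using assms(1) unfolding closed_one_form_def one_form_def by blast+
  have b: "\<And>c y. c \<in> A \<Longrightarrow> y \<in> cimg c \<Longrightarrow> linear (\<beta> c y)" "\<And>c \<xi>. c \<in> A \<Longrightarrow> smooth_on (cimg c) (\<lambda>y. \<beta> c y \<xi>)"
    "\<And>c d y \<xi>. c \<in> A \<Longrightarrow> d \<in> A \<Longrightarrow> y \<in> rep_dom c d id \<Longrightarrow> \<beta> c y \<xi> = \<beta> d (local_rep c d id y) (frechet_derivative (local_rep c d id) (at y) \<xi>)"
    "\<And>c y \<xi> \<eta>. c \<in> A \<Longrightarrow> y \<in> cimg c \<Longrightarrow> ext_d1 \<beta> c y \<xi> \<eta> = 0"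
    using assms(2) unfolding closed_one_form_def one_form_def by blast+
  fix c assume c: "c \<in> A"
  show "smooth_on (cimg c) (\<lambda>y. r * \<alpha> c y \<xi> + s * \<beta> c y \<xi>)" for \<xi>
    by (intro smooth_intros a(2) b(2) c)
  {
    fix y assume y: "y \<in> cimg c"
    show "linear (\<lambda>\<xi>. r * \<alpha> c y \<xi> + s * \<beta> c y \<xi>)"
      using a(1)[OF c y] b(1)[OF c y] by (auto intro!: linearI simp: linear_add linear_cmul algebra_simps)
    fix \<xi> \<eta>
    have fd: "frechet_derivative (\<lambda>z. r * \<alpha> c z \<eta> + s * \<beta> c z \<eta>) (at y) \<xi> =
        r * frechet_derivative (\<lambda>z. \<alpha> c z \<eta>) (at y) \<xi> + s * frechet_derivative (\<lambda>z. \<beta> c z \<eta>) (at y) \<xi>" for \<xi> \<eta>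
    proof -
      have "((\<lambda>z. r * \<alpha> c z \<eta> + s * \<beta> c z \<eta>) has_derivative
         (\<lambda>\<xi>. r * frechet_derivative (\<lambda>z. \<alpha> c z \<eta>) (at y) \<xi> + s * frechet_derivative (\<lambda>z. \<beta> c z \<eta>) (at y) \<xi>)) (at y)"
        by (intro has_derivative_add has_derivative_mult_right smooth_on_open_derivative(1)[OF open_cimg[OF c] _ y] a(2) b(2) c)
      from fun_cong[OF frechet_derivative_at[OF this], of \<xi>] show ?thesis by (rule sym)
    qed
    have "frechet_derivative (\<lambda>z. \<alpha> c z \<eta>) (at y) \<xi> = frechet_derivative (\<lambda>z. \<alpha> c z \<xi>) (at y) \<eta>"
      "frechet_derivative (\<lambda>z. \<beta> c z \<eta>) (at y) \<xi> = frechet_derivative (\<lambda>z. \<beta> c z \<xi>) (at y) \<eta>"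
      using a(4)[OF c y, of \<xi> \<eta>] b(4)[OF c y, of \<xi> \<eta>] unfolding ext_d1_def by simp_all
    then show "ext_d1 (\<lambda>c y \<xi>. r * \<alpha> c y \<xi> + s * \<beta> c y \<xi>) c y \<xi> \<eta> = 0"
      unfolding ext_d1_def fd by simp
  }
  fix d y \<xi> assume d: "d \<in> A" and y: "y \<in> rep_dom c d id"
  show "r * \<alpha> c y \<xi> + s * \<beta> c y \<xi> = r * \<alpha> d (local_rep c d id y) (frechet_derivative (local_rep c d id) (at y) \<xi>)
     + s * \<beta> d (local_rep c d id y) (frechet_derivative (local_rep c d id) (at y) \<xi>)"
    using a(3)[OF c d y] b(3)[OF c d y] by simp
qed

text \<open>\<open>form_apply\<close> evaluates in an unspecified chart; the transformation laws of
  form and field cancel.\<close>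

lemma form_apply_chart:
  assumes \<alpha>: "one_form A \<alpha>" and u: "vector_field u" and d: "d \<in> A" "x \<in> cdom d"
  shows "form_apply A \<alpha> u x = \<alpha> d (cmap d x) (u d (cmap d x))"
proof -
  define c where "c = (SOME c. c \<in> A \<and> x \<in> cdom c)"
  have c: "c \<in> A" "x \<in> cdom c" using someI[of "\<lambda>c. c \<in> A \<and> x \<in> cdom c" d] d unfolding c_def by auto
  define y where "y = cmap c x"
  have y: "y \<in> rep_dom c d id" "local_rep c d id y = cmap d x"
    using c d by (auto simp: y_def rep_dom_id local_rep_id cmap_in cinv_cmap)
  have "u d (local_rep c d id y) = frechet_derivative (local_rep c d id) (at y) (u c y)"
    using u c d y unfolding vector_field_def by blast
  moreover have "\<alpha> c y (u c y) = \<alpha> d (local_rep c d id y) (frechet_derivative (local_rep c d id) (at y) (u c y))"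
    using \<alpha> c d y unfolding one_form_def by blast
  ultimately show ?thesis unfolding form_apply_def Let_def c_def[symmetric] by (simp add: y_def[symmetric] y)
qed

lemma form_apply_smooth:
  assumes \<alpha>: "one_form A \<alpha>" and u: "vector_field u"
  shows "smooth_fun A (form_apply A \<alpha> u)"
  unfolding smooth_fun_def
proof
  fix c assume c: "c \<in> A"
  have l: "linear (\<alpha> c y)" if "y \<in> cimg c" for y using \<alpha> c that unfolding one_form_def by blast
  have s: "smooth_on (cimg c) (\<lambda>y. \<alpha> c y \<xi>)" "smooth_on (cimg c) (u c)" for \<xi>
    using \<alpha> u c unfolding one_form_def vector_field_def by blast+
  have "smooth_on (cimg c) (\<lambda>y. \<Sum>i\<in>Basis. (u c y \<bullet> i) * \<alpha> c y i)"
    by (intro smooth_on_sum smooth_on_mult smooth_on_inner smooth_on_const s)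
  then show "smooth_on (cimg c) (\<lambda>y. form_apply A \<alpha> u (cinv c y))"
  proof (rule smooth_on_cong)
    fix y assume y: "y \<in> cimg c"
    have "(\<Sum>i\<in>Basis. (u c y \<bullet> i) * \<alpha> c y i) = \<alpha> c y (\<Sum>i\<in>Basis. (u c y \<bullet> i) *\<^sub>R i)"
      using linear_sum[OF l[OF y], of "\<lambda>i. (u c y \<bullet> i) *\<^sub>R i" Basis] linear_cmul[OF l[OF y]] by simp
    also have "\<dots> = form_apply A \<alpha> u (cinv c y)"
      using form_apply_chart[OF \<alpha> u c, of "cinv c y"] y by (simp add: cinv_in[OF c] cmap_cinv[OF c] euclidean_representation)
    finally show "(\<Sum>i\<in>Basis. (u c y \<bullet> i) * \<alpha> c y i) = form_apply A \<alpha> u (cinv c y)" .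
  qed
qed

lemma smooth_fun_along_curve:
  assumes f: "smooth_fun A f" and u: "vector_field u" and g: "integral_curve u UNIV \<gamma>"
  shows "((\<lambda>t. f (\<gamma> t)) has_real_derivative form_apply A (ext_d0 f) u (\<gamma> t)) (at t)"
proof -
  obtain c where c: "c \<in> A" "\<gamma> t \<in> cdom c" by (rule chart_at)
  have d: "((\<lambda>s. cmap c (\<gamma> s)) has_vector_derivative u c (cmap c (\<gamma> t))) (at t)"
    using g c by (simp add: integral_curve_def)
  have "((\<lambda>y. f (cinv c y)) has_derivative ext_d0 f c (cmap c (\<gamma> t))) (at (cmap c (\<gamma> t)))"
    by (rule ext_d0_has_derivative[OF f c(1) cmap_in[OF c]])
  from vector_derivative_diff_chain_within[OF d has_derivative_at_withinI[OF this]]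
  have "((\<lambda>s. f (cinv c (cmap c (\<gamma> s)))) has_vector_derivative ext_d0 f c (cmap c (\<gamma> t)) (u c (cmap c (\<gamma> t)))) (at t)"
    by (simp add: o_def)
  moreover have "open (\<gamma> -` cdom c)"
    using g open_cdom[OF c(1)] continuous_on_open_vimage[OF open_UNIV, of \<gamma>] by (auto simp: integral_curve_def)
  moreover have "t \<in> \<gamma> -` cdom c" using c by simp
  moreover have "f (cinv c (cmap c (\<gamma> s))) = f (\<gamma> s)" if "s \<in> \<gamma> -` cdom c" for s
    using that by (simp add: cinv_cmap[OF c(1)])
  ultimately have "((\<lambda>s. f (\<gamma> s)) has_vector_derivative ext_d0 f c (cmap c (\<gamma> t)) (u c (cmap c (\<gamma> t)))) (at t)"
    by (rule has_vector_derivative_transform_within_open)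
  moreover have "one_form A (ext_d0 f)" using closed_one_form_ext_d0[OF f] by (simp add: closed_one_form_def)
  ultimately show ?thesis using form_apply_chart[OF _ u c] by (simp add: has_real_derivative_iff_has_vector_derivative)
qed

end

section \<open>The symplectic form and the duality between 1-forms and vector fields\<close>

locale closed_symplectic_manifold = closed_smooth_manifold A
  for A :: "('m::t2_space, 'e::euclidean_space) atlas" +
  fixes \<omega> :: "('m, 'e) form2"
  assumes symplectic: "symplectic_form A \<omega>"
begin

lemma omega:
  assumes "c \<in> A"
  shows omega_bilinear: "y \<in> cimg c \<Longrightarrow> bilinear (\<omega> c y)" and omega_alt: "y \<in> cimg c \<Longrightarrow> \<omega> c y \<xi> \<xi> = 0"
    and omega_smooth: "smooth_on (cimg c) (\<lambda>y. \<omega> c y \<xi> \<eta>)"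
    and omega_closed: "y \<in> cimg c \<Longrightarrow> ext_d2 \<omega> c y \<xi> \<eta> \<zeta> = 0"
    and omega_nondeg: "y \<in> cimg c \<Longrightarrow> (\<And>\<eta>. \<omega> c y \<xi> \<eta> = 0) \<Longrightarrow> \<xi> = 0"
    and omega_transform: "d \<in> A \<Longrightarrow> y \<in> rep_dom c d id \<Longrightarrow> \<omega> c y \<xi> \<eta> = \<omega> d (local_rep c d id y)
          (frechet_derivative (local_rep c d id) (at y) \<xi>) (frechet_derivative (local_rep c d id) (at y) \<eta>)"
  using symplectic assms unfolding symplectic_form_def two_form_def by blast+

lemma omega_linear:
  assumes "c \<in> A" "y \<in> cimg c"
  shows "linear (\<omega> c y \<xi>)" "linear (\<lambda>\<xi>. \<omega> c y \<xi> \<eta>)"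
  using omega_bilinear[OF assms] by (auto simp: bilinear_def)

lemma omega_anti: "c \<in> A \<Longrightarrow> y \<in> cimg c \<Longrightarrow> \<omega> c y \<xi> \<eta> = - \<omega> c y \<eta> \<xi>"
  using omega_alt[of c y "\<xi> + \<eta>"] omega_alt[of c y \<xi>] omega_alt[of c y \<eta>] omega_bilinear[of c y]
  by (simp add: bilinear_ladd bilinear_radd)

text \<open>Smoothness of \<open>\<omega>\<close> is given for constant arguments only; this
  expansion transfers it, and the product rule, to arguments that vary with the point.\<close>

lemma omega_expand:
  assumes "c \<in> A" "y \<in> cimg c"
  shows "\<omega> c y \<xi> \<eta> = (\<Sum>i\<in>Basis. \<Sum>j\<in>Basis. (\<xi> \<bullet> i) * (\<eta> \<bullet> j) * \<omega> c y i j)"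
proof -
  note l1 = omega_linear(1)[OF assms] and l2 = omega_linear(2)[OF assms]
  have 1: "\<omega> c y \<xi> \<eta> = (\<Sum>i\<in>Basis. (\<xi> \<bullet> i) * \<omega> c y i \<eta>)" for \<xi> \<eta>
    using linear_sum[OF l2, of "\<lambda>i. (\<xi> \<bullet> i) *\<^sub>R i" Basis \<eta>] by (simp add: linear_cmul[OF l2] euclidean_representation)
  have 2: "\<omega> c y \<xi> \<eta> = (\<Sum>j\<in>Basis. (\<eta> \<bullet> j) * \<omega> c y \<xi> j)" for \<xi> \<eta>
    using linear_sum[OF l1, of "\<xi>" "\<lambda>i. (\<eta> \<bullet> i) *\<^sub>R i" Basis] by (simp add: linear_cmul[OF l1] euclidean_representation)
  have "\<omega> c y \<xi> \<eta> = (\<Sum>i\<in>Basis. (\<xi> \<bullet> i) * (\<Sum>j\<in>Basis. (\<eta> \<bullet> j) * \<omega> c y i j))"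
    by (subst 1, subst 2) (rule refl)
  then show ?thesis by (simp add: sum_distrib_left mult.assoc)
qed

lemma smooth_on_omega:
  assumes c: "c \<in> A" and z: "smooth_on S z" "z ` S \<subseteq> cimg c" and ab: "smooth_on S a" "smooth_on S b"
  shows "smooth_on S (\<lambda>x. \<omega> c (z x) (a x) (b x))"
proof (rule smooth_on_cong)
  show "smooth_on S (\<lambda>x. \<Sum>i\<in>Basis. \<Sum>j\<in>Basis. (a x \<bullet> i) * (b x \<bullet> j) * \<omega> c (z x) i j)"
    by (intro smooth_on_sum smooth_on_mult smooth_on_inner smooth_on_const ab smooth_on_compose[OF omega_smooth[OF c] z])
  show "(\<Sum>i\<in>Basis. \<Sum>j\<in>Basis. (a x \<bullet> i) * (b x \<bullet> j) * \<omega> c (z x) i j) = \<omega> c (z x) (a x) (b x)" if "x \<in> S" for x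
    using omega_expand[OF c, of "z x" "a x" "b x"] z(2) that by auto
qed

abbreviation omega_deriv :: "('m, 'e) chart \<Rightarrow> 'e \<Rightarrow> 'e \<Rightarrow> 'e \<Rightarrow> 'e \<Rightarrow> real" where
  "omega_deriv c y v \<xi> \<eta> \<equiv> frechet_derivative (\<lambda>z. \<omega> c z \<xi> \<eta>) (at y) v"

lemma omega_has_derivative: "c \<in> A \<Longrightarrow> y \<in> cimg c \<Longrightarrow> ((\<lambda>z. \<omega> c z \<xi> \<eta>) has_derivative (\<lambda>v. omega_deriv c y v \<xi> \<eta>)) (at y)"
  using smooth_on_open_derivative(1)[OF open_cimg omega_smooth] by metis

lemma omega_deriv_expand:
  assumes c: "c \<in> A" and y: "y \<in> cimg c"
  shows "omega_deriv c y v \<xi> \<eta> = (\<Sum>i\<in>Basis. \<Sum>j\<in>Basis. (\<xi> \<bullet> i) * (\<eta> \<bullet> j) * omega_deriv c y v i j)"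
proof -
  have "((\<lambda>z. \<Sum>i\<in>Basis. \<Sum>j\<in>Basis. (\<xi> \<bullet> i) * (\<eta> \<bullet> j) * \<omega> c z i j) has_derivative
      (\<lambda>v. \<Sum>i\<in>Basis. \<Sum>j\<in>Basis. (\<xi> \<bullet> i) * (\<eta> \<bullet> j) * omega_deriv c y v i j)) (at y)"
    by (intro has_derivative_sum has_derivative_mult_right omega_has_derivative c y)
  then have "((\<lambda>z. \<omega> c z \<xi> \<eta>) has_derivative (\<lambda>v. \<Sum>i\<in>Basis. \<Sum>j\<in>Basis. (\<xi> \<bullet> i) * (\<eta> \<bullet> j) * omega_deriv c y v i j)) (at y)"
    by (rule has_derivative_transform_within_open[OF _ open_cimg[OF c] y]) (rule omega_expand[OF c, symmetric])
  from fun_cong[OF has_derivative_unique[OF omega_has_derivative[OF c y] this]] show ?thesis .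
qed

lemma omega_product_rule:
  fixes z a b :: "'p::euclidean_space \<Rightarrow> 'e"
  assumes c: "c \<in> A" and x: "x \<in> S" and zS: "z ` S \<subseteq> cimg c"
    and z: "(z has_derivative z') (at x within S)" and a: "(a has_derivative a') (at x within S)"
    and b: "(b has_derivative b') (at x within S)"
  shows "((\<lambda>x. \<omega> c (z x) (a x) (b x)) has_derivative
    (\<lambda>v. omega_deriv c (z x) (z' v) (a x) (b x) + \<omega> c (z x) (a' v) (b x) + \<omega> c (z x) (a x) (b' v))) (at x within S)"
proof -
  have zx: "z x \<in> cimg c" using x zS by auto
  have w: "((\<lambda>x. \<omega> c (z x) i j) has_derivative (\<lambda>v. omega_deriv c (z x) (z' v) i j)) (at x within S)" for i j
    using diff_chain_within[OF z has_derivative_at_withinI[OF omega_has_derivative[OF c zx]]] by (simp add: o_def)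
  have "((\<lambda>x. \<Sum>i\<in>Basis. \<Sum>j\<in>Basis. (a x \<bullet> i) * (b x \<bullet> j) * \<omega> c (z x) i j) has_derivative
     (\<lambda>v. \<Sum>i\<in>Basis. \<Sum>j\<in>Basis. ((a x \<bullet> i) * (b x \<bullet> j)) * omega_deriv c (z x) (z' v) i j +
        ((a x \<bullet> i) * (b' v \<bullet> j) + (a' v \<bullet> i) * (b x \<bullet> j)) * \<omega> c (z x) i j)) (at x within S)"
    by (intro has_derivative_sum has_derivative_mult has_derivative_inner_left a b w)
  moreover have "(\<Sum>i\<in>Basis. \<Sum>j\<in>Basis. ((a x \<bullet> i) * (b x \<bullet> j)) * omega_deriv c (z x) (z' v) i j +
        ((a x \<bullet> i) * (b' v \<bullet> j) + (a' v \<bullet> i) * (b x \<bullet> j)) * \<omega> c (z x) i j) =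
      omega_deriv c (z x) (z' v) (a x) (b x) + \<omega> c (z x) (a' v) (b x) + \<omega> c (z x) (a x) (b' v)" for v
    by (subst omega_deriv_expand[OF c zx, where v="z' v" and \<xi>="a x" and \<eta>="b x"], subst omega_expand[OF c zx, of "a' v" "b x"],
        subst omega_expand[OF c zx, of "a x" "b' v"]) (simp add: sum.distrib distrib_right add_ac)
  ultimately have "((\<lambda>x. \<Sum>i\<in>Basis. \<Sum>j\<in>Basis. (a x \<bullet> i) * (b x \<bullet> j) * \<omega> c (z x) i j) has_derivative
    (\<lambda>v. omega_deriv c (z x) (z' v) (a x) (b x) + \<omega> c (z x) (a' v) (b x) + \<omega> c (z x) (a x) (b' v))) (at x within S)"
    by simp
  then show ?thesis
    by (rule has_derivative_transform[OF x, rotated]) (use omega_expand[OF c] zS in blast)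
qed

text \<open>Cartan's formula for the closed form \<open>\<omega>\<close> in a chart: the left-hand side is the Lie derivative.\<close>

lemma Cartan_omega:
  assumes c: "c \<in> A" and y: "y \<in> cimg c" and w: "(w has_derivative w') (at y)"
    and wU: "open U" "y \<in> U" "U \<subseteq> cimg c"
  shows "omega_deriv c y (w y) p q + \<omega> c y (w' p) q + \<omega> c y p (w' q) = ext_d1 (\<lambda>c y \<xi>. \<omega> c y (w y) \<xi>) c y p q"
proof -
  have d: "((\<lambda>z. \<omega> c z (w z) r) has_derivative (\<lambda>v. omega_deriv c y v (w y) r + \<omega> c y (w' v) r + \<omega> c y (w y) 0)) (at y)" for r
  proof -
    have "((\<lambda>z. \<omega> c ((\<lambda>z. z) z) (w z) ((\<lambda>z. r) z)) has_derivative
       (\<lambda>v. omega_deriv c y v (w y) r + \<omega> c y (w' v) r + \<omega> c y (w y) 0)) (at y within U)"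
      using wU by (intro omega_product_rule[OF c] has_derivative_ident has_derivative_const has_derivative_at_withinI[OF w]) auto
    then show ?thesis using at_within_open[OF wU(2,1)] by simp
  qed
  have z: "\<omega> c y (w y) 0 = 0" by (rule linear_0[OF omega_linear(1)[OF c y]])
  have fd: "frechet_derivative (\<lambda>z. \<omega> c z (w z) r) (at y) v = omega_deriv c y v (w y) r + \<omega> c y (w' v) r" for v r
    using fun_cong[OF frechet_derivative_at[OF d[of r]], of v] z by simp
  have "omega_deriv c y (w y) p q - omega_deriv c y p (w y) q + omega_deriv c y q (w y) p = 0"
    using omega_closed[OF c y, of "w y" p q] by (simp add: ext_d2_def)
  moreover have "\<omega> c y p (w' q) = - \<omega> c y (w' q) p" by (rule omega_anti[OF c y])
  ultimately show ?thesis unfolding ext_d1_def fd by simp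
qed

text \<open>The inverse of v \<mapsto> i_v \<omega>. The field generating a path whose 1-form is
  \<alpha> is \<open>sharp \<alpha>\<close>, and sgrad F is the case \<alpha> = -dF.\<close>

definition sharp :: "('m, 'e) form1 \<Rightarrow> ('m, 'e) vfield" where
  "sharp \<alpha> c y = (THE v. \<forall>\<xi>. \<omega> c y v \<xi> = \<alpha> c y \<xi>)"

lemma sharp_unique:
  assumes c: "c \<in> A" and y: "y \<in> cimg c" and eq: "\<And>\<xi>. \<omega> c y v \<xi> = \<omega> c y w \<xi>"
  shows "v = w"
proof -
  have "\<omega> c y (v - w) \<xi> = 0" for \<xi> using eq[of \<xi>] linear_diff[OF omega_linear(2)[OF c y, of \<xi>]] by simp
  then have "v - w = 0" by (rule omega_nondeg[OF c y])
  then show ?thesis by simp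
qed

lemma omega_sharp:
  assumes c: "c \<in> A" and y: "y \<in> cimg c" and \<alpha>: "linear (\<alpha> c y)"
  shows "\<omega> c y (sharp \<alpha> c y) \<xi> = \<alpha> c y \<xi>"
proof -
  \<comment> \<open>\<open>B v\<close> lists the components of the functional
    \<open>\<omega> c y v\<close>. Nondegeneracy thereby becomes injectivity of an endomorphism of
    \<open>'e\<close>, which implies surjectivity.\<close>
  define B where "B v = (\<Sum>i\<in>Basis. \<omega> c y v i *\<^sub>R i)" for v
  have Bi: "B v \<bullet> i = \<omega> c y v i" if "i \<in> Basis" for v i
    using that by (simp add: B_def inner_sum_left inner_Basis if_distrib cong: if_cong)
  have lB: "linear B"
    using linear_add[OF omega_linear(2)[OF c y]] linear_cmul[OF omega_linear(2)[OF c y]]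
    by (intro linearI) (auto simp: B_def sum.distrib algebra_simps scaleR_sum_right)
  have exp: "l \<xi> = (\<Sum>i\<in>Basis. (\<xi> \<bullet> i) * l i)" if "linear l" for l :: "'e \<Rightarrow> real" and \<xi>
    using linear_sum[OF that, of "\<lambda>i. (\<xi> \<bullet> i) *\<^sub>R i" Basis] by (simp add: linear_cmul[OF that] euclidean_representation)
  have "inj B"
    unfolding linear_injective_0[OF lB]
  proof (intro allI impI)
    fix v assume "B v = 0"
    then have "\<omega> c y v i = 0" if "i \<in> Basis" for i using Bi[OF that, of v] by simp
    then have "\<omega> c y v \<xi> = 0" for \<xi> by (subst exp[OF omega_linear(1)[OF c y]]) simp
    then show "v = 0" by (rule omega_nondeg[OF c y])
  qed
  then have "surj B" using lB linear_injective_imp_surjective by blast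
  then obtain v where "B v = (\<Sum>i\<in>Basis. \<alpha> c y i *\<^sub>R i)" by (metis surjD)
  then have "\<omega> c y v i = \<alpha> c y i" if "i \<in> Basis" for i
    using Bi[OF that, of v] that by (simp add: inner_sum_left inner_Basis if_distrib cong: if_cong)
  then have v: "\<forall>\<xi>. \<omega> c y v \<xi> = \<alpha> c y \<xi>"
    by (intro allI, subst exp[OF omega_linear(1)[OF c y]], subst exp[OF \<alpha>]) simp
  have "\<exists>!v. \<forall>\<xi>. \<omega> c y v \<xi> = \<alpha> c y \<xi>"
  proof (rule ex1I)
    show "\<forall>\<xi>. \<omega> c y v \<xi> = \<alpha> c y \<xi>" by (rule v)
    fix w assume "\<forall>\<xi>. \<omega> c y w \<xi> = \<alpha> c y \<xi>"
    then show "w = v" by (intro sharp_unique[OF c y]) (simp add: v)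
  qed
  then have "\<forall>\<xi>. \<omega> c y (sharp \<alpha> c y) \<xi> = \<alpha> c y \<xi>"
    unfolding sharp_def by (rule theI')
  then show ?thesis by blast
qed

text \<open>In a chart the field solves a linear equation with smooth coefficients, so it is smooth
  by \<open>smooth_on_linear_solve\<close>; its transformation law follows from those of
  \<open>\<omega>\<close> and \<alpha> since nondegeneracy makes the solution unique.\<close>

lemma vector_field_sharp:
  assumes \<alpha>: "one_form A \<alpha>"
  shows "vector_field (sharp \<alpha>)"
proof -
  have a: "\<And>c y. c \<in> A \<Longrightarrow> y \<in> cimg c \<Longrightarrow> linear (\<alpha> c y)" "\<And>c \<xi>. c \<in> A \<Longrightarrow> smooth_on (cimg c) (\<lambda>y. \<alpha> c y \<xi>)"
    "\<And>c d y \<xi>. c \<in> A \<Longrightarrow> d \<in> A \<Longrightarrow> y \<in> rep_dom c d id \<Longrightarrow> \<alpha> c y \<xi> = \<alpha> d (local_rep c d id y) (frechet_derivative (local_rep c d id) (at y) \<xi>)"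
    using \<alpha> unfolding one_form_def by blast+
  show ?thesis
    unfolding vector_field_def
  proof (intro conjI ballI)
    fix c assume c: "c \<in> A"
    define B where "B y v = (\<Sum>i\<in>Basis. \<omega> c y v i *\<^sub>R i)" for y v
    have Bi: "B y v \<bullet> i = \<omega> c y v i" if "i \<in> Basis" for y v i
      using that by (simp add: B_def inner_sum_left inner_Basis if_distrib cong: if_cong)
    show "smooth_on (cimg c) (sharp \<alpha> c)"
    proof (rule smooth_on_linear_solve[of "cimg c" B])
      fix y assume y: "y \<in> cimg c"
      show "linear (B y)"
        using linear_add[OF omega_linear(2)[OF c y]] linear_cmul[OF omega_linear(2)[OF c y]]
        by (intro linearI) (auto simp: B_def sum.distrib algebra_simps scaleR_sum_right)
      show "v = 0" if "B y v = 0" for v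
      proof (rule omega_nondeg[OF c y])
        fix \<xi>
        have "\<omega> c y v i = 0" if "i \<in> Basis" for i using Bi[OF that, of y v] \<open>B y v = 0\<close> by simp
        then show "\<omega> c y v \<xi> = 0"
          using linear_sum[OF omega_linear(1)[OF c y, of v], of "\<lambda>i. (\<xi> \<bullet> i) *\<^sub>R i" Basis]
          by (simp add: linear_cmul[OF omega_linear(1)[OF c y]] euclidean_representation)
      qed
      show "B y (sharp \<alpha> c y) = (\<Sum>i\<in>Basis. \<alpha> c y i *\<^sub>R i)"
        by (simp add: B_def omega_sharp[where \<alpha>=\<alpha>, OF c y a(1)[OF c y]])
    next
      show "smooth_on (cimg c) (\<lambda>y. B y v)" for v unfolding B_def
        by (intro smooth_on_sum smooth_on_scaleR smooth_on_const omega_smooth c)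
      show "smooth_on (cimg c) (\<lambda>y. \<Sum>i\<in>Basis. \<alpha> c y i *\<^sub>R i)"
        by (intro smooth_on_sum smooth_on_scaleR smooth_on_const a(2) c)
    qed
  next
    fix c d y assume cd: "c \<in> A" "d \<in> A" and y: "y \<in> rep_dom c d id"
    let ?D = "frechet_derivative (local_rep c d id) (at y)"
    have yc: "y \<in> cimg c" using y by (simp add: rep_dom_id)
    have zd: "local_rep c d id y \<in> cimg d" using y cd by (auto simp: rep_dom_id local_rep_id cmap_in)
    show "sharp \<alpha> d (local_rep c d id y) = ?D (sharp \<alpha> c y)"
    proof (rule sharp_unique[OF cd(2) zd])
      fix \<xi>
      obtain \<eta> where \<eta>: "\<xi> = ?D \<eta>" using transition_inverse(3)[OF cd y] by metis
      have "\<omega> d (local_rep c d id y) (sharp \<alpha> d (local_rep c d id y)) (?D \<eta>) = \<alpha> d (local_rep c d id y) (?D \<eta>)"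
        by (rule omega_sharp[where \<alpha>=\<alpha>, OF cd(2) zd a(1)[OF cd(2) zd]])
      also have "\<dots> = \<alpha> c y \<eta>" using a(3)[OF cd y] by simp
      also have "\<dots> = \<omega> c y (sharp \<alpha> c y) \<eta>" by (rule omega_sharp[where \<alpha>=\<alpha>, OF cd(1) yc a(1)[OF cd(1) yc], symmetric])
      also have "\<dots> = \<omega> d (local_rep c d id y) (?D (sharp \<alpha> c y)) (?D \<eta>)" by (rule omega_transform[OF cd y])
      finally show "\<omega> d (local_rep c d id y) (sharp \<alpha> d (local_rep c d id y)) \<xi> = \<omega> d (local_rep c d id y) (?D (sharp \<alpha> c y)) \<xi>"
        by (simp add: \<eta>)
    qed
  qed
qed

lemma sgrad_eq_sharp: "sgrad \<omega> F = sharp (\<lambda>c y \<xi>. - ext_d0 F c y \<xi>)"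
  by (intro ext) (simp add: sgrad_def sharp_def)

end

section \<open>The Lie derivative of the symplectic form along a family of maps\<close>

lemma smooth_on_partial:
  fixes F :: "real \<times> 'a::euclidean_space \<Rightarrow> 'b::euclidean_space"
  assumes S: "thick S" and F: "smooth_on S F" and p: "(t, y) \<in> S"
  shows "\<And>U. open U \<Longrightarrow> y \<in> U \<Longrightarrow> {t} \<times> U \<subseteq> S \<Longrightarrow>
      ((\<lambda>z. F (t, z)) has_derivative (\<lambda>v. frechet_derivative F (at (t, y) within S) (0, v))) (at y)"
    and "\<And>I. t \<in> I \<Longrightarrow> I \<times> {y} \<subseteq> S \<Longrightarrow>
      ((\<lambda>s. F (s, y)) has_vector_derivative frechet_derivative F (at (t, y) within S) (1, 0)) (at t within I)"
proof -
  note d = smooth_on_derivative(1)[OF S F p]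
  fix U assume U: "open U" "y \<in> U" "{t} \<times> U \<subseteq> S"
  have "((\<lambda>z. F (t, z)) has_derivative (\<lambda>v. frechet_derivative F (at (t, y) within S) (0, v))) (at y within U)"
    using U by (intro has_derivative_in_compose[of "\<lambda>z. (t, z)" "\<lambda>v. (0, v)" y U F] has_derivative_Pair has_derivative_const
        has_derivative_ident has_derivative_subset[OF d]) auto
  then show "((\<lambda>z. F (t, z)) has_derivative (\<lambda>v. frechet_derivative F (at (t, y) within S) (0, v))) (at y)"
    by (simp add: at_within_open[OF U(2,1)])
next
  note d = smooth_on_derivative(1)[OF S F p]
  fix I assume I: "t \<in> I" "I \<times> {y} \<subseteq> S"
  have l: "linear (frechet_derivative F (at (t, y) within S))"
    using d has_derivative_bounded_linear bounded_linear.linear by blast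
  have "((\<lambda>s. F (s, y)) has_derivative (\<lambda>h. frechet_derivative F (at (t, y) within S) (h, 0))) (at t within I)"
    using I by (intro has_derivative_in_compose[of "\<lambda>s. (s, y)" "\<lambda>h. (h, 0)" t I F] has_derivative_Pair has_derivative_const
        has_derivative_ident has_derivative_subset[OF d]) auto
  moreover have "(\<lambda>h. frechet_derivative F (at (t, y) within S) (h, 0)) = (\<lambda>h. h *\<^sub>R frechet_derivative F (at (t, y) within S) (1, 0))"
  proof
    show "frechet_derivative F (at (t, y) within S) (h, 0) = h *\<^sub>R frechet_derivative F (at (t, y) within S) (1, 0)" for h
      using linear_cmul[OF l, of h "(1, 0)"] by simp
  qed
  ultimately show "((\<lambda>s. F (s, y)) has_vector_derivative frechet_derivative F (at (t, y) within S) (1, 0)) (at t within I)"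
    by (simp only: has_vector_derivative_def)
qed

context closed_symplectic_manifold
begin

text \<open>The time derivative of the pullback of \<open>\<omega>\<close> is the pullback of the
  exterior derivative of i_w \<omega>. Here \<open>w\<close> is the velocity at the one time
  \<open>t\<close>, so time-dependent fields are covered. It is used both ways: a closed i_w
  \<omega> makes the pullback constant, and a constant pullback makes i_w \<omega> closed.\<close>

lemma pullback_has_vector_derivative:
  fixes \<Phi> :: "real \<Rightarrow> 'e \<Rightarrow> 'e"
  assumes c: "c \<in> A" and ab: "a < b" and U: "open U" "y \<in> U" and t: "t \<in> {a..b}"
    and \<Phi>: "smooth_on ({a..b} \<times> U) (\<lambda>p. \<Phi> (fst p) (snd p))" "\<And>t z. t \<in> {a..b} \<Longrightarrow> z \<in> U \<Longrightarrow> \<Phi> t z \<in> cimg c"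
    and h: "\<And>z. z \<in> U \<Longrightarrow> ((\<lambda>s. \<Phi> s z) has_vector_derivative w (\<Phi> t z)) (at t within {a..b})"
    and w: "(w has_derivative w') (at (\<Phi> t y))"
  defines "D \<equiv> \<lambda>s. frechet_derivative (\<Phi> s) (at y)"
  shows "((\<lambda>s. \<omega> c (\<Phi> s y) (D s \<xi>) (D s \<eta>)) has_vector_derivative
    ext_d1 (\<lambda>c z \<xi>. \<omega> c z (w z) \<xi>) c (\<Phi> t y) (D t \<xi>) (D t \<eta>)) (at t within {a..b})"
proof -
  let ?S = "{a..b} \<times> U"
  define F where "F p = \<Phi> (fst p) (snd p)" for p
  have S: "thick ?S" by (intro thick_Times thick_Icc[OF ab] thick_open U)
  have F: "smooth_on ?S F" using \<Phi>(1) by (simp add: F_def[abs_def])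
  define G where "G p v = frechet_derivative F (at p within ?S) v" for p v
  have Gs: "smooth_on ?S (\<lambda>p. G p v)" for v unfolding G_def by (rule smooth_on_derivative(2)[OF S F])
  have Dy: "(\<Phi> s has_derivative (\<lambda>v. G (s, z) (0, v))) (at z)" if "s \<in> {a..b}" "z \<in> U" for s z
  proof -
    have "{s} \<times> U \<subseteq> ?S" using that by auto
    then show ?thesis using smooth_on_partial(1)[OF S F, of s z U] that U(1) by (simp add: F_def G_def)
  qed
  have Dt: "((\<lambda>s. \<Phi> s z) has_vector_derivative G (s, z) (1, 0)) (at s within {a..b})" if "s \<in> {a..b}" "z \<in> U" for s z
  proof -
    have "{a..b} \<times> {z} \<subseteq> ?S" using that by auto
    then show ?thesis using smooth_on_partial(2)[OF S F, of s z "{a..b}"] that by (simp add: F_def G_def)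
  qed
  \<comment> \<open>\<open>H\<close> is the velocity as a function of the starting point, equal to
    \<open>w\<close> composed with \<open>\<Phi> t\<close> at time \<open>t\<close>. Its spatial
    derivative \<open>K\<close> is, by exchange of derivatives, the time derivative of the spatial
    derivative of \<Phi>.\<close>
  define H where "H p = G p (1, 0)" for p
  have H: "smooth_on ?S H" unfolding H_def[abs_def] by (rule Gs)
  define K where "K p v = frechet_derivative H (at p within ?S) (0, v)" for p v
  have Ks: "smooth_on ?S (\<lambda>p. K p v)" for v unfolding K_def by (rule smooth_on_derivative(2)[OF S H])
  have Hy: "((\<lambda>z. H (s, z)) has_derivative K (s, z)) (at z)" if "s \<in> {a..b}" "z \<in> U" for s z
  proof -
    have "{s} \<times> U \<subseteq> ?S" using that by auto
    then show ?thesis using smooth_on_partial(1)[OF S H, of s z U] that U(1) by (simp add: K_def[abs_def])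
  qed
  have De: "D s = (\<lambda>v. G (s, y) (0, v))" if "s \<in> {a..b}" for s
    unfolding D_def using frechet_derivative_at[OF Dy[OF that U(2)]] by simp
  have mixed: "((\<lambda>s. G (s, y) (0, v)) has_vector_derivative K (t, y) v) (at t within {a..b})" for v
  proof (rule mixed_partials[OF ab U t Dt, where g="\<lambda>s z v. G (s, z) (0, v)" and h'="\<lambda>s z v. K (s, z) v"])
    show "continuous_on {a..b} (\<lambda>s. G (s, z) (1, 0))" if "z \<in> U" for z
      using continuous_on_Times_section[of "{a..b}" U "\<lambda>s z. G (s, z) (1, 0)" z] that smooth_on_imp_continuous[OF Gs] by simp
    show "continuous_on ({a..b} \<times> U) (\<lambda>p. K (fst p, snd p) v)" for v
      using smooth_on_imp_continuous[OF Ks] by simp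
  qed (use Dy Hy in \<open>auto simp: H_def\<close>)
  have hw: "H (t, z) = w (\<Phi> t z)" if "z \<in> U" for z
    unfolding H_def using Dt[OF t that] h[OF that] t ab by (intro vector_derivative_unique_within_closed_interval) auto
  have K: "K (t, y) v = w' (D t v)" for v
  proof -
    have "((\<lambda>z. w (\<Phi> t z)) has_derivative (\<lambda>v. w' (D t v))) (at y)"
      using diff_chain_at[OF Dy[OF t U(2)] w] by (simp add: o_def De[OF t])
    then have "((\<lambda>z. H (t, z)) has_derivative (\<lambda>v. w' (D t v))) (at y)"
      by (rule has_derivative_transform_within_open[OF _ U]) (simp add: hw)
    from fun_cong[OF has_derivative_unique[OF Hy[OF t U(2)] this]] show ?thesis .
  qed
  have mixed': "((\<lambda>s. D s v) has_vector_derivative w' (D t v)) (at t within {a..b})" for v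
    by (rule has_vector_derivative_transform[OF t _ mixed[of v, unfolded K]]) (simp add: De)
  have zc: "\<Phi> t y \<in> cimg c" by (rule \<Phi>(2)[OF t U(2)])
  note lin = linear_cmul[OF omega_linear(1)[OF c zc]] linear_cmul[OF omega_linear(2)[OF c zc]]
  have "((\<lambda>s. \<omega> c (\<Phi> s y) (D s \<xi>) (D s \<eta>)) has_derivative
    (\<lambda>r. omega_deriv c (\<Phi> t y) (r *\<^sub>R w (\<Phi> t y)) (D t \<xi>) (D t \<eta>) + \<omega> c (\<Phi> t y) (r *\<^sub>R w' (D t \<xi>)) (D t \<eta>)
      + \<omega> c (\<Phi> t y) (D t \<xi>) (r *\<^sub>R w' (D t \<eta>)))) (at t within {a..b})"
    using h[OF U(2)] mixed' \<Phi>(2) U(2)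
    by (intro omega_product_rule[OF c t]) (auto simp: has_vector_derivative_def)
  moreover have "omega_deriv c (\<Phi> t y) (r *\<^sub>R w (\<Phi> t y)) p q = r * omega_deriv c (\<Phi> t y) (w (\<Phi> t y)) p q" for r p q
    using linear_cmul[OF bounded_linear.linear[OF has_derivative_bounded_linear[OF omega_has_derivative[OF c zc]]]] by simp
  ultimately have "((\<lambda>s. \<omega> c (\<Phi> s y) (D s \<xi>) (D s \<eta>)) has_vector_derivative
    (omega_deriv c (\<Phi> t y) (w (\<Phi> t y)) (D t \<xi>) (D t \<eta>) + \<omega> c (\<Phi> t y) (w' (D t \<xi>)) (D t \<eta>)
      + \<omega> c (\<Phi> t y) (D t \<xi>) (w' (D t \<eta>)))) (at t within {a..b})"
    by (simp add: has_vector_derivative_def lin algebra_simps)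
  then show ?thesis
    unfolding Cartan_omega[OF c zc w open_cimg[OF c] zc order_refl] .
qed

definition pullback :: "('m \<Rightarrow> 'm) \<Rightarrow> ('m, 'e) chart \<Rightarrow> ('m, 'e) chart \<Rightarrow> 'e \<Rightarrow> 'e \<Rightarrow> 'e \<Rightarrow> real" where
  "pullback f c d y \<xi> \<eta> = \<omega> d (local_rep c d f y)
     (frechet_derivative (local_rep c d f) (at y) \<xi>) (frechet_derivative (local_rep c d f) (at y) \<eta>)"

lemma open_rep_dom: "continuous_on UNIV f \<Longrightarrow> c \<in> A \<Longrightarrow> d \<in> A \<Longrightarrow> open (rep_dom c d f)"
  unfolding rep_dom_def
  using open_transition_dom[of c "f -` cdom d"] continuous_on_open_vimage[OF open_UNIV, of f] open_cdom[of d] by auto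

lemma local_rep_has_derivative:
  assumes f: "smooth_map A f" and cd: "c \<in> A" "d \<in> A" and y: "y \<in> rep_dom c d f"
  shows "(local_rep c d f has_derivative frechet_derivative (local_rep c d f) (at y)) (at y)"
  using f cd y unfolding smooth_map_def
  by (intro smooth_on_open_derivative(1)[OF open_rep_dom]) auto

lemma pullback_chart_independent:
  assumes f: "smooth_map A f" and c: "c \<in> A" and d: "d \<in> A" "d' \<in> A" and y: "y \<in> rep_dom c d f" "y \<in> rep_dom c d' f"
  shows "pullback f c d y \<xi> \<eta> = pullback f c d' y \<xi> \<eta>"
proof -
  have fc: "continuous_on UNIV f" using f by (simp add: smooth_map_def)
  define z where "z = local_rep c d f y"
  have z: "z \<in> rep_dom d d' id" and zd': "local_rep d d' id z = local_rep c d' f y"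
    using y d by (auto simp: z_def rep_dom_id local_rep_id rep_dom_def local_rep_def cmap_in cinv_cmap)
  have "(local_rep d d' id \<circ> local_rep c d f has_derivative
     frechet_derivative (local_rep d d' id) (at z) \<circ> frechet_derivative (local_rep c d f) (at y)) (at y)"
    unfolding z_def
    by (intro diff_chain_at local_rep_has_derivative[OF f c d(1) y(1)] transition_derivative d z[unfolded z_def])
  then have "(local_rep c d' f has_derivative
     frechet_derivative (local_rep d d' id) (at z) \<circ> frechet_derivative (local_rep c d f) (at y)) (at y)"
    by (rule has_derivative_transform_within_open[OF _ open_rep_dom[OF fc c d(1)] y(1)])
      (use d in \<open>auto simp: rep_dom_def local_rep_def cinv_cmap\<close>)
  from fun_cong[OF frechet_derivative_at[OF this]] have "frechet_derivative (local_rep c d' f) (at y) v =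
      frechet_derivative (local_rep d d' id) (at z) (frechet_derivative (local_rep c d f) (at y) v)" for v
    by simp
  then show ?thesis
    unfolding pullback_def zd'[symmetric] z_def[symmetric] by (simp add: omega_transform[OF d z])
qed

lemma pullback_id:
  assumes c: "c \<in> A" and y: "y \<in> cimg c"
  shows "pullback id c c y \<xi> \<eta> = \<omega> c y \<xi> \<eta>"
proof -
  have "(local_rep c c id has_derivative (\<lambda>v. v)) (at y)"
    by (rule has_derivative_transform_within_open[OF has_derivative_ident open_cimg[OF c] y])
      (use c in \<open>auto simp: local_rep_id cmap_cinv\<close>)
  from fun_cong[OF frechet_derivative_at[OF this], symmetric]
  have "frechet_derivative (local_rep c c id) (at y) v = v" for v by simp
  then show ?thesis using y by (simp add: pullback_def) (simp add: local_rep_id cmap_cinv[OF c])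
qed

text \<open>The time derivative of the pulled back \<open>\<omega>\<close> is the pullback of
  d\<beta> = 0, so the pullback keeps its value at time 0, which is \<open>\<omega>\<close>.\<close>

lemma closed_form_flow_symplectic:
  assumes \<beta>: "closed_one_form A \<beta>" and T: "smooth_family UNIV T" "T 0 = id" "\<And>s t. T (s + t) = T s \<circ> T t"
    "\<And>x. integral_curve (sharp \<beta>) UNIV (\<lambda>t. T t x)"
  shows "symplectomorphism A \<omega> (T t)"
proof -
  have \<beta>1: "one_form A \<beta>" using \<beta> by (simp add: closed_one_form_def)
  have sm: "smooth_map A (T t)" for t by (rule smooth_map_of_family[OF T(1)]) simp
  have inv: "T t \<circ> T (- t) = id" "T (- t) \<circ> T t = id" for t
    using T(3)[of t "-t"] T(3)[of "-t" t] T(2) by auto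
  have "bij (T t)" using inv[of t] by (metis o_bij)
  have "inv (T t) = T (- t)" using inv[of t] by (simp add: inv_unique_comp)
  have diffeo: "diffeomorphism A (T t)" unfolding diffeomorphism_def
    using \<open>bij (T t)\<close> \<open>inv (T t) = T (- t)\<close> sm by simp
  have "pullback (T t) c d y \<xi> \<eta> = \<omega> c y \<xi> \<eta>" if cd: "c \<in> A" "d \<in> A" "y \<in> rep_dom c d (T t)" for c d y \<xi> \<eta>
  proof -
    have y: "y \<in> cimg c" using cd by (simp add: rep_dom_def)
    define x where "x = cinv c y"
    have dom: "y \<in> rep_dom c d (T s) \<longleftrightarrow> T s x \<in> cdom d" for s d using y by (simp add: rep_dom_def x_def)
    \<comment> \<open>No single target chart serves the whole orbit. A chart is chosen at every
      time, and \<open>pullback_chart_independent\<close> lets it be replaced by a fixed one near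
      each time when differentiating.\<close>
    define e where "e s = (SOME d. d \<in> A \<and> T s x \<in> cdom d)" for s
    have e: "e s \<in> A" "T s x \<in> cdom (e s)" for s
      using someI_ex[of "\<lambda>d. d \<in> A \<and> T s x \<in> cdom d"] chart_at[of "T s x"] unfolding e_def by blast+
    define q where "q s = pullback (T s) c (e s) y \<xi> \<eta>" for s
    have qe: "q s = pullback (T s) c d y \<xi> \<eta>" if "d \<in> A" "T s x \<in> cdom d" for s d
      unfolding q_def using that e by (intro pullback_chart_independent sm cd) (auto simp: dom)
    have "(q has_vector_derivative 0) (at t0)" for t0
    proof -
      define d where "d = e t0"
      have d: "d \<in> A" "T t0 x \<in> cdom d" using e by (auto simp: d_def)
      define W where "W = {p \<in> UNIV \<times> cimg c. T (fst p) (cinv c (snd p)) \<in> cdom d}"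
      have Tc: "continuous_on (UNIV \<times> cimg c) (\<lambda>p. T (fst p) (cinv c (snd p)))"
        using T(1) cd(1) smooth_into_continuous unfolding smooth_family_def by blast
      have "open W" unfolding W_def
        using openin_open_trans[OF smooth_into_preimage_openin[OF Tc open_cdom[OF d(1)]]] open_Times[OF open_UNIV open_cimg[OF cd(1)]] by auto
      moreover have "(t0, y) \<in> W" using d y by (simp add: W_def x_def)
      ultimately obtain I U where IU: "open I" "open U" "t0 \<in> I" "y \<in> U" "I \<times> U \<subseteq> W"
        unfolding open_prod_def by fast
      obtain \<delta> where \<delta>: "\<delta> > 0" "cball t0 \<delta> \<subseteq> I" using IU open_contains_cball by blast
      let ?I = "{t0 - \<delta>..t0 + \<delta>}"
      have sub: "?I \<times> U \<subseteq> W" using \<delta> IU(5) by (auto simp: cball_eq_atLeastAtMost)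
      define \<Phi> where "\<Phi> s = local_rep c d (T s)" for s
      have \<Phi>s: "smooth_on (?I \<times> U) (\<lambda>p. \<Phi> (fst p) (snd p))"
        unfolding \<Phi>_def by (rule smooth_on_subset[OF smooth_family_rep[OF T(1) cd(1) d(1)]])
          (use sub in \<open>auto simp: W_def rep_dom_def\<close>)
      have w: "(sharp \<beta> d has_derivative frechet_derivative (sharp \<beta> d) (at (\<Phi> t0 y))) (at (\<Phi> t0 y))"
        using vector_field_sharp[OF \<beta>1] d y
        by (intro smooth_on_open_derivative(1)[OF open_cimg[OF d(1)]]) (auto simp: vector_field_def \<Phi>_def local_rep_def cmap_in x_def)
      have "((\<lambda>s. \<omega> d (\<Phi> s y) (frechet_derivative (\<Phi> s) (at y) \<xi>) (frechet_derivative (\<Phi> s) (at y) \<eta>)) has_vector_derivative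
        ext_d1 (\<lambda>c z \<xi>. \<omega> c z (sharp \<beta> d z) \<xi>) d (\<Phi> t0 y) (frechet_derivative (\<Phi> t0) (at y) \<xi>) (frechet_derivative (\<Phi> t0) (at y) \<eta>)) (at t0 within ?I)"
      proof (rule pullback_has_vector_derivative[OF d(1) _ IU(2,4) _ \<Phi>s _ _ w])
        show "\<Phi> s z \<in> cimg d" if "s \<in> ?I" "z \<in> U" for s z
        proof -
          have "(s, z) \<in> W" using that sub by blast
          then show ?thesis using d by (simp add: W_def \<Phi>_def local_rep_def cmap_in)
        qed
        fix z assume z: "z \<in> U"
        then have "(t0, z) \<in> W" using IU by blast
        then have "T t0 (cinv c z) \<in> cdom d" by (simp add: W_def)
        then have "((\<lambda>s. cmap d (T s (cinv c z))) has_vector_derivative sharp \<beta> d (cmap d (T t0 (cinv c z)))) (at t0)"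
          using T(4)[of "cinv c z"] d(1) by (simp add: integral_curve_def)
        then show "((\<lambda>s. \<Phi> s z) has_vector_derivative sharp \<beta> d (\<Phi> t0 z)) (at t0 within ?I)"
          by (simp add: \<Phi>_def local_rep_def has_vector_derivative_at_within)
      qed (use \<delta> in auto)
      moreover have "ext_d1 (\<lambda>c z \<xi>. \<omega> c z (sharp \<beta> d z) \<xi>) d (\<Phi> t0 y) p q = 0" for p q
      proof -
        have z: "\<Phi> t0 y \<in> cimg d" using d y by (simp add: \<Phi>_def local_rep_def cmap_in x_def)
        have "frechet_derivative (\<lambda>z. \<omega> d z (sharp \<beta> d z) r) (at (\<Phi> t0 y)) = frechet_derivative (\<lambda>z. \<beta> d z r) (at (\<Phi> t0 y))" for r
        proof (rule sym, rule frechet_derivative_transform_within_open[OF _ open_cimg[OF d(1)] z])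
          fix z assume z: "z \<in> cimg d"
          have "linear (\<beta> d z)" using \<beta>1 d z unfolding one_form_def by blast
          then show "\<beta> d z r = \<omega> d z (sharp \<beta> d z) r" by (rule omega_sharp[OF d(1) z, symmetric])
        next
          have "smooth_on (cimg d) (\<lambda>z. \<beta> d z r)" using \<beta>1 d unfolding one_form_def by blast
          then show "(\<lambda>z. \<beta> d z r) differentiable at (\<Phi> t0 y)"
            using smooth_on_open_derivative(1)[OF open_cimg[OF d(1)] _ z] differentiableI by blast
        qed
        then have "ext_d1 (\<lambda>c z \<xi>. \<omega> c z (sharp \<beta> d z) \<xi>) d (\<Phi> t0 y) p q = ext_d1 \<beta> d (\<Phi> t0 y) p q"
          by (simp add: ext_d1_def)
        then show ?thesis using \<beta> d z by (simp add: closed_one_form_def)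
      qed
      ultimately have "((\<lambda>s. pullback (T s) c d y \<xi> \<eta>) has_vector_derivative 0) (at t0 within ?I)"
        by (simp add: pullback_def \<Phi>_def)
      then have "((\<lambda>s. pullback (T s) c d y \<xi> \<eta>) has_vector_derivative 0) (at t0)"
        using at_within_interior[of t0 ?I] \<delta> by simp
      moreover have "pullback (T s) c d y \<xi> \<eta> = q s" if "s \<in> {t0 - \<delta><..<t0 + \<delta>}" for s
      proof -
        have "(s, y) \<in> W" using that sub IU(4) by auto
        then show ?thesis using qe[OF d(1)] by (simp add: W_def x_def)
      qed
      ultimately show ?thesis
        using \<delta> by (intro has_vector_derivative_transform_within_open[of "\<lambda>s. pullback (T s) c d y \<xi> \<eta>" 0 t0 "{t0 - \<delta><..<t0 + \<delta>}" q]) auto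
    qed
    then have "(q has_real_derivative 0) (at s)" for s by (simp add: has_real_derivative_iff_has_vector_derivative)
    then have "q t = q 0" by (rule DERIV_isconst_all[rule_format])
    also have "q 0 = pullback (T 0) c c y \<xi> \<eta>" by (rule qe) (use cd y T(2) in \<open>auto simp: x_def cinv_in\<close>)
    also have "\<dots> = \<omega> c y \<xi> \<eta>" using pullback_id[OF cd(1) y] T(2) by simp
    finally show ?thesis using qe[OF cd(2), of t] cd(3) dom by simp
  qed
  then show ?thesis using diffeo unfolding symplectomorphism_def pullback_def by blast
qed

end

section \<open>Paths of symplectomorphisms\<close>

text \<open>A bootstrap: the derivative of \<open>g\<close> at a point is the inverse of the
  derivative of \<open>f\<close> at its image under \<open>g\<close>. By
  \<open>Ck_on_linear_solve\<close> it is C^k as soon as \<open>g\<close> is, so \<open>g\<close>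
  gains one order at each step, starting from continuity.\<close>

lemma smooth_on_inverse_map:
  fixes f g :: "'a::euclidean_space \<Rightarrow> 'a"
  assumes S: "thick S" and f: "smooth_on S f" and g: "continuous_on T g"
    and fg: "\<And>z. z \<in> T \<Longrightarrow> g z \<in> S \<and> f (g z) = z"
    and inj: "\<And>x v. x \<in> S \<Longrightarrow> frechet_derivative f (at x within S) v = 0 \<Longrightarrow> v = 0"
  shows "smooth_on T g"
proof -
  define B where "B x = frechet_derivative f (at (g x) within S)" for x
  have fd: "(f has_derivative B x) (at (g x) within S)" if "x \<in> T" for x
    unfolding B_def using fg[OF that] by (intro smooth_on_derivative(1)[OF S f]) auto
  have lin: "linear (B x)" if "x \<in> T" for x
    using fd[OF that] has_derivative_bounded_linear bounded_linear.linear by blast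
  have injB: "v = 0" if "x \<in> T" "B x v = 0" for x v
    using inj[of "g x" v] fg[OF that(1)] that(2) by (simp add: B_def)
  have sol: "bounded_linear (solve B x)" "B x (solve B x w) = w" "solve B x (B x w) = w" if "x \<in> T" for x w
    using that by (auto intro: solve[of T B] lin injB)
  have gd: "(g has_derivative solve B x) (at x within T)" if x: "x \<in> T" for x
  proof (rule has_derivative_inverse_within[OF fd[OF x] sol(1)[OF x] sol(3)[OF x] _ x fg])
    show "continuous (at x within T) g" using g x by (simp add: continuous_on_eq_continuous_within)
  qed
  have "Ck_on k T g" for k
  proof (induction k)
    case (Suc k)
    show ?case
    proof (rule Ck_on_SucI[OF gd])
      fix b
      have Bk: "Ck_on k T (\<lambda>x. B x v)" for v unfolding B_def
        by (rule Ck_on_compose[OF smooth_on_Ck[OF smooth_on_derivative(2)[OF S f]] Suc.IH]) (use fg in auto)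
      show "Ck_on k T (\<lambda>x. solve B x b)"
      proof (rule Ck_on_linear_solve[of T B k "\<lambda>x. b"])
        show "linear (B x)" if "x \<in> T" for x by (rule lin[OF that])
        show "v = 0" if "x \<in> T" "B x v = 0" for x v by (rule injB[OF that])
        show "B x (solve B x b) = b" if "x \<in> T" for x by (rule sol(2)[OF that])
      qed (rule Bk, rule Ck_on_const)
    qed
  qed (use g in simp)
  then show ?thesis by (simp add: smooth_on_def)
qed

section \<open>Inverse, velocity and flux form of a symplectic path\<close>

context closed_symplectic_manifold
begin

lemma symplecto_pullback:
  assumes "symplectomorphism A \<omega> f" "c \<in> A" "d \<in> A" "y \<in> rep_dom c d f"
  shows "\<omega> d (local_rep c d f y) (frechet_derivative (local_rep c d f) (at y) \<xi>) (frechet_derivative (local_rep c d f) (at y) \<eta>) = \<omega> c y \<xi> \<eta>"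
  using assms unfolding symplectomorphism_def by blast

lemma symplecto_smooth: "symplectomorphism A \<omega> f \<Longrightarrow> smooth_map A f"
  and symplecto_bij: "symplectomorphism A \<omega> f \<Longrightarrow> bij f"
  by (auto simp: symplectomorphism_def diffeomorphism_def)

text \<open>A linear map that preserves nondegenerate forms has trivial kernel, and source and
  target have equal dimension.\<close>

lemma symplecto_derivative:
  assumes f: "symplectomorphism A \<omega> f" and cd: "c \<in> A" "d \<in> A" and y: "y \<in> rep_dom c d f"
  shows "frechet_derivative (local_rep c d f) (at y) v = 0 \<Longrightarrow> v = 0"
    and "\<exists>v. frechet_derivative (local_rep c d f) (at y) v = w"
proof -
  let ?D = "frechet_derivative (local_rep c d f) (at y)"
  have yc: "y \<in> cimg c" using y by (simp add: rep_dom_def)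
  have zd: "local_rep c d f y \<in> cimg d" using y cd by (simp add: rep_dom_def local_rep_def cmap_in)
  have inj: "v = 0" if "?D v = 0" for v
  proof (rule omega_nondeg[OF cd(1) yc])
    fix \<eta> show "\<omega> c y v \<eta> = 0"
      using symplecto_pullback[OF f cd y, of v \<eta>] that linear_0[OF omega_linear(2)[OF cd(2) zd]] by simp
  qed
  then show "?D v = 0 \<Longrightarrow> v = 0" .
  have l: "linear ?D"
    using local_rep_has_derivative[OF symplecto_smooth[OF f] cd y] has_derivative_bounded_linear bounded_linear.linear by blast
  then have "inj ?D" using inj by (simp add: linear_injective_0)
  then have "surj ?D" using l linear_injective_imp_surjective by blast
  then show "\<exists>v. ?D v = w" by (metis surjD)
qed

text \<open>Smoothness of all local representatives in two charts, as in the definition, is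
  smoothness as a family; the composition results become available for paths.\<close>

lemma symplectic_path_family: "symplectic_path A \<omega> \<psi> \<longleftrightarrow> (\<forall>t\<in>{0..1}. symplectomorphism A \<omega> (\<psi> t)) \<and> smooth_family {0..1} \<psi>"
proof -
  have set_eq: "{(t, y). t \<in> {0..1} \<and> y \<in> rep_dom c d (\<psi> t)} = {p. fst p \<in> {0..1} \<and> snd p \<in> rep_dom c d (\<psi> (fst p))}" for c d
    by auto
  show ?thesis
    unfolding symplectic_path_def set_eq
    unfolding split_beta
    using smooth_familyI[of "{0..1}" \<psi>] smooth_family_continuous[of "{0..1}" \<psi>] smooth_family_rep[of "{0..1}" \<psi>] by blast
qed

context
  fixes \<psi> :: "real \<Rightarrow> 'm \<Rightarrow> 'm"
  assumes path: "symplectic_path A \<omega> \<psi>"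
begin

lemma path_symplecto: "t \<in> {0..1} \<Longrightarrow> symplectomorphism A \<omega> (\<psi> t)" and path_smooth: "smooth_family {0..1} \<psi>"
  using path by (auto simp: symplectic_path_family)

lemma path_inv:
  assumes "t \<in> {0..1}" shows "inv (\<psi> t) (\<psi> t x) = x" "\<psi> t (inv (\<psi> t) x) = x"
  using symplecto_bij[OF path_symplecto[OF assms]] by (simp_all add: bij_is_inj bij_is_surj surj_f_inv_f)

text \<open>Domain of the path in two charts as a set of pairs of time and coordinates. It is not
  open, since time ends at 0 and 1, but it is thick.\<close>

definition pdom where "pdom c d = {p. fst p \<in> {0..1} \<and> snd p \<in> rep_dom c d (\<psi> (fst p))}"

definition prep where "prep c d p = local_rep c d (\<psi> (fst p)) (snd p)"

lemma thick_pdom: "c \<in> A \<Longrightarrow> d \<in> A \<Longrightarrow> thick (pdom c d)"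
proof -
  assume cd: "c \<in> A" "d \<in> A"
  have "continuous_on ({0..1} \<times> cimg c) (\<lambda>p. \<psi> (fst p) (cinv c (snd p)))"
    using path_smooth cd smooth_into_continuous unfolding smooth_family_def by blast
  from smooth_into_preimage_openin[OF this open_cdom[OF cd(2)]]
  have "openin (top_of_set ({0..1} \<times> cimg c)) {p \<in> {0..1} \<times> cimg c. \<psi> (fst p) (cinv c (snd p)) \<in> cdom d}" .
  moreover have "{p \<in> {0..1} \<times> cimg c. \<psi> (fst p) (cinv c (snd p)) \<in> cdom d} = pdom c d"
    by (auto simp: pdom_def rep_dom_def)
  ultimately show ?thesis
    using thick_relopen[OF thick_Times[OF thick_Icc thick_open[OF open_cimg[OF cd(1)]]], of 0 1 "pdom c d"] by simp
qed

lemma smooth_prep: "c \<in> A \<Longrightarrow> d \<in> A \<Longrightarrow> smooth_on (pdom c d) (prep c d)"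
  using smooth_family_rep[OF path_smooth] unfolding pdom_def prep_def[abs_def] by simp

lemma prep_partial:
  assumes cd: "c \<in> A" "d \<in> A" and p: "(t, y) \<in> pdom c d"
  shows "frechet_derivative (prep c d) (at (t, y) within pdom c d) (0, v) = frechet_derivative (local_rep c d (\<psi> t)) (at y) v"
    and "((\<lambda>s. local_rep c d (\<psi> s) y) has_vector_derivative frechet_derivative (prep c d) (at (t, y) within pdom c d) (1, 0)) (at t within {0..1})"
proof -
  have t: "t \<in> {0..1}" and y: "y \<in> rep_dom c d (\<psi> t)" using p by (auto simp: pdom_def)
  have "open (rep_dom c d (\<psi> t))"
    using symplecto_smooth[OF path_symplecto[OF t]] cd by (intro open_rep_dom) (auto simp: smooth_map_def)
  moreover have "{t} \<times> rep_dom c d (\<psi> t) \<subseteq> pdom c d" using t by (auto simp: pdom_def)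
  ultimately have "((\<lambda>z. prep c d (t, z)) has_derivative (\<lambda>v. frechet_derivative (prep c d) (at (t, y) within pdom c d) (0, v))) (at y)"
    using y by (intro smooth_on_partial(1)[OF thick_pdom[OF cd] smooth_prep[OF cd] p])
  from fun_cong[OF frechet_derivative_at[OF this]]
  show "frechet_derivative (prep c d) (at (t, y) within pdom c d) (0, v) = frechet_derivative (local_rep c d (\<psi> t)) (at y) v"
    by (simp add: prep_def)
  define I where "I = {s \<in> {0..1}. \<psi> s (cinv c y) \<in> cdom d}"
  have yc: "y \<in> cimg c" using y by (simp add: rep_dom_def)
  have "continuous_on {0..1} (\<lambda>s. \<psi> s (cinv c y))"
    by (rule continuous_on_Times_section[OF smooth_family_continuous[OF path_smooth]]) simp
  then obtain V where V: "open V" "I = {0..1} \<inter> V"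
    using smooth_into_preimage_openin[OF _ open_cdom[OF cd(2)], of "{0..1}" "\<lambda>s. \<psi> s (cinv c y)"] unfolding I_def openin_open by blast
  have tI: "t \<in> I" using t y by (simp add: I_def rep_dom_def)
  have "((\<lambda>s. prep c d (s, y)) has_vector_derivative frechet_derivative (prep c d) (at (t, y) within pdom c d) (1, 0)) (at t within I)"
    using yc by (intro smooth_on_partial(2)[OF thick_pdom[OF cd] smooth_prep[OF cd] p tI]) (auto simp: I_def pdom_def rep_dom_def)
  moreover have "at t within I = at t within {0..1}" using V tI at_within_Int_open[of V t "{0..1}"] by auto
  ultimately show "((\<lambda>s. local_rep c d (\<psi> s) y) has_vector_derivative frechet_derivative (prep c d) (at (t, y) within pdom c d) (1, 0)) (at t within {0..1})"
    by (simp add: prep_def)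
qed

text \<open>The map (t, x) \<mapsto> (t, \<psi>_t x) treats all times at once. Compactness of [0,1]
  \<times> M makes its inverse continuous. In charts a kernel vector of its derivative has no time
  component, and its spatial part is killed by the derivative of a symplectomorphism, hence 0;
  \<open>smooth_on_inverse_map\<close> then applies up to the end points.\<close>

lemma path_inverse_smooth: "smooth_family {0..1} (\<lambda>t. inv (\<psi> t))"
proof (rule smooth_familyI)
  define f where "f p = (fst p, \<psi> (fst p) (snd p))" for p :: "real \<times> 'm"
  define g where "g p = (fst p, inv (\<psi> (fst p)) (snd p))" for p :: "real \<times> 'm"
  have "continuous_on (f ` ({0..1} \<times> UNIV)) g"
  proof (rule continuous_on_inv)
    show "compact ({0..1::real} \<times> (UNIV :: 'm set))" by (intro compact_Times compact) auto
    show "continuous_on ({0..1} \<times> UNIV) f" unfolding f_def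
      by (intro continuous_on_Pair continuous_on_fst continuous_on_id smooth_family_continuous[OF path_smooth])
    show "\<forall>x\<in>{0..1} \<times> UNIV. g (f x) = x" by (auto simp: f_def g_def path_inv)
  qed
  moreover have "f ` ({0..1} \<times> UNIV) = {0..1} \<times> UNIV"
  proof
    show "{0..1} \<times> UNIV \<subseteq> f ` ({0..1} \<times> UNIV)"
    proof
      fix p :: "real \<times> 'm" assume "p \<in> {0..1} \<times> UNIV"
      then have "p = f (g p)" "g p \<in> {0..1} \<times> UNIV" by (auto simp: f_def g_def path_inv)
      then show "p \<in> f ` ({0..1} \<times> UNIV)" by (rule image_eqI)
    qed
  qed (auto simp: f_def)
  ultimately have "continuous_on ({0..1} \<times> UNIV) g" by simp
  from continuous_on_snd[OF this] show cont: "continuous_on ({0..1} \<times> UNIV) (\<lambda>p. inv (\<psi> (fst p)) (snd p))"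
    by (simp add: g_def)
  fix c d assume cd: "c \<in> A" "d \<in> A"
  let ?T = "{p. fst p \<in> {0..1} \<and> snd p \<in> rep_dom c d (inv (\<psi> (fst p)))}"
  define h where "h p = (fst p, local_rep c d (inv (\<psi> (fst p))) (snd p))" for p
  define k where "k p = (fst p, prep d c p)" for p
  have k: "smooth_on (pdom d c) k" unfolding k_def[abs_def] using smooth_prep[OF cd(2,1)] by (intro smooth_intros)
  have "smooth_on ?T h"
  proof (rule smooth_on_inverse_map[OF thick_pdom[OF cd(2,1)] k])
    have "continuous_on ?T (\<lambda>p. (fst p, cinv c (snd p)))"
      by (intro continuous_on_Pair continuous_on_fst continuous_on_id continuous_on_compose2[OF continuous_on_cinv[OF cd(1)]] continuous_on_snd)
        (auto simp: rep_dom_def)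
    then have "continuous_on ?T (\<lambda>p. inv (\<psi> (fst p)) (cinv c (snd p)))"
      using continuous_on_compose2[OF cont, of ?T "\<lambda>p. (fst p, cinv c (snd p))"] by (simp add: image_subset_iff)
    then have "continuous_on ?T (\<lambda>p. cmap d (inv (\<psi> (fst p)) (cinv c (snd p))))"
      by (rule continuous_on_compose2[OF continuous_on_cmap[OF cd(2)]]) (auto simp: rep_dom_def)
    then show "continuous_on ?T h" unfolding h_def local_rep_def
      by (intro continuous_on_Pair continuous_on_fst continuous_on_id)
    fix p assume p: "p \<in> ?T"
    then show "h p \<in> pdom d c \<and> k (h p) = p"
    proof -
      obtain t z where tz: "p = (t, z)" by (cases p)
      define x where "x = inv (\<psi> t) (cinv c z)"
      have t: "t \<in> {0..1}" and z: "z \<in> cimg c" and x: "x \<in> cdom d"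
        using p by (auto simp: tz rep_dom_def x_def)
      have \<psi>x: "\<psi> t x = cinv c z" unfolding x_def by (rule path_inv(2)[OF t])
      have h: "h p = (t, cmap d x)" by (simp add: h_def tz local_rep_def x_def)
      show ?thesis
        unfolding h using t x z by (simp add: k_def pdom_def prep_def rep_dom_def local_rep_def cmap_in[OF cd(2)] cinv_cmap[OF cd(2)]
            \<psi>x cinv_in[OF cd(1)] cmap_cinv[OF cd(1)] tz)
    qed
  next
    fix p v assume p: "p \<in> pdom d c" and z: "frechet_derivative k (at p within pdom d c) v = 0"
    obtain t y where ty: "p = (t, y)" by (cases p)
    have "(k has_derivative (\<lambda>v. (fst v, frechet_derivative (prep d c) (at p within pdom d c) v))) (at p within pdom d c)"
      unfolding k_def[abs_def]
      by (intro has_derivative_Pair has_derivative_fst has_derivative_ident smooth_on_derivative(1)[OF thick_pdom smooth_prep] cd p)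
    then have eq: "frechet_derivative k (at p within pdom d c) = (\<lambda>v. (fst v, frechet_derivative (prep d c) (at p within pdom d c) v))"
      using thick_unique[OF thick_pdom[OF cd(2,1)] p smooth_on_derivative(1)[OF thick_pdom[OF cd(2,1)] k p]] by blast
    have z': "fst v = 0" "frechet_derivative (prep d c) (at p within pdom d c) v = 0"
      using z unfolding eq by (simp_all add: zero_prod_def)
    obtain w where v: "v = (0, w)" using z'(1) by (cases v) simp
    have "frechet_derivative (local_rep d c (\<psi> t)) (at y) w = 0"
      using prep_partial(1)[OF cd(2,1) p[unfolded ty], of w] z'(2) unfolding v ty by simp
    moreover have "t \<in> {0..1}" "y \<in> rep_dom d c (\<psi> t)" using p by (auto simp: ty pdom_def)
    ultimately have "w = 0"
      using symplecto_derivative(1)[OF path_symplecto cd(2,1)] by blast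
    then show "v = 0" using v by (simp add: zero_prod_def)
  qed
  from smooth_on_snd[OF this] show "smooth_on ?T (\<lambda>p. local_rep c d (inv (\<psi> (fst p))) (snd p))"
    by (simp add: h_def)
qed

text \<open>The velocity field belongs to the image point, whereas \<open>prep\<close> is
  parametrised by the starting point; evaluated at an image point the field is the time derivative
  of \<open>prep\<close>.\<close>

lemma path_velocity_prep:
  assumes bc: "b \<in> A" "c \<in> A" and p: "(t, y) \<in> pdom b c"
  shows "path_velocity \<psi> t c (local_rep b c (\<psi> t) y) = frechet_derivative (prep b c) (at (t, y) within pdom b c) (1, 0)"
    and "((\<lambda>s. local_rep b c (\<psi> s) y) has_vector_derivative path_velocity \<psi> t c (local_rep b c (\<psi> t) y)) (at t within {0..1})"
proof -
  have t: "t \<in> {0..1}" and y: "y \<in> cimg b" "\<psi> t (cinv b y) \<in> cdom c" using p by (auto simp: pdom_def rep_dom_def)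
  have "inv (\<psi> t) (cinv c (local_rep b c (\<psi> t) y)) = cinv b y"
    using y t by (simp add: local_rep_def cinv_cmap[OF bc(2)] path_inv)
  then have "path_velocity \<psi> t c (local_rep b c (\<psi> t) y) = vector_derivative (\<lambda>s. local_rep b c (\<psi> s) y) (at t within {0..1})"
    by (simp add: path_velocity_def local_rep_def)
  also have "\<dots> = frechet_derivative (prep b c) (at (t, y) within pdom b c) (1, 0)"
    using prep_partial(2)[OF bc p] vector_derivative_within_cbox[of 0 1 t] t by simp
  finally show "path_velocity \<psi> t c (local_rep b c (\<psi> t) y) = frechet_derivative (prep b c) (at (t, y) within pdom b c) (1, 0)" .
  then show "((\<lambda>s. local_rep b c (\<psi> s) y) has_vector_derivative path_velocity \<psi> t c (local_rep b c (\<psi> t) y)) (at t within {0..1})"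
    using prep_partial(2)[OF bc p] by simp
qed

lemma path_preimage:
  assumes t: "t \<in> {0..1}" and c: "c \<in> A" and z: "z \<in> cimg c"
  obtains b y where "b \<in> A" "(t, y) \<in> pdom b c" "local_rep b c (\<psi> t) y = z" "inv (\<psi> t) (cinv c z) \<in> cdom b" "y = cmap b (inv (\<psi> t) (cinv c z))"
proof -
  obtain b where b: "b \<in> A" "inv (\<psi> t) (cinv c z) \<in> cdom b" by (rule chart_at)
  then show thesis using t z c
    by (intro that[of b "cmap b (inv (\<psi> t) (cinv c z))"])
      (auto simp: pdom_def rep_dom_def local_rep_def cmap_in cinv_cmap path_inv cinv_in cmap_cinv)
qed

text \<open>The velocity at time t and point z is the time derivative of the path at the starting
  point \<psi>_t^-1 z, which depends smoothly on t and z by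
  \<open>path_inverse_smooth\<close>.\<close>

lemma smooth_path_velocity:
  assumes c: "c \<in> A"
  shows "smooth_on ({0..1} \<times> cimg c) (\<lambda>p. path_velocity \<psi> (fst p) c (snd p))"
proof (rule smooth_on_local)
  show "thick ({0..1::real} \<times> cimg c)" by (rule thick_Times[OF thick_Icc thick_open[OF open_cimg[OF c]]]) simp
  fix p :: "real \<times> 'e" assume p: "p \<in> {0..1} \<times> cimg c"
  obtain t0 z0 where tz: "p = (t0, z0)" by (cases p)
  obtain b where b: "b \<in> A" "inv (\<psi> t0) (cinv c z0) \<in> cdom b" by (rule chart_at)
  have sm: "smooth_into ({0..1} \<times> cimg c) (\<lambda>p. inv (\<psi> (fst p)) (cinv c (snd p)))"
    using path_inverse_smooth c by (simp add: smooth_family_def)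
  obtain V where V: "open V" "p \<in> V" "\<And>q. q \<in> ({0..1} \<times> cimg c) \<inter> V \<Longrightarrow> inv (\<psi> (fst q)) (cinv c (snd q)) \<in> cdom b"
    using smooth_into_preimage_open[OF smooth_into_continuous[OF sm] open_cdom[OF b(1)] p] b(2) tz by auto
  let ?S = "({0..1} \<times> cimg c) \<inter> V"
  define N where "N q = cmap b (inv (\<psi> (fst q)) (cinv c (snd q)))" for q
  have Ns: "smooth_on ?S N" unfolding N_def[abs_def] using V(3) by (intro smooth_into_chart[OF sm b(1)]) auto
  have mem: "(fst q, N q) \<in> pdom b c" and rep: "local_rep b c (\<psi> (fst q)) (N q) = snd q" if "q \<in> ?S" for q
    using V(3)[OF that] that b c
    by (auto simp: N_def pdom_def rep_dom_def local_rep_def cmap_in cinv_cmap path_inv cinv_in cmap_cinv)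
  have "smooth_on ?S (\<lambda>q. (fst q, N q))" by (intro smooth_intros Ns)
  then have "smooth_on ?S (\<lambda>q. frechet_derivative (prep b c) (at (fst q, N q) within pdom b c) (1, 0))"
    by (rule smooth_on_compose[OF smooth_on_derivative(2)[OF thick_pdom[OF b(1) c] smooth_prep[OF b(1) c]]]) (use mem in auto)
  then have "smooth_on ?S (\<lambda>p. path_velocity \<psi> (fst p) c (snd p))"
  proof (rule smooth_on_cong)
    fix q assume q: "q \<in> ?S"
    show "frechet_derivative (prep b c) (at (fst q, N q) within pdom b c) (1, 0) = path_velocity \<psi> (fst q) c (snd q)"
      using path_velocity_prep(1)[OF b(1) c mem[OF q]] unfolding rep[OF q] by simp
  qed
  then show "\<exists>U. open U \<and> p \<in> U \<and> smooth_on (({0..1} \<times> cimg c) \<inter> U) (\<lambda>p. path_velocity \<psi> (fst p) c (snd p))"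
    using V by blast
qed

text \<open>Both sides are the velocity of one curve s \<mapsto> \<psi>_s x at time t, seen in two
  charts.\<close>

lemma path_velocity_transform:
  assumes t: "t \<in> {0..1}" and cd: "c \<in> A" "d \<in> A" and z: "z \<in> rep_dom c d id"
  shows "path_velocity \<psi> t d (local_rep c d id z) = frechet_derivative (local_rep c d id) (at z) (path_velocity \<psi> t c z)"
proof -
  have zc: "z \<in> cimg c" "cinv c z \<in> cdom d" using z by (auto simp: rep_dom_id)
  obtain b y where b: "b \<in> A" "(t, y) \<in> pdom b c" "local_rep b c (\<psi> t) y = z" using path_preimage[OF t cd(1) zc(1)] by metis
  have y: "y \<in> cimg b" "\<psi> t (cinv b y) \<in> cdom c" using b(2) by (auto simp: pdom_def rep_dom_def)
  have cz: "cinv c z = \<psi> t (cinv b y)" using b(3) y by (auto simp: local_rep_def cinv_cmap[OF cd(1)])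
  have yd: "(t, y) \<in> pdom b d" using t y zc by (simp add: pdom_def rep_dom_def cz)
  have zd: "local_rep b d (\<psi> t) y = local_rep c d id z" by (simp add: local_rep_def cz)
  have v1: "((\<lambda>s. local_rep b c (\<psi> s) y) has_vector_derivative path_velocity \<psi> t c z) (at t within {0..1})"
    using path_velocity_prep(2)[OF b(1) cd(1) b(2)] b(3) by simp
  have v2: "((\<lambda>s. local_rep b d (\<psi> s) y) has_vector_derivative path_velocity \<psi> t d (local_rep c d id z)) (at t within {0..1})"
    using path_velocity_prep(2)[OF b(1) cd(2) yd] zd by simp
  have cs: "continuous_on {0..1} (\<lambda>s. \<psi> s (cinv b y))"
    by (rule continuous_on_Times_section[OF smooth_family_continuous[OF path_smooth]]) simp
  obtain V where V: "open V" "t \<in> V" "\<And>s. s \<in> {0..1} \<inter> V \<Longrightarrow> \<psi> s (cinv b y) \<in> cdom c"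
    by (rule smooth_into_preimage_open[OF cs open_cdom[OF cd(1)], of t]) (use t y(2) in auto)
  have "((\<lambda>s. local_rep c d id (local_rep b c (\<psi> s) y)) has_vector_derivative
      frechet_derivative (local_rep c d id) (at z) (path_velocity \<psi> t c z)) (at t within {0..1})"
    using vector_derivative_diff_chain_within[OF v1, of "local_rep c d id"] transition_derivative[OF cd z] b(3)
    by (simp add: o_def has_derivative_at_withinI)
  then have "((\<lambda>s. local_rep c d id (local_rep b c (\<psi> s) y)) has_vector_derivative
      frechet_derivative (local_rep c d id) (at z) (path_velocity \<psi> t c z)) (at t within {0..1} \<inter> V)"
    by (simp only: at_within_Int_open[OF V(1,2)])
  then have "((\<lambda>s. local_rep b d (\<psi> s) y) has_vector_derivative
      frechet_derivative (local_rep c d id) (at z) (path_velocity \<psi> t c z)) (at t within {0..1} \<inter> V)"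
    by (rule has_vector_derivative_transform[rotated 2]) (use V t in \<open>auto simp: local_rep_def cinv_cmap[OF cd(1)]\<close>)
  then have "((\<lambda>s. local_rep b d (\<psi> s) y) has_vector_derivative
      frechet_derivative (local_rep c d id) (at z) (path_velocity \<psi> t c z)) (at t within {0..1})"
    by (simp only: at_within_Int_open[OF V(1,2)])
  with v2 show ?thesis using t by (intro vector_derivative_unique_within_closed_interval[of 0 1 t]) auto
qed

text \<open>The pullback of \<open>\<omega>\<close> is constant along the path, so by
  \<open>pullback_has_vector_derivative\<close> the exterior derivative of i_v \<omega> vanishes on
  all images of the derivative of \<psi>_t, and these are all vectors.\<close>

lemma path_form_closed:
  assumes t: "t \<in> {0..1}" and c: "c \<in> A" and z: "z \<in> cimg c"
  shows "ext_d1 (interior_product (path_velocity \<psi> t) \<omega>) c z \<xi> \<eta> = 0"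
proof -
  obtain b y where b: "b \<in> A" "(t, y) \<in> pdom b c" "local_rep b c (\<psi> t) y = z" using path_preimage[OF t c z] by metis
  have y: "y \<in> cimg b" "\<psi> t (cinv b y) \<in> cdom c" using b(2) by (auto simp: pdom_def rep_dom_def)
  have cont: "continuous_on ({0..1} \<times> cimg b) (\<lambda>p. \<psi> (fst p) (cinv b (snd p)))"
    using path_smooth b smooth_into_continuous unfolding smooth_family_def by blast
  obtain V where V: "open V" "(t, y) \<in> V" "\<And>q. q \<in> ({0..1} \<times> cimg b) \<inter> V \<Longrightarrow> \<psi> (fst q) (cinv b (snd q)) \<in> cdom c"
    using smooth_into_preimage_open[OF cont open_cdom[OF c], of "(t, y)"] t y by auto
  obtain I U where IU: "open I" "open U" "t \<in> I" "y \<in> U" "I \<times> U \<subseteq> V"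
    using V(1,2) unfolding open_prod_def by fast
  obtain \<delta> where \<delta>: "\<delta> > 0" "cball t \<delta> \<subseteq> I" using IU open_contains_cball by blast
  \<comment> \<open>A nondegenerate interval around \<open>t\<close>, clipped to [0,1]; at t = 0 or
    t = 1 the derivative is one-sided.\<close>
  define a b' where "a = max 0 (t - \<delta>)" and "b' = min 1 (t + \<delta>)"
  have ab: "a < b'" "t \<in> {a..b'}" "{a..b'} \<subseteq> {0..1}" "{a..b'} \<subseteq> I"
    using \<delta> t by (auto simp: a_def b'_def cball_eq_atLeastAtMost)
  define U' where "U' = U \<inter> cimg b"
  have U': "open U'" "y \<in> U'" using IU y open_cimg[OF b(1)] by (auto simp: U'_def)
  have sub: "{a..b'} \<times> U' \<subseteq> pdom b c"
  proof
    fix q assume q: "q \<in> {a..b'} \<times> U'"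
    then have "q \<in> ({0..1} \<times> cimg b) \<inter> V" using ab(3,4) IU(5) by (auto simp: U'_def)
    from V(3)[OF this] q ab(3) show "q \<in> pdom b c" by (auto simp: pdom_def rep_dom_def U'_def)
  qed
  define \<Phi> where "\<Phi> s = local_rep b c (\<psi> s)" for s
  let ?w = "path_velocity \<psi> t c"
  have "smooth_on (cimg c) ?w"
  proof -
    have "smooth_on (cimg c) (\<lambda>z. (t, z))" by (intro smooth_intros)
    from smooth_on_compose[OF smooth_path_velocity[OF c] this] t show ?thesis by (simp add: image_subset_iff)
  qed
  then have w: "(?w has_derivative frechet_derivative ?w (at (\<Phi> t y))) (at (\<Phi> t y))"
    using z b(3) by (intro smooth_on_open_derivative(1)[OF open_cimg[OF c]]) (auto simp: \<Phi>_def)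
  let ?D = "\<lambda>s. frechet_derivative (\<Phi> s) (at y)"
  have zero: "ext_d1 (\<lambda>c' z \<xi>. \<omega> c' z (?w z) \<xi>) c (\<Phi> t y) (?D t p) (?D t q) = 0" for p q
  proof -
    have "((\<lambda>s. \<omega> c (\<Phi> s y) (?D s p) (?D s q)) has_vector_derivative
      ext_d1 (\<lambda>c' z \<xi>. \<omega> c' z (?w z) \<xi>) c (\<Phi> t y) (?D t p) (?D t q)) (at t within {a..b'})"
    proof (rule pullback_has_vector_derivative[where \<Phi>=\<Phi> and y=y and t=t and w="?w", OF c ab(1) U' ab(2) _ _ _ w])
      show "smooth_on ({a..b'} \<times> U') (\<lambda>p. \<Phi> (fst p) (snd p))"
        using smooth_on_subset[OF smooth_prep[OF b(1) c] sub] by (simp add: prep_def[abs_def] \<Phi>_def)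
      show "\<Phi> s z \<in> cimg c" if "s \<in> {a..b'}" "z \<in> U'" for s z
      proof -
        have "(s, z) \<in> pdom b c" using that sub by blast
        then show ?thesis using c by (simp add: \<Phi>_def pdom_def rep_dom_def local_rep_def cmap_in)
      qed
      show "((\<lambda>s. \<Phi> s z) has_vector_derivative ?w (\<Phi> t z)) (at t within {a..b'})" if "z \<in> U'" for z
      proof -
        have "(t, z) \<in> pdom b c" using that sub ab(2) by auto
        from has_vector_derivative_within_subset[OF path_velocity_prep(2)[OF b(1) c this] ab(3)] show ?thesis
          by (simp add: \<Phi>_def)
      qed
    qed
    moreover have "((\<lambda>s. \<omega> c (\<Phi> s y) (?D s p) (?D s q)) has_vector_derivative 0) (at t within {a..b'})"
    proof (rule has_vector_derivative_transform[OF ab(2) _ has_vector_derivative_const])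
      fix s assume s: "s \<in> {a..b'}"
      then have "(s, y) \<in> pdom b c" using sub U' by auto
      then show "\<omega> c (\<Phi> s y) (?D s p) (?D s q) = \<omega> b y p q" unfolding \<Phi>_def
        using ab(3) s by (intro symplecto_pullback[OF path_symplecto b(1) c]) (auto simp: pdom_def)
    qed
    ultimately show ?thesis using ab by (intro vector_derivative_unique_within_closed_interval[of a b' t]) auto
  qed
  have yr: "y \<in> rep_dom b c (\<psi> t)" using b(2) by (simp add: pdom_def)
  obtain p q where "?D t p = \<xi>" "?D t q = \<eta>"
    using symplecto_derivative(2)[OF path_symplecto[OF t] b(1) c yr] unfolding \<Phi>_def by metis
  then show ?thesis using zero[of p q] b(3) by (simp add: \<Phi>_def ext_d1_def interior_product_def)
qed

definition flux_form :: "('m, 'e) form1" where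
  "flux_form = (\<lambda>c y \<xi>. integral {0..1} (\<lambda>t. interior_product (path_velocity \<psi> t) \<omega> c y \<xi>))"

lemma smooth_path_form:
  assumes c: "c \<in> A"
  shows "smooth_on ({0..1} \<times> cimg c) (\<lambda>p. interior_product (path_velocity \<psi> (fst p)) \<omega> c (snd p) \<xi>)"
  unfolding interior_product_def
  by (rule smooth_on_omega[OF c _ _ smooth_path_velocity[OF c]]) (auto intro: smooth_intros)

lemma path_form_continuous:
  assumes c: "c \<in> A" and y: "y \<in> cimg c"
  shows "continuous_on {0..1} (\<lambda>t. interior_product (path_velocity \<psi> t) \<omega> c y \<xi>)"
  using continuous_on_Times_section[OF smooth_on_imp_continuous[OF smooth_path_form[OF c]] y] .

text \<open>Closedness and the transformation law hold at every time, and differentiation in the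
  chart passes under the time integral.\<close>

lemma flux_form_closed: "closed_one_form A flux_form"
  unfolding closed_one_form_def one_form_def
proof (intro conjI ballI allI)
  fix c assume c: "c \<in> A"
  show "smooth_on (cimg c) (\<lambda>y. flux_form c y \<xi>)" for \<xi>
    unfolding flux_form_def by (rule smooth_on_integral[OF open_cimg[OF c] smooth_path_form[OF c]])
  {
    fix y assume y: "y \<in> cimg c"
    have int: "(\<lambda>t. interior_product (path_velocity \<psi> t) \<omega> c y \<xi>) integrable_on {0..1}" for \<xi>
      by (intro integrable_continuous_real path_form_continuous c y)
    show "linear (flux_form c y)"
      using integral_add[OF int int]
      by (intro linearI) (simp_all add: flux_form_def interior_product_def linear_add[OF omega_linear(1)[OF c y]] linear_cmul[OF omega_linear(1)[OF c y]])
    let ?f = "\<lambda>t z \<xi>. interior_product (path_velocity \<psi> t) \<omega> c z \<xi>"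
    have sm: "smooth_on (cimg c) (\<lambda>z. ?f t z \<eta>)" if "t \<in> {0..1}" for t \<eta>
    proof -
      have "smooth_on (cimg c) (\<lambda>z. (t, z))" by (intro smooth_intros)
      from smooth_on_compose[OF smooth_path_form[OF c] this] that show ?thesis by (simp add: image_subset_iff)
    qed
    note fd = smooth_on_open_derivative(1)[OF open_cimg[OF c] sm]
    have S: "thick ({0..1::real} \<times> cimg c)" by (rule thick_Times[OF thick_Icc thick_open[OF open_cimg[OF c]]]) simp
    have dc: "continuous_on ({0..1} \<times> cimg c) (\<lambda>p. frechet_derivative (\<lambda>z. ?f (fst p) z \<eta>) (at (snd p)) v)" for \<eta> v
    proof (rule continuous_on_eq)
      let ?F = "\<lambda>p. ?f (fst p) (snd p) \<eta>"
      show "continuous_on ({0..1} \<times> cimg c) (\<lambda>p. frechet_derivative ?F (at p within {0..1} \<times> cimg c) (0, v))"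
        by (rule smooth_on_imp_continuous[OF smooth_on_derivative(2)[OF S smooth_path_form[OF c]]])
      fix p :: "real \<times> 'e" assume p: "p \<in> {0..1} \<times> cimg c"
      obtain t z where tz: "p = (t, z)" by (cases p)
      have "((\<lambda>z. ?F (t, z)) has_derivative (\<lambda>v. frechet_derivative ?F (at (t, z) within {0..1} \<times> cimg c) (0, v))) (at z)"
        by (rule smooth_on_partial(1)[OF S smooth_path_form[OF c], of t z "cimg c"]) (use p tz open_cimg[OF c] in auto)
      from fun_cong[OF frechet_derivative_at[OF this]]
      show "frechet_derivative ?F (at p within {0..1} \<times> cimg c) (0, v) = frechet_derivative (\<lambda>z. ?f (fst p) z \<eta>) (at (snd p)) v"
        by (simp add: tz)
    qed
    have "((\<lambda>z. flux_form c z \<eta>) has_derivative (\<lambda>v. integral {0..1} (\<lambda>t. frechet_derivative (\<lambda>z. ?f t z \<eta>) (at y) v))) (at y)" for \<eta>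
      unfolding flux_form_def
      by (rule has_derivative_integral_param[OF open_cimg[OF c] y fd dc path_form_continuous[OF c]])
    from fun_cong[OF frechet_derivative_at[OF this], symmetric]
    have fi: "frechet_derivative (\<lambda>z. flux_form c z \<eta>) (at y) v = integral {0..1} (\<lambda>t. frechet_derivative (\<lambda>z. ?f t z \<eta>) (at y) v)" for \<eta> v
      by simp
    fix \<xi> \<eta>
    have "frechet_derivative (\<lambda>z. ?f t z \<eta>) (at y) \<xi> = frechet_derivative (\<lambda>z. ?f t z \<xi>) (at y) \<eta>" if "t \<in> {0..1}" for t
      using path_form_closed[OF that c y, of \<xi> \<eta>] by (simp add: ext_d1_def)
    then have "integral {0..1} (\<lambda>t. frechet_derivative (\<lambda>z. ?f t z \<eta>) (at y) \<xi>) = integral {0..1} (\<lambda>t. frechet_derivative (\<lambda>z. ?f t z \<xi>) (at y) \<eta>)"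
      by (rule integral_cong)
    then show "ext_d1 flux_form c y \<xi> \<eta> = 0" by (simp add: ext_d1_def fi)
  }
  fix d y \<xi> assume d: "d \<in> A" and y: "y \<in> rep_dom c d id"
  show "flux_form c y \<xi> = flux_form d (local_rep c d id y) (frechet_derivative (local_rep c d id) (at y) \<xi>)"
    unfolding flux_form_def interior_product_def
    by (rule integral_cong) (simp add: omega_transform[OF c d y] path_velocity_transform[OF _ c d y])
qed

end

end

section \<open>Invariant measures\<close>

text \<open>Compact subsets of Euclidean spaces are continuous images of compact sets of real numbers,
  via base-3 digits in the domain and base-2 digits in the codomain. This reduces weak compactness
  of measures to Helly's selection theorem on the line.\<close>

definition digits :: "real \<Rightarrow> (nat \<Rightarrow> bool) \<Rightarrow> real" where
  "digits q b = (\<Sum>n. of_bool (b n) * q ^ Suc n)"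

context
  fixes q :: real
  assumes q: "0 < q" "q < 1"
begin

lemma summable_digits: "summable (\<lambda>n. of_bool (b n) * q ^ Suc n)"
proof (rule summable_comparison_test')
  show "summable (\<lambda>n. q * q ^ n)" using q by (intro summable_mult summable_geometric) simp
  show "norm (of_bool (b n) * q ^ Suc n) \<le> q * q ^ n" for n using q by (simp add: of_bool_def)
qed

lemma digits_bounds: "0 \<le> digits q b" "digits q b \<le> q / (1 - q)"
proof -
  show "0 \<le> digits q b" unfolding digits_def using q by (intro suminf_nonneg summable_digits) auto
  have "digits q b \<le> (\<Sum>n. q * q ^ n)" unfolding digits_def
    using q by (intro suminf_le summable_digits summable_mult summable_geometric) (auto simp: of_bool_def)
  also have "\<dots> = q / (1 - q)" using q by (simp add: suminf_mult suminf_geometric)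
  finally show "digits q b \<le> q / (1 - q)" .
qed

lemma digits_Suc: "digits q b = q * (of_bool (b 0) + digits q (\<lambda>n. b (Suc n)))"
proof -
  have "digits q b = (\<Sum>n. of_bool (b (Suc n)) * q ^ Suc (Suc n)) + of_bool (b 0) * q"
    unfolding digits_def using suminf_split_head[OF summable_digits[of b]] by simp
  also have "(\<Sum>n. of_bool (b (Suc n)) * q ^ Suc (Suc n)) = (\<Sum>n. q * (of_bool (b (Suc n)) * q ^ Suc n))"
    by (simp add: mult_ac)
  also have "\<dots> = q * digits q (\<lambda>n. b (Suc n))"
    unfolding digits_def by (rule suminf_mult[OF summable_digits])
  finally show ?thesis by (simp add: algebra_simps)
qed

lemma continuous_on_digits: "continuous_on UNIV (digits q)"
proof -
  have "uniform_limit UNIV (\<lambda>n b. \<Sum>i<n. of_bool (b i) * q ^ Suc i) (\<lambda>b. \<Sum>i. of_bool (b i) * q ^ Suc i) sequentially"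
  proof (rule Weierstrass_m_test)
    show "norm (of_bool (b n) * q ^ Suc n) \<le> q * q ^ n" for n b using q by (simp add: of_bool_def)
    show "summable (\<lambda>n. q * q ^ n)" using q by (intro summable_mult summable_geometric) simp
  qed
  moreover have "continuous_on UNIV (\<lambda>b :: nat \<Rightarrow> bool. \<Sum>i<n. of_bool (b i) * q ^ Suc i)" for n
  proof (intro continuous_intros)
    fix i
    have "continuous_on UNIV (of_bool :: bool \<Rightarrow> real)" by (simp add: continuous_on_discrete)
    from continuous_on_compose2[OF this continuous_on_product_coordinates[of i]]
    show "continuous_on UNIV (\<lambda>b :: nat \<Rightarrow> bool. of_bool (b i) :: real)" by simp
  qed
  ultimately have "continuous_on UNIV (\<lambda>b. \<Sum>i. of_bool (b i) * q ^ Suc i)"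
    by (intro uniform_limit_theorem[OF always_eventually]) auto
  then show ?thesis by (simp add: digits_def[abs_def])
qed

end

text \<open>With digits 0 and 1 in base 3 the digits after the first contribute at most 1/6 in
  total, less than the first digit's 1/3, so the first digit can be read off; induction gives the
  others.\<close>

lemma inj_digits_third: "inj (digits (1/3))"
proof (rule injI)
  have step: "b 0 = b' 0 \<and> digits (1/3) (\<lambda>n. b (Suc n)) = digits (1/3) (\<lambda>n. b' (Suc n))"
    if "digits (1/3) b = digits (1/3) b'" for b b'
    using digits_Suc[of "1/3" b] digits_Suc[of "1/3" b'] that
      digits_bounds[of "1/3" "\<lambda>n. b (Suc n)"] digits_bounds[of "1/3" "\<lambda>n. b' (Suc n)"]
    by (cases "b 0"; cases "b' 0") auto
  have "b n = b' n" if "digits (1/3) b = digits (1/3) b'" for b b' n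
    using that
  proof (induction n arbitrary: b b')
    case 0
    then show ?case using step by blast
  next
    case (Suc n)
    show ?case using Suc.IH[of "\<lambda>n. b (Suc n)" "\<lambda>n. b' (Suc n)"] step[OF Suc.prems] by simp
  qed
  then show "b = b'" if "digits (1/3) b = digits (1/3) b'" for b b' using that by auto
qed

lemma digits_half_surj:
  assumes t: "0 \<le> t" "t \<le> 1"
  shows "\<exists>b. digits (1/2) b = t"
\<comment> \<open>The digits obtained from floors would all be 0 for t = 1, which is represented by
  the constant sequence of ones instead.\<close>
proof (cases "t = 1")
  case True
  have "(\<lambda>n. (1/2::real) * (1/2) ^ n) sums (1/2 * (1 / (1 - 1/2)))"
    by (intro sums_mult geometric_sums) simp
  then have "digits (1/2) (\<lambda>_. True) = 1" unfolding digits_def using sums_unique by fastforce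
  then show ?thesis using True by blast
next
  case False
  define b where "b n = odd \<lfloor>2 ^ Suc n * t\<rfloor>" for n
  have fl: "\<lfloor>2 ^ Suc n * t\<rfloor> = 2 * \<lfloor>2 ^ n * t\<rfloor> + of_bool (b n)" for n
  proof -
    define x where "x = 2 ^ n * t"
    have "\<lfloor>2 * x\<rfloor> = 2 * \<lfloor>x\<rfloor> \<or> \<lfloor>2 * x\<rfloor> = 2 * \<lfloor>x\<rfloor> + 1" by linarith
    then have "\<lfloor>2 * x\<rfloor> = 2 * \<lfloor>x\<rfloor> + of_bool (odd \<lfloor>2 * x\<rfloor>)" by auto
    then show ?thesis by (simp add: b_def x_def mult.assoc)
  qed
  have sum: "(\<Sum>i<n. of_bool (b i) * (1/2) ^ Suc i) = \<lfloor>2 ^ n * t\<rfloor> / 2 ^ n" for n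
  proof (induction n)
    case 0
    have "\<lfloor>t\<rfloor> = 0" using t False by linarith
    then show ?case by simp
  next
    case (Suc n)
    then show ?case unfolding sum.lessThan_Suc Suc fl by (simp add: field_simps power_divide)
  qed
  have "(\<lambda>n. \<lfloor>2 ^ n * t\<rfloor> / 2 ^ n) \<longlonglongrightarrow> t"
  proof (rule real_tendsto_sandwich)
    show "\<forall>\<^sub>F n in sequentially. t - (1/2) ^ n \<le> \<lfloor>2 ^ n * t\<rfloor> / 2 ^ n"
    proof (rule always_eventually, rule allI)
      fix n :: nat
      have "2 ^ n * t - 1 \<le> \<lfloor>2 ^ n * t\<rfloor>" by linarith
      from divide_right_mono[OF this, of "2 ^ n"] show "t - (1/2) ^ n \<le> \<lfloor>2 ^ n * t\<rfloor> / 2 ^ n"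
        by (simp add: diff_divide_distrib power_divide)
    qed
    show "\<forall>\<^sub>F n in sequentially. \<lfloor>2 ^ n * t\<rfloor> / 2 ^ n \<le> t"
      by (rule always_eventually) (simp add: field_simps)
    have "(\<lambda>n. t - (1/2) ^ n) \<longlonglongrightarrow> t - 0" by (intro tendsto_diff tendsto_const LIMSEQ_power_zero) simp
    then show "(\<lambda>n. t - (1/2) ^ n) \<longlonglongrightarrow> t" by simp
  qed simp
  then have "(\<lambda>i. of_bool (b i) * (1/2) ^ Suc i) sums t" unfolding sums_def sum .
  then show ?thesis unfolding digits_def using sums_unique by metis
qed

lemma compact_UNIV_bool_seq: "compact (UNIV :: (nat \<Rightarrow> bool) set)"
proof -
  have "compact_space (euclidean :: bool topology)"
    by (simp add: compact_space_def finite_imp_compact)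
  then have "compact_space (product_topology (\<lambda>i::nat. euclidean :: bool topology) UNIV)"
    by (simp add: compact_space_product_topology)
  then show ?thesis by (simp add: euclidean_product_topology compact_space_def)
qed

text \<open>The Cantor set maps onto a cube containing \<open>S\<close>: a binary sequence is split
  into one sequence per coordinate, each read in base 2. The preimage of \<open>S\<close> is the
  compact set of reals sought.\<close>

lemma compact_imp_image_of_real_compact:
  fixes S :: "'a::euclidean_space set"
  assumes "compact S"
  obtains K and g :: "real \<Rightarrow> 'a" where "compact K" "continuous_on K g" "g ` K = S"
proof -
  obtain a where a: "S \<subseteq> cbox (-a) a"
    using bounded_subset_cbox_symmetric[OF compact_imp_bounded[OF assms]] by blast
  obtain e :: "'a \<Rightarrow> nat" where e: "inj_on e Basis" using finite_imp_inj_to_nat_seg[OF finite_Basis] by metis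
  \<comment> \<open>The pairing of \<open>e i\<close> with a position keeps the digits of different
    coordinates apart; 2 d - 1 stretches [0,1] to [-1,1] before scaling by the side of the
    cube.\<close>
  define h where "h b = (\<Sum>i\<in>Basis. ((a \<bullet> i) * (2 * digits (1/2) (\<lambda>n. b (prod_encode (e i, n))) - 1)) *\<^sub>R i)" for b :: "nat \<Rightarrow> bool"
  have hc: "continuous_on UNIV h" unfolding h_def
    by (intro continuous_intros continuous_on_compose2[OF continuous_on_digits]) auto
  have hs: "\<exists>b. h b = x" if x: "x \<in> cbox (-a) a" for x
  proof -
    have "\<exists>b. (a \<bullet> i) * (2 * digits (1/2) b - 1) = x \<bullet> i" if i: "i \<in> Basis" for i
    proof (cases "a \<bullet> i = 0")
      case True
      then show ?thesis using x i by (auto simp: mem_box)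
    next
      case False
      have "- (a \<bullet> i) \<le> x \<bullet> i" "x \<bullet> i \<le> a \<bullet> i" using x i by (auto simp: mem_box)
      then have "0 \<le> (x \<bullet> i / (a \<bullet> i) + 1) / 2" "(x \<bullet> i / (a \<bullet> i) + 1) / 2 \<le> 1"
        using False by (auto simp: field_simps)
      then obtain b where "digits (1/2) b = (x \<bullet> i / (a \<bullet> i) + 1) / 2" using digits_half_surj by blast
      then show ?thesis using False by (intro exI[of _ b]) (simp add: field_simps)
    qed
    then obtain B where B: "\<And>i. i \<in> Basis \<Longrightarrow> (a \<bullet> i) * (2 * digits (1/2) (B i) - 1) = x \<bullet> i" by metis
    define b where "b m = B (inv_into Basis e (fst (prod_decode m))) (snd (prod_decode m))" for m
    have "(\<lambda>n. b (prod_encode (e i, n))) = B i" if "i \<in> Basis" for i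
      using that e by (simp add: b_def)
    then have "h b = (\<Sum>i\<in>Basis. (x \<bullet> i) *\<^sub>R i)" unfolding h_def by (intro sum.cong) (simp_all add: B)
    then show ?thesis by (auto simp: euclidean_representation)
  qed
  define C where "C = range (digits (1/3))"
  define d where "d = inv (digits (1/3))"
  have "compact C" unfolding C_def
    by (intro compact_continuous_image compact_UNIV_bool_seq continuous_on_digits) auto
  have dc: "continuous_on C d" unfolding C_def d_def
    by (rule continuous_on_inv[OF continuous_on_digits compact_UNIV_bool_seq]) (auto simp: inv_f_f[OF inj_digits_third])
  have gc: "continuous_on C (h \<circ> d)" using continuous_on_compose2[OF hc dc] by (simp add: o_def)
  define K where "K = C \<inter> (h \<circ> d) -` S"
  show thesis
  proof (rule that[of K "h \<circ> d"])
    have "closed C" using \<open>compact C\<close> by (rule compact_imp_closed)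
    then have "closed K" unfolding K_def
      using continuous_closed_preimage[OF gc] compact_imp_closed[OF assms] by blast
    then show "compact K" using \<open>compact C\<close> unfolding K_def by (metis compact_Int_closed inf.absorb_iff2 inf_le1 inf_commute)
    show "continuous_on K (h \<circ> d)" using gc by (rule continuous_on_subset) (simp add: K_def)
    show "(h \<circ> d) ` K = S"
    proof
      show "S \<subseteq> (h \<circ> d) ` K"
      proof
        fix x assume x: "x \<in> S"
        then obtain b where "h b = x" using hs a by blast
        then have "(h \<circ> d) (digits (1/3) b) = x" by (simp add: d_def inv_f_f[OF inj_digits_third])
        moreover have "digits (1/3) b \<in> C" by (simp add: C_def)
        ultimately show "x \<in> (h \<circ> d) ` K" using x unfolding K_def by force
      qed
    qed (auto simp: K_def)
  qed
qed

section \<open>Covers, cut-off functions and real parametrisations of a closed manifold\<close>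

context smooth_manifold
begin

text \<open>The preimage of the support is compact, hence closed in the Hausdorff space, so the
  chart domain and its complement form an open cover on which the two definitions fit.\<close>

lemma continuous_chart_extension:
  fixes f :: "'e \<Rightarrow> 'c::{topological_space,zero}"
  assumes c: "c \<in> A" and f: "continuous_on UNIV f" and K: "compact K" "K \<subseteq> cimg c" "\<And>y. y \<notin> K \<Longrightarrow> f y = 0"
  shows "continuous_on UNIV (\<lambda>x. if x \<in> cdom c then f (cmap c x) else 0)"
proof -
  let ?g = "\<lambda>x. if x \<in> cdom c then f (cmap c x) else 0"
  have "compact (cinv c ` K)"
    by (intro compact_continuous_image continuous_on_subset[OF continuous_on_cinv[OF c]] K)
  then have cl: "closed (cinv c ` K)" by (rule compact_imp_closed)
  have "continuous_on (cdom c) (\<lambda>x. f (cmap c x))"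
    by (rule continuous_on_compose2[OF f continuous_on_cmap[OF c]]) simp
  then have 1: "continuous_on (cdom c) ?g" by (rule continuous_on_eq) simp
  have 2: "continuous_on (- cinv c ` K) ?g"
  proof (rule continuous_on_eq[OF continuous_on_const])
    fix x assume x: "x \<in> - cinv c ` K"
    show "0 = ?g x"
    proof (cases "x \<in> cdom c")
      case True
      then have "cmap c x \<notin> K" using x cinv_cmap[OF c True] by (metis ComplD image_eqI)
      then show ?thesis using K by simp
    qed simp
  qed
  have "continuous_on (cdom c \<union> - cinv c ` K) ?g"
    by (rule continuous_on_open_Un[OF open_cdom[OF c] _ 1 2]) (use cl in auto)
  moreover have "cdom c \<union> - cinv c ` K = UNIV" using K cinv_in[OF c] by auto
  ultimately show ?thesis by simp
qed

end

context closed_smooth_manifold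
begin

lemma finite_ball_cover:
  obtains C where "finite C" "\<And>c y r. (c, y, r) \<in> C \<Longrightarrow> c \<in> A \<and> cball y r \<subseteq> cimg c"
    "\<And>x. \<exists>(c, y, r)\<in>C. x \<in> cdom c \<and> cmap c x \<in> ball y r"
proof -
  define I where "I = {(c, y, r). c \<in> A \<and> cball y r \<subseteq> cimg c}"
  define U where "U z = (case z of (c, y, r) \<Rightarrow> {x \<in> cdom c. cmap c x \<in> ball y r})" for z :: "('a, 'b) chart \<times> 'b \<times> real"
  have op: "open (U z)" if "z \<in> I" for z
    using that open_chart_image[OF _ open_ball] by (cases z) (auto simp: U_def I_def)
  have cov: "UNIV \<subseteq> (\<Union>z\<in>I. U z)"
  proof
    fix x :: 'a
    obtain c where c: "c \<in> A" "x \<in> cdom c" by (rule chart_at)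
    obtain r where "r > 0" "cball (cmap c x) r \<subseteq> cimg c"
      using open_cimg[OF c(1)] cmap_in[OF c] open_contains_cball by blast
    then have "(c, cmap c x, r) \<in> I" "x \<in> U (c, cmap c x, r)" using c by (auto simp: I_def U_def)
    then show "x \<in> (\<Union>z\<in>I. U z)" by blast
  qed
  obtain C where C: "C \<subseteq> I" "finite C" "UNIV \<subseteq> (\<Union>z\<in>C. U z)"
    by (rule compactE_image[OF compact op cov])
  show thesis
  proof (rule that[OF C(2)])
    show "c \<in> A \<and> cball y r \<subseteq> cimg c" if "(c, y, r) \<in> C" for c y r using C(1) that by (auto simp: I_def)
    fix x
    obtain z where "z \<in> C" "x \<in> U z" using C(3) by blast
    then show "\<exists>(c, y, r)\<in>C. x \<in> cdom c \<and> cmap c x \<in> ball y r" by (cases z) (auto simp: U_def)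
  qed
qed

text \<open>The manifold is a finite union of chart preimages of closed balls, each a continuous
  image of a compact set of reals by \<open>compact_imp_image_of_real_compact\<close>.\<close>

lemma image_of_real_compact:
  obtains K and g :: "real \<Rightarrow> 'a" where "compact K" "continuous_on K g" "g ` K = UNIV"
proof -
  obtain C where C: "finite C" "\<And>c y r. (c, y, r) \<in> C \<Longrightarrow> c \<in> A \<and> cball y r \<subseteq> cimg c"
    "\<And>x. \<exists>(c, y, r)\<in>C. x \<in> cdom c \<and> cmap c x \<in> ball y r"
    using finite_ball_cover by blast
  define P where "P S \<longleftrightarrow> (\<exists>K (g :: real \<Rightarrow> 'a). compact K \<and> continuous_on K g \<and> g ` K = S)" for S :: "'a set"
  have Un: "P (S \<union> T)" if "P S" "P T" for S T
  proof -
    obtain K and g :: "real \<Rightarrow> 'a" where K: "compact K" "continuous_on K g" "g ` K = S" using \<open>P S\<close> unfolding P_def by blast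
    obtain L and h :: "real \<Rightarrow> 'a" where L: "compact L" "continuous_on L h" "h ` L = T" using \<open>P T\<close> unfolding P_def by blast
    obtain B where B: "\<And>x. x \<in> K \<Longrightarrow> \<bar>x\<bar> \<le> B" using compact_imp_bounded[OF K(1)] unfolding bounded_iff by auto
    obtain B' where B': "\<And>x. x \<in> L \<Longrightarrow> \<bar>x\<bar> \<le> B'" using compact_imp_bounded[OF L(1)] unfolding bounded_iff by auto
    \<comment> \<open>A translation large enough to make the two compact sets of reals disjoint, so
      that the maps on them combine continuously.\<close>
    define s where "s = B + B' + 1"
    define L' where "L' = (\<lambda>x. x + s) ` L"
    have L': "compact L'" unfolding L'_def by (intro compact_continuous_image continuous_intros L)
    have disj: "K \<inter> L' = {}" using B B' unfolding L'_def s_def by fastforce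
    define k where "k x = (if x \<in> K then g x else h (x - s))" for x
    have "continuous_on (K \<union> L') k"
    proof (rule continuous_on_closed_Un)
      show "continuous_on K k" by (rule continuous_on_eq[OF K(2)]) (simp add: k_def)
      have "continuous_on L' (\<lambda>x. h (x - s))"
        by (rule continuous_on_compose2[OF L(2)]) (auto simp: L'_def intro!: continuous_intros)
      then show "continuous_on L' k" by (rule continuous_on_eq) (use disj in \<open>auto simp: k_def\<close>)
    qed (use K L' compact_imp_closed in auto)
    moreover have "k ` (K \<union> L') = S \<union> T"
    proof -
      have "k ` K = S" using K(3) by (auto simp: k_def)
      moreover have "k ` L' = (\<lambda>x. h (x - s)) ` L'" using disj by (intro image_cong) (auto simp: k_def)
      moreover have "(\<lambda>x. h (x - s)) ` L' = T" unfolding L'_def image_image using L(3) by simp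
      ultimately show ?thesis by (simp add: image_Un)
    qed
    ultimately show ?thesis unfolding P_def using compact_Un[OF K(1) L'] by blast
  qed
  have ball: "P (cinv c ` cball y r)" if "(c, y, r) \<in> C" for c y r
  proof -
    obtain K and g :: "real \<Rightarrow> 'b" where K: "compact K" "continuous_on K g" "g ` K = cball y r"
      using compact_imp_image_of_real_compact[OF compact_cball] by blast
    have "continuous_on K (\<lambda>x. cinv c (g x))"
      by (rule continuous_on_compose2[OF continuous_on_cinv K(2)]) (use K C(2)[OF that] in auto)
    moreover have "(\<lambda>x. cinv c (g x)) ` K = cinv c ` cball y r" using K(3) by (metis image_image)
    ultimately show ?thesis unfolding P_def using K(1) by blast
  qed
  have fin: "P (\<Union>(c, y, r)\<in>D. cinv c ` cball y r)" if "finite D" "D \<subseteq> C" for D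
    using that
  proof (induction D rule: finite_induct)
    case empty
    show ?case unfolding P_def by (intro exI[of _ "{}"]) auto
  next
    case (insert z D)
    then show ?case using Un ball by (cases z) auto
  qed
  have "(\<Union>(c, y, r)\<in>C. cinv c ` cball y r) = UNIV"
  proof -
    have "x \<in> (\<Union>(c, y, r)\<in>C. cinv c ` cball y r)" for x
    proof -
      obtain c y r where z: "(c, y, r) \<in> C" "x \<in> cdom c" "cmap c x \<in> ball y r" using C(3)[of x] by auto
      then have "x \<in> cinv c ` cball y r" using cinv_cmap[of c x] C(2)[OF z(1)] by (metis ball_subset_cball image_eqI subsetD)
      then show ?thesis using z(1) by blast
    qed
    then show ?thesis by blast
  qed
  then have "P UNIV" using fin[OF C(1) order_refl] by simp
  then show thesis using that unfolding P_def by blast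
qed

text \<open>A substitute for the distance to the complement of \<open>U\<close>: in each chart that
  distance is multiplied by a function supported in a ball of the finite cover, and the products are
  added up.\<close>

lemma open_eq_positivity_set:
  assumes U: "open U"
  obtains g :: "'a \<Rightarrow> real" where "continuous_on UNIV g" "\<And>x. 0 \<le> g x" "\<And>x. 0 < g x \<longleftrightarrow> x \<in> U"
proof -
  obtain C where C: "finite C" "\<And>c y r. (c, y, r) \<in> C \<Longrightarrow> c \<in> A \<and> cball y r \<subseteq> cimg c"
    "\<And>x. \<exists>(c, y, r)\<in>C. x \<in> cdom c \<and> cmap c x \<in> ball y r"
    using finite_ball_cover by blast
  define W where "W c = {y \<in> cimg c. cinv c y \<in> U}" for c :: "('a, 'b) chart"
  \<comment> \<open>The distance to an empty complement would be 0 by convention, so this case gets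
    the value 1.\<close>
  define h where "h c y = (if W c = UNIV then 1 else infdist y (- W c))" for c y
  have hc: "continuous_on UNIV (h c)" for c unfolding h_def by (cases "W c = UNIV") (auto intro: continuous_intros)
  have h0: "0 \<le> h c y" for c y by (simp add: h_def infdist_nonneg)
  have hpos: "0 < h c y \<longleftrightarrow> y \<in> W c" if "c \<in> A" for c y
  proof (cases "W c = UNIV")
    case False
    have "closed (- W c)" unfolding W_def using open_transition_dom[OF that U] by auto
    then have "y \<in> - W c \<longleftrightarrow> infdist y (- W c) = 0" using False by (intro in_closed_iff_infdist_zero) auto
    then show ?thesis using False infdist_nonneg[of y "- W c"] by (auto simp: h_def)
  qed (simp add: h_def)
  define g where "g z x = (case z of (c, y, r) \<Rightarrow> if x \<in> cdom c then max 0 (r - dist y (cmap c x)) * h c (cmap c x) else 0)"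
    for z :: "('a, 'b) chart \<times> 'b \<times> real" and x
  have g0: "0 \<le> g z x" for z x using h0 by (cases z) (auto simp: g_def)
  have gU: "x \<in> U" if "z \<in> C" "0 < g z x" for z x
  proof -
    obtain c y r where z: "z = (c, y, r)" by (cases z)
    have c: "c \<in> A" using C(2) that z by auto
    have x: "x \<in> cdom c" "h c (cmap c x) > 0" using that(2) h0[of c "cmap c x"] by (auto simp: g_def z zero_less_mult_iff split: if_splits)
    then show ?thesis using hpos[OF c] by (simp add: W_def cinv_cmap[OF c])
  qed
  have gc: "continuous_on UNIV (g z)" if zC: "z \<in> C" for z
  proof -
    obtain c y r where z: "z = (c, y, r)" by (cases z)
    have c: "c \<in> A" "cball y r \<subseteq> cimg c" using C(2) zC z by auto
    have "continuous_on UNIV (\<lambda>x. if x \<in> cdom c then (\<lambda>v. max 0 (r - dist y v) * h c v) (cmap c x) else 0)"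
      by (rule continuous_chart_extension[OF c(1) _ compact_cball c(2)]) (auto intro!: continuous_intros hc)
    then show ?thesis by (simp add: g_def[abs_def] z)
  qed
  show thesis
  proof (rule that[of "\<lambda>x. \<Sum>z\<in>C. g z x"])
    show "continuous_on UNIV (\<lambda>x. \<Sum>z\<in>C. g z x)" by (intro continuous_intros gc)
    show "0 \<le> (\<Sum>z\<in>C. g z x)" for x by (intro sum_nonneg g0)
    show "0 < (\<Sum>z\<in>C. g z x) \<longleftrightarrow> x \<in> U" for x
    proof
      assume "0 < (\<Sum>z\<in>C. g z x)"
      then obtain z where "z \<in> C" "0 < g z x" by (meson less_le_not_le linorder_not_le sum_nonpos)
      then show "x \<in> U" by (rule gU)
    next
      assume x: "x \<in> U"
      obtain c y r where z: "(c, y, r) \<in> C" "x \<in> cdom c" "cmap c x \<in> ball y r" using C(3)[of x] by auto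
      have c: "c \<in> A" using C(2)[OF z(1)] by simp
      have "0 < h c (cmap c x)" using hpos[OF c] x z(2) by (simp add: W_def cmap_in[OF c] cinv_cmap[OF c])
      then have "0 < g (c, y, r) x" using z by (simp add: g_def)
      then show "0 < (\<Sum>z\<in>C. g z x)" using C(1) z(1) g0 by (intro sum_pos2) auto
    qed
  qed
qed

end

section \<open>Time averages and weak limits of measures\<close>

lemma time_average_integral:
  fixes h :: "real \<Rightarrow> real"
  assumes N: "0 < N" and h: "continuous_on UNIV h"
  shows "prob_space (uniform_measure lborel {0..N})" "integral\<^sup>L (uniform_measure lborel {0..N}) h = (1 / N) * integral {0..N} h"
proof -
  show "prob_space (uniform_measure lborel {0..N})"
    using N by (intro prob_space_uniform_measure) auto
  have "uniform_measure lborel {0..N} = density lborel (\<lambda>x. ennreal (indicator {0..N} x / N))"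
  proof -
    have "(1 :: ennreal) / ennreal N = ennreal (1 / N)" using divide_ennreal[of 1 N] N by simp
    then show ?thesis unfolding uniform_measure_def
      using N by (intro density_cong) (auto simp: indicator_def)
  qed
  then have "integral\<^sup>L (uniform_measure lborel {0..N}) h = (\<integral>x. (indicator {0..N} x / N) *\<^sub>R h x \<partial>lborel)"
    using N h by (simp add: integral_density borel_measurable_continuous_onI)
  also have "\<dots> = (1 / N) * (LINT x:{0..N}|lborel. h x)"
    unfolding set_lebesgue_integral_def by (subst Bochner_Integration.integral_mult_right_zero[symmetric]) (simp add: mult_ac)
  also have "(LINT x:{0..N}|lborel. h x) = integral {0..N} h"
    using h by (intro set_borel_integral_eq_integral(2) borel_integrable_compact[unfolded set_integrable_def[symmetric]])
      (auto intro: continuous_on_subset)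
  finally show "integral\<^sup>L (uniform_measure lborel {0..N}) h = (1 / N) * integral {0..N} h" .
qed

text \<open>A primitive of \<open>h\<close> is Lipschitz with constant \<open>C\<close>, and
  shifting the window by \<tau> moves each of its two end points by |\<tau>|. The bound does not
  depend on \<open>N\<close>, which makes time averages asymptotically invariant.\<close>

lemma integral_shift_bound:
  fixes h :: "real \<Rightarrow> real"
  assumes h: "continuous_on UNIV h" and C: "\<And>t. \<bar>h t\<bar> \<le> C" and N: "0 \<le> N"
  shows "\<bar>integral {0..N} (\<lambda>s. h (s + \<tau>)) - integral {0..N} h\<bar> \<le> 2 * C * \<bar>\<tau>\<bar>"
proof -
  define H where "H = prim h"
  have H: "(H has_vector_derivative h t) (at t)" for t unfolding H_def by (rule prim_has_vector_derivative[OF h])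
  have 1: "integral {0..N} h = H N - H 0"
    by (rule integral_unique[OF fundamental_theorem_of_calculus[OF N has_vector_derivative_at_within[OF H]]])
  have "((\<lambda>s. H (s + \<tau>)) has_vector_derivative h (s + \<tau>)) (at s)" for s
  proof -
    have "((\<lambda>s. s + \<tau>) has_vector_derivative 1 + 0) (at s)"
      by (intro has_vector_derivative_add has_vector_derivative_const has_vector_derivative_id)
    from vector_diff_chain_at[OF this H] show ?thesis by (simp add: o_def)
  qed
  from integral_unique[OF fundamental_theorem_of_calculus[OF N has_vector_derivative_at_within[OF this]]]
  have 2: "integral {0..N} (\<lambda>s. h (s + \<tau>)) = H (N + \<tau>) - H (0 + \<tau>)" .
  have L: "\<bar>H a - H b\<bar> \<le> C * \<bar>a - b\<bar>" for a b
  proof -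
    have "norm (H a - H b) \<le> C * norm (a - b)"
    proof (rule differentiable_bound[OF convex_UNIV, of H "\<lambda>t r. r * h t"])
      fix t
      show "(H has_derivative (\<lambda>r. r * h t)) (at t within UNIV)" using H[of t] by (simp add: has_vector_derivative_def)
      show "onorm (\<lambda>r. r * h t) \<le> C"
      proof (rule onorm_le)
        fix r :: real
        show "norm (r * h t) \<le> C * norm r" using mult_left_mono[OF C[of t], of "\<bar>r\<bar>"] by (simp add: abs_mult mult.commute)
      qed
    qed auto
    then show ?thesis by simp
  qed
  show ?thesis unfolding 1 2 using L[of "N + \<tau>" N] L[of \<tau> 0] by simp
qed

context closed_smooth_manifold
begin

lemma continuous_imp_bounded:
  fixes g :: "'a \<Rightarrow> 'c::real_normed_vector"
  assumes "continuous_on UNIV g"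
  shows "\<exists>C. \<forall>x. norm (g x) \<le> C"
proof -
  have "bounded (g ` UNIV)" by (rule compact_imp_bounded[OF compact_continuous_image[OF assms compact]])
  then show ?thesis unfolding bounded_iff by blast
qed

text \<open>The functions min 1 (n g) converge to the indicator of the open set where
  \<open>g\<close> is positive. Hence integrals of continuous functions determine the measure of
  open sets, an intersection-stable generator of the Borel sets.\<close>

lemma measure_eqI_continuous:
  fixes \<mu> \<nu> :: "'a measure"
  assumes "prob_space \<mu>" "prob_space \<nu>" and sets: "sets \<mu> = sets borel" "sets \<nu> = sets borel"
    and eq: "\<And>g :: 'a \<Rightarrow> real. continuous_on UNIV g \<Longrightarrow> integral\<^sup>L \<mu> g = integral\<^sup>L \<nu> g"
  shows "\<mu> = \<nu>"
proof -
  interpret \<mu>: prob_space \<mu> by fact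
  interpret \<nu>: prob_space \<nu> by fact
  have lim: "(\<lambda>n. integral\<^sup>L \<kappa> (\<lambda>x. min 1 (real n * g x))) \<longlonglongrightarrow> measure \<kappa> U"
    if \<kappa>: "prob_space \<kappa>" "sets \<kappa> = sets borel" and U: "open U" and g: "continuous_on UNIV g" "\<And>x. 0 \<le> g x" "\<And>x. 0 < g x \<longleftrightarrow> x \<in> U"
    for \<kappa> U and g :: "'a \<Rightarrow> real"
  proof -
    interpret \<kappa>: prob_space \<kappa> by fact
    have Us: "U \<in> sets \<kappa>" using U \<kappa> by simp
    have m: "h \<in> borel_measurable \<kappa>" if "continuous_on UNIV h" for h :: "'a \<Rightarrow> real"
      using borel_measurable_continuous_onI[OF that] \<kappa>(2) measurable_cong_sets by blast
    have "(\<lambda>n. integral\<^sup>L \<kappa> (\<lambda>x. min 1 (real n * g x))) \<longlonglongrightarrow> integral\<^sup>L \<kappa> (indicator U)"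
    proof (rule integral_dominated_convergence[where w="\<lambda>_. 1"])
      show "AE x in \<kappa>. (\<lambda>n. min 1 (real n * g x)) \<longlonglongrightarrow> indicator U x"
      proof (rule AE_I2)
        fix x
        show "(\<lambda>n. min 1 (real n * g x)) \<longlonglongrightarrow> indicator U x"
        proof (cases "x \<in> U")
          case True
          then have gx: "0 < g x" using g by simp
          obtain k :: nat where k: "1 / g x < k" using reals_Archimedean2 by blast
          have "\<forall>\<^sub>F n in sequentially. 1 = min 1 (real n * g x)"
          proof (rule eventually_sequentiallyI[of k])
            fix n assume "k \<le> n"
            then have "1 / g x \<le> n" using k by linarith
            then have "1 \<le> n * g x" using gx by (simp add: field_simps)
            then show "1 = min 1 (real n * g x)" by simp
          qed
          then have "\<forall>\<^sub>F n in sequentially. min 1 (real n * g x) = 1" by (rule eventually_mono) simp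
          then have "(\<lambda>n. min 1 (real n * g x)) \<longlonglongrightarrow> 1" by (rule tendsto_eventually)
          then show ?thesis using True by simp
        next
          case False
          then have "g x = 0" using g(2,3)[of x] by auto
          then show ?thesis using False by simp
        qed
      qed
      show "AE x in \<kappa>. norm (min 1 (real n * g x)) \<le> 1" for n
      proof (rule AE_I2)
        fix x
        have "0 \<le> real n * g x" using g(2) by simp
        then show "norm (min 1 (real n * g x)) \<le> 1" by simp
      qed
    qed (use Us in \<open>auto intro!: m continuous_intros g\<close>)
    then show ?thesis using Us by simp
  qed
  show ?thesis
  proof (rule measure_eqI_generator_eq[where \<Omega>=UNIV and E="{U. open U}" and A="\<lambda>_. UNIV"])
    show "Int_stable {U :: 'a set. open U}" by (auto simp: Int_stable_def)
    show "sets \<mu> = sigma_sets UNIV {U. open U}" "sets \<nu> = sigma_sets UNIV {U. open U}"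
      using sets by (simp_all add: borel_def)
    fix U :: "'a set" assume "U \<in> {U. open U}"
    then have U: "open U" by simp
    obtain g :: "'a \<Rightarrow> real" where g: "continuous_on UNIV g" "\<And>x. 0 \<le> g x" "\<And>x. 0 < g x \<longleftrightarrow> x \<in> U"
      using open_eq_positivity_set[OF U] by blast
    have "integral\<^sup>L \<mu> (\<lambda>x. min 1 (real n * g x)) = integral\<^sup>L \<nu> (\<lambda>x. min 1 (real n * g x))" for n
      by (rule eq) (intro continuous_intros g)
    then have "measure \<mu> U = measure \<nu> U"
      using lim[OF assms(1) sets(1) U g] lim[OF assms(2) sets(2) U g] LIMSEQ_unique by simp
    then show "emeasure \<mu> U = emeasure \<nu> U" by (simp add: \<mu>.emeasure_eq_measure \<nu>.emeasure_eq_measure)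
  qed (auto simp: \<mu>.emeasure_eq_measure)
qed

text \<open>The measures are moved to a compact set \<open>K\<close> of reals by a Borel section of
  the surjection \<open>q\<close>, a weakly convergent subsequence is selected there, and the limit
  is pushed back by \<open>q\<close>.\<close>

lemma weak_limit_of_measures:
  fixes m :: "nat \<Rightarrow> 'a measure"
  assumes m: "\<And>n. prob_space (m n)" "\<And>n. sets (m n) = sets borel"
  obtains r \<mu> where "strict_mono (r :: nat \<Rightarrow> nat)" "prob_space \<mu>" "sets \<mu> = sets borel"
    "\<And>g :: 'a \<Rightarrow> real. continuous_on UNIV g \<Longrightarrow> (\<lambda>n. integral\<^sup>L (m (r n)) g) \<longlonglongrightarrow> integral\<^sup>L \<mu> g"
proof -
  obtain K and q :: "real \<Rightarrow> 'a" where K: "compact K" "continuous_on K q" "q ` K = UNIV"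
    using image_of_real_compact by blast
  have Kc: "closed K" using K(1) by (rule compact_imp_closed)
  define fib where "fib x = {k \<in> K. q k = x}" for x
  have fib: "compact (fib x)" "fib x \<noteq> {}" for x
  proof -
    have "closed (K \<inter> q -` {x})" using continuous_closed_preimage[OF K(2) Kc] by simp
    moreover have "fib x = K \<inter> (K \<inter> q -` {x})" by (auto simp: fib_def)
    ultimately show "compact (fib x)" using compact_Int_closed[OF K(1)] by metis
    have "x \<in> q ` K" using K(3) by simp
    then show "fib x \<noteq> {}" by (auto simp: fib_def)
  qed
  \<comment> \<open>The smallest point of each fibre. This section is Borel because its sublevel set
    at \<open>a\<close> is the image under \<open>q\<close> of the compact set K \<inter>
    {..a}.\<close>
  define s where "s x = Inf (fib x)" for x
  have s: "s x \<in> K" "q (s x) = x" and s_le: "\<And>k. k \<in> K \<Longrightarrow> q k = x \<Longrightarrow> s x \<le> k" for x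
  proof -
    have bd: "bdd_below (fib x)" by (rule bounded_imp_bdd_below[OF compact_imp_bounded[OF fib(1)]])
    have "s x \<in> fib x" unfolding s_def
      by (rule closed_contains_Inf[OF fib(2) bd compact_imp_closed[OF fib(1)]])
    then show "s x \<in> K" "q (s x) = x" by (auto simp: fib_def)
    show "s x \<le> k" if "k \<in> K" "q k = x" for k
      unfolding s_def using that bd by (intro cInf_lower) (auto simp: fib_def)
  qed
  have sm: "s \<in> borel_measurable borel"
  proof (rule borel_measurableI_le)
    fix a
    have "{x. s x \<le> a} = q ` (K \<inter> {..a})"
    proof
      show "{x. s x \<le> a} \<subseteq> q ` (K \<inter> {..a})" using s by (auto intro!: image_eqI[of _ q "s x" for x])
      show "q ` (K \<inter> {..a}) \<subseteq> {x. s x \<le> a}" using s_le by force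
    qed
    moreover have "compact (q ` (K \<inter> {..a}))"
      by (intro compact_continuous_image continuous_on_subset[OF K(2)] compact_Int_closed K(1)) auto
    ultimately show "{x \<in> space borel. s x \<le> a} \<in> sets borel" by (simp add: compact_imp_closed)
  qed
  define \<nu> where "\<nu> n = distr (m n) borel s" for n
  have smn: "s \<in> measurable (m n) borel" for n using sm m(2) measurable_cong_sets by blast
  have rd: "real_distribution (\<nu> n)" for n
  proof -
    interpret prob_space "m n" by (rule m)
    show ?thesis unfolding \<nu>_def by (rule real_distribution_distr[OF smn])
  qed
  have tight: "tight \<nu>"
    unfolding tight_def
  proof (intro conjI allI impI rd)
    fix \<epsilon> :: real assume \<epsilon>: "\<epsilon> > 0"
    obtain B where B: "\<And>x. x \<in> K \<Longrightarrow> \<bar>x\<bar> \<le> B" using compact_imp_bounded[OF K(1)] unfolding bounded_iff by auto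
    have "measure (\<nu> n) {- \<bar>B\<bar> - 1<..\<bar>B\<bar>} = 1" for n
    proof -
      interpret prob_space "m n" by (rule m)
      have "s x \<in> {- \<bar>B\<bar> - 1<..\<bar>B\<bar>}" for x using B[OF s(1), of x] by auto
      then have "s -` {- \<bar>B\<bar> - 1<..\<bar>B\<bar>} \<inter> space (m n) = space (m n)" by auto
      then show ?thesis unfolding \<nu>_def by (subst measure_distr[OF smn]) (auto simp: prob_space)
    qed
    then show "\<exists>a b. a < b \<and> (\<forall>n. 1 - \<epsilon> < measure (\<nu> n) {a<..b})"
      using \<epsilon> by (intro exI[of _ "- \<bar>B\<bar> - 1"] exI[of _ "\<bar>B\<bar>"]) simp
  qed
  obtain r M where r: "strict_mono (r :: nat \<Rightarrow> nat)" and M: "real_distribution M" and w: "weak_conv_m (\<lambda>n. \<nu> (r n)) M"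
    using tight_imp_convergent_subsubsequence[OF tight strict_mono_id] by (auto simp: o_def)
  interpret M: real_distribution M by (rule M)
  have lim: "(\<lambda>n. integral\<^sup>L (\<nu> (r n)) G) \<longlonglongrightarrow> integral\<^sup>L M G" if "continuous_on UNIV G" "\<And>x. norm (G x) \<le> B" for G :: "real \<Rightarrow> real" and B
    by (rule weak_conv_imp_integral_bdd_continuous_conv[OF rd M w])
      (use that in \<open>auto simp: continuous_on_eq_continuous_at\<close>)
  have int_\<nu>: "integral\<^sup>L (\<nu> n) G = integral\<^sup>L (m n) (\<lambda>x. G (s x))" if "continuous_on UNIV G" for G :: "real \<Rightarrow> real" and n
    unfolding \<nu>_def by (rule integral_distr[OF smn]) (use that in \<open>simp add: borel_measurable_continuous_onI\<close>)
  have "K \<noteq> {}" using K(3) by auto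
  \<comment> \<open>The truncated distance to \<open>K\<close> is continuous, bounded and has
    integral 0 for every measure of the sequence, hence also for the limit.\<close>
  have aeK: "AE k in M. k \<in> K"
  proof -
    define G where "G k = min 1 (infdist k K)" for k :: real
    have Gc: "continuous_on UNIV G" unfolding G_def by (intro continuous_intros)
    have G0: "0 \<le> G k" for k by (simp add: G_def infdist_nonneg)
    have "G (s x) = 0" for x using s(1) by (simp add: G_def)
    then have "integral\<^sup>L (\<nu> (r n)) G = 0" for n using int_\<nu>[OF Gc] by simp
    moreover have G1: "norm (G k) \<le> 1" for k using G0 by (simp add: G_def)
    ultimately have "(\<lambda>n. 0) \<longlonglongrightarrow> integral\<^sup>L M G" using lim[OF Gc G1] by simp
    then have "integral\<^sup>L M G = 0" by (rule LIMSEQ_unique[OF _ tendsto_const])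
    moreover have "integrable M G"
      by (rule M.integrable_const_bound[of _ 1]) (use G1 Gc in \<open>auto simp: borel_measurable_continuous_onI\<close>)
    ultimately have "AE k in M. G k = 0" using G0 by (subst integral_nonneg_eq_0_iff_AE[symmetric]) auto
    then show ?thesis
    proof (rule AE_mp, intro AE_I2 impI)
      fix k assume "G k = 0"
      then have "infdist k K = 0" by (auto simp: G_def min_def split: if_splits)
      then show "k \<in> K" using in_closed_iff_infdist_zero[OF Kc \<open>K \<noteq> {}\<close>] by simp
    qed
  qed
  \<comment> \<open>Off \<open>K\<close>, a null set, \<open>q\<close> is unspecified; a constant
    value there makes the map measurable.\<close>
  define Q where "Q k = (if k \<in> K then q k else q (SOME k. k \<in> K))" for k
  have Qm: "Q \<in> measurable M borel"
  proof -
    have "Q \<in> measurable borel borel" unfolding Q_def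
      using borel_measurable_continuous_on_restrict[OF K(2)] Kc
      by (subst measurable_If_restrict_space_iff) (auto simp: restrict_space_def)
    then show ?thesis by (simp cong: measurable_cong_sets)
  qed
  show thesis
  proof (rule that[OF r])
    show "prob_space (distr M borel Q)" by (rule M.prob_space_distr[OF Qm])
    fix g :: "'a \<Rightarrow> real" assume g: "continuous_on UNIV g"
    obtain B where B: "\<And>x. norm (g x) \<le> B" using continuous_imp_bounded[OF g] by blast
    have B0: "0 \<le> B" using B[of undefined] norm_ge_zero order_trans by blast
    have gq: "continuous_on K (\<lambda>k. g (q k))" by (rule continuous_on_compose2[OF g K(2)]) simp
    \<comment> \<open>Weak convergence tests functions on the whole line, so g composed with
      \<open>q\<close> is extended from \<open>K\<close> by Tietze's theorem without increasing its
      bound.\<close>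
    obtain G where G: "continuous_on UNIV G" "\<And>k. k \<in> K \<Longrightarrow> G k = g (q k)" "\<And>k. norm (G k) \<le> B"
      using Tietze[OF gq, of UNIV B] Kc B B0 by auto
    have "integral\<^sup>L (\<nu> (r n)) G = integral\<^sup>L (m (r n)) g" for n
      using int_\<nu>[OF G(1)] s by (simp add: G(2))
    moreover have "integral\<^sup>L (distr M borel Q) g = integral\<^sup>L M (\<lambda>k. g (Q k))"
      by (rule integral_distr[OF Qm]) (use g in \<open>simp add: borel_measurable_continuous_onI\<close>)
    moreover have "integral\<^sup>L M (\<lambda>k. g (Q k)) = integral\<^sup>L M G"
    proof (rule integral_cong_AE)
      show "(\<lambda>k. g (Q k)) \<in> borel_measurable M"
        by (rule measurable_compose[OF Qm]) (use g in \<open>simp add: borel_measurable_continuous_onI\<close>)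
      show "G \<in> borel_measurable M" using G(1) by (simp add: borel_measurable_continuous_onI cong: measurable_cong_sets)
      show "AE k in M. g (Q k) = G k" using aeK by (rule AE_mp) (auto simp: Q_def G(2))
    qed
    ultimately show "(\<lambda>n. integral\<^sup>L (m (r n)) g) \<longlonglongrightarrow> integral\<^sup>L (distr M borel Q) g"
      using lim[OF G(1,3)] by simp
  qed simp
qed

text \<open>The argument of Krylov and Bogolyubov with varying starting points: the n-th measure is
  uniformly distributed in time on the orbit segment of \<open>x n\<close> of length n + 1. Moving
  it by a fixed time changes integrals by O(1/n), so a weak limit is invariant, and the lower bound
  on the absolute averages survives in the limit.\<close>

lemma invariant_measure_of_averages:
  fixes f :: "'a \<Rightarrow> real"
  assumes T: "continuous_on (UNIV \<times> UNIV) (\<lambda>p. T (fst p) (snd p))" "\<And>s t. T (s + t) = T s \<circ> T t"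
    and f: "continuous_on UNIV f"
    and av: "\<And>n. 1 \<le> \<bar>(1 / Suc n) * integral {0..real (Suc n)} (\<lambda>t. f (T t (x n)))\<bar>"
  obtains \<mu> where "invariant_borel_prob T \<mu>" "1 \<le> \<bar>integral\<^sup>L \<mu> f\<bar>"
proof -
  have Tx: "continuous_on UNIV (\<lambda>t. T t x)" for x
    by (rule continuous_on_Times_section[OF T(1)]) simp
  have Tt: "continuous_on UNIV (T t)" for t
    using continuous_on_Times_section[OF continuous_on_Times_swap[OF T(1)], of t] by simp
  define m where "m n = distr (uniform_measure lborel {0..real (Suc n)}) borel (\<lambda>t. T t (x n))" for n
  have Txm: "(\<lambda>t. T t (x n)) \<in> measurable (uniform_measure lborel {0..real (Suc n)}) borel" for n
    using borel_measurable_continuous_onI[OF Tx] by (simp cong: measurable_cong_sets)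
  have m: "prob_space (m n)" "sets (m n) = sets borel" for n
    unfolding m_def using time_average_integral(1)[of "real (Suc n)" "\<lambda>_. 0"] Txm by (auto intro!: prob_space.prob_space_distr)
  have mint: "integral\<^sup>L (m n) g = (1 / Suc n) * integral {0..real (Suc n)} (\<lambda>t. g (T t (x n)))"
    if g: "continuous_on UNIV g" for g :: "'a \<Rightarrow> real" and n
  proof -
    have "integral\<^sup>L (m n) g = integral\<^sup>L (uniform_measure lborel {0..real (Suc n)}) (\<lambda>t. g (T t (x n)))"
      unfolding m_def by (rule integral_distr[OF Txm]) (use g in \<open>simp add: borel_measurable_continuous_onI\<close>)
    also have "\<dots> = (1 / Suc n) * integral {0..real (Suc n)} (\<lambda>t. g (T t (x n)))"
      by (rule time_average_integral(2)) (auto intro: continuous_on_compose2[OF g Tx])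
    finally show ?thesis .
  qed
  obtain r \<mu> where r: "strict_mono (r :: nat \<Rightarrow> nat)" and \<mu>: "prob_space \<mu>" "sets \<mu> = sets borel"
    and lim: "\<And>g :: 'a \<Rightarrow> real. continuous_on UNIV g \<Longrightarrow> (\<lambda>n. integral\<^sup>L (m (r n)) g) \<longlonglongrightarrow> integral\<^sup>L \<mu> g"
    using weak_limit_of_measures[of m, OF m] by blast
  have T\<mu>: "T \<tau> \<in> measurable \<mu> \<mu>" for \<tau>
    using borel_measurable_continuous_onI[OF Tt] \<mu>(2) by (simp cong: measurable_cong_sets)
  have inv: "integral\<^sup>L \<mu> (\<lambda>x. g (T \<tau> x)) = integral\<^sup>L \<mu> g" if g: "continuous_on UNIV g" for g :: "'a \<Rightarrow> real" and \<tau>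
  proof -
    obtain C where C: "\<And>x. norm (g x) \<le> C" using continuous_imp_bounded[OF g] by blast
    have gT: "continuous_on UNIV (\<lambda>x. g (T \<tau> x))" by (rule continuous_on_compose2[OF g Tt]) simp
    have "\<bar>integral\<^sup>L (m n) (\<lambda>x. g (T \<tau> x)) - integral\<^sup>L (m n) g\<bar> \<le> 2 * C * \<bar>\<tau>\<bar> * (1 / real (Suc n))" for n
    proof -
      have "T \<tau> (T t y) = T (t + \<tau>) y" for t y using T(2)[of \<tau> t] by (simp add: add.commute)
      then have "integral\<^sup>L (m n) (\<lambda>x. g (T \<tau> x)) - integral\<^sup>L (m n) g =
          (1 / Suc n) * (integral {0..real (Suc n)} (\<lambda>t. g (T (t + \<tau>) (x n))) - integral {0..real (Suc n)} (\<lambda>t. g (T t (x n))))"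
        unfolding mint[OF gT] mint[OF g] by (simp add: right_diff_distrib)
      also have "\<bar>\<dots>\<bar> \<le> (1 / Suc n) * (2 * C * \<bar>\<tau>\<bar>)"
        unfolding abs_mult using integral_shift_bound[of "\<lambda>t. g (T t (x n))" C "real (Suc n)" \<tau>] C continuous_on_compose2[OF g Tx]
        by (intro mult_mono) auto
      finally show ?thesis by (simp add: mult_ac)
    qed
    then have bd: "norm (integral\<^sup>L (m (r n)) (\<lambda>x. g (T \<tau> x)) - integral\<^sup>L (m (r n)) g) \<le> 2 * C * \<bar>\<tau>\<bar> * (1 / real (Suc (r n)))" for n
      by simp
    have "(\<lambda>n. 1 / real (Suc (r n))) \<longlonglongrightarrow> 0"
      using LIMSEQ_subseq_LIMSEQ[OF LIMSEQ_inverse_real_of_nat r] by (simp add: o_def inverse_eq_divide)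
    then have "(\<lambda>n. 2 * C * \<bar>\<tau>\<bar> * (1 / real (Suc (r n)))) \<longlonglongrightarrow> 0" by (rule tendsto_mult_right_zero)
    then have "(\<lambda>n. integral\<^sup>L (m (r n)) (\<lambda>x. g (T \<tau> x)) - integral\<^sup>L (m (r n)) g) \<longlonglongrightarrow> 0"
      by (rule Lim_null_comparison[OF always_eventually, rotated]) (rule allI, rule bd)
    moreover have "(\<lambda>n. integral\<^sup>L (m (r n)) (\<lambda>x. g (T \<tau> x)) - integral\<^sup>L (m (r n)) g) \<longlonglongrightarrow> integral\<^sup>L \<mu> (\<lambda>x. g (T \<tau> x)) - integral\<^sup>L \<mu> g"
      by (intro tendsto_diff lim g gT)
    ultimately show ?thesis using LIMSEQ_unique by fastforce
  qed
  have "distr \<mu> \<mu> (T \<tau>) = \<mu>" for \<tau>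
  proof (rule measure_eqI_continuous)
    interpret prob_space \<mu> by (rule \<mu>)
    show "prob_space (distr \<mu> \<mu> (T \<tau>))" by (rule prob_space_distr[OF T\<mu>])
    fix g :: "'a \<Rightarrow> real" assume g: "continuous_on UNIV g"
    have gm: "g \<in> borel_measurable \<mu>" using borel_measurable_continuous_onI[OF g] \<mu>(2) measurable_cong_sets by blast
    show "integral\<^sup>L (distr \<mu> \<mu> (T \<tau>)) g = integral\<^sup>L \<mu> g"
      using integral_distr[OF T\<mu> gm] inv[OF g] by simp
  qed (use \<mu> in auto)
  then have "invariant_borel_prob T \<mu>" using \<mu> T\<mu> by (simp add: invariant_borel_prob_def)
  moreover have "1 \<le> \<bar>integral\<^sup>L \<mu> f\<bar>"
  proof (rule tendsto_lowerbound[OF tendsto_rabs[OF lim[OF f]]])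
    show "\<forall>\<^sub>F n in sequentially. 1 \<le> \<bar>integral\<^sup>L (m (r n)) f\<bar>"
      using av by (intro always_eventually allI) (simp add: mint[OF f])
  qed simp
  ultimately show thesis by (rule that)
qed

end

section \<open>Averaging along a flow\<close>

text \<open>The weight \<open>1 - s / N\<close> is chosen so that the derivative along the flow is the average minus the
  value, which makes \<open>\<beta>\<close> plus an exact form equal to the average.\<close>

lemma weighted_average_derivative:
  fixes h :: "real \<Rightarrow> real"
  assumes h: "continuous_on UNIV h" and N: "0 < N"
  shows "((\<lambda>t. integral {0..N} (\<lambda>s. (1 - s / N) * h (s + t))) has_real_derivative (1 / N) * integral {0..N} h - h 0) (at 0)"
proof -
  define P where "P = prim h"
  have P: "(P has_real_derivative h t) (at t)" for t
    unfolding P_def using prim_has_vector_derivative[OF h] by (simp add: has_real_derivative_iff_has_vector_derivative)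
  have Pc: "continuous_on UNIV P" using DERIV_isCont[OF P] by (simp add: continuous_at_imp_continuous_on)
  define R where "R = prim P"
  have R: "(R has_real_derivative P t) (at t)" for t
    unfolding R_def using prim_has_vector_derivative[OF Pc] by (simp add: has_real_derivative_iff_has_vector_derivative)
  have int: "integral {0..N} (\<lambda>s. (1 - s / N) * h (s + t)) = (R (N + t) - R t) / N - P t" for t
  proof -
    \<comment> \<open>Integration by parts: \<open>P\<close> is a primitive of \<open>h\<close> and
      \<open>R\<close> one of \<open>P\<close>. The boundary terms are then easy to differentiate in
      \<open>t\<close>, without differentiating \<open>h\<close>.\<close>
    have "((\<lambda>s. (1 - s / N) * P (s + t) + R (s + t) / N) has_real_derivative (1 - s / N) * h (s + t)) (at s)" for s
      using N by (auto intro!: derivative_eq_intros DERIV_chain2[OF P] DERIV_chain2[OF R])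
    then have "((\<lambda>s. (1 - s / N) * h (s + t)) has_integral
        ((1 - N / N) * P (N + t) + R (N + t) / N) - ((1 - 0 / N) * P (0 + t) + R (0 + t) / N)) {0..N}"
      using N by (intro fundamental_theorem_of_calculus)
        (auto simp: has_real_derivative_iff_has_vector_derivative[symmetric] intro: has_field_derivative_at_within)
    from integral_unique[OF this] show ?thesis using N by (simp add: diff_divide_distrib)
  qed
  have hN: "integral {0..N} h = P N - P 0"
    using N P by (intro integral_unique fundamental_theorem_of_calculus)
      (auto simp: has_real_derivative_iff_has_vector_derivative[symmetric] intro: has_field_derivative_at_within)
  have "((\<lambda>t. (R (N + t) - R t) / N - P t) has_real_derivative (P (N + 0) - P 0) / N - h 0) (at 0)"
    using N by (auto intro!: derivative_eq_intros DERIV_chain2[OF R] R P)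
  then show ?thesis unfolding int hN by simp
qed

context closed_smooth_manifold
begin

lemma smooth_fun_continuous:
  assumes "smooth_fun A f"
  shows "continuous_on UNIV f"
proof (rule continuous_at_imp_continuous_on, rule ballI)
  fix x
  obtain c where c: "c \<in> A" "x \<in> cdom c" by (rule chart_at)
  have "continuous_on (cdom c) (\<lambda>x. f (cinv c (cmap c x)))"
    by (rule continuous_on_compose2[OF smooth_on_imp_continuous[OF smooth_fun_chart[OF assms c(1)]] continuous_on_cmap[OF c(1)]])
      (use cmap_in[OF c(1)] in auto)
  then have "continuous_on (cdom c) f" by (rule continuous_on_eq) (simp add: cinv_cmap[OF c(1)])
  then show "isCont f x" using c open_cdom[OF c(1)] by (simp add: continuous_on_eq_continuous_at)
qed

lemma smooth_fun_lincomb: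
  assumes "smooth_fun A f" "smooth_fun A g"
  shows "smooth_fun A (\<lambda>x. r * f x + s * g x)"
    and "c \<in> A \<Longrightarrow> y \<in> cimg c \<Longrightarrow> ext_d0 (\<lambda>x. r * f x + s * g x) c y \<xi> = r * ext_d0 f c y \<xi> + s * ext_d0 g c y \<xi>"
proof -
  show "smooth_fun A (\<lambda>x. r * f x + s * g x)"
    unfolding smooth_fun_def by (intro ballI smooth_intros smooth_fun_chart assms)
  assume c: "c \<in> A" "y \<in> cimg c"
  have "((\<lambda>y. r * f (cinv c y) + s * g (cinv c y)) has_derivative (\<lambda>\<xi>. r * ext_d0 f c y \<xi> + s * ext_d0 g c y \<xi>)) (at y)"
    by (intro has_derivative_add has_derivative_mult_right ext_d0_has_derivative assms c)
  from fun_cong[OF frechet_derivative_at[OF this], of \<xi>]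
  show "ext_d0 (\<lambda>x. r * f x + s * g x) c y \<xi> = r * ext_d0 f c y \<xi> + s * ext_d0 g c y \<xi>"
    by (simp add: ext_d0_def)
qed

text \<open>By the group law, moving the base point along its orbit only shifts the time argument of
  the integrand, so the derivative of \<open>G\<close> along the field is the one found in
  \<open>weighted_average_derivative\<close>.\<close>

lemma averaging:
  assumes f: "smooth_fun A f" and u: "vector_field u" and T: "smooth_family UNIV T" "T 0 = id" "\<And>s t. T (s + t) = T s \<circ> T t"
    "\<And>x. integral_curve u UNIV (\<lambda>t. T t x)" and N: "0 < N"
  obtains G where "smooth_fun A G"
    "\<And>x. form_apply A (ext_d0 G) u x = (1 / N) * integral {0..N} (\<lambda>s. f (T s x)) - f x"
proof -
  define G where "G x = integral {0..N} (\<lambda>s. (1 - s / N) * f (T s x))" for x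
  have G: "smooth_fun A G"
    unfolding smooth_fun_def G_def
  proof
    fix c assume c: "c \<in> A"
    have S: "thick ({0..N} \<times> cimg c)" by (rule thick_Times[OF thick_Icc[OF N] thick_open[OF open_cimg[OF c]]])
    have "smooth_into (UNIV \<times> cimg c) (\<lambda>p. T (fst p) (cinv c (snd p)))"
      using T(1) c by (simp add: smooth_family_def)
    then have "smooth_into ({0..N} \<times> cimg c) (\<lambda>p. T (fst p) (cinv c (snd p)))"
      by (rule smooth_into_subset) auto
    then have "smooth_on ({0..N} \<times> cimg c) (\<lambda>p. (1 - fst p * (1 / N)) * f (T (fst p) (cinv c (snd p))))"
      by (intro smooth_intros smooth_fun_comp[OF S _ f])
    then have "smooth_on ({0..N} \<times> cimg c) (\<lambda>p. (1 - fst p / N) * f (T (fst p) (cinv c (snd p))))" by simp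
    then show "smooth_on (cimg c) (\<lambda>y. integral {0..N} (\<lambda>s. (1 - s / N) * f (T s (cinv c y))))"
      by (rule smooth_on_integral[OF open_cimg[OF c]])
  qed
  show thesis
  proof (rule that[OF G])
    fix x
    have "continuous_on UNIV (\<lambda>t. T t x)"
      by (rule continuous_on_Times_section[OF smooth_family_continuous[OF T(1)]]) simp
    then have hc: "continuous_on UNIV (\<lambda>t. f (T t x))"
      by (rule continuous_on_compose2[OF smooth_fun_continuous[OF f]]) simp
    have "T s (T t x) = T (s + t) x" for s t using T(3) by simp
    then have "((\<lambda>t. G (T t x)) has_real_derivative (1 / N) * integral {0..N} (\<lambda>s. f (T s x)) - f (T 0 x)) (at 0)"
      unfolding G_def using weighted_average_derivative[OF hc N] by simp
    moreover have "((\<lambda>t. G (T t x)) has_real_derivative form_apply A (ext_d0 G) u (T 0 x)) (at 0)"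
      by (rule smooth_fun_along_curve[OF G u T(4)])
    ultimately show "form_apply A (ext_d0 G) u x = (1 / N) * integral {0..N} (\<lambda>s. f (T s x)) - f x"
      using DERIV_unique T(2) by fastforce
  qed
qed

lemma smooth_map_comp:
  assumes "smooth_map A f" "smooth_map A g"
  shows "smooth_map A (f \<circ> g)"
proof -
  have "smooth_family (UNIV :: real set) (\<lambda>t. f \<circ> g)"
    unfolding smooth_family_def
  proof
    fix c assume c: "c \<in> A"
    have S: "thick ((UNIV :: real set) \<times> cimg c)" by (rule thick_Times[OF thick_UNIV thick_open[OF open_cimg[OF c]]])
    have "smooth_into ((UNIV :: real set) \<times> cimg c) (\<lambda>p. cinv c (snd p))"
      by (rule smooth_into_cinv_comp[OF c]) (auto intro: smooth_intros)
    from smooth_into_map[OF assms(1) smooth_into_map[OF assms(2) this S] S]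
    show "smooth_into ((UNIV :: real set) \<times> cimg c) (\<lambda>p. (f \<circ> g) (cinv c (snd p)))" by simp
  qed
  from smooth_map_of_family[OF this, of 0] show ?thesis by simp
qed

end

section \<open>Concatenation of a symplectic path with a flow\<close>

lemma step_function:
  obtains \<sigma> :: "real \<Rightarrow> real" where "smooth_on UNIV \<sigma>" "\<And>t. t \<le> 1/2 \<Longrightarrow> \<sigma> t = 0" "\<sigma> 1 = 1" "\<And>t. 0 \<le> \<sigma> t" "\<And>t. t \<le> 1 \<Longrightarrow> \<sigma> t \<le> 1"
proof
  define e where "e = expinv 0 (1/2)"
  have e: "e > 0" unfolding e_def by (rule expinv_pos) simp
  show "smooth_on UNIV (\<lambda>t. expinv 0 (t - 1/2) * (1 / e))"
    by (intro smooth_on_mult smooth_on_const smooth_on_compose[OF smooth_on_expinv] smooth_on_diff smooth_on_id) simp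
  show "t \<le> 1/2 \<Longrightarrow> expinv 0 (t - 1/2) * (1 / e) = 0" for t by (simp add: expinv_0)
  show "expinv 0 (1 - 1/2) * (1 / e) = 1" using e by (simp add: e_def)
  show "0 \<le> expinv 0 (t - 1/2) * (1 / e)" for t using e expinv_nonneg by simp
  show "expinv 0 (t - 1/2) * (1 / e) \<le> 1" if "t \<le> 1" for t
  proof -
    have "expinv 0 (t - 1/2) \<le> e"
    proof (cases "t > 1/2")
      case True
      then have "2 \<le> 1 / (t - 1/2)" using that by (simp add: field_simps)
      then show ?thesis using True by (simp add: expinv_def e_def divide_left_mono)
    next
      case False
      then show ?thesis using e by (simp add: expinv_0)
    qed
    then show ?thesis using e by (simp add: field_simps)
  qed
qed

context closed_symplectic_manifold
begin

lemma symplectomorphism_comp: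
  assumes f: "symplectomorphism A \<omega> f" and g: "symplectomorphism A \<omega> g"
  shows "symplectomorphism A \<omega> (f \<circ> g)"
proof -
  have d: "bij f" "smooth_map A f" "smooth_map A (inv f)" "bij g" "smooth_map A g" "smooth_map A (inv g)"
    using f g by (auto simp: symplectomorphism_def diffeomorphism_def)
  have "diffeomorphism A (f \<circ> g)"
    unfolding diffeomorphism_def using d by (simp add: bij_comp smooth_map_comp o_inv_distrib)
  moreover have "\<omega> d (local_rep c d (f \<circ> g) y) (frechet_derivative (local_rep c d (f \<circ> g)) (at y) \<xi>)
      (frechet_derivative (local_rep c d (f \<circ> g)) (at y) \<eta>) = \<omega> c y \<xi> \<eta>"
    if cd: "c \<in> A" "d \<in> A" and y: "y \<in> rep_dom c d (f \<circ> g)" for c d y \<xi> \<eta>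
  proof -
    obtain b where b: "b \<in> A" "g (cinv c y) \<in> cdom b" by (rule chart_at)
    have yb: "y \<in> rep_dom c b g" using y b by (simp add: rep_dom_def)
    define z where "z = local_rep c b g y"
    have z: "z \<in> rep_dom b d f" using y b by (simp add: rep_dom_def z_def local_rep_def cmap_in cinv_cmap)
    have eq: "local_rep b d f (local_rep c b g y') = local_rep c d (f \<circ> g) y'" if "y' \<in> rep_dom c b g" for y'
      using that b by (simp add: rep_dom_def local_rep_def cinv_cmap)
    have gc: "continuous_on UNIV g" using d by (simp add: smooth_map_def)
    have "(local_rep b d f \<circ> local_rep c b g has_derivative
        frechet_derivative (local_rep b d f) (at z) \<circ> frechet_derivative (local_rep c b g) (at y)) (at y)"
      unfolding z_def by (intro diff_chain_at local_rep_has_derivative d cd b yb z[unfolded z_def])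
    then have "(local_rep c d (f \<circ> g) has_derivative
        frechet_derivative (local_rep b d f) (at z) \<circ> frechet_derivative (local_rep c b g) (at y)) (at y)"
      by (rule has_derivative_transform_within_open[OF _ open_rep_dom[OF gc cd(1) b(1)] yb]) (simp add: eq)
    from fun_cong[OF frechet_derivative_at[OF this], symmetric]
    have D: "frechet_derivative (local_rep c d (f \<circ> g)) (at y) v =
        frechet_derivative (local_rep b d f) (at z) (frechet_derivative (local_rep c b g) (at y) v)" for v by simp
    show ?thesis
      unfolding D eq[OF yb, symmetric]
      using symplecto_pullback[OF f b(1) cd(2) z] symplecto_pullback[OF g cd(1) b(1) yb] by (simp add: z_def)
  qed
  ultimately show ?thesis unfolding symplectomorphism_def by blast
qed

lemma path_velocity_has_vector_derivative:
  assumes \<psi>: "symplectic_path A \<omega> \<psi>" and t: "t \<in> {0..1}" and c: "c \<in> A" and z: "z \<in> cimg c"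
  shows "((\<lambda>s. cmap c (\<psi> s (inv (\<psi> t) (cinv c z)))) has_vector_derivative path_velocity \<psi> t c z) (at t within {0..1})"
proof -
  obtain b y where b: "b \<in> A" "(t, y) \<in> pdom \<psi> b c" "local_rep b c (\<psi> t) y = z" "inv (\<psi> t) (cinv c z) \<in> cdom b"
    "y = cmap b (inv (\<psi> t) (cinv c z))"
    using path_preimage[OF \<psi> t c z] by metis
  have "cinv b y = inv (\<psi> t) (cinv c z)" using b by (simp add: cinv_cmap)
  then show ?thesis using path_velocity_prep(2)[OF \<psi> b(1) c b(2)] b(3) by (simp add: local_rep_def)
qed

text \<open>The velocity can be computed from any curve that agrees with the path near the given
  time; this treats the two halves of a concatenation separately.\<close>

lemma path_velocity_eqI:
  assumes \<psi>: "symplectic_path A \<omega> \<psi>" and t: "t \<in> {0..1}" and c: "c \<in> A" and z: "z \<in> cimg c"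
    and V: "open V" "t \<in> V" and eq: "\<And>s. s \<in> {0..1} \<inter> V \<Longrightarrow> \<psi> s (inv (\<psi> t) (cinv c z)) = \<gamma> s"
    and \<gamma>: "((\<lambda>s. cmap c (\<gamma> s)) has_vector_derivative w) (at t within {0..1})"
  shows "path_velocity \<psi> t c z = w"
proof -
  have "((\<lambda>s. cmap c (\<gamma> s)) has_vector_derivative w) (at t within {0..1} \<inter> V)"
    using \<gamma> by (simp only: at_within_Int_open[OF V])
  then have "((\<lambda>s. cmap c (\<psi> s (inv (\<psi> t) (cinv c z)))) has_vector_derivative w) (at t within {0..1} \<inter> V)"
    by (rule has_vector_derivative_transform[rotated 2]) (use t V eq in auto)
  then have "((\<lambda>s. cmap c (\<psi> s (inv (\<psi> t) (cinv c z)))) has_vector_derivative w) (at t within {0..1})"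
    by (simp only: at_within_Int_open[OF V])
  with path_velocity_has_vector_derivative[OF \<psi> t c z] show ?thesis
    using t by (intro vector_derivative_unique_within_closed_interval[of 0 1 t]) auto
qed

text \<open>The path \<open>\<psi>\<close> is followed during the first half of the time interval and the flow \<open>T\<close> of
  \<open>sharp \<beta>\<close> during the second half; \<open>\<sigma>\<close> makes the concatenation smooth. Its flux form is the sum of
  both flux forms on the nose, so that no homotopy invariance is needed.\<close>

lemma concatenation:
  assumes \<psi>: "symplectic_path A \<omega> \<psi>" "\<psi> 0 = id" and \<beta>: "closed_one_form A \<beta>"
    and T: "smooth_family UNIV T" "T 0 = id" "\<And>s t. T (s + t) = T s \<circ> T t" "\<And>x. integral_curve (sharp \<beta>) UNIV (\<lambda>t. T t x)"
  obtains \<Psi> where "symplectic_path A \<omega> \<Psi>" "\<Psi> 0 = id" "\<Psi> 1 = T 1 \<circ> \<psi> 1"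
    "\<And>c z \<xi>. c \<in> A \<Longrightarrow> z \<in> cimg c \<Longrightarrow> flux_form \<Psi> c z \<xi> = flux_form \<psi> c z \<xi> + \<beta> c z \<xi>"
proof -
  obtain \<sigma> :: "real \<Rightarrow> real" where \<sigma>: "smooth_on UNIV \<sigma>" "\<And>t. t \<le> 1/2 \<Longrightarrow> \<sigma> t = 0" "\<sigma> 1 = 1" "\<And>t. 0 \<le> \<sigma> t" "\<And>t. t \<le> 1 \<Longrightarrow> \<sigma> t \<le> 1"
    using step_function by blast
  \<comment> \<open>\<sigma> read backwards: \<tau> goes from 0 to 1 in the first half and stays at
    1, while \<sigma> stays at 0 and goes to 1 in the second half.\<close>
  define \<tau> where "\<tau> t = 1 - \<sigma> (1 - t)" for t
  have \<tau>s: "smooth_on UNIV \<tau>" unfolding \<tau>_def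
    by (intro smooth_on_diff smooth_on_const smooth_on_compose[OF \<sigma>(1)] smooth_on_id) simp
  have \<tau>1: "\<tau> t = 1" if "1/2 \<le> t" for t using \<sigma>(2)[of "1 - t"] that by (simp add: \<tau>_def)
  have \<tau>0: "\<tau> 0 = 0" using \<sigma>(3) by (simp add: \<tau>_def)
  have \<tau>I: "\<tau> t \<in> {0..1}" if "0 \<le> t" for t using \<sigma>(4,5)[of "1 - t"] that by (simp add: \<tau>_def)
  have der: "\<exists>h'. \<forall>t. (h has_real_derivative h' t) (at t)" if "smooth_on UNIV h" for h :: "real \<Rightarrow> real"
  proof -
    have "(h has_real_derivative frechet_derivative h (at t) 1) (at t)" for t
    proof -
      have d: "(h has_derivative frechet_derivative h (at t)) (at t)" by (rule smooth_on_open_derivative(1)[OF open_UNIV that]) simp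
      have e: "frechet_derivative h (at t) r = r * frechet_derivative h (at t) 1" for r
        using linear_cmul[OF bounded_linear.linear[OF has_derivative_bounded_linear[OF d]], of r 1] by simp
      have "frechet_derivative h (at t) = (*) (frechet_derivative h (at t) 1)"
        by (rule ext, rule trans[OF e mult.commute])
      with d show ?thesis by (simp only: has_field_derivative_def)
    qed
    then show ?thesis by (intro exI[of _ "\<lambda>t. frechet_derivative h (at t) 1"]) simp
  qed
  obtain \<sigma>' where \<sigma>': "\<And>t. (\<sigma> has_real_derivative \<sigma>' t) (at t)" using der[OF \<sigma>(1)] by blast
  obtain \<tau>' where \<tau>': "\<And>t. (\<tau> has_real_derivative \<tau>' t) (at t)" using der[OF \<tau>s] by blast
  define \<Psi> where "\<Psi> t = T (\<sigma> t) \<circ> \<psi> (\<tau> t)" for t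
  have \<psi>f: "smooth_family {0..1} \<psi>" "\<And>t. t \<in> {0..1} \<Longrightarrow> symplectomorphism A \<omega> (\<psi> t)"
    using \<psi>(1) by (auto simp: symplectic_path_family)
  have "smooth_family {0..1} (\<lambda>t x. T (\<sigma> t) (\<psi> (\<tau> t) x))"
  proof (rule smooth_family_comp_family[OF _ T(1)])
    show "thick {0..1::real}" by (rule thick_Icc) simp
    show "smooth_on {0..1} \<sigma>" by (rule smooth_on_subset[OF \<sigma>(1)]) simp
    show "smooth_family {0..1} (\<lambda>t. \<psi> (\<tau> t))"
      by (rule smooth_family_const_compose[OF \<psi>f(1) smooth_on_subset[OF \<tau>s subset_UNIV]], rule image_subsetI, rule \<tau>I) simp
  qed simp
  then have "smooth_family {0..1} \<Psi>" by (simp add: \<Psi>_def[abs_def] o_def)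
  moreover have "symplectomorphism A \<omega> (\<Psi> t)" if "t \<in> {0..1}" for t
  proof -
    have "\<tau> t \<in> {0..1}" using that by (intro \<tau>I) simp
    from symplectomorphism_comp[OF closed_form_flow_symplectic[OF \<beta> T] \<psi>f(2)[OF this]]
    show ?thesis by (simp only: \<Psi>_def)
  qed
  ultimately have \<Psi>: "symplectic_path A \<omega> \<Psi>" by (simp add: symplectic_path_family)
  have sTinv: "T (\<sigma> t) x = x" if "t \<le> 1/2" for t x using \<sigma>(2)[OF that] T(2) by simp
  show thesis
  proof (rule that[OF \<Psi>])
    show "\<Psi> 0 = id" using \<sigma>(2)[of 0] \<tau>0 T(2) \<psi>(2) by (simp add: \<Psi>_def)
    show "\<Psi> 1 = T 1 \<circ> \<psi> 1" using \<sigma>(3) \<tau>1[of 1] by (simp add: \<Psi>_def)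
    fix c z \<xi> assume c: "c \<in> A" and z: "z \<in> cimg c"
    have v1: "path_velocity \<Psi> t c z = \<tau>' t *\<^sub>R path_velocity \<psi> (\<tau> t) c z" if t: "0 \<le> t" "t < 1/2" for t
    proof (rule path_velocity_eqI[OF \<Psi> _ c z, of t "{..<1/2}" "\<lambda>s. \<psi> (\<tau> s) (inv (\<psi> (\<tau> t)) (cinv c z))"])
      have "\<Psi> t = \<psi> (\<tau> t)" using sTinv t by (auto simp: \<Psi>_def)
      then show "\<Psi> s (inv (\<Psi> t) (cinv c z)) = \<psi> (\<tau> s) (inv (\<psi> (\<tau> t)) (cinv c z))" if "s \<in> {0..1} \<inter> {..<1/2}" for s
        using that sTinv by (simp add: \<Psi>_def)
      have \<tau>v: "(\<tau> has_vector_derivative \<tau>' t) (at t within {0..1})"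
        using \<tau>'[of t] by (simp add: has_real_derivative_iff_has_vector_derivative has_vector_derivative_at_within)
      have "((\<lambda>s. cmap c (\<psi> s (inv (\<psi> (\<tau> t)) (cinv c z)))) has_vector_derivative path_velocity \<psi> (\<tau> t) c z) (at (\<tau> t) within \<tau> ` {0..1})"
        by (rule has_vector_derivative_within_subset[OF path_velocity_has_vector_derivative[OF \<psi>(1) \<tau>I[OF t(1)] c z]],
            rule image_subsetI, rule \<tau>I) simp
      from vector_diff_chain_within[OF \<tau>v this]
      show "((\<lambda>s. cmap c (\<psi> (\<tau> s) (inv (\<psi> (\<tau> t)) (cinv c z)))) has_vector_derivative \<tau>' t *\<^sub>R path_velocity \<psi> (\<tau> t) c z) (at t within {0..1})"
        by (simp add: o_def)
    qed (use t in auto)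
    have v2: "path_velocity \<Psi> t c z = \<sigma>' t *\<^sub>R sharp \<beta> c z" if t: "1/2 < t" "t \<le> 1" for t
    proof -
      define x where "x = inv (\<Psi> t) (cinv c z)"
      \<comment> \<open>In the second half \<psi> has already reached its end, so the orbit through
        \<open>x\<close> is moved by the flow \<open>T\<close> alone, starting from
        \<open>w\<close>.\<close>
      define w where "w = \<psi> 1 x"
      have bij: "bij (\<Psi> t)" using symplecto_bij path_symplecto[OF \<Psi>] t by simp
      have "\<Psi> t x = cinv c z" unfolding x_def using bij by (simp add: bij_is_surj surj_f_inv_f)
      then have Tw: "T (\<sigma> t) w = cinv c z" using \<tau>1[of t] t by (simp add: \<Psi>_def w_def)
      show ?thesis
      proof (rule path_velocity_eqI[OF \<Psi> _ c z, of t "{1/2<..}" "\<lambda>s. T (\<sigma> s) w"])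
        show "\<Psi> s (inv (\<Psi> t) (cinv c z)) = T (\<sigma> s) w" if "s \<in> {0..1} \<inter> {1/2<..}" for s
          using that \<tau>1[of s] by (simp add: \<Psi>_def w_def x_def)
        have \<sigma>v: "(\<sigma> has_vector_derivative \<sigma>' t) (at t)"
          using \<sigma>'[of t] by (simp add: has_real_derivative_iff_has_vector_derivative)
        have "T (\<sigma> t) w \<in> cdom c" using Tw cinv_in[OF c z] by simp
        then have "((\<lambda>s. cmap c (T s w)) has_vector_derivative sharp \<beta> c (cmap c (T (\<sigma> t) w))) (at (\<sigma> t))"
          using T(4)[of w] c by (simp add: integral_curve_def)
        then have "((\<lambda>s. cmap c (T s w)) has_vector_derivative sharp \<beta> c z) (at (\<sigma> t))"
          using Tw cmap_cinv[OF c z] by simp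
        from vector_diff_chain_at[OF \<sigma>v this]
        show "((\<lambda>s. cmap c (T (\<sigma> s) w)) has_vector_derivative \<sigma>' t *\<^sub>R sharp \<beta> c z) (at t within {0..1})"
          by (simp add: o_def has_vector_derivative_at_within)
      qed (use t in auto)
    qed
    have l: "\<omega> c z (r *\<^sub>R v) \<xi> = r * \<omega> c z v \<xi>" for r v using linear_cmul[OF omega_linear(2)[OF c z]] by simp
    have "linear (\<beta> c z)" using \<beta> c z unfolding closed_one_form_def one_form_def by blast
    then have b: "\<omega> c z (sharp \<beta> c z) \<xi> = \<beta> c z \<xi>" by (rule omega_sharp[where \<alpha>=\<beta>, OF c z])
    define L where "L t = interior_product (path_velocity \<psi> t) \<omega> c z \<xi>" for t
    have Lc: "continuous_on {0..1} L" unfolding L_def by (rule path_form_continuous[OF \<psi>(1) c z])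
    let ?k = "\<lambda>t. interior_product (path_velocity \<Psi> t) \<omega> c z \<xi>"
    \<comment> \<open>Substitution r = \<tau>(t): reparametrising the path in time does not change
      the integral of its 1-forms.\<close>
    have "((\<lambda>t. \<tau>' t * L (\<tau> t)) has_integral (integral {0..\<tau> (1/2)} L - integral {0..\<tau> 0} L)) {0..1/2}"
    proof (rule fundamental_theorem_of_calculus)
      fix t :: real assume t: "t \<in> {0..1/2}"
      have \<tau>v: "(\<tau> has_vector_derivative \<tau>' t) (at t within {0..1/2})"
        using \<tau>'[of t] by (simp add: has_real_derivative_iff_has_vector_derivative has_vector_derivative_at_within)
      have "((\<lambda>r. integral {0..r} L) has_vector_derivative L (\<tau> t)) (at (\<tau> t) within \<tau> ` {0..1/2})"
      proof (rule has_vector_derivative_within_subset[OF integral_has_vector_derivative[OF Lc \<tau>I]])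
        show "0 \<le> t" using t by simp
        show "\<tau> ` {0..1/2} \<subseteq> {0..1}" by (rule image_subsetI, rule \<tau>I) simp
      qed
      from vector_diff_chain_within[OF \<tau>v this]
      show "((\<lambda>t. integral {0..\<tau> t} L) has_vector_derivative \<tau>' t * L (\<tau> t)) (at t within {0..1/2})" by (simp add: o_def)
    qed simp
    then have "((\<lambda>t. \<tau>' t * L (\<tau> t)) has_integral integral {0..1} L) {0..1/2}" using \<tau>1[of "1/2"] \<tau>0 by simp
    then have i1: "(?k has_integral integral {0..1} L) {0..1/2}"
    \<comment> \<open>The velocity was computed on either side of t = 1/2 only; one point does not
      affect the integral.\<close>
    proof (rule has_integral_spike_finite[of "{1/2}", rotated 2])
      show "?k t = \<tau>' t * L (\<tau> t)" if "t \<in> {0..1/2} - {1/2}" for t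
        using v1[of t] that by (auto simp: interior_product_def L_def l)
    qed simp
    have "((\<lambda>t. \<sigma>' t * \<beta> c z \<xi>) has_integral (\<sigma> 1 * \<beta> c z \<xi> - \<sigma> (1/2) * \<beta> c z \<xi>)) {1/2..1}"
    proof (rule fundamental_theorem_of_calculus)
      fix t :: real
      have "((\<lambda>t. \<sigma> t * \<beta> c z \<xi>) has_real_derivative \<sigma>' t * \<beta> c z \<xi>) (at t)" by (rule DERIV_cmult_right[OF \<sigma>'])
      then show "((\<lambda>t. \<sigma> t * \<beta> c z \<xi>) has_vector_derivative \<sigma>' t * \<beta> c z \<xi>) (at t within {1/2..1})"
        by (simp add: has_real_derivative_iff_has_vector_derivative has_vector_derivative_at_within)
    qed simp
    then have "((\<lambda>t. \<sigma>' t * \<beta> c z \<xi>) has_integral \<beta> c z \<xi>) {1/2..1}" using \<sigma>(2)[of "1/2"] \<sigma>(3) by simp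
    then have i2: "(?k has_integral \<beta> c z \<xi>) {1/2..1}"
    proof (rule has_integral_spike_finite[of "{1/2}", rotated 2])
      show "?k t = \<sigma>' t * \<beta> c z \<xi>" if "t \<in> {1/2..1} - {1/2}" for t
        using v2[of t] that by (auto simp: interior_product_def l b)
    qed simp
    have "(?k has_integral (integral {0..1} L + \<beta> c z \<xi>)) {0..1}"
      by (rule has_integral_combine[OF _ _ i1 i2]) auto
    then show "flux_form \<Psi> c z \<xi> = flux_form \<psi> c z \<xi> + \<beta> c z \<xi>"
      unfolding flux_form_def[OF \<Psi>] flux_form_def[OF \<psi>(1)] by (simp add: integral_unique L_def[abs_def])
  qed
qed

section \<open>Flux classes and their representatives\<close>

lemma flux_eq_class: "symplectic_path A \<omega> \<psi> \<Longrightarrow> flux A \<omega> \<psi> = cohom_class A (flux_form \<psi>)"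
  by (simp add: flux_def flux_form_def)

text \<open>The class is nonempty because the flux form is closed, so the representative chosen in
  \<open>rotation_vector\<close> is a genuine one.\<close>

lemma flux_form_mem_flux: "symplectic_path A \<omega> \<psi> \<Longrightarrow> flux_form \<psi> \<in> flux A \<omega> \<psi>"
proof -
  assume \<psi>: "symplectic_path A \<omega> \<psi>"
  have z: "smooth_fun A (\<lambda>x. 0)" by (simp add: smooth_fun_def)
  have "ext_d0 (\<lambda>x. 0) c y \<xi> = 0" for c y \<xi> by (simp add: ext_d0_def)
  then show ?thesis
    unfolding flux_eq_class[OF \<psi>] cohom_class_def using flux_form_closed[OF \<psi>] z by (auto intro!: exI[of _ "\<lambda>x. 0"])
qed

lemma cohom_class_exact:
  assumes k: "smooth_fun A k" and \<gamma>: "\<And>c y \<xi>. c \<in> A \<Longrightarrow> y \<in> cimg c \<Longrightarrow> \<gamma> c y \<xi> = ext_d0 k c y \<xi>"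
  shows "cohom_class A \<gamma> = cohom_class A (\<lambda>_ _ _. 0)"
proof -
  have "(\<exists>f. smooth_fun A f \<and> (\<forall>c\<in>A. \<forall>y\<in>cimg c. \<forall>\<xi>. \<beta> c y \<xi> - \<gamma> c y \<xi> = ext_d0 f c y \<xi>)) \<longleftrightarrow>
    (\<exists>f. smooth_fun A f \<and> (\<forall>c\<in>A. \<forall>y\<in>cimg c. \<forall>\<xi>. \<beta> c y \<xi> - 0 = ext_d0 f c y \<xi>))" for \<beta>
  proof
    assume "\<exists>f. smooth_fun A f \<and> (\<forall>c\<in>A. \<forall>y\<in>cimg c. \<forall>\<xi>. \<beta> c y \<xi> - \<gamma> c y \<xi> = ext_d0 f c y \<xi>)"
    then obtain f where f: "smooth_fun A f" "\<forall>c\<in>A. \<forall>y\<in>cimg c. \<forall>\<xi>. \<beta> c y \<xi> - \<gamma> c y \<xi> = ext_d0 f c y \<xi>" by blast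
    have "\<beta> c y \<xi> - 0 = ext_d0 (\<lambda>x. 1 * f x + 1 * k x) c y \<xi>" if "c \<in> A" "y \<in> cimg c" for c y \<xi>
    proof -
      have "\<beta> c y \<xi> - \<gamma> c y \<xi> = ext_d0 f c y \<xi>" using f that by blast
      then show ?thesis unfolding smooth_fun_lincomb(2)[OF f(1) k that] using \<gamma>[OF that, of \<xi>] by simp
    qed
    then show "\<exists>f. smooth_fun A f \<and> (\<forall>c\<in>A. \<forall>y\<in>cimg c. \<forall>\<xi>. \<beta> c y \<xi> - 0 = ext_d0 f c y \<xi>)"
      using smooth_fun_lincomb(1)[OF f(1) k] by blast
  next
    assume "\<exists>f. smooth_fun A f \<and> (\<forall>c\<in>A. \<forall>y\<in>cimg c. \<forall>\<xi>. \<beta> c y \<xi> - 0 = ext_d0 f c y \<xi>)"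
    then obtain f where f: "smooth_fun A f" "\<forall>c\<in>A. \<forall>y\<in>cimg c. \<forall>\<xi>. \<beta> c y \<xi> - 0 = ext_d0 f c y \<xi>" by blast
    have "\<beta> c y \<xi> - \<gamma> c y \<xi> = ext_d0 (\<lambda>x. 1 * f x + (-1) * k x) c y \<xi>" if "c \<in> A" "y \<in> cimg c" for c y \<xi>
    proof -
      have "\<beta> c y \<xi> - 0 = ext_d0 f c y \<xi>" using f that by blast
      then show ?thesis unfolding smooth_fun_lincomb(2)[OF f(1) k that] using \<gamma>[OF that, of \<xi>] by simp
    qed
    then show "\<exists>f. smooth_fun A f \<and> (\<forall>c\<in>A. \<forall>y\<in>cimg c. \<forall>\<xi>. \<beta> c y \<xi> - \<gamma> c y \<xi> = ext_d0 f c y \<xi>)"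
      using smooth_fun_lincomb(1)[OF f(1) k] by blast
  qed
  then show ?thesis unfolding cohom_class_def by simp
qed

end

theorem theorem1p1:
  fixes A :: "('m::t2_space, 'e::euclidean_space) atlas"
    and \<omega> :: "('m, 'e) form2"
    and X Y :: "'m set"
    and \<psi> \<phi> :: "real \<Rightarrow> 'm \<Rightarrow> 'm"
    and F :: "'m \<Rightarrow> real"
  assumes "closed_manifold A" and "symplectic_form A \<omega>"
    and "compact X" and "compact Y"
    and P1: "\<forall>\<theta>\<in>Ham A \<omega>. \<theta> ` Y \<inter> X \<noteq> {}"
    and P2: "symplectic_path A \<omega> \<psi>" "\<psi> 0 = id" "\<psi> 1 ` Y \<inter> X = {}"
    and F: "smooth_fun A F" "\<forall>x\<in>X. F x \<le> 0" "\<forall>x\<in>\<psi> 1 ` Y. F x \<ge> 1"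
    and flow: "is_flow A (sgrad \<omega> F) \<phi>"
  shows "\<exists>\<mu>. invariant_borel_prob \<phi> \<mu> \<and>
             \<bar>rotation_vector A \<mu> (sgrad \<omega> F) (flux A \<omega> \<psi>)\<bar> \<ge> 1"
proof (rule ccontr)
  assume contra: "\<not> ?thesis"
  interpret closed_symplectic_manifold A \<omega>
    using \<open>closed_manifold A\<close> \<open>symplectic_form A \<omega>\<close> by unfold_locales (auto simp: closed_manifold_def)
  define v where "v = sgrad \<omega> F"
  have dF: "closed_one_form A (ext_d0 F)" by (rule closed_one_form_ext_d0[OF F(1)])
  have mdF: "closed_one_form A (\<lambda>c y \<xi>. - ext_d0 F c y \<xi>)"
    using closed_one_form_lincomb[OF dF dF, of "-1" 0] by simp
  have v: "vector_field v" unfolding v_def sgrad_eq_sharp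
    using mdF by (intro vector_field_sharp) (simp add: closed_one_form_def)
  obtain S where S: "smooth_family UNIV S" "S 0 = id" "\<And>s t. S (s + t) = S s \<circ> S t" "\<And>x. integral_curve v UNIV (\<lambda>t. S t x)"
    using flow_exists[OF v] by blast
  \<comment> \<open>\<open>is_flow\<close> requires continuity only along single orbits; uniqueness
    identifies \<phi> with the smooth flow \<open>S\<close>, whose joint continuity and group law
    are needed later.\<close>
  have "\<phi> t x = S t x" for t x
  proof (rule integral_curve_unique[OF v _ S(4)[of x], of "\<lambda>t. \<phi> t x" 0 t])
    show "integral_curve v UNIV (\<lambda>t. \<phi> t x)"
      using flow unfolding is_flow_def integral_curve_def v_def by blast
    show "\<phi> 0 x = S 0 x" using flow S(2) by (simp add: is_flow_def)
  qed auto
  then have \<phi>S: "\<phi> = S" by (intro ext)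
  \<comment> \<open>Exactly the representative selected in \<open>rotation_vector\<close>, so its
    integral needs no comparison with that of another one.\<close>
  define \<beta> where "\<beta> = (SOME \<alpha>. \<alpha> \<in> flux A \<omega> \<psi>)"
  have "\<beta> \<in> flux A \<omega> \<psi>" unfolding \<beta>_def by (rule someI[of "\<lambda>\<alpha>. \<alpha> \<in> flux A \<omega> \<psi>", OF flux_form_mem_flux[OF P2(1)]])
  then obtain f1 where \<beta>: "closed_one_form A \<beta>" and f1: "smooth_fun A f1"
    "\<And>c y \<xi>. c \<in> A \<Longrightarrow> y \<in> cimg c \<Longrightarrow> \<beta> c y \<xi> - flux_form \<psi> c y \<xi> = ext_d0 f1 c y \<xi>"
    unfolding flux_eq_class[OF P2(1)] cohom_class_def by blast
  have \<beta>1: "one_form A \<beta>" using \<beta> by (simp add: closed_one_form_def)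
  define f0 where "f0 = form_apply A \<beta> v"
  have f0: "smooth_fun A f0" unfolding f0_def by (rule form_apply_smooth[OF \<beta>1 v])
  have nomu: "\<not> 1 \<le> \<bar>integral\<^sup>L \<mu> f0\<bar>" if "invariant_borel_prob S \<mu>" for \<mu>
    using contra that unfolding rotation_vector_def \<phi>S f0_def \<beta>_def v_def by blast
  \<comment> \<open>One length has to serve all starting points. If every length failed, the failing
    orbit segments would produce a forbidden invariant measure. Writing the length as
    \<open>Suc n\<close> keeps it positive.\<close>
  have "\<exists>n. \<forall>x. \<bar>(1 / Suc n) * integral {0..real (Suc n)} (\<lambda>t. f0 (S t x))\<bar> < 1"
  proof (rule ccontr)
    assume "\<not> ?thesis"
    then have "\<forall>n. \<exists>x. 1 \<le> \<bar>(1 / Suc n) * integral {0..real (Suc n)} (\<lambda>t. f0 (S t x))\<bar>" by (meson not_less)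
    then obtain x where x: "\<And>n. 1 \<le> \<bar>(1 / Suc n) * integral {0..real (Suc n)} (\<lambda>t. f0 (S t (x n)))\<bar>" by metis
    show False
      by (rule invariant_measure_of_averages[OF smooth_family_continuous[OF S(1)] S(3) smooth_fun_continuous[OF f0] x])
        (use nomu in blast)
  qed
  then obtain n where n: "\<And>x. \<bar>(1 / Suc n) * integral {0..real (Suc n)} (\<lambda>t. f0 (S t x))\<bar> < 1" by blast
  obtain G where G: "smooth_fun A G"
    "\<And>x. form_apply A (ext_d0 G) v x = (1 / real (Suc n)) * integral {0..real (Suc n)} (\<lambda>s. f0 (S s x)) - f0 x"
    using averaging[OF f0 v S, of "real (Suc n)"] by auto
  have dG: "closed_one_form A (ext_d0 G)" by (rule closed_one_form_ext_d0[OF G(1)])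
  \<comment> \<open>The sign makes the flux of the second half cancel that of \<psi>; the exact term
    replaces \<beta>(v) by its time average.\<close>
  define \<gamma> where "\<gamma> = (\<lambda>c y \<xi>. (-1) * \<beta> c y \<xi> + (-1) * ext_d0 G c y \<xi>)"
  have \<gamma>: "closed_one_form A \<gamma>" unfolding \<gamma>_def by (rule closed_one_form_lincomb[OF \<beta> dG])
  have \<gamma>1: "one_form A \<gamma>" using \<gamma> by (simp add: closed_one_form_def)
  have \<gamma>v: "\<bar>form_apply A \<gamma> v x\<bar> < 1" for x
  proof -
    obtain c where c: "c \<in> A" "x \<in> cdom c" by (rule chart_at)
    have "form_apply A \<gamma> v x = - (form_apply A \<beta> v x + form_apply A (ext_d0 G) v x)"
      using dG unfolding form_apply_chart[OF \<gamma>1 v c] form_apply_chart[OF \<beta>1 v c]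
      by (subst form_apply_chart[OF _ v c]) (auto simp: closed_one_form_def \<gamma>_def)
    also have "\<dots> = - ((1 / Suc n) * integral {0..real (Suc n)} (\<lambda>t. f0 (S t x)))"
      unfolding G(2) f0_def[symmetric] by simp
    finally show ?thesis using n[of x] by simp
  qed
  define u where "u = sharp \<gamma>"
  have u: "vector_field u" unfolding u_def by (rule vector_field_sharp[OF \<gamma>1])
  obtain T where T: "smooth_family UNIV T" "T 0 = id" "\<And>s t. T (s + t) = T s \<circ> T t" "\<And>x. integral_curve u UNIV (\<lambda>t. T t x)"
    using flow_exists[OF u] by blast
  \<comment> \<open>Since i_v \<omega> = -dF and i_u \<omega> = \<gamma>, antisymmetry of
    \<open>\<omega>\<close> exchanges the roles of \<open>u\<close> and \<open>v\<close>.\<close>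
  have speed: "form_apply A (ext_d0 F) u x = form_apply A \<gamma> v x" for x
  proof -
    obtain c where c: "c \<in> A" "x \<in> cdom c" by (rule chart_at)
    define y where "y = cmap c x"
    have y: "y \<in> cimg c" using cmap_in[OF c] by (simp add: y_def)
    have lF: "linear (\<lambda>\<xi>. - ext_d0 F c y \<xi>)" and l\<gamma>: "linear (\<gamma> c y)" and F1: "one_form A (ext_d0 F)"
      using mdF \<gamma>1 dF c y unfolding closed_one_form_def one_form_def by blast+
    have "ext_d0 F c y (u c y) = - \<omega> c y (v c y) (u c y)"
      using omega_sharp[OF c(1) y, of "\<lambda>c y \<xi>. - ext_d0 F c y \<xi>", OF lF] by (simp add: v_def sgrad_eq_sharp)
    also have "\<dots> = \<omega> c y (u c y) (v c y)" using omega_anti[OF c(1) y, of "u c y" "v c y"] by simp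
    also have "\<dots> = \<gamma> c y (v c y)" unfolding u_def by (rule omega_sharp[where \<alpha>=\<gamma>, OF c(1) y l\<gamma>])
    finally show ?thesis
      unfolding form_apply_chart[OF F1 u c] form_apply_chart[OF \<gamma>1 v c] by (simp add: y_def)
  qed
  obtain \<Psi> where \<Psi>: "symplectic_path A \<omega> \<Psi>" "\<Psi> 0 = id" "\<Psi> 1 = T 1 \<circ> \<psi> 1"
    "\<And>c z \<xi>. c \<in> A \<Longrightarrow> z \<in> cimg c \<Longrightarrow> flux_form \<Psi> c z \<xi> = flux_form \<psi> c z \<xi> + \<gamma> c z \<xi>"
    using concatenation[OF P2(1,2) \<gamma> T[unfolded u_def]] by blast
  have "flux A \<omega> \<Psi> = cohom_class A (\<lambda>_ _ _. 0)"
    unfolding flux_eq_class[OF \<Psi>(1)]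
  proof (rule cohom_class_exact)
    \<comment> \<open>The flux form of \<psi> is \<beta> - d f1, and adding \<gamma> = -\<beta> - dG
      leaves -d f1 - dG.\<close>
    show "smooth_fun A (\<lambda>x. (-1) * f1 x + (-1) * G x)" by (rule smooth_fun_lincomb(1)[OF f1(1) G(1)])
    show "flux_form \<Psi> c y \<xi> = ext_d0 (\<lambda>x. (-1) * f1 x + (-1) * G x) c y \<xi>" if "c \<in> A" "y \<in> cimg c" for c y \<xi>
      unfolding smooth_fun_lincomb(2)[OF f1(1) G(1) that] \<Psi>(4)[OF that] \<gamma>_def f1(2)[OF that, symmetric] by simp
  qed
  then have "T 1 \<circ> \<psi> 1 \<in> Ham A \<omega>" unfolding Ham_def using \<Psi> by blast
  then obtain x where x: "x \<in> Y" "T 1 (\<psi> 1 x) \<in> X" using P1 by fastforce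
  define z where "z = \<psi> 1 x"
  have d: "((\<lambda>t. F (T t z)) has_real_derivative form_apply A \<gamma> v (T t z)) (at t)" for t
    using smooth_fun_along_curve[OF F(1) u T(4)] by (simp add: speed)
  \<comment> \<open>The mean value theorem keeps the strict inequality, as the speed is evaluated at
    one time only: \<open>F\<close> falls by less than 1 on the way from a point of \<psi>_1(Y) to a
    point of \<open>X\<close>.\<close>
  obtain s where "F (T 1 z) - F (T 0 z) = (1 - 0) * form_apply A \<gamma> v (T s z)"
    using MVT2[of 0 1 "\<lambda>t. F (T t z)" "\<lambda>t. form_apply A \<gamma> v (T t z)"] d by auto
  then have "F (T 1 z) - F z > -1" using \<gamma>v[of "T s z"] T(2) by simp
  moreover have "F z \<ge> 1" "F (T 1 z) \<le> 0" using F x by (auto simp: z_def)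
  ultimately show False by simp
qed

end
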